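(* Let $w$ be a strictly subexponential normalized weight, let $(\delta_n)_{n\ge1}$ be a family of alternate gap lengths on $\mathcal H^{o}=L^2(S^1,\mathbb C)$, and for $q\in\mathcal H^{o}$ let $\Gamma_n(q)=|\gamma_n(q)|+|\delta_n(q)|$. Then for $q\in\mathcal H^{o}$, $$q\in\mathcal H^w\iff\sum_{n\ge1}w_n^2\Gamma_n^2(q)<\infty.$$
   Context: Let $S^1=\mathbb R/\mathbb Z$. A normalized weight is a function $w:\mathbb Z\to\mathbb R$, $n\mapsto w_n=w(n)$, with $w_n=w_{-n}\ge1$ for all $n$. A normalized weight is strictly subexponential if $\frac{\log w(n)}{n}\to0$ as $n\to\infty$ in an eventually monotone manner, and $w(n)$ is nondecreasing for $n\ge0$. For $q=\sum_{n\in\mathbb Z}q_ne^{2n\pi ix}$ put $\|q\|_w^2=\sum_{n\in\mathbb Z}w_n^2|q_n|^2$, and $\mathcal H^w=\{q\in L^2(S^1,\mathbb C):\|q\|_w<\infty\}$. Let $\|\cdot\|_{o}$ be the usual norm of $\mathcal H^{o}=L^2(S^1,\mathbb C)$. For complex $q\in\mathcal H^{o}$, the periodic eigenvalues are the eigenvalues of $L=-\frac{d^2}{dx^2}+q$ on $[0,1]$ with periodic or anti-periodic boundary conditions (both types taken together; equivalently the eigenvalues of $-\frac{d^2}{dx^2}+q$ on functions of period 2), listed with algebraic multiplicity and ordered lexicographically (first by real part, then by imaginary part): $\lambda_0(q)\prec\lambda_1^-(q)\preceq\lambda_1^+(q)\prec\dots\prec\lambda_n^-(q)\preceq\lambda_n^+(q)\prec\cdots$.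 The gap lengths are $\gamma_n(q)=\lambda_n^+(q)-\lambda_n^-(q)$, $n\ge1$. A family of alternate gap lengths is a family of continuously differentiable functions $\delta_n:\mathcal H^{o}\to\mathbb C$, $n\ge1$, such that: (a) $\delta_n(q)=0$ whenever $\lambda_n^+(q)=\lambda_n^-(q)$ and this eigenvalue also has geometric multiplicity 2; (b) there are real numbers $\xi_n$ such that, with $t_n(x)=\cos 2n\pi(x+\xi_n)$, $\|d_q\delta_n-t_n\|_{o}\le C_\delta(\|q\|_{o})/n$ with $C_\delta$ depending only on $\|q\|_{o}$, uniformly on bounded subsets of $\mathcal H^{o}$. Here the gradient $d_q\delta_n\in L^2(S^1,\mathbb C)$ represents the derivative at $q$ via $h\mapsto\int_0^1(d_q\delta_n)\,h\,dx$. The quantity $\Gamma_n(q)$ is called the size of the $n$-th spectral triangle, whose vertices are $\lambda_n^-,\ \tau_n+\delta_n,\ \lambda_n^+$ with $\tau_n=(\lambda_n^++\lambda_n^-)/2$. *)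

theory Defs
  imports "HOL-Analysis.Analysis"
begin

text \<open>
  The space \<open>L\<^sup>2(S\<^sup>1, \<complex>)\<close>, \<open>S\<^sup>1 = \<real>/\<int>\<close>: square integrable functions on the fundamental domain
  \<open>[0,1]\<close>, modulo equality almost everywhere.  Values outside \<open>[0,1]\<close> are irrelevant.
\<close>

abbreviation circle_measure :: "real measure" where
  "circle_measure \<equiv> lebesgue_on {0..1}"

definition square_integrable :: "(real \<Rightarrow> complex) \<Rightarrow> bool" where
  "square_integrable f \<longleftrightarrow>
     f \<in> borel_measurable circle_measure \<and> integrable circle_measure (\<lambda>x. (cmod (f x))\<^sup>2)"

definition l2_rel :: "(real \<Rightarrow> complex) \<Rightarrow> (real \<Rightarrow> complex) \<Rightarrow> bool" where
  "l2_rel f g \<longleftrightarrow> square_integrable f \<and> square_integrable g \<and> (AE x in circle_measure. f x = g x)"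

lemma square_integrable_measurable:
  "square_integrable f \<Longrightarrow> f \<in> borel_measurable circle_measure"
  by (simp add: square_integrable_def)

lemma square_integrable_zero: "square_integrable (\<lambda>x. 0)"
  by (simp add: square_integrable_def)

lemma square_integrable_cmult:
  assumes "square_integrable f"
  shows "square_integrable (\<lambda>x. c * f x)"
  using assms by (auto simp: square_integrable_def norm_mult power_mult_distrib)

lemma square_integrable_uminus:
  assumes "square_integrable f"
  shows "square_integrable (\<lambda>x. - f x)"
  using assms by (auto simp: square_integrable_def)

lemma square_integrable_add:
  assumes f: "square_integrable f" and g: "square_integrable g"
  shows "square_integrable (\<lambda>x. f x + g x)"
proof -
  have meas: "(\<lambda>x. f x + g x) \<in> borel_measurable circle_measure"
    using f g by (auto simp: square_integrable_def)
  have bound: "(cmod (f x + g x))\<^sup>2 \<le> 2 * (cmod (f x))\<^sup>2 + 2 * (cmod (g x))\<^sup>2" for x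
  proof -
    have "(cmod (f x + g x))\<^sup>2 \<le> (cmod (f x) + cmod (g x))\<^sup>2"
      by (simp add: norm_triangle_ineq power_mono)
    also have "\<dots> \<le> 2 * (cmod (f x))\<^sup>2 + 2 * (cmod (g x))\<^sup>2"
      using zero_le_power2[of "cmod (f x) - cmod (g x)"] by (simp add: power2_eq_square algebra_simps)
    finally show ?thesis .
  qed
  have "integrable circle_measure (\<lambda>x. (cmod (f x + g x))\<^sup>2)"
  proof (rule Bochner_Integration.integrable_bound)
    show "integrable circle_measure (\<lambda>x. 2 * (cmod (f x))\<^sup>2 + 2 * (cmod (g x))\<^sup>2)"
      using f g by (auto simp: square_integrable_def)
    show "(\<lambda>x. (cmod (f x + g x))\<^sup>2) \<in> borel_measurable circle_measure"
      using meas by measurable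
    show "AE x in circle_measure. norm ((cmod (f x + g x))\<^sup>2)
            \<le> norm (2 * (cmod (f x))\<^sup>2 + 2 * (cmod (g x))\<^sup>2)"
      using bound by simp
  qed
  with meas show ?thesis by (simp add: square_integrable_def)
qed

lemma square_integrable_diff:
  assumes "square_integrable f" "square_integrable g"
  shows "square_integrable (\<lambda>x. f x - g x)"
  using square_integrable_add[OF assms(1) square_integrable_uminus[OF assms(2)]] by simp

lemma integrable_mult_square_integrable:
  assumes f: "square_integrable f" and g: "square_integrable g"
  shows "integrable circle_measure (\<lambda>x. f x * g x)"
proof (rule Bochner_Integration.integrable_bound)
  show "integrable circle_measure (\<lambda>x. (cmod (f x))\<^sup>2 + (cmod (g x))\<^sup>2)"
    using f g by (auto simp: square_integrable_def)
  show "(\<lambda>x. f x * g x) \<in> borel_measurable circle_measure"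
    using f g by (auto simp: square_integrable_def)
  have "cmod (f x * g x) \<le> (cmod (f x))\<^sup>2 + (cmod (g x))\<^sup>2" for x
  proof -
    have "2 * (cmod (f x) * cmod (g x)) \<le> (cmod (f x))\<^sup>2 + (cmod (g x))\<^sup>2"
      using zero_le_power2[of "cmod (f x) - cmod (g x)"] by (simp add: power2_eq_square algebra_simps)
    moreover have "0 \<le> cmod (f x) * cmod (g x)" by simp
    ultimately show ?thesis unfolding norm_mult by linarith
  qed
  then show "AE x in circle_measure. norm (f x * g x) \<le> norm ((cmod (f x))\<^sup>2 + (cmod (g x))\<^sup>2)"
    by simp
qed

lemma square_integrable_cnj:
  assumes "square_integrable f"
  shows "square_integrable (\<lambda>x. cnj (f x))"
proof -
  have "(\<lambda>x. cnj (f x)) \<in> borel_measurable circle_measure"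
    by (rule measurable_compose[OF square_integrable_measurable[OF assms]])
      (intro borel_measurable_continuous_onI continuous_intros)
  with assms show ?thesis by (simp add: square_integrable_def)
qed

lemma square_integrable_continuous:
  assumes "continuous_on {0..1} f"
  shows "square_integrable f"
proof -
  have "integrable circle_measure (\<lambda>x. (cmod (f x))\<^sup>2)"
    using assms by (intro continuous_imp_integrable_real continuous_intros)
  moreover have "f \<in> borel_measurable circle_measure"
    using assms by (intro continuous_imp_measurable_on_sets_lebesgue) auto
  ultimately show ?thesis by (simp add: square_integrable_def)
qed

lemma AE_cong1: "AE x in M. f x = f' x \<Longrightarrow> AE x in M. F (f x) = F (f' x)"
  by (erule eventually_mono) simp

lemma AE_cong2:
  assumes "AE x in M. f x = f' x" "AE x in M. g x = g' x"
  shows "AE x in M. F (f x) (g x) = F (f' x) (g' x)"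
  using assms by eventually_elim simp

lemma l2_rel_lift1:
  assumes "l2_rel f f'" and "\<And>f. square_integrable f \<Longrightarrow> square_integrable (\<lambda>x. F (f x))"
  shows "l2_rel (\<lambda>x. F (f x)) (\<lambda>x. F (f' x))"
  using assms AE_cong1[of f f' circle_measure F] by (simp add: l2_rel_def)

lemma l2_rel_lift2:
  assumes "l2_rel f f'" and "l2_rel g g'"
    and "\<And>f g. square_integrable f \<Longrightarrow> square_integrable g \<Longrightarrow> square_integrable (\<lambda>x. F (f x) (g x))"
  shows "l2_rel (\<lambda>x. F (f x) (g x)) (\<lambda>x. F (f' x) (g' x))"
  using assms AE_cong2[of f f' circle_measure g g' F] by (simp add: l2_rel_def)

lemma part_equivp_l2_rel: "part_equivp l2_rel"
proof (rule part_equivpI)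
  show "\<exists>f. l2_rel f f"
    using square_integrable_zero by (auto simp: l2_rel_def)
  show "symp l2_rel"
    by (rule sympI) (auto simp: l2_rel_def elim!: eventually_mono)
  show "transp l2_rel"
  proof (rule transpI)
    fix f g h assume "l2_rel f g" "l2_rel g h"
    then have "AE x in circle_measure. f x = g x" "AE x in circle_measure. g x = h x"
      by (simp_all add: l2_rel_def)
    then have "AE x in circle_measure. f x = h x" by eventually_elim simp
    with \<open>l2_rel f g\<close> \<open>l2_rel g h\<close> show "l2_rel f h" by (simp add: l2_rel_def)
  qed
qed

quotient_type l2_circle = "real \<Rightarrow> complex" / partial: l2_rel
  morphisms l2_rep l2_class
  by (rule part_equivp_l2_rel)

instantiation l2_circle :: real_inner
begin

lift_definition zero_l2_circle :: l2_circle is "\<lambda>x. 0"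
  by (simp add: l2_rel_def square_integrable_zero)

lift_definition plus_l2_circle :: "l2_circle \<Rightarrow> l2_circle \<Rightarrow> l2_circle" is "\<lambda>f g x. f x + g x"
  by (rule l2_rel_lift2[where F = "(+)"]) (auto simp: square_integrable_add)

lift_definition uminus_l2_circle :: "l2_circle \<Rightarrow> l2_circle" is "\<lambda>f x. - f x"
  by (rule l2_rel_lift1[where F = uminus]) (auto simp: square_integrable_uminus)

lift_definition minus_l2_circle :: "l2_circle \<Rightarrow> l2_circle \<Rightarrow> l2_circle" is "\<lambda>f g x. f x - g x"
  by (rule l2_rel_lift2[where F = "(-)"]) (auto simp: square_integrable_diff)

lift_definition scaleR_l2_circle :: "real \<Rightarrow> l2_circle \<Rightarrow> l2_circle" is "\<lambda>r f x. of_real r * f x"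
  by (rule l2_rel_lift1) (auto intro: square_integrable_cmult)

lift_definition norm_l2_circle :: "l2_circle \<Rightarrow> real" is
  "\<lambda>f. sqrt (\<integral>x. (cmod (f x))\<^sup>2 \<partial>circle_measure)"
proof -
  fix f g assume *: "l2_rel f g"
  then have [measurable]: "f \<in> borel_measurable circle_measure" "g \<in> borel_measurable circle_measure"
    by (simp_all add: l2_rel_def square_integrable_def)
  have "AE x in circle_measure. (cmod (f x))\<^sup>2 = (cmod (g x))\<^sup>2"
    using * by (intro AE_cong1[where F = "\<lambda>z. (cmod z)\<^sup>2"]) (simp add: l2_rel_def)
  then have "(\<integral>x. (cmod (f x))\<^sup>2 \<partial>circle_measure) = (\<integral>x. (cmod (g x))\<^sup>2 \<partial>circle_measure)"
    by (intro integral_cong_AE) simp_all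
  then show "sqrt (\<integral>x. (cmod (f x))\<^sup>2 \<partial>circle_measure) = sqrt (\<integral>x. (cmod (g x))\<^sup>2 \<partial>circle_measure)"
    by simp
qed

text \<open>The real inner product is the real part of the Hermitian one.\<close>

lift_definition inner_l2_circle :: "l2_circle \<Rightarrow> l2_circle \<Rightarrow> real" is
  "\<lambda>f g. \<integral>x. Re (f x * cnj (g x)) \<partial>circle_measure"
proof -
  fix f f' g g' assume "l2_rel f f'" "l2_rel g g'"
  then have *: "square_integrable f" "square_integrable f'" "square_integrable g" "square_integrable g'"
    and ae: "AE x in circle_measure. f x = f' x" "AE x in circle_measure. g x = g' x"
    by (auto simp: l2_rel_def)
  have "integrable circle_measure (\<lambda>x. f x * cnj (g x))" "integrable circle_measure (\<lambda>x. f' x * cnj (g' x))"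
    by (auto intro!: integrable_mult_square_integrable square_integrable_cnj *)
  then have "(\<lambda>x. Re (f x * cnj (g x))) \<in> borel_measurable circle_measure"
    "(\<lambda>x. Re (f' x * cnj (g' x))) \<in> borel_measurable circle_measure"
    by (auto simp del: times_complex.sel intro!: borel_measurable_integrable integrable_Re)
  then show "(\<integral>x. Re (f x * cnj (g x)) \<partial>circle_measure) = (\<integral>x. Re (f' x * cnj (g' x)) \<partial>circle_measure)"
    using ae by (intro integral_cong_AE AE_cong2[where F = "\<lambda>z w. Re (z * cnj w)"]) assumption+
qed

definition dist_l2_circle :: "l2_circle \<Rightarrow> l2_circle \<Rightarrow> real" where
  "dist_l2_circle p q = norm (p - q)"

definition sgn_l2_circle :: "l2_circle \<Rightarrow> l2_circle" where
  "sgn_l2_circle q = inverse (norm q) *\<^sub>R q"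

definition uniformity_l2_circle :: "(l2_circle \<times> l2_circle) filter" where
  "uniformity_l2_circle = (INF e\<in>{0<..}. principal {(p, q). dist p q < e})"

definition open_l2_circle :: "l2_circle set \<Rightarrow> bool" where
  "open_l2_circle U \<longleftrightarrow> (\<forall>p\<in>U. \<forall>\<^sub>F (p', q) in uniformity. p' = p \<longrightarrow> q \<in> U)"

instance
proof
  fix a b c :: l2_circle and r s :: real and U :: "l2_circle set"
  note [simp] = l2_rel_def square_integrable_add square_integrable_diff square_integrable_uminus
    square_integrable_cmult square_integrable_zero
  show "a + b + c = a + (b + c)" by transfer (auto simp: algebra_simps)
  show "a + b = b + a" by transfer (auto simp: algebra_simps)
  show "0 + a = a" by transfer auto
  show "- a + a = 0" by transfer auto
  show "a - b = a + - b" by transfer auto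
  show "r *\<^sub>R (a + b) = r *\<^sub>R a + r *\<^sub>R b" by transfer (auto simp: distrib_left)
  show "(r + s) *\<^sub>R a = r *\<^sub>R a + s *\<^sub>R a"
    by transfer (auto simp: distrib_right)
  show "r *\<^sub>R s *\<^sub>R a = (r * s) *\<^sub>R a"
    by transfer (auto simp: mult.assoc)
  show "1 *\<^sub>R a = a" by transfer auto
  show "dist a b = norm (a - b)" by (rule dist_l2_circle_def)
  show "sgn a = inverse (norm a) *\<^sub>R a" by (rule sgn_l2_circle_def)
  show "uniformity = (INF e\<in>{0<..}. principal {(p::l2_circle, q). dist p q < e})"
    by (rule uniformity_l2_circle_def)
  show "open U = (\<forall>p\<in>U. \<forall>\<^sub>F (p', q) in uniformity. p' = p \<longrightarrow> q \<in> U)"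
    by (rule open_l2_circle_def)
  show "inner a b = inner b a" by transfer (simp add: algebra_simps)
  show "inner (a + b) c = inner a c + inner b c"
  proof transfer
    fix f g h assume "l2_rel f f" "l2_rel g g" "l2_rel h h"
    then have "integrable circle_measure (\<lambda>x. f x * cnj (h x))" "integrable circle_measure (\<lambda>x. g x * cnj (h x))"
      by (auto intro!: integrable_mult_square_integrable square_integrable_cnj)
    from Bochner_Integration.integral_add[OF this[THEN integrable_Re]]
    show "(\<integral>x. Re ((f x + g x) * cnj (h x)) \<partial>circle_measure) =
       (\<integral>x. Re (f x * cnj (h x)) \<partial>circle_measure) + (\<integral>x. Re (g x * cnj (h x)) \<partial>circle_measure)"
      by (simp add: distrib_right)
  qed
  show "inner (r *\<^sub>R a) b = r * inner a b"
  proof transfer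
    fix r f g
    show "(\<integral>x. Re (of_real r * f x * cnj (g x)) \<partial>circle_measure) =
       r * (\<integral>x. Re (f x * cnj (g x)) \<partial>circle_measure)"
      by (subst integral_mult_right_zero[symmetric]) (simp add: algebra_simps)
  qed
  have sq: "inner a a = (norm a)\<^sup>2"
    by transfer (simp add: complex_mult_cnj cmod_power2)
  show "0 \<le> inner a a" by (simp add: sq)
  show "(inner a a = 0) = (a = 0)"
  proof transfer
    fix f assume f: "l2_rel f f"
    have "(\<integral>x. Re (f x * cnj (f x)) \<partial>circle_measure) = (\<integral>x. (cmod (f x))\<^sup>2 \<partial>circle_measure)"
      by (simp add: complex_mult_cnj cmod_power2)
    also have "\<dots> = 0 \<longleftrightarrow> (AE x in circle_measure. (cmod (f x))\<^sup>2 = 0)"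
      using f by (intro integral_nonneg_eq_0_iff_AE) (auto simp: square_integrable_def)
    finally show "((\<integral>x. Re (f x * cnj (f x)) \<partial>circle_measure) = 0) = l2_rel f (\<lambda>x. 0)"
      using f by simp
  qed
  have "0 \<le> norm a" by transfer simp
  then show "norm a = sqrt (inner a a)" by (simp add: sq)
qed

end

lift_definition scaleC :: "complex \<Rightarrow> l2_circle \<Rightarrow> l2_circle" is "\<lambda>c f x. c * f x"
  by (rule l2_rel_lift1) (auto intro: square_integrable_cmult)

global_interpretation l2_circle: vector_space scaleC
proof
  fix c d :: complex and a b :: l2_circle
  note [simp] = l2_rel_def square_integrable_add square_integrable_cmult
  show "scaleC c (a + b) = scaleC c a + scaleC c b" by transfer (auto simp: distrib_left)
  show "scaleC (c + d) a = scaleC c a + scaleC d a"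
    by transfer (auto simp: distrib_right)
  show "scaleC c (scaleC d a) = scaleC (c * d) a"
    by transfer (auto simp: mult.assoc)
  show "scaleC 1 a = a" by transfer auto
qed

text \<open>The bilinear (not Hermitian) pairing \<open>\<integral>\<^sub>0\<^sup>1 g h dx\<close>, through which gradients act.\<close>

lift_definition pairing :: "l2_circle \<Rightarrow> l2_circle \<Rightarrow> complex" is
  "\<lambda>g h. \<integral>x. g x * h x \<partial>circle_measure"
proof -
  fix f f' g g' assume *: "l2_rel f f'" "l2_rel g g'"
  then have [measurable]:
    "f \<in> borel_measurable circle_measure" "f' \<in> borel_measurable circle_measure"
    "g \<in> borel_measurable circle_measure" "g' \<in> borel_measurable circle_measure"
    by (simp_all add: l2_rel_def square_integrable_def)
  have "AE x in circle_measure. f x * g x = f' x * g' x"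
    using * by (intro AE_cong2[where F = "(*)"]) (simp_all add: l2_rel_def)
  then show "(\<integral>x. f x * g x \<partial>circle_measure) = (\<integral>x. f' x * g' x \<partial>circle_measure)"
    by (intro integral_cong_AE) simp_all
qed

definition l2_exp :: "int \<Rightarrow> l2_circle" where
  "l2_exp n = l2_class (\<lambda>x. exp (2 * of_int n * of_real pi * \<i> * of_real x))"

definition l2_cos :: "nat \<Rightarrow> real \<Rightarrow> l2_circle" where
  "l2_cos n \<xi> = l2_class (\<lambda>x. of_real (cos (2 * real n * pi * (x + \<xi>))))"

definition fourier_coeff :: "l2_circle \<Rightarrow> int \<Rightarrow> complex" where
  "fourier_coeff q n = pairing q (l2_exp (- n))"

definition normalized_weight :: "(int \<Rightarrow> real) \<Rightarrow> bool" where
  "normalized_weight w \<longleftrightarrow> (\<forall>n. w (- n) = w n \<and> 1 \<le> w n)"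

definition strictly_subexponential :: "(int \<Rightarrow> real) \<Rightarrow> bool" where
  "strictly_subexponential w \<longleftrightarrow>
     (\<lambda>n::nat. ln (w (int n)) / real n) \<longlonglongrightarrow> 0 \<and>
     (\<exists>N. monoseq (\<lambda>k::nat. ln (w (int (k + N))) / real (k + N))) \<and>
     mono_on {0..} w"

definition weighted_space :: "(int \<Rightarrow> real) \<Rightarrow> l2_circle set" where
  "weighted_space w = {q. (\<lambda>n. (w n)\<^sup>2 * (cmod (fourier_coeff q n))\<^sup>2) summable_on UNIV}"

text \<open>
  The graph of the unbounded operator \<open>L y = - y'' + q y\<close> in \<open>L\<^sup>2[0,1]\<close> with boundary conditions
  \<open>y(1) = \<sigma> y(0)\<close>, \<open>y'(1) = \<sigma> y'(0)\<close>; periodic for \<open>\<sigma> = 1\<close> and anti-periodic for \<open>\<sigma> = -1\<close>.  Its domain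
  consists of Sobolev functions of order 2: \<open>u\<close> and \<open>u'\<close> are indefinite integrals of \<open>u'\<close> and
  \<open>u'' \<in> L\<^sup>2\<close>, respectively.  The choice of the representative of \<open>q\<close> does not matter.
\<close>

definition hill_operator :: "complex \<Rightarrow> l2_circle \<Rightarrow> (l2_circle \<times> l2_circle) set" where
  "hill_operator \<sigma> q =
     {(l2_class u, l2_class (\<lambda>x. - u'' x + l2_rep q x * u x)) | u u' u''.
        square_integrable u'' \<and>
        (\<forall>x\<in>{0..1}. (u' has_integral (u x - u 0)) {0..x}) \<and>
        (\<forall>x\<in>{0..1}. (u'' has_integral (u' x - u' 0)) {0..x}) \<and>
        u 1 = \<sigma> * u 0 \<and> u' 1 = \<sigma> * u' 0}"

definition hill_shifted :: "complex \<Rightarrow> l2_circle \<Rightarrow> complex \<Rightarrow> (l2_circle \<times> l2_circle) set" where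
  "hill_shifted \<sigma> q z = {(y, f - scaleC z y) | y f. (y, f) \<in> hill_operator \<sigma> q}"

definition eigenspace :: "complex \<Rightarrow> l2_circle \<Rightarrow> complex \<Rightarrow> l2_circle set" where
  "eigenspace \<sigma> q z = {y. (y, 0) \<in> hill_shifted \<sigma> q z}"

text \<open>The root space \<open>\<Union>\<^sub>k ker (L - z)\<^sup>k\<close>; powers of the operator are relational powers of its graph.\<close>

definition root_space :: "complex \<Rightarrow> l2_circle \<Rightarrow> complex \<Rightarrow> l2_circle set" where
  "root_space \<sigma> q z = {y. \<exists>k. (y, 0) \<in> hill_shifted \<sigma> q z ^^ k}"

definition geometric_multiplicity :: "l2_circle \<Rightarrow> complex \<Rightarrow> nat" where
  "geometric_multiplicity q z = (\<Sum>\<sigma>\<in>{1, -1}. l2_circle.dim (eigenspace \<sigma> q z))"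

definition algebraic_multiplicity :: "l2_circle \<Rightarrow> complex \<Rightarrow> nat" where
  "algebraic_multiplicity q z = (\<Sum>\<sigma>\<in>{1, -1}. l2_circle.dim (root_space \<sigma> q z))"

definition lex_le :: "complex \<Rightarrow> complex \<Rightarrow> bool" where
  "lex_le z w \<longleftrightarrow> Re z < Re w \<or> Re z = Re w \<and> Im z \<le> Im w"

text \<open>
  All periodic and anti-periodic eigenvalues in lexicographic order, each repeated according to its
  algebraic multiplicity.  The listing \<open>\<lambda>\<^sub>0, \<lambda>\<^sub>1\<^sup>-, \<lambda>\<^sub>1\<^sup>+, \<lambda>\<^sub>2\<^sup>-, \<lambda>\<^sub>2\<^sup>+, \<dots>\<close> has indices \<open>0, 1, 2, 3, 4, \<dots>\<close>.
\<close>

definition eigenvalue_listing :: "l2_circle \<Rightarrow> (nat \<Rightarrow> complex) \<Rightarrow> bool" where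
  "eigenvalue_listing q \<mu> \<longleftrightarrow>
     (\<forall>k. lex_le (\<mu> k) (\<mu> (Suc k))) \<and>
     (\<forall>z. finite {k. \<mu> k = z} \<and> card {k. \<mu> k = z} = algebraic_multiplicity q z)"

definition periodic_eigenvalue :: "l2_circle \<Rightarrow> nat \<Rightarrow> complex" where
  "periodic_eigenvalue q = (THE \<mu>. eigenvalue_listing q \<mu>)"

definition lambda_minus :: "nat \<Rightarrow> l2_circle \<Rightarrow> complex" where
  "lambda_minus n q = periodic_eigenvalue q (2 * n - 1)"

definition lambda_plus :: "nat \<Rightarrow> l2_circle \<Rightarrow> complex" where
  "lambda_plus n q = periodic_eigenvalue q (2 * n)"

definition gap_length :: "nat \<Rightarrow> l2_circle \<Rightarrow> complex" where
  "gap_length n q = lambda_plus n q - lambda_minus n q"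

text \<open>
  \<open>d n q\<close> is the gradient of \<open>\<delta> n\<close> at \<open>q\<close>.  Since the pairing identifies \<open>L\<^sup>2\<close> isometrically with its
  dual, continuity of the gradient is continuity of the derivative in the operator norm.
\<close>

definition alternate_gap_lengths :: "(nat \<Rightarrow> l2_circle \<Rightarrow> complex) \<Rightarrow> bool" where
  "alternate_gap_lengths \<delta> \<longleftrightarrow>
     (\<exists>d :: nat \<Rightarrow> l2_circle \<Rightarrow> l2_circle.
        (\<forall>n\<ge>1. (\<forall>q. (\<delta> n has_derivative pairing (d n q)) (at q)) \<and> continuous_on UNIV (d n)) \<and>
        (\<forall>n\<ge>1. \<forall>q. lambda_plus n q = lambda_minus n q \<and>
            geometric_multiplicity q (lambda_plus n q) = 2 \<longrightarrow> \<delta> n q = 0) \<and>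
        (\<exists>\<xi> :: nat \<Rightarrow> real. \<exists>C :: real \<Rightarrow> real.
            (\<forall>R. bounded (C ` {0..R})) \<and>
            (\<forall>n\<ge>1. \<forall>q. norm (d n q - l2_cos n (\<xi> n)) \<le> C (norm q) / real n)))"

definition triangle_size :: "(nat \<Rightarrow> l2_circle \<Rightarrow> complex) \<Rightarrow> nat \<Rightarrow> l2_circle \<Rightarrow> real" where
  "triangle_size \<delta> n q = cmod (gap_length n q) + cmod (\<delta> n q)"

end

theory Submission
  imports Defs "HOL-Computational_Algebra.Fundamental_Theorem_Algebra"
begin

text \<open>In Fourier coordinates the operator is a diagonal matrix plus convolution with the coefficients \<open>a\<close> of
  \<open>q\<close>. A Riccati equation, solved by contraction, splits off the low modes; it shows that exactly two
  eigenvalues lie near the two equal diagonal entries \<open>(\<pi> n)\<^sup>2\<close> when \<open>n\<close> is large. Eliminating all other modes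
  leaves the equation \<open>\<zeta>\<^sup>2 = c\<^sub>+ c\<^sub>-\<close> for these eigenvalues, where \<open>c\<^sub>+\<close>, \<open>c\<^sub>-\<close> are close to \<open>a n\<close>, \<open>a (- n)\<close> and
  the derivative of \<open>\<zeta>\<close> with respect to the spectral parameter is close to 1.
  With \<open>\<rho> = |c\<^sub>+| + |c\<^sub>-|\<close> the size of the \<open>n\<close>-th spectral triangle is comparable to \<open>\<rho>\<close>: a change of \<open>q\<close> in the
  coefficients of index \<open>n\<close>, \<open>- n\<close> alone, approximately by \<open>- c\<^sub>+\<close>, \<open>- c\<^sub>-\<close>, makes \<open>c\<^sub>+\<close>, \<open>c\<^sub>-\<close> and \<open>\<zeta>\<close> vanish
  and hence \<open>\<delta>\<^sub>n\<close> vanish, so the gradient condition gives \<open>\<delta>\<^sub>n(q)\<close> up to a small multiple of \<open>\<rho>\<close>.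
  If the gap is small, then \<open>\<zeta>\<close> is small, \<open>|c\<^sub>+|\<close> and \<open>|c\<^sub>-|\<close> differ by at least \<open>\<rho> / 2\<close>, and \<open>\<delta>\<^sub>n\<close> is large.
  It remains to compare \<open>c\<^sub>\<plusminus>\<close> with \<open>a (\<plusminus> n)\<close>. In a bounded submultiplicative weight the error is
  \<open>O(\<parallel>a\<parallel>\<^sup>2 / n)\<close> with the weighted norm of \<open>a\<close>. This settles one direction; for the converse one deforms the trivial
  weight into the given one and shows that the weighted norm of \<open>a\<close> stays bounded along the way.\<close>

section \<open>Square summable sequences\<close>

text \<open>For complex \<open>q\<close> the operator is not self-adjoint, so neither orthogonality
  nor a variational principle orders the eigenvalues, and \<open>gap_length\<close> has a meaning
  only once the listing is known to exist and to be unique. The Riccati equation supplies exactly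
  invariant spaces, of total dimension \<open>2 * M + 1\<close> for the two boundary conditions,
  which contain every root vector left of \<open>cut_line M\<close>; consecutive values of
  \<open>M\<close> isolate a pair. Symmetry survives only for a bilinear form that pairs each mode
  with its mirror image. It makes the diagonal of the 2 x 2 reduction constant and controls Jordan
  chains, where division by the gap is impossible. The only exact fact about an alternate gap length
  is that it vanishes at a double eigenvalue of geometric multiplicity 2, so the nearby potential
  must have one of exactly this kind. Bounded weights enter because a weighted norm can be absorbed
  into itself only if it is finite beforehand; the bound of the weight never occurs in the
  estimates.\<close>

definition l2_seq :: "('a \<Rightarrow> 'b::real_normed_vector) \<Rightarrow> bool" where
  "l2_seq f \<longleftrightarrow> (\<lambda>k. (norm (f k))\<^sup>2) summable_on UNIV"

text \<open>Off \<open>l2_seq\<close> the infinite sum is 0 by convention, so \<open>l2_norm\<close>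
  carries information only together with \<open>l2_seq\<close>; most bounds below therefore come in
  pairs.\<close>

definition l2_norm :: "('a \<Rightarrow> 'b::real_normed_vector) \<Rightarrow> real" where
  "l2_norm f = sqrt (\<Sum>\<^sub>\<infinity>k. (norm (f k))\<^sup>2)"

lemma l2_norm_nonneg [simp]: "0 \<le> l2_norm f"
  by (simp add: l2_norm_def infsum_nonneg)

lemma l2_norm_square: "(l2_norm f)\<^sup>2 = (\<Sum>\<^sub>\<infinity>k. (norm (f k))\<^sup>2)"
  by (simp add: l2_norm_def infsum_nonneg)

lemma l2_norm_leI:
  assumes "(\<Sum>\<^sub>\<infinity>k. (norm (f k))\<^sup>2) \<le> C\<^sup>2" "0 \<le> C"
  shows "l2_norm f \<le> C"
  using assms by (metis l2_norm_def real_le_lsqrt)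

lemma l2_seq_sum_le:
  assumes "l2_seq f" "finite F"
  shows "(\<Sum>k\<in>F. (norm (f k))\<^sup>2) \<le> (l2_norm f)\<^sup>2"
  unfolding l2_norm_square using assms
  by (intro finite_sum_le_infsum) (auto simp: l2_seq_def)

text \<open>Bounds are proved on finite partial sums, which gives membership and norm at the same
  time.\<close>

lemma l2_seqI_sum_le:
  assumes "\<And>F. finite F \<Longrightarrow> (\<Sum>k\<in>F. (norm (f k))\<^sup>2) \<le> C\<^sup>2" "0 \<le> C"
  shows "l2_seq f" "l2_norm f \<le> C"
proof -
  show *: "l2_seq f" unfolding l2_seq_def
    by (rule nonneg_bdd_above_summable_on) (use assms in \<open>auto simp: bdd_above_def\<close>)
  show "l2_norm f \<le> C"
    using * assms by (intro l2_norm_leI infsum_le_finite_sums) (auto simp: l2_seq_def)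
qed

lemma norm_le_l2_norm: "l2_seq f \<Longrightarrow> norm (f k) \<le> l2_norm f"
  using l2_seq_sum_le[of f "{k}"] by (auto intro: power2_le_imp_le[OF _ l2_norm_nonneg])

lemma l2_comparison:
  assumes g: "l2_seq g" and le: "\<And>k. norm (f k) \<le> C * norm (g k)" and C: "0 \<le> C"
  shows "l2_seq f" "l2_norm f \<le> C * l2_norm g"
proof -
  have "(\<Sum>k\<in>F. (norm (f k))\<^sup>2) \<le> (C * l2_norm g)\<^sup>2" if "finite F" for F
  proof -
    have "(\<Sum>k\<in>F. (norm (f k))\<^sup>2) \<le> (\<Sum>k\<in>F. C\<^sup>2 * (norm (g k))\<^sup>2)"
      using le by (intro sum_mono) (metis norm_ge_zero power_mono power_mult_distrib)
    also have "\<dots> \<le> C\<^sup>2 * (l2_norm g)\<^sup>2"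
      using l2_seq_sum_le[OF g that] by (simp add: sum_distrib_left[symmetric] mult_left_mono)
    finally show ?thesis by (simp add: power_mult_distrib)
  qed
  then show "l2_seq f" "l2_norm f \<le> C * l2_norm g"
    using C l2_seqI_sum_le[of f "C * l2_norm g"] by auto
qed

lemma l2_zero [simp]: "l2_seq (\<lambda>_. 0)" "l2_norm (\<lambda>_. 0) = 0"
  by (auto simp: l2_seq_def l2_norm_def)

lemma l2_norm_eq_0D: "l2_seq f \<Longrightarrow> l2_norm f \<le> 0 \<Longrightarrow> f k = 0"
  using norm_le_l2_norm[of f k] norm_ge_zero[of "f k"] by (metis norm_le_zero_iff order_trans)

lemma l2_add:
  assumes "l2_seq f" "l2_seq g"
  shows "l2_seq (\<lambda>k. f k + g k)" "l2_norm (\<lambda>k. f k + g k) \<le> l2_norm f + l2_norm g"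
proof -
  have "(\<Sum>k\<in>F. (norm (f k + g k))\<^sup>2) \<le> (l2_norm f + l2_norm g)\<^sup>2" if F: "finite F" for F
  proof -
    have "L2_set (\<lambda>k. norm (f k + g k)) F \<le> L2_set (\<lambda>k. norm (f k) + norm (g k)) F"
      by (rule L2_set_mono) (auto simp: norm_triangle_ineq)
    also have "\<dots> \<le> L2_set (\<lambda>k. norm (f k)) F + L2_set (\<lambda>k. norm (g k)) F"
      by (rule L2_set_triangle_ineq)
    also have "\<dots> \<le> l2_norm f + l2_norm g"
      using l2_seq_sum_le[OF assms(1) F] l2_seq_sum_le[OF assms(2) F]
      by (intro add_mono) (auto simp: L2_set_def real_le_lsqrt sum_nonneg)
    finally show ?thesis
      unfolding L2_set_def by (rule sqrt_le_D)
  qed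
  then show "l2_seq (\<lambda>k. f k + g k)" "l2_norm (\<lambda>k. f k + g k) \<le> l2_norm f + l2_norm g"
    using l2_seqI_sum_le[of "\<lambda>k. f k + g k" "l2_norm f + l2_norm g"] by auto
qed

lemma l2_uminus [simp]: "l2_seq (\<lambda>k. - f k) = l2_seq f" "l2_norm (\<lambda>k. - f k) = l2_norm f"
  by (auto simp: l2_seq_def l2_norm_def)

lemma l2_diff:
  assumes "l2_seq f" "l2_seq g"
  shows "l2_seq (\<lambda>k. f k - g k)" "l2_norm (\<lambda>k. f k - g k) \<le> l2_norm f + l2_norm g"
  using l2_add[of f "\<lambda>k. - g k"] assms by auto

lemma l2_cmult:
  fixes c :: complex
  assumes "l2_seq f"
  shows "l2_seq (\<lambda>k. c * f k)" "l2_norm (\<lambda>k. c * f k) \<le> cmod c * l2_norm f"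
  using l2_comparison[OF assms, of "\<lambda>k. c * f k" "cmod c"] by (auto simp: norm_mult)

lemma l2_reindex:
  assumes "bij h"
  shows "l2_seq (\<lambda>k. f (h k)) = l2_seq f" "l2_norm (\<lambda>k. f (h k)) = l2_norm f"
  unfolding l2_seq_def l2_norm_def
  using summable_on_reindex_bij_betw[of h UNIV UNIV "\<lambda>k. (norm (f k))\<^sup>2"]
    infsum_reindex_bij_betw[of h UNIV UNIV "\<lambda>k. (norm (f k))\<^sup>2"] assms by (auto simp: bij_def)

lemma bij_int_minus [simp]: "bij (\<lambda>k::int. j - k)"
  by (rule involuntory_imp_bij) simp

lemma bij_int_shift [simp]: "bij (\<lambda>k::int. k - j)"
  by (rule bij_betw_byWitness[where f' = "\<lambda>k. k + j"]) auto

lemma l2_cauchy_schwarz: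
  assumes "l2_seq f" "l2_seq g"
  shows "(\<lambda>k. norm (f k) * norm (g k)) summable_on UNIV"
    "(\<Sum>\<^sub>\<infinity>k. norm (f k) * norm (g k)) \<le> l2_norm f * l2_norm g"
proof -
  have *: "(\<Sum>k\<in>F. norm (f k) * norm (g k)) \<le> l2_norm f * l2_norm g" if F: "finite F" for F
  proof -
    have "(\<Sum>k\<in>F. norm (f k) * norm (g k)) \<le> L2_set (\<lambda>k. norm (f k)) F * L2_set (\<lambda>k. norm (g k)) F"
      using L2_set_mult_ineq[of "\<lambda>k. norm (f k)" "\<lambda>k. norm (g k)" F] by simp
    also have "\<dots> \<le> l2_norm f * l2_norm g"
      using l2_seq_sum_le[OF assms(1) F] l2_seq_sum_le[OF assms(2) F]
      by (intro mult_mono) (auto simp: L2_set_def real_le_lsqrt sum_nonneg)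
    finally show ?thesis .
  qed
  show s: "(\<lambda>k. norm (f k) * norm (g k)) summable_on UNIV"
    by (rule nonneg_bdd_above_summable_on) (use * in \<open>auto simp: bdd_above_def\<close>)
  show "(\<Sum>\<^sub>\<infinity>k. norm (f k) * norm (g k)) \<le> l2_norm f * l2_norm g"
    using * s by (intro infsum_le_finite_sums) auto
qed

lemma l2_product:
  fixes f g :: "'a \<Rightarrow> complex"
  assumes "l2_seq f" "l2_seq g"
  shows "(\<lambda>k. cmod (f k * g k)) summable_on UNIV" "(\<lambda>k. f k * g k) summable_on UNIV"
    "cmod (\<Sum>\<^sub>\<infinity>k. f k * g k) \<le> l2_norm f * l2_norm g"
proof -
  show s: "(\<lambda>k. cmod (f k * g k)) summable_on UNIV"
    using l2_cauchy_schwarz[OF assms] by (simp add: norm_mult)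
  then show "(\<lambda>k. f k * g k) summable_on UNIV"
    by (rule abs_summable_summable)
  show "cmod (\<Sum>\<^sub>\<infinity>k. f k * g k) \<le> l2_norm f * l2_norm g"
    using norm_infsum_bound[OF s] l2_cauchy_schwarz[OF assms] by (simp add: norm_mult)
qed

lemma l2_seq_of_abs_summable:
  fixes f :: "'a \<Rightarrow> complex"
  assumes "(\<lambda>k. cmod (f k)) summable_on UNIV"
  shows "l2_seq f"
proof -
  define S where "S = (\<Sum>\<^sub>\<infinity>k. cmod (f k))"
  have le: "(\<Sum>k\<in>F. cmod (f k)) \<le> S" if "finite F" for F
    unfolding S_def using assms that by (intro finite_sum_le_infsum) auto
  have "(\<Sum>k\<in>F. (cmod (f k))\<^sup>2) \<le> S\<^sup>2" if F: "finite F" for F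
  proof -
    have "(\<Sum>k\<in>F. (cmod (f k))\<^sup>2) \<le> (\<Sum>k\<in>F. cmod (f k))\<^sup>2"
    proof -
      have "cmod (f k) * cmod (f k) \<le> cmod (f k) * (\<Sum>k\<in>F. cmod (f k))" if "k \<in> F" for k
        using F that by (intro mult_left_mono member_le_sum) auto
      then have "(\<Sum>k\<in>F. cmod (f k) * cmod (f k)) \<le> (\<Sum>k\<in>F. cmod (f k) * (\<Sum>k\<in>F. cmod (f k)))"
        by (intro sum_mono)
      then show ?thesis by (simp add: power2_eq_square sum_distrib_right)
    qed
    also have "\<dots> \<le> S\<^sup>2" using le[OF F] by (intro power_mono sum_nonneg) auto
    finally show ?thesis .
  qed
  moreover have "0 \<le> S" using le[of "{}"] by simp
  ultimately show ?thesis using l2_seqI_sum_le(1)[of f S] by auto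
qed

section \<open>Convolution of square summable sequences\<close>

definition conv :: "(int \<Rightarrow> complex) \<Rightarrow> (int \<Rightarrow> complex) \<Rightarrow> int \<Rightarrow> complex" where
  "conv a f j = (\<Sum>\<^sub>\<infinity>k. a (j - k) * f k)"

lemma conv_summable:
  fixes a f :: "int \<Rightarrow> complex"
  assumes "l2_seq a" "l2_seq f"
  shows "(\<lambda>k. a (j - k) * f k) summable_on UNIV"
  using l2_product(2)[of "\<lambda>k. a (j - k)" f] assms l2_reindex[OF bij_int_minus[of j], of a] by auto

text \<open>Cauchy-Schwarz makes the convolution of two square summable sequences bounded, not
  square summable. The equations below are therefore solved among bounded sequences, and the decay
  of a diagonal factor leads back to square summable ones.\<close>

lemma norm_conv_le:
  assumes "l2_seq a" "l2_seq f"
  shows "cmod (conv a f j) \<le> l2_norm a * l2_norm f"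
  unfolding conv_def using l2_product(3)[of "\<lambda>k. a (j - k)" f] assms l2_reindex[OF bij_int_minus[of j], of a] by auto

lemma conv_zero [simp]: "conv a (\<lambda>_. 0) j = 0"
  by (simp add: conv_def)

lemma conv_add:
  assumes "l2_seq a" "l2_seq f" "l2_seq g"
  shows "conv a (\<lambda>k. f k + g k) j = conv a f j + conv a g j"
  unfolding conv_def using infsum_add[OF conv_summable[OF assms(1,2)] conv_summable[OF assms(1,3)]]
  by (simp add: algebra_simps)

lemma conv_diff:
  assumes "l2_seq a" "l2_seq f" "l2_seq g"
  shows "conv a (\<lambda>k. f k - g k) j = conv a f j - conv a g j"
  using conv_add[OF assms(1) l2_diff(1)[OF assms(2,3)] assms(3)] by simp

lemma conv_diff_left:
  assumes "l2_seq a" "l2_seq b" "l2_seq f"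
  shows "conv (\<lambda>k. a k - b k) f j = conv a f j - conv b f j"
  unfolding conv_def
  using infsum_add[OF conv_summable[OF assms(1,3)] summable_on_uminus[THEN iffD2, OF conv_summable[OF assms(2,3)]], of j j]
  by (simp add: algebra_simps infsum_uminus)

lemma conv_cmult: "conv a (\<lambda>k. c * f k) j = c * conv a f j"
  unfolding conv_def by (simp add: infsum_cmult_right'[symmetric] algebra_simps)

lemma conv_sum:
  assumes "l2_seq a" "\<And>i. i \<in> I \<Longrightarrow> l2_seq (f i)" "finite I"
  shows "conv a (\<lambda>k. \<Sum>i\<in>I. f i k) j = (\<Sum>i\<in>I. conv a (f i) j)"
    and "l2_seq (\<lambda>k. \<Sum>i\<in>I. f i k)"
proof -
  have "conv a (\<lambda>k. \<Sum>i\<in>I. f i k) j = (\<Sum>i\<in>I. conv a (f i) j) \<and> l2_seq (\<lambda>k. \<Sum>i\<in>I. f i k)"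
    using assms(3,2)
  proof (induction I rule: finite_induct)
    case empty
    then show ?case by simp
  next
    case (insert x F)
    then show ?case using conv_add[OF assms(1), of "f x" "\<lambda>k. \<Sum>i\<in>F. f i k"] l2_add(1)[of "f x" "\<lambda>k. \<Sum>i\<in>F. f i k"]
      by auto
  qed
  then show "conv a (\<lambda>k. \<Sum>i\<in>I. f i k) j = (\<Sum>i\<in>I. conv a (f i) j)" "l2_seq (\<lambda>k. \<Sum>i\<in>I. f i k)"
    by auto
qed

lemma conv_single: "conv a (\<lambda>k. if k = i then c else 0) j = a (j - i) * c"
proof -
  have "conv a (\<lambda>k. if k = i then c else 0) j = (\<Sum>\<^sub>\<infinity>k\<in>{i}. a (j - k) * (if k = i then c else 0))"
    unfolding conv_def by (rule infsum_cong_neutral) auto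
  then show ?thesis by simp
qed

lemma l2_single: "l2_seq (\<lambda>k. if k = i then (c::complex) else 0)"
  using l2_seqI_sum_le(1)[of "\<lambda>k. if k = i then c else 0" "cmod c"]
  by (auto simp: if_distrib[of norm] if_distrib[of "\<lambda>x. x\<^sup>2"] sum.delta cong: if_cong)

text \<open>Banach's theorem by Picard iteration from 0. Contraction is phrased with an arbitrary
  bound \<open>e\<close>, so no supremum occurs, and the index type is free: pairs of integers for
  the Riccati map, integers for the reduced equation, \<open>nat\<close> for the three unknowns of
  the collapse.\<close>

lemma sup_norm_fixpoint:
  fixes \<Phi> :: "('a \<Rightarrow> complex) \<Rightarrow> 'a \<Rightarrow> complex"
  assumes bd: "\<And>f i. (\<And>i. cmod (f i) \<le> A) \<Longrightarrow> cmod (\<Phi> f i) \<le> A"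
    and contr: "\<And>f g e i. \<lbrakk>\<And>i. cmod (f i) \<le> A; \<And>i. cmod (g i) \<le> A; \<And>i. cmod (f i - g i) \<le> e\<rbrakk>
      \<Longrightarrow> cmod (\<Phi> f i - \<Phi> g i) \<le> e / 2"
    and A: "0 \<le> A"
  obtains f where "\<And>i. cmod (f i) \<le> A" "\<And>i. \<Phi> f i = f i"
proof -
  define u where "u n = (\<Phi> ^^ n) (\<lambda>_. 0)" for n
  have u_Suc: "u (Suc n) = \<Phi> (u n)" for n by (simp add: u_def)
  have u_bd: "cmod (u n i) \<le> A" for n i
    by (induction n arbitrary: i) (auto simp: u_Suc bd, simp add: u_def A)
  have step: "cmod (u (Suc n) i - u n i) \<le> A / 2 ^ n" for n i
  proof (induction n arbitrary: i)
    case 0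
    then show ?case using u_bd[of 1 i] by (simp add: u_def)
  next
    case (Suc n)
    have "cmod (\<Phi> (u (Suc n)) i - \<Phi> (u n) i) \<le> (A / 2 ^ n) / 2"
      by (rule contr) (use u_bd Suc in auto)
    then show ?case by (simp add: u_Suc)
  qed
  \<comment> \<open>The right-hand side telescopes, which keeps the induction on \<open>m\<close>
    free of geometric sums.\<close>
  have far: "cmod (u (n + m) i - u n i) \<le> 2 * A / 2 ^ n - 2 * A / 2 ^ (n + m)" for n m i
  proof (induction m)
    case 0
    then show ?case by simp
  next
    case (Suc m)
    have "cmod (u (n + Suc m) i - u n i) \<le> cmod (u (Suc (n + m)) i - u (n + m) i) + cmod (u (n + m) i - u n i)"
      using norm_triangle_ineq[of "u (Suc (n + m)) i - u (n + m) i" "u (n + m) i - u n i"] by simp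
    then show ?case using Suc step[of "n + m" i] by simp
  qed
  have lim0: "(\<lambda>n. 2 * A / 2 ^ n) \<longlonglongrightarrow> 0"
    by (intro LIMSEQ_divide_realpow_zero) auto
  have "Cauchy (\<lambda>n. u n i)" for i
  proof (rule metric_CauchyI)
    fix e :: real assume "0 < e"
    then obtain N where N: "\<And>n. n \<ge> N \<Longrightarrow> 2 * A / 2 ^ n < e / 2"
      using order_tendstoD(2)[OF lim0, of "e / 2"] by (auto simp: eventually_sequentially)
    have near: "cmod (u n i - u N i) < e / 2" if "n \<ge> N" for n
    proof -
      have "cmod (u n i - u N i) \<le> 2 * A / 2 ^ N - 2 * A / 2 ^ n"
        using far[of N "n - N" i] that by simp
      moreover have "0 \<le> 2 * A / 2 ^ n" using A by simp
      ultimately show ?thesis using N[of N] by linarith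
    qed
    show "\<exists>M. \<forall>m\<ge>M. \<forall>n\<ge>M. dist (u m i) (u n i) < e"
    proof (intro exI allI impI)
      fix m n assume "N \<le> m" "N \<le> n"
      then show "dist (u m i) (u n i) < e"
        using near[of m] near[of n] dist_triangle_half_l[of "u m i" "u N i" e "u n i"]
        by (auto simp: dist_norm norm_minus_commute)
    qed
  qed
  then have "\<forall>i. \<exists>l. (\<lambda>n. u n i) \<longlonglongrightarrow> l"
    by (auto simp: Cauchy_convergent_iff convergent_def)
  then obtain f where f: "\<And>i. (\<lambda>n. u n i) \<longlonglongrightarrow> f i" by metis
  have f_bd: "cmod (f i) \<le> A" for i
    by (rule LIMSEQ_le_const2[OF tendsto_norm[OF f]]) (use u_bd in auto)
  have near: "cmod (f i - u n i) \<le> 2 * A / 2 ^ n" for n i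
  proof (rule LIMSEQ_le_const2)
    show "(\<lambda>m. cmod (u m i - u n i)) \<longlonglongrightarrow> cmod (f i - u n i)"
      by (intro tendsto_intros f)
    have "cmod (u m i - u n i) \<le> 2 * A / 2 ^ n" if "m \<ge> n" for m
    proof -
      have "cmod (u m i - u n i) \<le> 2 * A / 2 ^ n - 2 * A / 2 ^ m"
        using far[of n "m - n" i] that by simp
      moreover have "0 \<le> 2 * A / 2 ^ m" using A by simp
      ultimately show ?thesis by linarith
    qed
    then show "\<exists>N. \<forall>m\<ge>N. cmod (u m i - u n i) \<le> 2 * A / 2 ^ n" by blast
  qed
  have fixed: "\<Phi> f i = f i" for i
  proof (rule LIMSEQ_unique)
    have "(\<lambda>n. cmod (u (Suc n) i - \<Phi> f i)) \<longlonglongrightarrow> 0"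
    proof (rule tendsto_sandwich[OF _ _ tendsto_const lim0])
      have "cmod (u (Suc n) i - \<Phi> f i) \<le> 2 * A / 2 ^ n" for n
      proof -
        have "cmod (\<Phi> (u n) i - \<Phi> f i) \<le> (2 * A / 2 ^ n) / 2"
          by (rule contr) (use u_bd f_bd near in \<open>auto simp: norm_minus_commute\<close>)
        also have "\<dots> \<le> 2 * A / 2 ^ n" using A by (simp add: divide_right_mono)
        finally show ?thesis by (simp add: u_Suc)
      qed
      then show "\<forall>\<^sub>F n in sequentially. cmod (u (Suc n) i - \<Phi> f i) \<le> 2 * A / 2 ^ n"
        by simp
    qed auto
    then show "(\<lambda>n. u (Suc n) i) \<longlonglongrightarrow> \<Phi> f i"
      using LIM_zero_iff tendsto_norm_zero_iff by blast
    show "(\<lambda>n. u (Suc n) i) \<longlonglongrightarrow> f i"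
      by (rule LIMSEQ_Suc[OF f])
  qed
  show thesis by (rule that[OF f_bd fixed])
qed

section \<open>Sequences that decay away from a point of the spectrum\<close>

lemma inverse_square_summable_on_int: "(\<lambda>i::int. 1 / (1 + (real_of_int i)\<^sup>2)) summable_on UNIV"
proof -
  have "summable (\<lambda>n::nat. 1 / (1 + (real n)\<^sup>2))"
  proof (rule summable_comparison_test_ev)
    show "summable (\<lambda>n::nat. 1 / (real n)\<^sup>2)"
      using inverse_power_summable[of 2, where 'a = real] by (simp add: inverse_eq_divide)
    show "\<forall>\<^sub>F n in sequentially. norm (1 / (1 + (real n)\<^sup>2)) \<le> 1 / (real n)\<^sup>2"
      using eventually_gt_at_top[of 0] by eventually_elim (auto intro!: frac_le)
  qed
  then have nat: "(\<lambda>n::nat. 1 / (1 + (real n)\<^sup>2)) summable_on UNIV"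
    by (intro norm_summable_imp_summable_on) simp
  have "(\<lambda>i::int. 1 / (1 + (real_of_int i)\<^sup>2)) summable_on range int"
    using nat by (subst summable_on_reindex) (auto simp: inj_on_def o_def)
  moreover have "(\<lambda>i::int. 1 / (1 + (real_of_int i)\<^sup>2)) summable_on range (\<lambda>n. - int n)"
    using nat by (subst summable_on_reindex) (auto simp: inj_on_def o_def)
  moreover have "range int \<union> range (\<lambda>n. - int n) = UNIV"
    by (auto simp: image_iff) (metis int_cases2)
  ultimately show ?thesis
    using summable_on_union by metis
qed

text \<open>The 16 is 8 + 8, from the two translates in \<open>gap_sum_le\<close>; the root turns
  the bound into one for an \<open>l2_norm\<close>.\<close>

definition gap_const :: real where
  "gap_const = sqrt (16 * (\<Sum>\<^sub>\<infinity>i::int. 1 / (1 + (real_of_int i)\<^sup>2)))"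

lemma gap_const_square: "gap_const\<^sup>2 = 16 * (\<Sum>\<^sub>\<infinity>i::int. 1 / (1 + (real_of_int i)\<^sup>2))"
  by (simp add: gap_const_def infsum_nonneg)

lemma gap_const_ge_1: "1 \<le> gap_const"
proof -
  have "(\<Sum>i\<in>{0::int}. 1 / (1 + (real_of_int i)\<^sup>2)) \<le> (\<Sum>\<^sub>\<infinity>i::int. 1 / (1 + (real_of_int i)\<^sup>2))"
    by (rule finite_sum_le_infsum) (auto intro: inverse_square_summable_on_int)
  then show ?thesis by (simp add: gap_const_def)
qed

text \<open>The bound has to be uniform in \<open>t\<close>, which may be large. Rounding
  \<open>t\<close> to an integer \<open>r\<close> costs a factor 2, because every distance is at
  least 1 / 2; then the absolute value of \<open>m\<close> minus \<open>r\<close> is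
  \<open>m - r\<close> or \<open>- (m + r)\<close>, so two translates of one convergent series
  dominate.\<close>

lemma gap_sum_le:
  fixes t :: real and s :: int
  assumes "finite F" and gap: "\<And>j. j \<in> F \<Longrightarrow> 1 / 2 \<le> \<bar>\<bar>real_of_int (2 * j + s)\<bar> - t\<bar>"
  shows "(\<Sum>j\<in>F. 1 / (\<bar>real_of_int (2 * j + s)\<bar> - t)\<^sup>2) \<le> gap_const\<^sup>2"
proof -
  define \<phi> where "\<phi> i = 1 / (1 + (real_of_int i)\<^sup>2)" for i
  define r where "r = round t"
  have r: "\<bar>t - real_of_int r\<bar> \<le> 1 / 2"
    unfolding r_def using of_int_round_abs_le[of t] by (simp add: abs_minus_commute)
  have bound: "1 / (\<bar>real_of_int m\<bar> - t)\<^sup>2 \<le> 8 * \<phi> (m - r) + 8 * \<phi> (m + r)"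
    if "1 / 2 \<le> \<bar>\<bar>real_of_int m\<bar> - t\<bar>" for m
  proof -
    define x where "x = \<bar>real_of_int m\<bar> - t"
    have x: "1 / 2 \<le> \<bar>x\<bar>" using that by (simp add: x_def)
    have "\<bar>\<bar>real_of_int m\<bar> - real_of_int r\<bar> \<le> 2 * \<bar>x\<bar>"
      using abs_triangle_ineq[of x "t - real_of_int r"] r x by (simp add: x_def)
    then have "(\<bar>real_of_int m\<bar> - real_of_int r)\<^sup>2 \<le> 4 * x\<^sup>2"
      by (metis abs_le_square_iff abs_mult abs_numeral power_mult_distrib four_x_squared)
    moreover have "1 \<le> 4 * x\<^sup>2"
      using power_mono[OF x, of 2] by (simp add: power2_eq_square)
    \<comment> \<open>8 = 4 + 4: each of the two summands is at most
      \<open>4 * x\<^sup>2\<close>.\<close>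
    ultimately have "1 + (\<bar>real_of_int m\<bar> - real_of_int r)\<^sup>2 \<le> 8 * x\<^sup>2" by simp
    then have "8 / (8 * x\<^sup>2) \<le> 8 / (1 + (\<bar>real_of_int m\<bar> - real_of_int r)\<^sup>2)"
      using x by (intro divide_left_mono) (auto intro!: add_pos_nonneg mult_pos_pos)
    then have "1 / x\<^sup>2 \<le> 8 / (1 + (\<bar>real_of_int m\<bar> - real_of_int r)\<^sup>2)" by simp
    also have "\<dots> \<le> 8 * \<phi> (m - r) + 8 * \<phi> (m + r)"
    proof -
      have "0 \<le> \<phi> i" for i by (simp add: \<phi>_def)
      moreover have "\<bar>real_of_int m\<bar> - real_of_int r = real_of_int (m - r)
          \<or> \<bar>real_of_int m\<bar> - real_of_int r = - real_of_int (m + r)" by auto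
      then have "8 / (1 + (\<bar>real_of_int m\<bar> - real_of_int r)\<^sup>2) = 8 * \<phi> (m - r)
          \<or> 8 / (1 + (\<bar>real_of_int m\<bar> - real_of_int r)\<^sup>2) = 8 * \<phi> (m + r)"
        by (elim disjE) (simp_all only: \<phi>_def power2_minus, simp_all)
      ultimately show ?thesis by (smt (verit))
    qed
    finally show ?thesis by (simp add: x_def)
  qed
  have shift: "(\<Sum>j\<in>F. \<phi> (2 * j + i)) \<le> (\<Sum>\<^sub>\<infinity>i. \<phi> i)" for i
  proof -
    have "(\<Sum>j\<in>F. \<phi> (2 * j + i)) = sum \<phi> ((\<lambda>j. 2 * j + i) ` F)"
      by (subst sum.reindex) (auto simp: inj_on_def)
    also have "\<dots> \<le> (\<Sum>\<^sub>\<infinity>i. \<phi> i)"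
      using assms(1) inverse_square_summable_on_int
      by (intro finite_sum_le_infsum) (auto simp: \<phi>_def[abs_def])
    finally show ?thesis .
  qed
  have "(\<Sum>j\<in>F. 1 / (\<bar>real_of_int (2 * j + s)\<bar> - t)\<^sup>2)
      \<le> (\<Sum>j\<in>F. 8 * \<phi> (2 * j + (s - r)) + 8 * \<phi> (2 * j + (s + r)))"
    using bound[OF gap] by (intro sum_mono) (simp add: algebra_simps)
  also have "\<dots> \<le> 16 * (\<Sum>\<^sub>\<infinity>i. \<phi> i)"
    using shift[of "s - r"] shift[of "s + r"] by (simp add: sum.distrib sum_distrib_left[symmetric])
  also have "\<dots> = gap_const\<^sup>2"
    by (simp add: gap_const_square \<phi>_def)
  finally show ?thesis .
qed

text \<open>The hypotheses concern nonzero entries only, so modes that have been removed may lie at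
  \<open>t\<close> itself. In most applications \<open>C\<close> carries a factor
  \<open>1 / M\<close> or \<open>1 / n\<close>, which is the source of the smallness.\<close>

lemma gap_l2:
  assumes C: "0 \<le> C"
    and gap: "\<And>j. f j \<noteq> 0 \<Longrightarrow> 1 / 2 \<le> \<bar>\<bar>real_of_int (2 * j + s)\<bar> - t\<bar>"
    and le: "\<And>j. f j \<noteq> 0 \<Longrightarrow> norm (f j) * \<bar>\<bar>real_of_int (2 * j + s)\<bar> - t\<bar> \<le> C"
  shows "l2_seq f" "l2_norm f \<le> C * gap_const"
proof -
  have "(\<Sum>j\<in>F. (norm (f j))\<^sup>2) \<le> (C * gap_const)\<^sup>2" if F: "finite F" for F
  proof -
    have "(norm (f j))\<^sup>2 \<le> C\<^sup>2 * (1 / (\<bar>real_of_int (2 * j + s)\<bar> - t)\<^sup>2)" if "f j \<noteq> 0" for j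
    proof -
      have "norm (f j) \<le> C / \<bar>\<bar>real_of_int (2 * j + s)\<bar> - t\<bar>"
        using gap[OF that] le[OF that] by (subst pos_le_divide_eq) linarith+
      then have "(norm (f j))\<^sup>2 \<le> (C / \<bar>\<bar>real_of_int (2 * j + s)\<bar> - t\<bar>)\<^sup>2"
        by (rule power_mono) simp
      then show ?thesis by (simp add: power_divide)
    qed
    then have "(\<Sum>j\<in>{j\<in>F. f j \<noteq> 0}. (norm (f j))\<^sup>2)
        \<le> (\<Sum>j\<in>{j\<in>F. f j \<noteq> 0}. C\<^sup>2 * (1 / (\<bar>real_of_int (2 * j + s)\<bar> - t)\<^sup>2))"
      by (intro sum_mono) auto
    also have "\<dots> \<le> C\<^sup>2 * gap_const\<^sup>2"
      unfolding sum_distrib_left[symmetric] using F gap by (intro mult_left_mono gap_sum_le) auto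
    also have "(\<Sum>j\<in>{j\<in>F. f j \<noteq> 0}. (norm (f j))\<^sup>2) = (\<Sum>j\<in>F. (norm (f j))\<^sup>2)"
      using F by (intro sum.mono_neutral_left) auto
    finally show ?thesis by (simp add: power_mult_distrib)
  qed
  moreover have "0 \<le> C * gap_const" using C gap_const_ge_1 by simp
  ultimately show "l2_seq f" "l2_norm f \<le> C * gap_const"
    using l2_seqI_sum_le[of f "C * gap_const"] by auto
qed

text \<open>Square roots reduce this to \<open>gap_l2\<close>. Absolute summability is what turns a
  coefficient sequence into a uniformly convergent series.\<close>

lemma gap_l1:
  assumes C: "0 \<le> C"
    and gap: "\<And>j. f j \<noteq> 0 \<Longrightarrow> 1 / 2 \<le> \<bar>\<bar>real_of_int (2 * j + s)\<bar> - t\<bar>"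
    and le: "\<And>j. f j \<noteq> 0 \<Longrightarrow> norm (f j) * (\<bar>real_of_int (2 * j + s)\<bar> - t)\<^sup>2 \<le> C"
  shows "(\<lambda>j. norm (f j)) summable_on UNIV"
proof -
  define g where "g j = sqrt (norm (f j))" for j
  have "l2_seq g"
  proof (rule gap_l2(1))
    fix j assume "g j \<noteq> 0"
    then have j: "f j \<noteq> 0" by (simp add: g_def)
    show "1 / 2 \<le> \<bar>\<bar>real_of_int (2 * j + s)\<bar> - t\<bar>" by (rule gap[OF j])
    have "norm (g j) * \<bar>\<bar>real_of_int (2 * j + s)\<bar> - t\<bar> = sqrt (norm (f j) * (\<bar>real_of_int (2 * j + s)\<bar> - t)\<^sup>2)"
      by (simp add: g_def real_sqrt_mult)
    also have "\<dots> \<le> sqrt C" using le[OF j] by simp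
    finally show "norm (g j) * \<bar>\<bar>real_of_int (2 * j + s)\<bar> - t\<bar> \<le> sqrt C" .
  qed (use C in auto)
  then show ?thesis by (simp add: l2_seq_def g_def)
qed

section \<open>Fourier series on the circle\<close>

text \<open>Even \<open>m\<close> gives functions of period 1, odd \<open>m\<close> antiperiodic
  ones, so one family serves both boundary conditions.\<close>

definition trig :: "int \<Rightarrow> real \<Rightarrow> complex" where
  "trig m x = cis (pi * of_int m * x)"

lemma trig_0 [simp]: "trig 0 x = 1"
  by (simp add: trig_def)

lemma trig_at_0 [simp]: "trig m 0 = 1"
  by (simp add: trig_def)

lemma trig_mult: "trig m x * trig n x = trig (m + n) x"
  by (simp add: trig_def cis_mult algebra_simps)

lemma trig_add: "trig m (x + y) = trig m x * trig m y"
  by (simp add: trig_def cis_mult algebra_simps)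

lemma trig_minus_arg: "trig m (- x) = trig (- m) x"
  by (simp add: trig_def)

lemma trig_diff_arg: "trig m (x - y) = trig m x * trig (- m) y"
  using trig_add[of m x "- y"] by (simp add: trig_minus_arg)

lemma norm_trig [simp]: "cmod (trig m x) = 1"
  by (simp add: trig_def)

lemma cnj_trig: "cnj (trig m x) = trig (- m) x"
  by (simp add: trig_def cis_cnj)

lemma trig_inverse: "trig m x * trig (- m) x = 1"
  by (simp add: trig_mult)

lemma trig_at_1: "trig m 1 = (if even m then 1 else -1)"
proof -
  have "cis (pi * of_int m) = (if even m then 1 else -1)"
  proof (cases "even m")
    case True
    then obtain k where "m = 2 * k" by blast
    then have "pi * of_int m = 2 * pi * of_int k" by simp
    then show ?thesis using True by (metis Ints_of_int cis_multiple_2pi)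
  next
    case False
    then obtain k where "m = 2 * k + 1" by (metis oddE)
    then have "pi * of_int m = 2 * pi * of_int k + pi" by (simp add: algebra_simps)
    then show ?thesis using False
      by (metis Ints_of_int cis_mult cis_multiple_2pi cis_pi mult_1)
  qed
  then show ?thesis by (simp add: trig_def)
qed

lemma continuous_on_trig [continuous_intros]: "continuous_on A (trig m)"
  unfolding trig_def by (intro continuous_intros)

lemma trig_has_vector_derivative:
  "(trig m has_vector_derivative (\<i> * (pi * of_int m) * trig m x)) (at x within A)"
  unfolding trig_def[abs_def] cis_conv_exp
  by (auto intro!: derivative_eq_intros has_vector_derivative_real_field simp: field_simps)

lemma trig_measurable [measurable]: "trig m \<in> borel_measurable circle_measure"
  by (intro continuous_imp_measurable_on_sets_lebesgue continuous_intros) auto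

lemma square_integrable_trig: "square_integrable (trig m)"
  by (intro square_integrable_continuous continuous_intros)

lemma integrable_circle_continuous:
  fixes f :: "real \<Rightarrow> complex"
  assumes "continuous_on {0..1} f"
  shows "integrable circle_measure f"
  by (rule continuous_imp_integrable_real[OF assms])

lemma circle_integral_FTC:
  fixes f :: "real \<Rightarrow> complex"
  assumes "\<And>x. x \<in> {0..1} \<Longrightarrow> (f has_vector_derivative f' x) (at x within {0..1})"
    and "continuous_on {0..1} f'"
  shows "(\<integral>x. f' x \<partial>circle_measure) = f 1 - f 0"
proof -
  have "(f' has_integral (f 1 - f 0)) {0..1}"
    by (rule fundamental_theorem_of_calculus) (use assms in auto)
  moreover have "(f' has_integral (\<integral>x. f' x \<partial>circle_measure)) {0..1}"
    by (intro has_integral_integral_lebesgue_on integrable_circle_continuous assms) auto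
  ultimately show ?thesis using has_integral_unique by blast
qed

text \<open>Only even indices: products of one exponential with the conjugate of another of equal
  parity are of this form, while different parities are not orthogonal on the unit interval.\<close>

lemma trig_integral: "(\<integral>x. trig (2 * i) x \<partial>circle_measure) = (if i = 0 then 1 else 0)"
proof (cases "i = 0")
  case True
  have "(\<integral>x. (1::complex) \<partial>circle_measure) = 1"
    by (simp add: measure_restrict_space)
  then show ?thesis using True by simp
next
  case False
  have "(\<integral>x. trig (2 * i) x \<partial>circle_measure)
    = trig (2 * i) 1 / (\<i> * (pi * of_int (2 * i))) - trig (2 * i) 0 / (\<i> * (pi * of_int (2 * i)))"
  proof (rule circle_integral_FTC)
    fix x :: real
    have "((\<lambda>x. (1 / (\<i> * (pi * of_int (2 * i)))) * trig (2 * i) x) has_vector_derivative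
        (1 / (\<i> * (pi * of_int (2 * i)))) * (\<i> * (pi * of_int (2 * i)) * trig (2 * i) x)) (at x within {0..1})"
      by (intro has_vector_derivative_mult_right trig_has_vector_derivative)
    then show "((\<lambda>x. trig (2 * i) x / (\<i> * (pi * of_int (2 * i)))) has_vector_derivative trig (2 * i) x)
        (at x within {0..1})"
      using False by (simp add: field_simps)
  qed (intro continuous_intros)
  then show ?thesis using False by (simp add: trig_at_1)
qed

section \<open>Fourier coefficients of both parities and Bessel's inequality\<close>

definition coef :: "int \<Rightarrow> (real \<Rightarrow> complex) \<Rightarrow> complex" where
  "coef m f = (\<integral>x. f x * trig (- m) x \<partial>circle_measure)"

definition l2_coeff :: "int \<Rightarrow> l2_circle \<Rightarrow> complex" where
  "l2_coeff m y = pairing y (l2_class (trig (- m)))"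

lemma l2_rel_refl: "square_integrable f \<Longrightarrow> l2_rel f f"
  by (simp add: l2_rel_def)

lemma l2_class_rep: "l2_class (l2_rep y) = y"
  using Quotient3_abs_rep[OF Quotient3_l2_circle] .

lemma square_integrable_rep: "square_integrable (l2_rep y)"
  using Quotient3_rep_reflp[OF Quotient3_l2_circle, of y] by (simp add: l2_rel_def)

lemma l2_coeff_class: "square_integrable f \<Longrightarrow> l2_coeff m (l2_class f) = coef m f"
  by (simp add: l2_coeff_def coef_def pairing.abs_eq l2_rel_refl square_integrable_trig)

lemma l2_coeff_rep: "l2_coeff m y = coef m (l2_rep y)"
  using l2_coeff_class[OF square_integrable_rep] by (simp add: l2_class_rep)

lemma norm_l2_class: "square_integrable f \<Longrightarrow> norm (l2_class f) = sqrt (\<integral>x. (cmod (f x))\<^sup>2 \<partial>circle_measure)"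
  by (simp add: norm_l2_circle.abs_eq l2_rel_refl)

lemma integrable_mult_trig:
  "square_integrable f \<Longrightarrow> integrable circle_measure (\<lambda>x. f x * trig m x)"
  by (intro integrable_mult_square_integrable square_integrable_trig)

lemma l2_class_eqI:
  assumes "square_integrable f" "\<And>x. x \<in> {0..1} \<Longrightarrow> f x = g x"
  shows "square_integrable g" "l2_class f = l2_class g"
proof -
  have "g \<in> borel_measurable circle_measure"
    using square_integrable_measurable[OF assms(1)] assms(2)
    using measurable_cong[of circle_measure f g] by auto
  moreover have "integrable circle_measure (\<lambda>x. (cmod (g x))\<^sup>2)"
    using assms by (subst Bochner_Integration.integrable_cong[where g = "\<lambda>x. (cmod (f x))\<^sup>2"]) (auto simp: square_integrable_def)
  ultimately show g: "square_integrable g" by (simp add: square_integrable_def)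
  have "l2_rel f g" using assms g by (auto simp: l2_rel_def intro!: AE_I2)
  then show "l2_class f = l2_class g"
    using Quotient3_rel_abs[OF Quotient3_l2_circle] by blast
qed

lemma pairing_add_left: "pairing (a + b) c = pairing a c + pairing b c"
proof transfer
  fix f g h assume "l2_rel f f" "l2_rel g g" "l2_rel h h"
  then have "integrable circle_measure (\<lambda>x. f x * h x)" "integrable circle_measure (\<lambda>x. g x * h x)"
    by (auto intro!: integrable_mult_square_integrable simp: l2_rel_def)
  then show "(\<integral>x. (f x + g x) * h x \<partial>circle_measure) =
       (\<integral>x. f x * h x \<partial>circle_measure) + (\<integral>x. g x * h x \<partial>circle_measure)"
    by (simp add: distrib_right)
qed

lemma pairing_scale_left: "pairing (scaleC r a) c = r * pairing a c"
proof transfer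
  fix f g h and r :: complex assume "l2_rel f f" "l2_rel h h"
  then have "integrable circle_measure (\<lambda>x. f x * h x)"
    by (auto intro!: integrable_mult_square_integrable simp: l2_rel_def)
  then show "(\<integral>x. r * f x * h x \<partial>circle_measure) = r * (\<integral>x. f x * h x \<partial>circle_measure)"
    by (simp add: mult.assoc)
qed

lemma pairing_commute: "pairing a b = pairing b a"
  by transfer (simp add: mult.commute)

lemma l2_coeff_add: "l2_coeff m (a + b) = l2_coeff m a + l2_coeff m b"
  by (simp add: l2_coeff_def pairing_add_left)

lemma l2_coeff_scale: "l2_coeff m (scaleC r a) = r * l2_coeff m a"
  by (simp add: l2_coeff_def pairing_scale_left)

lemma l2_coeff_0 [simp]: "l2_coeff m 0 = 0"
  using l2_coeff_scale[of m 0 0] by simp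

lemma l2_coeff_diff: "l2_coeff m (a - b) = l2_coeff m a - l2_coeff m b"
  using l2_coeff_add[of m "a - b" b] by simp

lemma l2_coeff_sum: "l2_coeff m (\<Sum>i\<in>I. g i) = (\<Sum>i\<in>I. l2_coeff m (g i))"
  by (induction I rule: infinite_finite_induct) (auto simp: l2_coeff_add)

lemma fourier_coeff_eq: "fourier_coeff q n = l2_coeff (2 * n) q"
proof -
  have "(\<lambda>x. exp (2 * of_int (- n) * of_real pi * \<i> * of_real x)) = trig (- (2 * n))"
    by (auto simp: trig_def cis_conv_exp algebra_simps)
  then show ?thesis by (simp add: fourier_coeff_def l2_coeff_def l2_exp_def)
qed

lemma bessel:
  "l2_seq (\<lambda>j. l2_coeff (2 * j + s) y)" "l2_norm (\<lambda>j. l2_coeff (2 * j + s) y) \<le> norm y"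
proof -
  define f where "f = l2_rep y"
  have f: "square_integrable f" and y: "y = l2_class f"
    by (simp_all add: f_def square_integrable_rep l2_class_rep)
  define c where "c j = coef (2 * j + s) f" for j
  have c: "l2_coeff (2 * j + s) y = c j" for j
    by (simp add: c_def y l2_coeff_class[OF f])
  have "(\<Sum>j\<in>F. (norm (l2_coeff (2 * j + s) y))\<^sup>2) \<le> (norm y)\<^sup>2" if F: "finite F" for F
  proof -
    define P where "P x = (\<Sum>j\<in>F. c j * trig (2 * j + s) x)" for x
    have P: "square_integrable P"
      unfolding P_def by (intro square_integrable_continuous continuous_intros)
    have int1: "integrable circle_measure (\<lambda>x. f x * cnj (P x))"
      and int2: "integrable circle_measure (\<lambda>x. P x * cnj (P x))"
      and int3: "integrable circle_measure (\<lambda>x. (cmod (f x))\<^sup>2)"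
      using f P by (auto intro!: integrable_mult_square_integrable square_integrable_cnj simp: square_integrable_def[of f])
    have fP: "(\<integral>x. f x * cnj (P x) \<partial>circle_measure) = of_real (\<Sum>j\<in>F. (cmod (c j))\<^sup>2)"
    proof -
      have "(\<integral>x. f x * cnj (P x) \<partial>circle_measure) = (\<integral>x. (\<Sum>j\<in>F. cnj (c j) * (f x * trig (- (2 * j + s)) x)) \<partial>circle_measure)"
        by (simp add: P_def sum_distrib_left cnj_trig algebra_simps)
      also have "\<dots> = (\<Sum>j\<in>F. cnj (c j) * c j)"
        using integrable_mult_trig[OF f] by (subst Bochner_Integration.integral_sum) (auto simp: c_def coef_def)
      also have "\<dots> = of_real (\<Sum>j\<in>F. (cmod (c j))\<^sup>2)"
        by (simp add: complex_norm_square[symmetric] mult.commute)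
      finally show ?thesis .
    qed
    have PP: "(\<integral>x. P x * cnj (P x) \<partial>circle_measure) = of_real (\<Sum>j\<in>F. (cmod (c j))\<^sup>2)"
    proof -
      have "P x * cnj (P x) = (\<Sum>j\<in>F. \<Sum>k\<in>F. c j * cnj (c k) * trig (2 * (j - k)) x)" for x
        unfolding P_def by (simp add: sum_product cnj_trig trig_mult algebra_simps)
      then have "(\<integral>x. P x * cnj (P x) \<partial>circle_measure)
          = (\<integral>x. (\<Sum>j\<in>F. \<Sum>k\<in>F. c j * cnj (c k) * trig (2 * (j - k)) x) \<partial>circle_measure)"
        by simp
      also have "\<dots> = (\<Sum>j\<in>F. \<Sum>k\<in>F. c j * cnj (c k) * (if j - k = 0 then 1 else 0))"
        using integrable_circle_continuous[OF continuous_on_trig] trig_integral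
        by (simp add: Bochner_Integration.integral_sum del: right_diff_distrib_numeral)
      also have "\<dots> = (\<Sum>j\<in>F. c j * cnj (c j))"
      proof (intro sum.cong refl)
        fix j assume "j \<in> F"
        have "(\<Sum>k\<in>F. c j * cnj (c k) * (if j - k = 0 then 1 else 0)) = (\<Sum>k\<in>F. if k = j then c j * cnj (c k) else 0)"
          by (intro sum.cong) auto
        then show "(\<Sum>k\<in>F. c j * cnj (c k) * (if j - k = 0 then 1 else 0)) = c j * cnj (c j)"
          using F \<open>j \<in> F\<close> by simp
      qed
      also have "\<dots> = of_real (\<Sum>j\<in>F. (cmod (c j))\<^sup>2)"
        by (simp add: complex_norm_square[symmetric])
      finally show ?thesis .
    qed
    have "0 \<le> (\<integral>x. (cmod (f x - P x))\<^sup>2 \<partial>circle_measure)" by simp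
    also have "(\<lambda>x. (cmod (f x - P x))\<^sup>2) = (\<lambda>x. (cmod (f x))\<^sup>2 - 2 * Re (f x * cnj (P x)) + Re (P x * cnj (P x)))"
    proof
      fix x
      show "(cmod (f x - P x))\<^sup>2 = (cmod (f x))\<^sup>2 - 2 * Re (f x * cnj (P x)) + Re (P x * cnj (P x))"
        unfolding cmod_power2 by (simp add: algebra_simps power2_eq_square)
    qed
    also have "(\<integral>x. (cmod (f x))\<^sup>2 - 2 * Re (f x * cnj (P x)) + Re (P x * cnj (P x)) \<partial>circle_measure)
       = (\<integral>x. (cmod (f x))\<^sup>2 \<partial>circle_measure) - 2 * Re (\<integral>x. f x * cnj (P x) \<partial>circle_measure)
         + Re (\<integral>x. P x * cnj (P x) \<partial>circle_measure)"
      using int1[THEN integrable_Re] int2[THEN integrable_Re] int3 int1 int2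
      by (simp del: times_complex.sel cnj.sel)
    also have "\<dots> = (norm y)\<^sup>2 - (\<Sum>j\<in>F. (cmod (c j))\<^sup>2)"
      by (simp add: fP PP y norm_l2_class[OF f])
    finally show ?thesis by (simp add: c)
  qed
  then show "l2_seq (\<lambda>j. l2_coeff (2 * j + s) y)" "l2_norm (\<lambda>j. l2_coeff (2 * j + s) y) \<le> norm y"
    using l2_seqI_sum_le[of "\<lambda>j. l2_coeff (2 * j + s) y" "norm y"] by auto
qed

text \<open>The functions in the domain of \<open>hill_operator\<close> are indefinite integrals and
  need not be differentiable everywhere, so the product rule is replaced by Fubini: the integral of
  \<open>g t * \<phi>' x\<close> over the triangle \<open>t \<le> x\<close> is computed in both
  orders by \<open>inner1\<close> and \<open>inner2\<close>.\<close>

lemma integration_by_parts_indefinite: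
  fixes g G \<phi> \<phi>' :: "real \<Rightarrow> complex"
  assumes g: "integrable circle_measure g"
    and G: "\<And>x. x \<in> {0..1} \<Longrightarrow> (g has_integral (G x - G 0)) {0..x}"
    and \<phi>: "\<And>x. x \<in> {0..1} \<Longrightarrow> (\<phi> has_vector_derivative \<phi>' x) (at x within {0..1})"
    and \<phi>': "continuous_on {0..1} \<phi>'"
  shows "(\<integral>x. g x * \<phi> x \<partial>circle_measure) = G 1 * \<phi> 1 - G 0 * \<phi> 0 - (\<integral>x. G x * \<phi>' x \<partial>circle_measure)"
proof -
  interpret finite_measure circle_measure
    by (rule finite_measure_lebesgue_on) simp
  interpret P: pair_sigma_finite circle_measure circle_measure ..
  have [measurable]: "g \<in> borel_measurable circle_measure"
    using g by (rule borel_measurable_integrable)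
  have int\<phi>': "integrable circle_measure \<phi>'"
    by (rule integrable_circle_continuous[OF \<phi>'])
  then have [measurable]: "\<phi>' \<in> borel_measurable circle_measure"
    by (rule borel_measurable_integrable)
  have [measurable]: "(\<lambda>x::real. x) \<in> borel_measurable circle_measure"
    by (intro continuous_imp_measurable_on_sets_lebesgue continuous_intros) auto
  have "bounded (\<phi>' ` {0..1})"
    by (intro compact_imp_bounded compact_continuous_image \<phi>') auto
  then obtain B where B: "\<And>x. x \<in> {0..1} \<Longrightarrow> cmod (\<phi>' x) \<le> B" and B0: "0 < B"
    unfolding bounded_pos by (metis imageI)
  define f where "f x t = (if t \<le> x then g t * \<phi>' x else 0)" for x t :: real
  have f_meas [measurable]: "(\<lambda>(x, t). f x t) \<in> borel_measurable (circle_measure \<Otimes>\<^sub>M circle_measure)"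
    unfolding f_def by measurable
  have f_int: "integrable circle_measure (\<lambda>t. f x t)" for x
    by (rule Bochner_Integration.integrable_bound[of _ "\<lambda>t. g t * \<phi>' x"])
      (use g in \<open>auto simp: f_def\<close>)
  have "integrable (circle_measure \<Otimes>\<^sub>M circle_measure) (\<lambda>(x, t). f x t)"
  proof (rule P.Fubini_integrable)
    show "integrable circle_measure (\<lambda>x. \<integral>y. norm (case (x, y) of (x, t) \<Rightarrow> f x t) \<partial>circle_measure)"
    proof (rule integrable_const_bound)
      show "AE x in circle_measure. norm (\<integral>y. norm (case (x, y) of (x, t) \<Rightarrow> f x t) \<partial>circle_measure)
          \<le> (\<integral>t. norm (g t) * B \<partial>circle_measure)"
      proof (rule AE_I2)
        fix x assume x: "x \<in> space circle_measure"
        have "(\<integral>t. norm (f x t) \<partial>circle_measure) \<le> (\<integral>t. norm (g t) * B \<partial>circle_measure)"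
          using g f_int B[of x] B0 x
          by (intro integral_mono) (auto simp: f_def norm_mult intro!: mult_left_mono)
        then show "norm (\<integral>y. norm (case (x, y) of (x, t) \<Rightarrow> f x t) \<partial>circle_measure)
          \<le> (\<integral>t. norm (g t) * B \<partial>circle_measure)" by simp
      qed
    qed measurable
  qed (use f_int in auto)
  then have swap: "(\<integral>t. (\<integral>x. f x t \<partial>circle_measure) \<partial>circle_measure) = (\<integral>x. (\<integral>t. f x t \<partial>circle_measure) \<partial>circle_measure)"
    by (rule P.Fubini_integral)
  have inner1: "(\<integral>t. f x t \<partial>circle_measure) = (G x - G 0) * \<phi>' x" if x: "x \<in> {0..1}" for x
  proof -
    have "((\<lambda>t. g t * \<phi>' x) has_integral (G x - G 0) * \<phi>' x) {0..x}"
      by (intro has_integral_mult_left G x)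
    then have "((\<lambda>t. if t \<in> {0..x} then g t * \<phi>' x else 0) has_integral (G x - G 0) * \<phi>' x) {0..1}"
      using x by (subst has_integral_restrict) auto
    then have "(f x has_integral (G x - G 0) * \<phi>' x) {0..1}"
      by (rule has_integral_eq[rotated]) (auto simp: f_def)
    moreover have "(f x has_integral (\<integral>t. f x t \<partial>circle_measure)) {0..1}"
      by (intro has_integral_integral_lebesgue_on f_int) auto
    ultimately show ?thesis using has_integral_unique by blast
  qed
  have inner2: "(\<integral>x. f x t \<partial>circle_measure) = g t * (\<phi> 1 - \<phi> t)" if t: "t \<in> {0..1}" for t
  proof -
    have "(\<phi>' has_integral (\<phi> 1 - \<phi> t)) {t..1}"
      using t by (intro fundamental_theorem_of_calculus)
        (auto intro!: has_vector_derivative_within_subset[OF \<phi>])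
    then have "((\<lambda>x. g t * \<phi>' x) has_integral g t * (\<phi> 1 - \<phi> t)) {t..1}"
      by (rule has_integral_mult_right)
    then have "((\<lambda>x. if x \<in> {t..1} then g t * \<phi>' x else 0) has_integral g t * (\<phi> 1 - \<phi> t)) {0..1}"
      using t by (subst has_integral_restrict) auto
    then have "((\<lambda>x. f x t) has_integral g t * (\<phi> 1 - \<phi> t)) {0..1}"
      by (rule has_integral_eq[rotated]) (auto simp: f_def)
    moreover have "integrable circle_measure (\<lambda>x. f x t)"
      by (rule Bochner_Integration.integrable_bound[of _ "\<lambda>x. g t * \<phi>' x"])
        (use int\<phi>' in \<open>auto simp: f_def\<close>)
    then have "((\<lambda>x. f x t) has_integral (\<integral>x. f x t \<partial>circle_measure)) {0..1}"
      by (intro has_integral_integral_lebesgue_on) auto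
    ultimately show ?thesis using has_integral_unique by blast
  qed
  have \<phi>_cont: "continuous_on {0..1} \<phi>"
    using \<phi> has_vector_derivative_continuous continuous_on_eq_continuous_within by blast
  have G_cont: "continuous_on {0..1} G"
  proof -
    have "continuous_on {0..1} (\<lambda>x. integral {0..x} g + G 0)"
      using integrable_on_lebesgue_on[OF g] by (intro continuous_intros indefinite_integral_continuous_1) auto
    then show ?thesis
      by (rule continuous_on_eq) (use integral_unique[OF G] in auto)
  qed
  have g\<phi>: "integrable circle_measure (\<lambda>t. g t * \<phi> t)"
  proof -
    have "bounded (\<phi> ` {0..1})"
      by (intro compact_imp_bounded compact_continuous_image \<phi>_cont) auto
    then obtain K where K: "\<And>x. x \<in> {0..1} \<Longrightarrow> cmod (\<phi> x) \<le> K"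
      unfolding bounded_iff by (metis imageI)
    have [measurable]: "\<phi> \<in> borel_measurable circle_measure"
      by (rule borel_measurable_integrable[OF integrable_circle_continuous[OF \<phi>_cont]])
    show ?thesis
    proof (rule Bochner_Integration.integrable_bound[of _ "\<lambda>t. g t * of_real K"])
      show "AE x in circle_measure. norm (g x * \<phi> x) \<le> norm (g x * complex_of_real K)"
      proof (rule AE_I2)
        fix x assume "x \<in> space circle_measure"
        then have "cmod (\<phi> x) \<le> \<bar>K\<bar>" using K[of x] by force
        then show "norm (g x * \<phi> x) \<le> norm (g x * complex_of_real K)"
          by (simp add: norm_mult mult_left_mono)
      qed
    qed (use g in auto)
  qed
  have "(\<integral>t. g t * (\<phi> 1 - \<phi> t) \<partial>circle_measure) = (\<integral>x. (G x - G 0) * \<phi>' x \<partial>circle_measure)"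
  proof -
    have "(\<integral>t. g t * (\<phi> 1 - \<phi> t) \<partial>circle_measure) = (\<integral>t. (\<integral>x. f x t \<partial>circle_measure) \<partial>circle_measure)"
      by (intro Bochner_Integration.integral_cong refl) (simp add: inner2)
    also have "\<dots> = (\<integral>x. (G x - G 0) * \<phi>' x \<partial>circle_measure)"
      unfolding swap by (intro Bochner_Integration.integral_cong refl) (simp add: inner1)
    finally show ?thesis .
  qed
  also have "\<dots> = (\<integral>x. G x * \<phi>' x \<partial>circle_measure) - G 0 * (\<phi> 1 - \<phi> 0)"
  proof -
    have "integrable circle_measure (\<lambda>x. G x * \<phi>' x)"
      by (intro integrable_circle_continuous continuous_intros G_cont \<phi>')
    then show ?thesis
      using int\<phi>' circle_integral_FTC[OF \<phi> \<phi>'] by (simp add: left_diff_distrib)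
  qed
  finally have "(\<integral>t. g t * (\<phi> 1 - \<phi> t) \<partial>circle_measure)
      = (\<integral>x. G x * \<phi>' x \<partial>circle_measure) - G 0 * (\<phi> 1 - \<phi> 0)" .
  moreover have "(\<integral>t. g t * (\<phi> 1 - \<phi> t) \<partial>circle_measure) = (G 1 - G 0) * \<phi> 1 - (\<integral>t. g t * \<phi> t \<partial>circle_measure)"
  proof -
    have "(g has_integral (\<integral>t. g t \<partial>circle_measure)) {0..1}"
      by (intro has_integral_integral_lebesgue_on g) auto
    moreover have "(g has_integral (G 1 - G 0)) {0..1}" by (rule G) simp
    ultimately have "(\<integral>t. g t \<partial>circle_measure) = G 1 - G 0" by (rule has_integral_unique)
    then show ?thesis
      using g g\<phi> by (simp add: right_diff_distrib)
  qed
  ultimately have "(G 1 - G 0) * \<phi> 1 - (\<integral>t. g t * \<phi> t \<partial>circle_measure)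
      = (\<integral>x. G x * \<phi>' x \<partial>circle_measure) - G 0 * (\<phi> 1 - \<phi> 0)"
    by metis
  then show ?thesis by (simp add: algebra_simps)
qed

text \<open>The boundary terms cancel, because \<open>G\<close> and the exponential pick up the same
  sign \<open>trig s 1\<close> between 0 and 1.\<close>

lemma coef_derivative:
  assumes "integrable circle_measure g"
    and "\<And>x. x \<in> {0..1} \<Longrightarrow> (g has_integral (G x - G 0)) {0..x}"
    and "G 1 = trig s 1 * G 0"
  shows "coef (2 * j + s) g = \<i> * (pi * of_int (2 * j + s)) * coef (2 * j + s) G"
proof -
  have "coef (2 * j + s) g = G 1 * trig (- (2 * j + s)) 1 - G 0 * trig (- (2 * j + s)) 0
      - (\<integral>x. G x * (\<i> * (pi * of_int (- (2 * j + s))) * trig (- (2 * j + s)) x) \<partial>circle_measure)"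
    unfolding coef_def
  proof (rule integration_by_parts_indefinite[OF assms(1,2)])
    show "(trig (- (2 * j + s)) has_vector_derivative \<i> * (pi * of_int (- (2 * j + s))) * trig (- (2 * j + s)) x)
        (at x within {0..1})" for x
      by (rule trig_has_vector_derivative)
  qed (auto intro!: continuous_intros)
  also have "(\<integral>x. G x * (\<i> * (pi * of_int (- (2 * j + s))) * trig (- (2 * j + s)) x) \<partial>circle_measure)
     = \<i> * (pi * of_int (- (2 * j + s))) * coef (2 * j + s) G"
    unfolding coef_def by (subst integral_mult_right_zero[symmetric]) (simp add: mult_ac)
  also have "G 1 * trig (- (2 * j + s)) 1 = G 0"
    by (simp add: assms(3) trig_at_1)
  finally show ?thesis by (simp add: algebra_simps)
qed

lemma has_integral_imp_lipschitz:
  fixes u u' :: "real \<Rightarrow> complex"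
  assumes u: "\<And>x. x \<in> {0..1} \<Longrightarrow> (u' has_integral (u x - u 0)) {0..x}"
    and bd: "\<And>x. x \<in> {0..1} \<Longrightarrow> cmod (u' x) \<le> K"
    and x: "x \<in> {0..1}" and y: "y \<in> {0..1}"
  shows "cmod (u x - u y) \<le> K * \<bar>x - y\<bar>"
proof -
  have le: "cmod (u b - u a) \<le> K * (b - a)" if ab: "a \<le> b" "a \<in> {0..1}" "b \<in> {0..1}" for a b
  proof -
    have int: "u' integrable_on {0..b}" using u[OF ab(3)] by blast
    then have int': "u' integrable_on {a..b}"
      by (rule integrable_on_subinterval) (use ab in auto)
    have "integral {0..a} u' + integral {a..b} u' = integral {0..b} u'"
      using ab int by (intro Henstock_Kurzweil_Integration.integral_combine) auto
    then have "u b - u a = integral {a..b} u'"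
      using integral_unique[OF u[OF ab(2)]] integral_unique[OF u[OF ab(3)]] by (simp add: algebra_simps)
    moreover have "cmod (integral {a..b} u') \<le> integral {a..b} (\<lambda>_. K)"
      using int' ab bd by (intro integral_norm_bound_integral) auto
    ultimately show ?thesis using ab by (simp add: mult.commute)
  qed
  show ?thesis
    using le[of x y] le[of y x] x y by (cases "x \<le> y") (auto simp: norm_minus_commute)
qed

lemma trig_lipschitz: "cmod (trig m x - trig m y) \<le> pi * \<bar>of_int m\<bar> * \<bar>x - y\<bar>"
proof -
  have "trig m x - trig m y = (trig m (x - y) - 1) * trig m y"
    by (simp add: left_diff_distrib trig_add[symmetric])
  then have "cmod (trig m x - trig m y) = cmod (exp (\<i> * of_real (pi * of_int m * (x - y))) - 1)"
    by (simp add: norm_mult trig_def cis_conv_exp)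
  also have "\<dots> = 2 * \<bar>sin (pi * of_int m * (x - y) / 2)\<bar>"
    by (rule dist_exp_i_1)
  also have "\<dots> \<le> 2 * \<bar>pi * of_int m * (x - y) / 2\<bar>"
    by (intro mult_left_mono abs_sin_x_le_abs_x) auto
  finally show ?thesis by (simp add: abs_mult)
qed

text \<open>Jordan's inequality: a concave function lies above its chord, here the one from 0 to
  \<open>pi / 2\<close>.\<close>

lemma sin_ge_two_t:
  assumes "0 \<le> t" "t \<le> 1 / 2"
  shows "2 * t \<le> sin (pi * t)"
proof -
  have "convex_on {0..pi} (\<lambda>x. - sin x)"
    by (rule f''_ge0_imp_convex[where f' = "\<lambda>x. - cos x" and f'' = sin])
      (auto intro!: derivative_eq_intros sin_ge_zero)
  from convex_onD[OF this, of "2 * t" 0 "pi / 2"] show ?thesis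
    using assms by (simp add: mult.commute)
qed

text \<open>The left-hand side is the distance from \<open>t\<close> to the integers. The difference
  quotient in \<open>fourier_inversion\<close> has to be controlled at both ends of the interval if
  \<open>x0\<close> is one of them.\<close>

lemma trig_2_minus_1:
  assumes "\<bar>t\<bar> \<le> 1"
  shows "min \<bar>t\<bar> (1 - \<bar>t\<bar>) \<le> cmod (trig 2 t - 1)"
proof -
  have "cmod (trig 2 t - 1) = cmod (exp (\<i> * of_real (2 * pi * t)) - 1)"
    by (simp add: trig_def cis_conv_exp mult.commute)
  also have "\<dots> = 2 * \<bar>sin (pi * t)\<bar>"
    by (subst dist_exp_i_1) simp
  also have "\<bar>sin (pi * t)\<bar> = \<bar>sin (pi * \<bar>t\<bar>)\<bar>"
    by (cases "0 \<le> t") auto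
  finally have *: "cmod (trig 2 t - 1) = 2 * \<bar>sin (pi * \<bar>t\<bar>)\<bar>" .
  show ?thesis
  proof (cases "\<bar>t\<bar> \<le> 1 / 2")
    case True
    then show ?thesis using sin_ge_two_t[of "\<bar>t\<bar>"] * by auto
  next
    case False
    have "sin (pi * (1 - \<bar>t\<bar>)) = sin (pi * \<bar>t\<bar>)"
      by (simp add: right_diff_distrib sin_diff)
    then show ?thesis using sin_ge_two_t[of "1 - \<bar>t\<bar>"] * False assms by auto
  qed
qed

lemma summable_on_int_tendsto_0:
  fixes a :: "int \<Rightarrow> real"
  assumes "a summable_on UNIV" and h: "inj h"
  shows "(\<lambda>n::nat. a (h n)) \<longlonglongrightarrow> 0"
proof -
  have "a summable_on range h" by (rule summable_on_subset_banach[OF assms(1)]) simp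
  then have "(a \<circ> h) summable_on UNIV" using h by (simp add: summable_on_reindex)
  then show ?thesis
    using summable_LIMSEQ_zero[OF summable_on_imp_summable] by (simp add: o_def)
qed

lemma l2_seq_tendsto_0:
  assumes "l2_seq (f :: int \<Rightarrow> complex)" and h: "inj h"
  shows "(\<lambda>n::nat. f (h n)) \<longlonglongrightarrow> 0"
proof -
  have "(\<lambda>n. (cmod (f (h n)))\<^sup>2) \<longlonglongrightarrow> 0"
    using assms by (intro summable_on_int_tendsto_0[where a = "\<lambda>k. (cmod (f k))\<^sup>2"]) (auto simp: l2_seq_def)
  then have "(\<lambda>n. sqrt ((cmod (f (h n)))\<^sup>2)) \<longlonglongrightarrow> sqrt 0"
    by (intro tendsto_real_sqrt)
  then show ?thesis by (simp add: tendsto_norm_zero_iff)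
qed

text \<open>Unconditional summability is known beforehand, so symmetric partial sums only have to
  identify the value.\<close>

lemma has_sum_int_symmetric_limit:
  fixes f :: "int \<Rightarrow> complex"
  assumes "f summable_on UNIV" "(\<lambda>N. \<Sum>j\<in>{- int N..int N}. f j) \<longlonglongrightarrow> l"
  shows "(f has_sum l) UNIV"
proof -
  have flim: "filterlim (\<lambda>N. {- int N..int N}) (finite_subsets_at_top UNIV) sequentially"
    unfolding filterlim_finite_subsets_at_top
  proof (intro allI impI)
    fix X :: "int set" assume "finite X \<and> X \<subseteq> UNIV"
    then have "finite ((\<lambda>x. nat \<bar>x\<bar>) ` X)" by simp
    then obtain N where "\<forall>n\<in>(\<lambda>x. nat \<bar>x\<bar>) ` X. n \<le> N"
      using finite_nat_set_iff_bounded_le by blast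
    then have "X \<subseteq> {- int n..int n}" if "n \<ge> N" for n
      using that by fastforce
    then show "\<forall>\<^sub>F y in sequentially. finite {- int y..int y} \<and> X \<subseteq> {- int y..int y} \<and> {- int y..int y} \<subseteq> UNIV"
      unfolding eventually_sequentially by blast
  qed
  have "(f has_sum infsum f UNIV) UNIV" using assms(1) by simp
  then have "(\<lambda>N. \<Sum>j\<in>{- int N..int N}. f j) \<longlonglongrightarrow> infsum f UNIV"
    unfolding has_sum_def by (rule filterlim_compose[OF _ flim])
  then have "infsum f UNIV = l" using assms(2) LIMSEQ_unique by blast
  then show ?thesis using assms(1) by (simp add: has_sum_iff)
qed

lemma telescope_int_sum:
  fixes f :: "int \<Rightarrow> complex"
  shows "(\<Sum>j\<in>{- int N..int N}. f (j - 1) - f j) = f (- int N - 1) - f (int N)"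
proof (induction N)
  case 0
  then show ?case by simp
next
  case (Suc N)
  have "{- int (Suc N)..int (Suc N)} = insert (- int N - 1) (insert (int N + 1) {- int N..int N})"
    by auto
  then show ?case using Suc by (simp add: algebra_simps)
qed

text \<open>Dini's argument: the difference quotient with \<open>trig 2 (x - x0) - 1\<close> is square integrable, so the
  symmetric partial sums telescope up to two of its Fourier coefficients, which tend to 0 by Bessel.\<close>

lemma fourier_inversion:
  assumes lip: "\<And>x y. x \<in> {0..1} \<Longrightarrow> y \<in> {0..1} \<Longrightarrow> cmod (u x - u y) \<le> K * \<bar>x - y\<bar>"
    and bc: "u 1 = trig s 1 * u 0"
    and sm: "(\<lambda>j. cmod (coef (2 * j + s) u)) summable_on UNIV"
    and x0: "x0 \<in> {0..1}"
  shows "((\<lambda>j. coef (2 * j + s) u * trig (2 * j + s) x0) has_sum u x0) UNIV"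
proof -
  have K: "0 \<le> K" using lip[of 1 0] by (simp add: order_trans[OF norm_ge_zero])
  have u_cont: "continuous_on {0..1} u"
    using lip by (intro lipschitz_on_continuous_on[of K] lipschitz_onI) (auto simp: dist_norm K)
  have "bounded (u ` {0..1})"
    by (intro compact_imp_bounded compact_continuous_image u_cont) auto
  then obtain B where B: "\<And>x. x \<in> {0..1} \<Longrightarrow> cmod (u x) \<le> B" and B0: "0 < B"
    unfolding bounded_pos by (metis imageI)
  \<comment> \<open>The twist around \<open>x0\<close> undoes the sign \<open>trig s 1\<close>:
    \<open>h\<close> is periodic for both parities and keeps its value at \<open>x0\<close>.\<close>
  define h where "h x = u x * trig (- s) (x - x0)" for x
  define L where "L = K + B * (pi * \<bar>of_int s\<bar>)"
  have h_x0: "h x0 = u x0" by (simp add: h_def)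
  have h_lip: "cmod (h x - h y) \<le> L * \<bar>x - y\<bar>" if xy: "x \<in> {0..1}" "y \<in> {0..1}" for x y
  proof -
    have "h x - h y = (u x - u y) * trig (- s) (x - x0) + u y * (trig (- s) (x - x0) - trig (- s) (y - x0))"
      by (simp add: h_def algebra_simps)
    then have "cmod (h x - h y) \<le> cmod (u x - u y) + cmod (u y) * cmod (trig (- s) (x - x0) - trig (- s) (y - x0))"
      by (metis norm_triangle_ineq norm_mult norm_trig mult.right_neutral)
    also have "\<dots> \<le> K * \<bar>x - y\<bar> + B * (pi * \<bar>of_int s\<bar> * \<bar>x - y\<bar>)"
      using lip[OF xy] B[OF xy(2)] B0 trig_lipschitz[of "- s" "x - x0" "y - x0"]
      by (intro add_mono mult_mono) auto
    finally show ?thesis by (simp add: L_def algebra_simps)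
  qed
  have h_per: "h 1 = h 0"
    using trig_inverse[of s 1] by (simp add: h_def bc trig_diff_arg trig_minus_arg mult_ac)
  have L0: "0 \<le> L" using K B0 by (simp add: L_def)
  have h_bd: "cmod (h x - u x0) \<le> L * cmod (trig 2 (x - x0) - 1)" if x: "x \<in> {0..1}" for x
  proof -
    have "cmod (h x - h x0) \<le> L * \<bar>x - x0\<bar>" using h_lip[OF x x0] .
    \<comment> \<open>The same difference estimated the other way round the circle, through the
      identified end points.\<close>
    moreover have "cmod (h x - h x0) \<le> L * (1 - \<bar>x - x0\<bar>)"
    proof (cases "x0 \<le> x")
      case True
      have "cmod (h x - h x0) \<le> cmod (h x - h 1) + cmod (h 0 - h x0)"
        using norm_triangle_ineq[of "h x - h 1" "h 0 - h x0"] by (simp add: h_per)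
      also have "\<dots> \<le> L * \<bar>x - 1\<bar> + L * \<bar>0 - x0\<bar>" by (intro add_mono h_lip) (use x x0 in auto)
      also have "\<dots> = L * (1 - \<bar>x - x0\<bar>)" using True x x0 by (simp add: algebra_simps)
      finally show ?thesis .
    next
      case False
      have "cmod (h x - h x0) \<le> cmod (h x - h 0) + cmod (h 1 - h x0)"
        using norm_triangle_ineq[of "h x - h 0" "h 1 - h x0"] by (simp add: h_per)
      also have "\<dots> \<le> L * \<bar>x - 0\<bar> + L * \<bar>1 - x0\<bar>" by (intro add_mono h_lip) (use x x0 in auto)
      also have "\<dots> = L * (1 - \<bar>x - x0\<bar>)" using False x x0 by (simp add: algebra_simps)
      finally show ?thesis .
    qed
    ultimately have "cmod (h x - h x0) \<le> L * min \<bar>x - x0\<bar> (1 - \<bar>x - x0\<bar>)"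
      by (simp add: min_def)
    also have "\<dots> \<le> L * cmod (trig 2 (x - x0) - 1)"
      using x x0 by (intro mult_left_mono L0 trig_2_minus_1) auto
    finally show ?thesis by (simp add: h_x0)
  qed
  define g where "g x = (h x - u x0) / (trig 2 (x - x0) - 1)" for x
  have [measurable]: "u \<in> borel_measurable circle_measure"
    by (rule borel_measurable_integrable[OF integrable_circle_continuous[OF u_cont]])
  have trig_shift_meas [measurable]: "(\<lambda>x. trig m (x - x0)) \<in> borel_measurable circle_measure" for m
    by (simp add: trig_diff_arg)
  have g_meas: "g \<in> borel_measurable circle_measure"
    unfolding g_def h_def by measurable
  have g_bd: "cmod (g x) \<le> L" if "x \<in> {0..1}" for x
    using h_bd[OF that] L0 by (cases "trig 2 (x - x0) = 1") (auto simp: g_def norm_divide divide_le_eq)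
  have g_sq: "square_integrable g"
  proof -
    interpret finite_measure circle_measure by (rule finite_measure_lebesgue_on) simp
    have "integrable circle_measure (\<lambda>x. (cmod (g x))\<^sup>2)"
      by (rule integrable_const_bound[where B = "L\<^sup>2"]) (use g_meas g_bd in \<open>auto intro!: AE_I2 power_mono\<close>)
    with g_meas show ?thesis by (simp add: square_integrable_def)
  qed
  \<comment> \<open>Where the denominator vanishes, \<open>g\<close> is 0 by the convention for
    division, and \<open>h_bd\<close> makes the numerator vanish as well.\<close>
  have g_eq: "g x * (trig 2 (x - x0) - 1) = h x - u x0" if "x \<in> {0..1}" for x
    using h_bd[OF that] by (cases "trig 2 (x - x0) = 1") (auto simp: g_def)
  define d where "d j = trig (2 * j) x0 * coef (2 * j) g" for j
  have coef_diff: "coef (2 * j + s) u * trig (2 * j + s) x0 - (if j = 0 then u x0 else 0) = d (j - 1) - d j" for j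
  proof -
    have e1: "(\<integral>x. (h x - u x0) * trig (- (2 * j)) (x - x0) \<partial>circle_measure)
        = coef (2 * j + s) u * trig (2 * j + s) x0 - (if j = 0 then u x0 else 0)"
    proof -
      have "h x * trig (- (2 * j)) (x - x0) = u x * trig (- (2 * j + s)) x * trig (2 * j + s) x0" for x
      proof -
        have "- s + - (2 * j) = - (2 * j + s)" by simp
        then have "trig (- s) (x - x0) * trig (- (2 * j)) (x - x0) = trig (- (2 * j + s)) (x - x0)"
          by (simp only: trig_mult)
        also have "\<dots> = trig (- (2 * j + s)) x * trig (2 * j + s) x0"
          by (simp only: trig_diff_arg minus_minus)
        finally show ?thesis by (simp only: h_def mult.assoc)
      qed
      then have "(\<lambda>x. (h x - u x0) * trig (- (2 * j)) (x - x0))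
        = (\<lambda>x. u x * trig (- (2 * j + s)) x * trig (2 * j + s) x0 - u x0 * trig (2 * j) x0 * trig (2 * (- j)) x)"
        by (auto simp: left_diff_distrib trig_diff_arg)
      moreover have "integrable circle_measure (\<lambda>x. u x * trig (- (2 * j + s)) x)"
        by (intro integrable_circle_continuous continuous_intros u_cont)
      moreover have "integrable circle_measure (trig (2 * (- j)))"
        by (intro integrable_circle_continuous continuous_intros)
      ultimately show ?thesis
        using trig_integral[of "- j"] by (simp add: coef_def del: mult_minus_right)
    qed
    have "(\<integral>x. (h x - u x0) * trig (- (2 * j)) (x - x0) \<partial>circle_measure)
        = (\<integral>x. g x * (trig 2 (x - x0) - 1) * trig (- (2 * j)) (x - x0) \<partial>circle_measure)"
      by (intro Bochner_Integration.integral_cong refl) (simp add: g_eq)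
    also have "\<dots> = (\<integral>x. trig (2 * (j - 1)) x0 * (g x * trig (- (2 * (j - 1))) x)
          - trig (2 * j) x0 * (g x * trig (- (2 * j)) x) \<partial>circle_measure)"
    proof (intro Bochner_Integration.integral_cong refl)
      fix x
      have "g x * (trig 2 (x - x0) - 1) * trig (- (2 * j)) (x - x0)
          = g x * (trig 2 (x - x0) * trig (- (2 * j)) (x - x0)) - g x * trig (- (2 * j)) (x - x0)"
        by (simp add: algebra_simps)
      also have "trig 2 (x - x0) * trig (- (2 * j)) (x - x0) = trig (- (2 * (j - 1))) (x - x0)"
        by (simp add: trig_mult algebra_simps)
      finally show "g x * (trig 2 (x - x0) - 1) * trig (- (2 * j)) (x - x0)
          = trig (2 * (j - 1)) x0 * (g x * trig (- (2 * (j - 1))) x)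
          - trig (2 * j) x0 * (g x * trig (- (2 * j)) x)"
        by (simp add: trig_diff_arg mult_ac)
    qed
    also have "\<dots> = d (j - 1) - d j"
      using integrable_mult_trig[OF g_sq] by (simp add: d_def coef_def)
    finally show ?thesis using e1 by simp
  qed
  have "l2_seq (\<lambda>j. coef (2 * j) g)"
    using bessel(1)[of 0 "l2_class g"] by (simp add: l2_coeff_class[OF g_sq])
  then have d_l2: "l2_seq d"
    by (rule l2_comparison(1)[where C = 1]) (auto simp: d_def norm_mult)
  have sum_eq: "(\<Sum>j\<in>{- int N..int N}. coef (2 * j + s) u * trig (2 * j + s) x0) = u x0 + (d (- int N - 1) - d (int N))" for N
  proof -
    have "(\<Sum>j\<in>{- int N..int N}. coef (2 * j + s) u * trig (2 * j + s) x0)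
        = (\<Sum>j\<in>{- int N..int N}. (if j = 0 then u x0 else 0) + (d (j - 1) - d j))"
      by (intro sum.cong refl) (simp add: coef_diff[symmetric])
    also have "\<dots> = u x0 + (d (- int N - 1) - d (int N))"
      by (simp add: sum.distrib telescope_int_sum)
    finally show ?thesis .
  qed
  show ?thesis
  proof (rule has_sum_int_symmetric_limit)
    show "(\<lambda>j. coef (2 * j + s) u * trig (2 * j + s) x0) summable_on UNIV"
      by (rule abs_summable_summable) (use sm in \<open>simp add: norm_mult\<close>)
    have "(\<lambda>N. u x0 + (d (- int N - 1) - d (int N))) \<longlonglongrightarrow> u x0 + (0 - 0)"
      by (intro tendsto_intros l2_seq_tendsto_0[OF d_l2]) (auto simp: inj_on_def)
    then show "(\<lambda>N. \<Sum>j\<in>{- int N..int N}. coef (2 * j + s) u * trig (2 * j + s) x0) \<longlonglongrightarrow> u x0"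
      by (simp add: sum_eq)
  qed
qed

section \<open>Hill's operator on Fourier coefficients\<close>

text \<open>For \<open>s \<in> {0, 1}\<close> the functions \<open>trig (2 * j + s)\<close> form an orthonormal basis of eigenfunctions of \<open>- y''\<close> with
  \<open>y(1) = (-1)\<^sup>s y(0)\<close>; all sequences below are indexed by \<open>j\<close>, and \<open>lap s j\<close> is the eigenvalue.\<close>

definition lap :: "int \<Rightarrow> int \<Rightarrow> real" where
  "lap s j = (pi * of_int (2 * j + s))\<^sup>2"

definition synth :: "int \<Rightarrow> (int \<Rightarrow> complex) \<Rightarrow> real \<Rightarrow> complex" where
  "synth s c x = (\<Sum>\<^sub>\<infinity>j. c j * trig (2 * j + s) x)"

definition l2_synth :: "int \<Rightarrow> (int \<Rightarrow> complex) \<Rightarrow> l2_circle" where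
  "l2_synth s c = l2_class (synth s c)"

lemma lap_nonneg [simp]: "0 \<le> lap s j"
  by (simp add: lap_def)

section \<open>Absolutely convergent trigonometric series\<close>

lemma synth_has_sum:
  assumes "(\<lambda>j. cmod (c j)) summable_on UNIV"
  shows "((\<lambda>j. c j * trig (2 * j + s) x) has_sum synth s c x) UNIV"
  unfolding synth_def
  by (rule has_sum_infsum, rule abs_summable_summable) (use assms in \<open>simp add: norm_mult\<close>)

lemma synth_uniform_limit:
  assumes "(\<lambda>j. cmod (c j)) summable_on UNIV"
  shows "uniform_limit A (\<lambda>F x. \<Sum>j\<in>F. c j * trig (2 * j + s) x) (synth s c) (finite_subsets_at_top UNIV)"
  unfolding synth_def[abs_def]
  by (rule Weierstrass_m_test_general[OF _ assms]) (simp add: norm_mult)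

lemma synth_continuous:
  assumes "(\<lambda>j. cmod (c j)) summable_on UNIV"
  shows "continuous_on A (synth s c)"
  by (rule uniform_limit_theorem[OF _ synth_uniform_limit[OF assms]])
    (auto intro!: always_eventually continuous_intros)

lemma synth_square_integrable:
  "(\<lambda>j. cmod (c j)) summable_on UNIV \<Longrightarrow> square_integrable (synth s c)"
  by (intro square_integrable_continuous synth_continuous)

text \<open>Uniform convergence allows termwise integration against an integrable \<open>Q\<close>.
  An exponential as \<open>Q\<close> recovers the coefficients of \<open>synth\<close>; the
  potential times an exponential turns multiplication by \<open>q\<close> into
  \<open>conv\<close>.\<close>

lemma integral_mult_synth:
  assumes c: "(\<lambda>j. cmod (c j)) summable_on UNIV" and Q: "integrable circle_measure Q"
  shows "((\<lambda>k. c k * (\<integral>x. Q x * trig (2 * k + s) x \<partial>circle_measure)) has_sum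
    (\<integral>x. Q x * synth s c x \<partial>circle_measure)) UNIV"
proof -
  have bounded_mult: "integrable circle_measure (\<lambda>x. Q x * g x)" if g: "continuous_on {0..1} g" for g
  proof -
    have "bounded (g ` {0..1})"
      by (intro compact_imp_bounded compact_continuous_image g) auto
    then obtain K where K: "\<And>x. x \<in> {0..1} \<Longrightarrow> cmod (g x) \<le> K" "0 < K"
      unfolding bounded_pos by (metis imageI)
    have [measurable]: "g \<in> borel_measurable circle_measure" "Q \<in> borel_measurable circle_measure"
      using borel_measurable_integrable[OF integrable_circle_continuous[OF g]] borel_measurable_integrable[OF Q] by auto
    show ?thesis
    proof (rule Bochner_Integration.integrable_bound[of _ "\<lambda>t. Q t * of_real K"])
      show "AE x in circle_measure. norm (Q x * g x) \<le> norm (Q x * complex_of_real K)"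
        by (rule AE_I2) (use K in \<open>auto simp: norm_mult intro!: mult_left_mono\<close>)
    qed (use Q in auto)
  qed
  define B where "B = (\<integral>x. cmod (Q x) \<partial>circle_measure)"
  have B: "0 \<le> B" by (simp add: B_def)
  show ?thesis unfolding has_sum_def
  proof (rule tendstoI)
    fix e :: real assume e: "0 < e"
    define e' where "e' = e / (B + 1)"
    have e': "0 < e'" using e B by (simp add: e'_def)
    have "\<forall>\<^sub>F F in finite_subsets_at_top UNIV. \<forall>x\<in>{0..1}. dist (\<Sum>j\<in>F. c j * trig (2 * j + s) x) (synth s c x) < e'"
      by (rule uniform_limitD[OF synth_uniform_limit[OF c] e'])
    then show "\<forall>\<^sub>F F in finite_subsets_at_top UNIV.
        dist (\<Sum>k\<in>F. c k * (\<integral>x. Q x * trig (2 * k + s) x \<partial>circle_measure)) (\<integral>x. Q x * synth s c x \<partial>circle_measure) < e"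
    proof eventually_elim
      case (elim F)
      have cont: "continuous_on {0..1} (\<lambda>x. \<Sum>j\<in>F. c j * trig (2 * j + s) x)"
        by (intro continuous_intros)
      have "(\<Sum>k\<in>F. c k * (\<integral>x. Q x * trig (2 * k + s) x \<partial>circle_measure))
          = (\<integral>x. (\<Sum>k\<in>F. c k * (Q x * trig (2 * k + s) x)) \<partial>circle_measure)"
        using bounded_mult[OF continuous_on_trig] by (simp add: Bochner_Integration.integral_sum)
      also have "(\<lambda>x. \<Sum>k\<in>F. c k * (Q x * trig (2 * k + s) x)) = (\<lambda>x. Q x * (\<Sum>j\<in>F. c j * trig (2 * j + s) x))"
        by (auto simp: sum_distrib_left intro!: sum.cong)
      finally have "(\<Sum>k\<in>F. c k * (\<integral>x. Q x * trig (2 * k + s) x \<partial>circle_measure)) - (\<integral>x. Q x * synth s c x \<partial>circle_measure)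
          = (\<integral>x. Q x * ((\<Sum>j\<in>F. c j * trig (2 * j + s) x) - synth s c x) \<partial>circle_measure)"
        using bounded_mult[OF cont] bounded_mult[OF synth_continuous[OF c]]
        by (simp add: right_diff_distrib)
      also have "cmod \<dots> \<le> (\<integral>x. cmod (Q x * ((\<Sum>j\<in>F. c j * trig (2 * j + s) x) - synth s c x)) \<partial>circle_measure)"
        by (rule integral_norm_bound)
      also have "\<dots> \<le> (\<integral>x. cmod (Q x) * e' \<partial>circle_measure)"
      proof (rule integral_mono)
        show "integrable circle_measure (\<lambda>x. cmod (Q x * ((\<Sum>j\<in>F. c j * trig (2 * j + s) x) - synth s c x)))"
          by (intro integrable_norm bounded_mult continuous_intros synth_continuous c)
        show "integrable circle_measure (\<lambda>x. cmod (Q x) * e')" using Q by simp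
        show "cmod (Q x * ((\<Sum>j\<in>F. c j * trig (2 * j + s) x) - synth s c x)) \<le> cmod (Q x) * e'"
          if "x \<in> space circle_measure" for x
          using elim that unfolding norm_mult
          by (intro mult_left_mono) (auto simp: dist_norm intro!: less_imp_le)
      qed
      also have "\<dots> = B * e'" by (simp add: B_def)
      also have "\<dots> < e"
        using B e by (simp add: e'_def field_simps)
      finally show ?case by (simp add: dist_norm)
    qed
  qed
qed

lemma square_integrable_imp_integrable: "square_integrable f \<Longrightarrow> integrable circle_measure f"
  using integrable_mult_square_integrable[of f "\<lambda>_. 1"] square_integrable_continuous[of "\<lambda>_. 1"] by simp

lemma l2_coeff_synth:
  assumes "(\<lambda>j. cmod (c j)) summable_on UNIV"
  shows "l2_coeff (2 * j + s) (l2_synth s c) = c j"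
proof -
  have "((\<lambda>k. c k * (\<integral>x. trig (- (2 * j + s)) x * trig (2 * k + s) x \<partial>circle_measure)) has_sum
      (\<integral>x. trig (- (2 * j + s)) x * synth s c x \<partial>circle_measure)) UNIV"
    by (intro integral_mult_synth assms integrable_circle_continuous continuous_intros)
  moreover have "c k * (\<integral>x. trig (- (2 * j + s)) x * trig (2 * k + s) x \<partial>circle_measure) = (if k = j then c j else 0)" for k
  proof -
    have "- (2 * j + s) + (2 * k + s) = 2 * (k - j)" by simp
    then show ?thesis by (simp only: trig_mult trig_integral) auto
  qed
  ultimately have "((\<lambda>k. if k = j then c j else 0) has_sum coef (2 * j + s) (synth s c)) UNIV"
    by (simp add: coef_def mult.commute)
  moreover have "((\<lambda>k. if k = j then c j else 0) has_sum c j) UNIV"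
    by (rule has_sum_finite_neutralI[of "{j}"]) auto
  ultimately have "coef (2 * j + s) (synth s c) = c j" by (rule has_sum_unique)
  then show ?thesis by (simp add: l2_synth_def l2_coeff_class[OF synth_square_integrable[OF assms]])
qed

lemma product_coeff:
  assumes "(\<lambda>j. cmod (c j)) summable_on UNIV"
  shows "coef (2 * j + s) (\<lambda>x. l2_rep q x * synth s c x) = conv (fourier_coeff q) c j"
proof -
  have "((\<lambda>k. c k * (\<integral>x. (l2_rep q x * trig (- (2 * j + s)) x) * trig (2 * k + s) x \<partial>circle_measure)) has_sum
      (\<integral>x. (l2_rep q x * trig (- (2 * j + s)) x) * synth s c x \<partial>circle_measure)) UNIV"
    by (intro integral_mult_synth assms integrable_mult_trig square_integrable_rep)
  moreover have "(\<integral>x. (l2_rep q x * trig (- (2 * j + s)) x) * trig (2 * k + s) x \<partial>circle_measure) = fourier_coeff q (j - k)" for k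
  proof -
    have "- (2 * j + s) + (2 * k + s) = - (2 * (j - k))" by simp
    then show ?thesis by (simp only: mult.assoc trig_mult fourier_coeff_eq l2_coeff_rep coef_def)
  qed
  ultimately have "((\<lambda>k. fourier_coeff q (j - k) * c k) has_sum coef (2 * j + s) (\<lambda>x. l2_rep q x * synth s c x)) UNIV"
    by (simp add: coef_def mult_ac)
  then show ?thesis by (simp add: conv_def infsumI)
qed

text \<open>With \<open>t = - 1\<close> the distance in \<open>gap_l2\<close> is at least 1 for
  every mode, so the zero mode is no exception.\<close>

lemma inverse_lap_l2: "l2_seq (\<lambda>j. complex_of_real (1 / (1 + lap s j)))"
proof (rule gap_l2(1)[where C = 1 and t = "-1" and s = s])
  fix j
  define m where "m = \<bar>real_of_int (2 * j + s)\<bar>"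
  have "m \<le> m\<^sup>2"
  proof (cases "2 * j + s = 0")
    case False
    then have "1 \<le> \<bar>2 * j + s\<bar>" by linarith
    then have "1 \<le> m" unfolding m_def by linarith
    then show ?thesis by (simp add: power2_eq_square)
  qed (simp add: m_def)
  moreover have "lap s j = pi\<^sup>2 * m\<^sup>2" by (simp add: lap_def m_def power_mult_distrib)
  moreover have "1 * m\<^sup>2 \<le> pi\<^sup>2 * m\<^sup>2"
    using pi_gt3 by (intro mult_right_mono) (auto intro: order_trans[OF _ self_le_power])
  ultimately have "m + 1 \<le> 1 + lap s j" by linarith
  moreover have "norm (complex_of_real (1 / (1 + lap s j))) = 1 / (1 + lap s j)"
    by (simp del: of_real_divide of_real_add)
  moreover have "\<bar>m - -1\<bar> = m + 1" by (simp add: m_def)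
  ultimately show "norm (complex_of_real (1 / (1 + lap s j))) * \<bar>\<bar>real_of_int (2 * j + s)\<bar> - -1\<bar> \<le> 1"
    unfolding m_def[symmetric] using add_pos_nonneg[OF zero_less_one lap_nonneg[of s j]]
    by (simp add: divide_le_eq)
qed auto

lemma square_integrable_mult_continuous:
  assumes Q: "square_integrable Q" and u: "continuous_on {0..1} u"
  shows "square_integrable (\<lambda>x. Q x * u x)"
proof -
  have [measurable]: "u \<in> borel_measurable circle_measure" "Q \<in> borel_measurable circle_measure"
    using square_integrable_measurable square_integrable_continuous[OF u] Q by auto
  have "bounded (u ` {0..1})"
    by (intro compact_imp_bounded compact_continuous_image u) auto
  then obtain B where B: "\<And>x. x \<in> {0..1} \<Longrightarrow> cmod (u x) \<le> B" "0 < B"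
    unfolding bounded_pos by (metis imageI)
  have "integrable circle_measure (\<lambda>x. (cmod (Q x * u x))\<^sup>2)"
  proof (rule Bochner_Integration.integrable_bound[of _ "\<lambda>x. (cmod (Q x))\<^sup>2 * B\<^sup>2"])
    show "integrable circle_measure (\<lambda>x. (cmod (Q x))\<^sup>2 * B\<^sup>2)"
      using Q by (simp add: square_integrable_def)
    show "AE x in circle_measure. norm ((cmod (Q x * u x))\<^sup>2) \<le> norm ((cmod (Q x))\<^sup>2 * B\<^sup>2)"
      by (rule AE_I2) (use B in \<open>auto simp: norm_mult power_mult_distrib intro!: mult_left_mono power_mono\<close>)
  qed measurable
  then show ?thesis by (simp add: square_integrable_def)
qed

text \<open>Two integrations by parts identify the coefficients of \<open>u''\<close>, so Bessel's
  inequality makes \<open>lap s j * c j\<close> square summable. Division by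
  \<open>1 + lap s j\<close> is multiplication by another square summable sequence, hence
  \<open>c\<close> is absolutely summable and \<open>u\<close> is the sum of its series.\<close>

lemma hill_operator_coeff:
  fixes y f :: l2_circle
  assumes "(y, f) \<in> hill_operator (trig s 1) q"
  defines "c \<equiv> \<lambda>j. l2_coeff (2 * j + s) y"
  shows "(\<lambda>j. cmod (c j)) summable_on UNIV"
    and "l2_seq (\<lambda>j. of_real (lap s j) * c j)"
    and "l2_coeff (2 * j + s) f = of_real (lap s j) * c j + conv (fourier_coeff q) c j"
    and "y = l2_synth s c"
proof -
  obtain u u' u'' where y: "y = l2_class u"
    and f: "f = l2_class (\<lambda>x. - u'' x + l2_rep q x * u x)"
    and u'': "square_integrable u''"
    and u: "\<And>x. x \<in> {0..1} \<Longrightarrow> (u' has_integral (u x - u 0)) {0..x}"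
    and u': "\<And>x. x \<in> {0..1} \<Longrightarrow> (u'' has_integral (u' x - u' 0)) {0..x}"
    and bc: "u 1 = trig s 1 * u 0" "u' 1 = trig s 1 * u' 0"
    using assms(1) unfolding hill_operator_def by blast
  have u''_int: "integrable circle_measure u''"
    by (rule square_integrable_imp_integrable[OF u''])
  have u'_cont: "continuous_on {0..1} u'"
  proof -
    have "continuous_on {0..1} (\<lambda>x. integral {0..x} u'' + u' 0)"
      using integrable_on_lebesgue_on[OF u''_int] by (intro continuous_intros indefinite_integral_continuous_1) auto
    then show ?thesis
      by (rule continuous_on_eq) (use integral_unique[OF u'] in auto)
  qed
  have "bounded (u' ` {0..1})"
    by (intro compact_imp_bounded compact_continuous_image u'_cont) auto
  then obtain K where K: "\<And>x. x \<in> {0..1} \<Longrightarrow> cmod (u' x) \<le> K" "0 < K"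
    unfolding bounded_pos by (metis imageI)
  have lip: "cmod (u x - u y) \<le> K * \<bar>x - y\<bar>" if "x \<in> {0..1}" "y \<in> {0..1}" for x y
    by (rule has_integral_imp_lipschitz[OF u K(1) that])
  have u_cont: "continuous_on {0..1} u"
    using lip K(2) by (intro lipschitz_on_continuous_on[of K] lipschitz_onI) (auto simp: dist_norm)
  have c: "c j = coef (2 * j + s) u" for j
    by (simp add: c_def y l2_coeff_class[OF square_integrable_continuous[OF u_cont]])
  have u''_coef: "coef (2 * j + s) u'' = - of_real (lap s j) * c j" for j
  proof -
    have "coef (2 * j + s) u'' = \<i> * (pi * of_int (2 * j + s)) * coef (2 * j + s) u'"
      by (rule coef_derivative[OF u''_int u' bc(2)])
    also have "coef (2 * j + s) u' = \<i> * (pi * of_int (2 * j + s)) * coef (2 * j + s) u"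
      by (rule coef_derivative[OF integrable_circle_continuous[OF u'_cont] u bc(1)])
    finally show ?thesis by (simp add: c lap_def power2_eq_square mult_ac)
  qed
  have "l2_seq (\<lambda>j. coef (2 * j + s) u'')"
    using bessel(1)[of s "l2_class u''"] by (simp add: l2_coeff_class[OF u''])
  then show lap_l2: "l2_seq (\<lambda>j. of_real (lap s j) * c j)"
    by (simp add: u''_coef)
  have "l2_seq c" using bessel(1)[of s y] by (simp add: c_def)
  then have "l2_seq (\<lambda>j. c j + of_real (lap s j) * c j)"
    using lap_l2 by (rule l2_add(1))
  moreover have "c j = complex_of_real (1 / (1 + lap s j)) * (c j + of_real (lap s j) * c j)" for j
  proof -
    have "1 + complex_of_real (lap s j) \<noteq> 0"
      by (metis add_cancel_right_left add_nonneg_eq_0_iff lap_nonneg of_real_1 of_real_add of_real_eq_0_iff zero_le_one zero_neq_one)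
    then show ?thesis by (simp add: field_simps)
  qed
  ultimately show sm: "(\<lambda>j. cmod (c j)) summable_on UNIV"
    using l2_product(1)[OF inverse_lap_l2[of s], of "\<lambda>j. c j + of_real (lap s j) * c j"] by simp
  have u_synth: "u x = synth s c x" if "x \<in> {0..1}" for x
  proof -
    have "((\<lambda>j. coef (2 * j + s) u * trig (2 * j + s) x) has_sum u x) UNIV"
      using sm by (intro fourier_inversion[OF lip bc(1) _ that]) (simp_all add: c)
    then have "((\<lambda>j. c j * trig (2 * j + s) x) has_sum u x) UNIV" by (simp add: c)
    then show ?thesis by (rule has_sum_unique[OF _ synth_has_sum[OF sm]])
  qed
  show "y = l2_synth s c"
    unfolding y l2_synth_def
    by (rule l2_class_eqI(2)[OF square_integrable_continuous[OF u_cont] u_synth])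
  have qu0: "square_integrable (\<lambda>x. l2_rep q x * u x)"
    by (rule square_integrable_mult_continuous[OF square_integrable_rep u_cont])
  then have qu: "square_integrable (\<lambda>x. - u'' x + l2_rep q x * u x)"
    by (intro square_integrable_add square_integrable_uminus u'')
  have "l2_coeff (2 * j + s) f = coef (2 * j + s) (\<lambda>x. - u'' x + l2_rep q x * u x)"
    by (simp only: f l2_coeff_class[OF qu])
  also have "\<dots> = - coef (2 * j + s) u'' + coef (2 * j + s) (\<lambda>x. l2_rep q x * u x)"
    using integrable_mult_trig[OF u'', of "- (2 * j + s)"] integrable_mult_trig[OF qu0, of "- (2 * j + s)"]
    unfolding coef_def by (simp add: left_diff_distrib del: minus_add_distrib)
  also have "coef (2 * j + s) (\<lambda>x. l2_rep q x * u x) = coef (2 * j + s) (\<lambda>x. l2_rep q x * synth s c x)"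
    unfolding coef_def by (intro Bochner_Integration.integral_cong refl) (simp add: u_synth)
  also have "\<dots> = conv (fourier_coeff q) c j"
    by (rule product_coeff[OF sm])
  finally show "l2_coeff (2 * j + s) f = of_real (lap s j) * c j + conv (fourier_coeff q) c j"
    by (simp add: u''_coef)
qed

lemma l2_synth_add:
  assumes "(\<lambda>j. cmod (c j)) summable_on UNIV" "(\<lambda>j. cmod (d j)) summable_on UNIV"
  shows "l2_synth s (\<lambda>j. c j + d j) = l2_synth s c + l2_synth s d"
proof -
  have "synth s (\<lambda>j. c j + d j) = (\<lambda>x. synth s c x + synth s d x)"
    using infsum_add[OF has_sum_imp_summable[OF synth_has_sum[OF assms(1)]] has_sum_imp_summable[OF synth_has_sum[OF assms(2)]]]
    by (auto simp: synth_def algebra_simps)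
  then show ?thesis
    by (simp add: l2_synth_def plus_l2_circle.abs_eq l2_rel_refl synth_square_integrable assms)
qed

lemma l2_synth_scale:
  assumes "(\<lambda>j. cmod (c j)) summable_on UNIV"
  shows "l2_synth s (\<lambda>j. r * c j) = scaleC r (l2_synth s c)"
proof -
  have "synth s (\<lambda>j. r * c j) = (\<lambda>x. r * synth s c x)"
    by (auto simp: synth_def infsum_cmult_right'[symmetric] algebra_simps)
  then show ?thesis
    by (simp add: l2_synth_def scaleC.abs_eq l2_rel_refl synth_square_integrable assms)
qed

lemma l2_synth_zero [simp]: "l2_synth s (\<lambda>_. 0) = 0"
  by (simp add: l2_synth_def synth_def[abs_def] zero_l2_circle_def)

lemma l2_synth_sum:
  assumes "finite I" "\<And>i. i \<in> I \<Longrightarrow> (\<lambda>j. cmod (F i j)) summable_on UNIV"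
  shows "(\<lambda>j. cmod (\<Sum>i\<in>I. x i * F i j)) summable_on UNIV"
    and "l2_synth s (\<lambda>j. \<Sum>i\<in>I. x i * F i j) = (\<Sum>i\<in>I. scaleC (x i) (l2_synth s (F i)))"
proof -
  have "(\<lambda>j. cmod (\<Sum>i\<in>I. x i * F i j)) summable_on UNIV \<and>
      l2_synth s (\<lambda>j. \<Sum>i\<in>I. x i * F i j) = (\<Sum>i\<in>I. scaleC (x i) (l2_synth s (F i)))"
    using assms
  proof (induction I rule: finite_induct)
    case empty
    then show ?case by simp
  next
    case (insert i I)
    have sm1: "(\<lambda>j. cmod (x i * F i j)) summable_on UNIV"
      using insert.prems by (simp add: norm_mult summable_on_cmult_right)
    have sm2: "(\<lambda>j. cmod (\<Sum>i\<in>I. x i * F i j)) summable_on UNIV"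
      using insert by simp
    have "(\<lambda>j. cmod (x i * F i j + (\<Sum>i\<in>I. x i * F i j))) summable_on UNIV"
      by (rule summable_on_comparison_test[OF summable_on_add[OF sm1 sm2]]) (auto intro: norm_triangle_ineq)
    then show ?case
      using insert l2_synth_add[OF sm1 sm2] l2_synth_scale[of "F i" s "x i"] by simp
  qed
  then show "(\<lambda>j. cmod (\<Sum>i\<in>I. x i * F i j)) summable_on UNIV"
    "l2_synth s (\<lambda>j. \<Sum>i\<in>I. x i * F i j) = (\<Sum>i\<in>I. scaleC (x i) (l2_synth s (F i)))"
    by auto
qed

text \<open>The function \<open>v\<close> is the double primitive of \<open>q * synth s c - f\<close> with the right boundary values; its
  Fourier coefficients are \<open>c\<close>, so it equals \<open>synth s c\<close>.\<close>

lemma hill_operator_synth: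
  assumes s: "s \<in> {0, 1}" and c: "(\<lambda>j. cmod (c j)) summable_on UNIV"
    and f: "\<And>j. l2_coeff (2 * j + s) f = of_real (lap s j) * c j + conv (fourier_coeff q) c j"
  shows "(l2_synth s c, f) \<in> hill_operator (trig s 1) q"
proof -
  define u where "u = synth s c"
  have u_cont: "continuous_on {0..1} u" unfolding u_def by (rule synth_continuous[OF c])
  define g where "g x = l2_rep q x * u x - l2_rep f x" for x
  have qu: "square_integrable (\<lambda>x. l2_rep q x * u x)"
    by (rule square_integrable_mult_continuous[OF square_integrable_rep u_cont])
  have g: "square_integrable g"
    unfolding g_def by (intro square_integrable_diff qu square_integrable_rep)
  have g_int: "integrable circle_measure g" by (rule square_integrable_imp_integrable[OF g])
  have g_coef: "coef (2 * j + s) g = - of_real (lap s j) * c j" for j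
  proof -
    have "coef (2 * j + s) g = coef (2 * j + s) (\<lambda>x. l2_rep q x * u x) - coef (2 * j + s) (l2_rep f)"
      using integrable_mult_trig[OF qu] integrable_mult_trig[OF square_integrable_rep]
      by (simp add: coef_def g_def left_diff_distrib)
    then show ?thesis
      using f[of j] by (simp add: u_def product_coeff[OF c] l2_coeff_rep)
  qed
  define G where "G x = integral {0..x} g" for x
  have G: "(g has_integral G x) {0..x}" if "x \<in> {0..1}" for x
    unfolding G_def
    by (rule integrable_integral, rule integrable_on_subinterval[OF integrable_on_lebesgue_on[OF g_int]])
      (use that in auto)
  have G_cont: "continuous_on {0..1} G"
    unfolding G_def using integrable_on_lebesgue_on[OF g_int] by (intro indefinite_integral_continuous_1) auto
  \<comment> \<open>For \<open>s = 1\<close> half of \<open>G 1\<close> is subtracted, which gives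
    \<open>v' 1 = - v' 0\<close>. For \<open>s = 0\<close> the function \<open>v'\<close> is
    periodic anyway, because \<open>g\<close> has mean 0, and \<open>b'\<close> gives
    \<open>v'\<close> mean 0, which makes \<open>v\<close> periodic.\<close>
  define b' where "b' = (if s = 0 then - integral {0..1} G else - G 1 / 2)"
  define v' where "v' x = b' + G x" for x
  have v'_cont: "continuous_on {0..1} v'" unfolding v'_def by (intro continuous_intros G_cont)
  define H where "H x = integral {0..x} v'" for x
  have H: "(v' has_integral H x) {0..x}" if "x \<in> {0..1}" for x
    unfolding H_def by (intro integrable_integral integrable_continuous_real continuous_on_subset[OF v'_cont])
      (use that in auto)
  have H_cont: "continuous_on {0..1} H"
    unfolding H_def using integrable_continuous_real[OF v'_cont] by (intro indefinite_integral_continuous_1) auto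
  \<comment> \<open>For \<open>s = 0\<close> the zero mode is invisible to \<open>lap\<close>, so
    the constant is fitted to \<open>c 0\<close>.\<close>
  define b where "b = (if s = 0 then c 0 - (\<integral>x. H x \<partial>circle_measure) else - H 1 / 2)"
  define v where "v x = b + H x" for x
  have G0: "G 0 = 0" and H0: "H 0 = 0" by (auto simp: G_def H_def)
  have v_v': "(v' has_integral (v x - v 0)) {0..x}" if "x \<in> {0..1}" for x
    using H[OF that] by (simp add: v_def H0)
  have v'_g: "(g has_integral (v' x - v' 0)) {0..x}" if "x \<in> {0..1}" for x
    using G[OF that] by (simp add: v'_def G0)
  have G1: "G 1 = 0" if "s = 0"
  proof -
    have "(g has_integral (\<integral>x. g x \<partial>circle_measure)) {0..1}"
      by (intro has_integral_integral_lebesgue_on g_int) auto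
    moreover have "(g has_integral G 1) {0..1}" by (rule G) simp
    ultimately have "G 1 = coef 0 g"
      using has_integral_unique by (simp add: coef_def) blast
    also have "\<dots> = 0" using g_coef[of 0] that by (simp add: lap_def)
    finally show ?thesis .
  qed
  have H1: "H 1 = 0" if "s = 0"
  proof -
    have "((\<lambda>x. b' + G x) has_integral (b' + integral {0..1} G)) {0..1}"
      using has_integral_const_real[of b' 0 1] integrable_integral[OF integrable_continuous_real[OF G_cont]]
      by (intro has_integral_add) auto
    then have "(v' has_integral 0) {0..1}" using that by (simp add: v'_def[abs_def] b'_def)
    moreover have "(v' has_integral H 1) {0..1}" by (rule H) simp
    ultimately show ?thesis using has_integral_unique by blast
  qed
  have bc': "v' 1 = trig s 1 * v' 0"
    using s G1 by (auto simp: v'_def G0 b'_def trig_at_1 field_simps)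
  have bc: "v 1 = trig s 1 * v 0"
    using s H1 by (auto simp: v_def H0 b_def trig_at_1 field_simps)
  have v_cont: "continuous_on {0..1} v" unfolding v_def by (intro continuous_intros H_cont)
  have v_coef: "coef (2 * j + s) v = c j" for j
  proof (cases "2 * j + s = 0")
    case True
    moreover have "s = 0 \<or> s = 1" using s by auto
    ultimately have "j = 0 \<and> s = 0" by presburger
    then have js: "j = 0" "s = 0" by auto
    have "coef 0 v = b + (\<integral>x. H x \<partial>circle_measure)"
      using integrable_circle_continuous[OF H_cont] trig_integral[of 0]
        integrable_circle_continuous[OF continuous_on_const]
      by (simp add: coef_def v_def measure_restrict_space)
    then show ?thesis by (simp add: js b_def)
  next
    case False
    have "coef (2 * j + s) g = \<i> * (pi * of_int (2 * j + s)) * coef (2 * j + s) v'"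
      by (rule coef_derivative[OF g_int v'_g bc'])
    also have "coef (2 * j + s) v' = \<i> * (pi * of_int (2 * j + s)) * coef (2 * j + s) v"
      by (rule coef_derivative[OF integrable_circle_continuous[OF v'_cont] v_v' bc])
    finally have "of_real (lap s j) * coef (2 * j + s) v = of_real (lap s j) * c j"
      using g_coef[of j] by (simp add: lap_def power2_eq_square mult_ac)
    then show ?thesis using False by (auto simp: lap_def simp flip: of_int_add of_int_mult)
  qed
  have "bounded (v' ` {0..1})"
    by (intro compact_imp_bounded compact_continuous_image v'_cont) auto
  then obtain K where K: "\<And>x. x \<in> {0..1} \<Longrightarrow> cmod (v' x) \<le> K"
    unfolding bounded_iff by (metis imageI)
  have lip: "cmod (v x - v y) \<le> K * \<bar>x - y\<bar>" if "x \<in> {0..1}" "y \<in> {0..1}" for x y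
    by (rule has_integral_imp_lipschitz[OF v_v' K that])
  have v_u: "v x = u x" if "x \<in> {0..1}" for x
  proof -
    have "((\<lambda>j. coef (2 * j + s) v * trig (2 * j + s) x) has_sum v x) UNIV"
      by (rule fourier_inversion[OF lip bc _ that]) (simp_all add: v_coef c)
    then have "((\<lambda>j. c j * trig (2 * j + s) x) has_sum v x) UNIV" by (simp add: v_coef)
    then show ?thesis unfolding u_def by (rule has_sum_unique[OF _ synth_has_sum[OF c]])
  qed
  have "l2_synth s c = l2_class v"
    using l2_class_eqI(2)[OF square_integrable_continuous[OF v_cont], of u] v_u by (simp add: l2_synth_def u_def)
  moreover have "f = l2_class (\<lambda>x. - g x + l2_rep q x * v x)"
    using l2_class_eqI(2)[OF square_integrable_rep[of f], of "\<lambda>x. - g x + l2_rep q x * v x"] v_u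
    by (simp add: g_def l2_class_rep)
  ultimately show ?thesis
    unfolding hill_operator_def using g v_v' v'_g bc bc' by blast
qed

section \<open>Root spaces of an operator on a finite-dimensional subspace\<close>

lemma dim_zero: "l2_circle.dim {0} = 0"
  using l2_circle.dim_eq_card_independent[OF l2_circle.independent_empty] l2_circle.dim_span[of "{}"] by simp

locale l2_operator =
  fixes T :: "l2_circle \<Rightarrow> l2_circle"
  assumes linear_T: "Vector_Spaces.linear scaleC scaleC T"
begin

lemma T_add: "T (x + y) = T x + T y"
  using linear_T by (simp add: Vector_Spaces.linear_iff)

lemma T_scale: "T (scaleC c x) = scaleC c (T x)"
  using linear_T by (simp add: Vector_Spaces.linear_iff)

lemma T_zero [simp]: "T 0 = 0"
  using T_scale[of 0 0] by simp

text \<open>The polynomial \<open>p\<close> in \<open>T\<close> applied to \<open>y\<close>, by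
  Horner's scheme.\<close>

definition poly_act :: "complex poly \<Rightarrow> l2_circle \<Rightarrow> l2_circle" where
  "poly_act p y = fold_coeffs (\<lambda>a v. scaleC a y + T v) p 0"

lemma poly_act_0 [simp]: "poly_act 0 y = 0"
  by (simp add: poly_act_def)

lemma poly_act_pCons: "poly_act (pCons a p) y = scaleC a y + T (poly_act p y)"
  by (cases "a = 0 \<and> p = 0") (auto simp: poly_act_def)

lemma poly_act_add: "poly_act (p + q) y = poly_act p y + poly_act q y"
  by (induction p q rule: poly_induct2)
    (simp_all add: poly_act_pCons T_add l2_circle.scale_left_distrib)

lemma poly_act_smult: "poly_act (smult c p) y = scaleC c (poly_act p y)"
  by (induction p) (simp_all add: poly_act_pCons T_scale l2_circle.scale_right_distrib)

lemma poly_act_linear_factor: "poly_act ([:- z, 1:] * p) y = T (poly_act p y) - scaleC z (poly_act p y)"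
proof -
  have "[:- z, 1:] * p = smult (- z) p + pCons 0 p" by simp
  then show ?thesis
    by (simp only: poly_act_add poly_act_smult poly_act_pCons) simp
qed

lemma poly_act_in_subspace:
  assumes "l2_circle.subspace W" "\<And>y. y \<in> W \<Longrightarrow> T y \<in> W" "y \<in> W"
  shows "poly_act p y \<in> W"
  by (induction p) (use assms in \<open>auto simp: poly_act_pCons l2_circle.subspace_def\<close>)

lemma poly_act_monom: "poly_act (monom 1 k) y = (T ^^ k) y"
  by (induction k) (simp_all add: monom_0 monom_Suc poly_act_pCons)

text \<open>The iterates of \<open>y\<close> become dependent, so some nonzero polynomial
  annihilates \<open>y\<close>. One of least degree has a root \<open>z\<close>, and its cofactor
  applied to \<open>y\<close> is nonzero and an eigenvector for \<open>z\<close>.\<close>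

lemma eigenvalue_exists:
  assumes W: "l2_circle.subspace W" and inv: "\<And>y. y \<in> W \<Longrightarrow> T y \<in> W"
    and fin: "finite B" "W \<subseteq> l2_circle.span B" and y: "y \<in> W" "y \<noteq> 0"
  obtains z v where "v \<in> W" "v \<noteq> 0" "T v = scaleC z v"
proof -
  define f where "f i = (T ^^ i) y" for i
  have f_W: "f i \<in> W" for i by (induction i) (auto simp: f_def y inv)
  have "\<exists>k. f k \<in> l2_circle.span (f ` {..<k})"
  proof (rule ccontr)
    assume *: "\<nexists>k. f k \<in> l2_circle.span (f ` {..<k})"
    have ind: "l2_circle.independent (f ` {..<k}) \<and> card (f ` {..<k}) = k" for k
    proof (induction k)
      case (Suc k)
      have notin: "f k \<notin> l2_circle.span (f ` {..<k})" using * by simp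
      then have "f k \<notin> f ` {..<k}" using l2_circle.span_base[of "f k"] by metis
      moreover have "l2_circle.independent (insert (f k) (f ` {..<k}))"
        using Suc by (intro l2_circle.independent_insertI notin) simp
      ultimately show ?case using Suc by (simp add: lessThan_Suc)
    qed (simp add: l2_circle.independent_empty)
    have "card (f ` {..<Suc (card B)}) \<le> card B"
      using l2_circle.independent_span_bound[OF fin(1)] ind f_W fin(2) by blast
    then show False using ind[of "Suc (card B)"] by simp
  qed
  then obtain k where k: "f k \<in> l2_circle.span (f ` {..<k})" ..
  have "l2_circle.span (f ` {..<k}) \<subseteq> {poly_act p y | p. \<forall>i\<ge>k. coeff p i = 0}" (is "_ \<subseteq> ?S")
  proof (rule l2_circle.span_minimal)
    show "f ` {..<k} \<subseteq> ?S"
    proof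
      fix v assume "v \<in> f ` {..<k}"
      then obtain i where "i < k" "v = poly_act (monom 1 i) y" by (auto simp: f_def poly_act_monom)
      then show "v \<in> ?S" by fastforce
    qed
    show "l2_circle.subspace ?S"
    proof (rule l2_circle.subspaceI)
      show "0 \<in> ?S" by (rule CollectI, rule exI[of _ 0]) simp
      fix u v assume "u \<in> ?S" "v \<in> ?S"
      then obtain p q where "u = poly_act p y" "v = poly_act q y" "\<forall>i\<ge>k. coeff p i = 0" "\<forall>i\<ge>k. coeff q i = 0" by blast
      then show "u + v \<in> ?S" by (intro CollectI exI[of _ "p + q"]) (simp add: poly_act_add)
    next
      fix c u assume "u \<in> ?S"
      then obtain p where "u = poly_act p y" "\<forall>i\<ge>k. coeff p i = 0" by blast
      then show "scaleC c u \<in> ?S" by (intro CollectI exI[of _ "smult c p"]) (simp add: poly_act_smult)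
    qed
  qed
  then obtain r where r: "f k = poly_act r y" "coeff r k = 0" using k by blast
  have "poly_act (monom 1 k + smult (- 1) r) y = 0"
    using r by (simp only: poly_act_add poly_act_smult poly_act_monom f_def) simp
  moreover have "monom 1 k + smult (- 1) r \<noteq> 0"
    using r(2) by (metis (no_types) coeff_add coeff_monom coeff_smult coeff_0 mult_zero_right add.right_neutral zero_neq_one)
  ultimately have "\<exists>p. p \<noteq> 0 \<and> poly_act p y = 0" by blast
  then obtain p where p: "p \<noteq> 0" "poly_act p y = 0"
    and min: "\<And>r. r \<noteq> 0 \<Longrightarrow> poly_act r y = 0 \<Longrightarrow> degree p \<le> degree r"
    using arg_min_nat_lemma[of "\<lambda>p. p \<noteq> 0 \<and> poly_act p y = 0" _ degree] by blast
  have "degree p \<noteq> 0"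
  proof
    assume "degree p = 0"
    then obtain a where "p = [:a:]" by (metis degree_eq_zeroE)
    then show False using p y by (simp add: poly_act_pCons)
  qed
  then obtain z where "poly p z = 0"
    using fundamental_theorem_of_algebra[of p] by (auto simp: constant_degree)
  then obtain r where pr: "p = [:- z, 1:] * r"
    by (metis poly_eq_0_iff_dvd dvdE)
  then have "r \<noteq> 0" using p by auto
  then have "degree p = Suc (degree r)" unfolding pr by (subst degree_mult_eq) auto
  then have "poly_act r y \<noteq> 0" using min[OF \<open>r \<noteq> 0\<close>] by force
  moreover have "T (poly_act r y) = scaleC z (poly_act r y)"
    using p(2) unfolding pr poly_act_linear_factor by simp
  ultimately show thesis
    using that poly_act_in_subspace[OF W inv y(1)] by blast
qed

definition shift :: "complex \<Rightarrow> l2_circle \<Rightarrow> l2_circle" where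
  "shift z y = T y - scaleC z y"

lemma linear_shift: "Vector_Spaces.linear scaleC scaleC (shift z)"
  unfolding Vector_Spaces.linear_iff shift_def
  using l2_circle.vector_space_axioms
  by (auto simp: T_add T_scale l2_circle.scale_right_distrib l2_circle.scale_right_diff_distrib mult.commute)

lemma linear_shift_pow: "Vector_Spaces.linear scaleC scaleC (shift z ^^ k)"
proof (induction k)
  case 0
  then show ?case using l2_circle.linear_id by (simp add: id_def)
next
  case (Suc k)
  then show ?case using Vector_Spaces.linear_compose[OF Suc linear_shift] by (simp add: o_def)
qed

lemma shift_pow_add: "(shift z ^^ k) (x + y) = (shift z ^^ k) x + (shift z ^^ k) y"
  and shift_pow_scale: "(shift z ^^ k) (scaleC c x) = scaleC c ((shift z ^^ k) x)"
  using linear_shift_pow[of k z] by (simp_all add: Vector_Spaces.linear_iff)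

lemma shift_pow_zero [simp]: "(shift z ^^ k) 0 = 0"
  using shift_pow_scale[of k z 0 0] by simp

lemma shift_pow_diff: "(shift z ^^ k) (x - y) = (shift z ^^ k) x - (shift z ^^ k) y"
  using shift_pow_add[of k z "x - y" y] by simp

lemma T_shift_pow: "T ((shift z ^^ k) x) = (shift z ^^ k) (T x)"
proof -
  have "(shift z ^^ k) (shift z x) = shift z ((shift z ^^ k) x)"
    by (metis funpow_swap1)
  then show ?thesis
    by (simp add: shift_def[of z x] shift_def[of z "(shift z ^^ k) x"] shift_pow_diff shift_pow_scale)
qed

definition root_vectors :: "l2_circle set \<Rightarrow> complex \<Rightarrow> l2_circle set" where
  "root_vectors W z = {y \<in> W. \<exists>k. (shift z ^^ k) y = 0}"

lemma subspace_root_vectors: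
  assumes "l2_circle.subspace W"
  shows "l2_circle.subspace (root_vectors W z)"
proof (rule l2_circle.subspaceI)
  show "0 \<in> root_vectors W z"
    using assms by (auto simp: root_vectors_def l2_circle.subspace_0)
  fix x y assume "x \<in> root_vectors W z" "y \<in> root_vectors W z"
  then obtain k l where *: "x \<in> W" "y \<in> W" "(shift z ^^ k) x = 0" "(shift z ^^ l) y = 0"
    by (auto simp: root_vectors_def)
  have "(shift z ^^ (l + k)) x = 0" using *(3) by (simp add: funpow_add)
  moreover have "(shift z ^^ (l + k)) y = 0" using *(4) by (simp add: add.commute[of l] funpow_add)
  ultimately have "(shift z ^^ (l + k)) (x + y) = 0" by (simp only: shift_pow_add) simp
  then show "x + y \<in> root_vectors W z"
    using * l2_circle.subspace_add[OF assms] by (auto simp: root_vectors_def)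
next
  fix c x assume "x \<in> root_vectors W z"
  then show "scaleC c x \<in> root_vectors W z"
    using l2_circle.subspace_scale[OF assms] by (auto simp: root_vectors_def shift_pow_scale)
qed

lemma shift_in_subspace:
  assumes "l2_circle.subspace W" "\<And>y. y \<in> W \<Longrightarrow> T y \<in> W" "y \<in> W"
  shows "(shift z ^^ k) y \<in> W"
  using assms by (induction k) (auto simp: shift_def l2_circle.subspace_diff l2_circle.subspace_scale)

text \<open>\<open>W\<close> sits in an infinite-dimensional space, and finiteness comes from the
  spanning set \<open>B\<close>. A basis of the kernel is extended to one of \<open>W\<close>; the
  new vectors map to a basis of the image.\<close>

lemma rank_nullity_shift_pow:
  assumes W: "l2_circle.subspace W" and fin: "finite B" "W \<subseteq> l2_circle.span B"
  shows "l2_circle.dim W = l2_circle.dim {y \<in> W. (shift z ^^ n) y = 0} + l2_circle.dim ((shift z ^^ n) ` W)"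
proof -
  define A where "A = shift z ^^ n"
  have linA: "Vector_Spaces.linear scaleC scaleC A" unfolding A_def by (rule linear_shift_pow)
  define K where "K = {y \<in> W. A y = 0}"
  obtain C where C: "C \<subseteq> K" "l2_circle.independent C" "K \<subseteq> l2_circle.span C" "card C = l2_circle.dim K"
    by (rule l2_circle.basis_exists)
  have CW: "C \<subseteq> W" using C(1) by (auto simp: K_def)
  obtain D where D: "C \<subseteq> D" "D \<subseteq> W" "l2_circle.independent D" "W \<subseteq> l2_circle.span D"
    by (rule l2_circle.maximal_independent_subset_extend[OF CW C(2)])
  have finD: "finite D"
    using l2_circle.independent_span_bound[OF fin(1) D(3)] D(2) fin(2) by blast
  have dimW: "l2_circle.dim W = card D"
    using l2_circle.basis_card_eq_dim[OF D(2,4,3)] by simp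
  have K_sub: "l2_circle.subspace K" unfolding K_def
    using W by (auto simp: l2_circle.subspace_def A_def shift_pow_add shift_pow_scale)
  have spanC: "l2_circle.span C \<subseteq> K" by (rule l2_circle.span_minimal[OF C(1) K_sub])
  have inj: "inj_on A (l2_circle.span (D - C))"
  proof (rule inj_onI)
    fix x y assume x: "x \<in> l2_circle.span (D - C)" and y: "y \<in> l2_circle.span (D - C)" and eq: "A x = A y"
    have xy: "x - y \<in> l2_circle.span (D - C)" using x y by (rule l2_circle.span_diff)
    then have "x - y \<in> W" using l2_circle.span_minimal[OF _ W, of "D - C"] D(2) by blast
    moreover have "A (x - y) = 0" using eq by (simp add: A_def shift_pow_diff)
    ultimately have "x - y \<in> l2_circle.span C" using C(3) by (auto simp: K_def)
    then have "x - y \<in> l2_circle.span (D - C) \<inter> l2_circle.span C" using xy by blast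
    then have "x - y \<in> range (\<lambda>u. \<Sum>v\<in>D - C. scaleC (u v) v)" "x - y \<in> range (\<lambda>u. \<Sum>v\<in>C. scaleC (u v) v)"
      using finD finite_subset[OF D(1) finD] by (simp_all add: l2_circle.span_finite)
    then obtain a b where a: "x - y = (\<Sum>v\<in>D - C. scaleC (a v) v)" and b: "x - y = (\<Sum>v\<in>C. scaleC (b v) v)"
      by blast
    define e where "e v = (if v \<in> C then b v else - a v)" for v
    have "(\<Sum>v\<in>D. scaleC (e v) v) = (\<Sum>v\<in>D - C. scaleC (e v) v) + (\<Sum>v\<in>C. scaleC (e v) v)"
      using finD D(1) by (rule sum.subset_diff[rotated])
    also have "\<dots> = 0"
    proof -
      have "(\<Sum>v\<in>D - C. scaleC (e v) v) = (\<Sum>v\<in>D - C. - scaleC (a v) v)"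
        by (intro sum.cong) (auto simp: e_def)
      moreover have "(\<Sum>v\<in>C. scaleC (e v) v) = (\<Sum>v\<in>C. scaleC (b v) v)"
        by (intro sum.cong) (auto simp: e_def)
      ultimately show ?thesis using a b by (simp add: sum_negf)
    qed
    finally have "\<And>v. v \<in> D \<Longrightarrow> e v = 0"
      using l2_circle.independentD[OF D(3) finD] by blast
    then have "\<And>v. v \<in> C \<Longrightarrow> b v = 0" using D(1) by (force simp: e_def)
    then show "x = y" using b by simp
  qed
  interpret L: Vector_Spaces.linear scaleC scaleC A by (rule linA)
  have ind: "l2_circle.independent (A ` (D - C))"
    using l2_circle.independent_mono[OF D(3), of "D - C"] inj by (intro L.independent_injective_image) auto
  have "A ` W \<subseteq> l2_circle.span (A ` D)"
    using D(4) by (rule L.spans_image)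
  also have "\<dots> \<subseteq> l2_circle.span (A ` (D - C))"
  proof (rule l2_circle.span_minimal)
    show "A ` D \<subseteq> l2_circle.span (A ` (D - C))"
    proof
      fix w assume "w \<in> A ` D"
      then obtain x where x: "x \<in> D" "w = A x" by blast
      show "w \<in> l2_circle.span (A ` (D - C))"
      proof (cases "x \<in> C")
        case True
        then have "w = 0" using C(1) x by (auto simp: K_def)
        then show ?thesis by (simp add: l2_circle.span_zero)
      next
        case False
        then show ?thesis using x by (intro l2_circle.span_base) auto
      qed
    qed
  qed auto
  finally have "card (A ` (D - C)) = l2_circle.dim (A ` W)"
    using D(2) by (intro l2_circle.basis_card_eq_dim ind) auto
  moreover have "card (A ` (D - C)) = card (D - C)"
    using inj l2_circle.span_superset by (intro card_image inj_on_subset[OF inj]) auto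
  ultimately show ?thesis
    using dimW C(4) card_Diff_subset[of C D] card_mono[OF finD D(1)] finite_subset[OF D(1) finD] D(1)
    by (simp add: A_def K_def)
qed

text \<open>The sum of the exponents of a finite basis is an exponent for the whole root
  space.\<close>

lemma root_vectors_uniform:
  assumes W: "l2_circle.subspace W" and fin: "finite B" "W \<subseteq> l2_circle.span B"
  obtains n where "\<And>y. y \<in> root_vectors W z \<Longrightarrow> (shift z ^^ n) y = 0"
proof -
  obtain C where C: "C \<subseteq> root_vectors W z" "l2_circle.independent C" "root_vectors W z \<subseteq> l2_circle.span C"
    by (rule l2_circle.basis_exists)
  have finC: "finite C"
    using l2_circle.independent_span_bound[OF fin(1) C(2)] C(1) fin(2) by (auto simp: root_vectors_def)
  have "\<forall>v\<in>C. \<exists>k. (shift z ^^ k) v = 0" using C(1) by (auto simp: root_vectors_def)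
  then obtain k where k: "\<And>v. v \<in> C \<Longrightarrow> (shift z ^^ k v) v = 0" by metis
  define n where "n = (\<Sum>v\<in>C. k v)"
  have n: "(shift z ^^ n) v = 0" if "v \<in> C" for v
  proof -
    have "k v \<le> n" unfolding n_def using finC that by (intro member_le_sum) auto
    then have "shift z ^^ n = (shift z ^^ (n - k v)) \<circ> (shift z ^^ k v)"
      by (simp add: funpow_add[symmetric])
    then show ?thesis using k[OF that] by simp
  qed
  have "l2_circle.span C \<subseteq> {y. (shift z ^^ n) y = 0}"
    by (rule l2_circle.span_minimal)
      (use n in \<open>auto simp: l2_circle.subspace_def shift_pow_add shift_pow_scale\<close>)
  then show thesis using that C(3) by blast
qed

text \<open>Write \<open>(z - z0) x\<close> as the difference of \<open>shift z0 x\<close> and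
  \<open>shift z x\<close>. The first is in the image by the outer induction on \<open>n\<close>,
  the second by the inner induction on the order \<open>k\<close> of \<open>x\<close>.\<close>

lemma root_vectors_in_image:
  assumes W: "l2_circle.subspace W" and inv: "\<And>y. y \<in> W \<Longrightarrow> T y \<in> W" and ne: "z \<noteq> z0"
  shows "root_vectors W z \<subseteq> (shift z0 ^^ n) ` W"
proof (induction n)
  case 0
  then show ?case by (auto simp: root_vectors_def)
next
  case (Suc n)
  have sub: "l2_circle.subspace ((shift z0 ^^ Suc n) ` W)"
  proof -
    interpret L: Vector_Spaces.linear scaleC scaleC "shift z0 ^^ Suc n" by (rule linear_shift_pow)
    show ?thesis by (rule L.subspace_image[OF W])
  qed
  have "x \<in> (shift z0 ^^ Suc n) ` W" if "x \<in> W" "(shift z ^^ k) x = 0" for k x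
    using that
  proof (induction k arbitrary: x)
    case 0
    then show ?case using l2_circle.subspace_0[OF sub] by simp
  next
    case (Suc k)
    have "(shift z ^^ k) (shift z x) = 0" using Suc.prems(2) by (simp add: funpow_swap1)
    then have 1: "shift z x \<in> (shift z0 ^^ Suc n) ` W"
      using Suc.IH shift_in_subspace[OF W inv Suc.prems(1), where k = 1 and z = z] by simp
    have "x \<in> root_vectors W z" using Suc.prems unfolding root_vectors_def by blast
    then have 2: "shift z0 x \<in> (shift z0 ^^ Suc n) ` W"
      using \<open>root_vectors W z \<subseteq> (shift z0 ^^ n) ` W\<close> by auto
    have "scaleC (z - z0) x = shift z0 x - shift z x"
      by (simp add: shift_def l2_circle.scale_left_diff_distrib)
    then have "scaleC (z - z0) x \<in> (shift z0 ^^ Suc n) ` W"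
      using l2_circle.subspace_diff[OF sub 2 1] by simp
    then have "scaleC (inverse (z - z0)) (scaleC (z - z0) x) \<in> (shift z0 ^^ Suc n) ` W"
      by (rule l2_circle.subspace_scale[OF sub])
    then show ?case using ne by simp
  qed
  then show ?case by (auto simp: root_vectors_def)
qed

text \<open>Fitting's splitting, by induction on the dimension. For an eigenvalue \<open>z0\<close>
  the kernel of a high power of \<open>shift z0\<close> is the root space at \<open>z0\<close>; the
  image of this power is invariant, contains all other root spaces and has only 0 in common with the
  one at \<open>z0\<close>. Rank-nullity adds up the dimensions.\<close>

theorem root_space_decomposition:
  assumes "l2_circle.subspace W" "\<And>y. y \<in> W \<Longrightarrow> T y \<in> W" "finite B" "W \<subseteq> l2_circle.span B"
  shows "\<exists>Z. finite Z \<and> (\<forall>z. z \<notin> Z \<longrightarrow> root_vectors W z = {0})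
    \<and> (\<Sum>z\<in>Z. l2_circle.dim (root_vectors W z)) = l2_circle.dim W"
  using assms
proof (induction "l2_circle.dim W" arbitrary: W rule: less_induct)
  case (less W)
  note W = less.prems(1) and inv = less.prems(2) and fin = less.prems(3,4)
  have zero_root: "0 \<in> root_vectors W z" for z
    using l2_circle.subspace_0[OF subspace_root_vectors[OF W]] .
  show ?case
  proof (cases "W = {0}")
    case True
    then have "root_vectors W z = {0}" for z using zero_root by (auto simp: root_vectors_def)
    moreover have "l2_circle.dim W = 0"
      using True dim_zero by simp
    ultimately show ?thesis by (intro exI[of _ "{}"]) auto
  next
    case False
    then obtain y where "y \<in> W" "y \<noteq> 0" using l2_circle.subspace_0[OF W] by auto
    then obtain z0 v where v: "v \<in> W" "v \<noteq> 0" "T v = scaleC z0 v"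
      using eigenvalue_exists[OF W inv fin] by metis
    obtain n where n: "\<And>y. y \<in> root_vectors W z0 \<Longrightarrow> (shift z0 ^^ n) y = 0"
      using root_vectors_uniform[OF W fin] by metis
    then have ker: "{y \<in> W. (shift z0 ^^ n) y = 0} = root_vectors W z0"
      by (auto simp: root_vectors_def)
    define I where "I = (shift z0 ^^ n) ` W"
    have dims: "l2_circle.dim W = l2_circle.dim (root_vectors W z0) + l2_circle.dim I"
      using rank_nullity_shift_pow[OF W fin, of n z0] by (simp add: ker I_def)
    have I_W: "I \<subseteq> W" using shift_in_subspace[OF W inv] by (auto simp: I_def)
    have I_sub: "l2_circle.subspace I"
    proof -
      interpret L: Vector_Spaces.linear scaleC scaleC "shift z0 ^^ n" by (rule linear_shift_pow)
      show ?thesis unfolding I_def by (rule L.subspace_image[OF W])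
    qed
    have I_inv: "T y \<in> I" if "y \<in> I" for y
      using that inv by (auto simp: I_def T_shift_pow)
    have v_root: "v \<in> root_vectors W z0"
      using v by (auto simp: root_vectors_def shift_def intro!: exI[of _ 1])
    have "l2_circle.dim (root_vectors W z0) \<noteq> 0"
    proof
      assume dim0: "l2_circle.dim (root_vectors W z0) = 0"
      obtain C where C: "C \<subseteq> root_vectors W z0" "l2_circle.independent C" "root_vectors W z0 \<subseteq> l2_circle.span C"
        "card C = l2_circle.dim (root_vectors W z0)"
        by (rule l2_circle.basis_exists)
      have "finite C"
        using l2_circle.independent_span_bound[OF fin(1) C(2)] C(1) fin(2) by (auto simp: root_vectors_def)
      then have "C = {}" using C(4) dim0 by simp
      then show False using C(3) v_root v(2) by auto
    qed
    then have "l2_circle.dim I < l2_circle.dim W" using dims by simp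
    moreover have "I \<subseteq> l2_circle.span B" using I_W fin by blast
    ultimately obtain Z where Z: "finite Z" "\<And>z. z \<notin> Z \<Longrightarrow> root_vectors I z = {0}"
      "(\<Sum>z\<in>Z. l2_circle.dim (root_vectors I z)) = l2_circle.dim I"
      using less.hyps[of I] I_sub I_inv fin(1) by metis
    have other: "root_vectors I z = root_vectors W z" if "z \<noteq> z0" for z
      using root_vectors_in_image[OF W inv that, of n] I_W by (auto simp: root_vectors_def I_def)
    have self: "root_vectors I z0 = {0}"
    proof -
      have "y = 0" if y: "y \<in> root_vectors I z0" for y
      proof -
        obtain x where x: "x \<in> W" "y = (shift z0 ^^ n) x" using y unfolding root_vectors_def I_def by blast
        obtain k where "(shift z0 ^^ k) y = 0" using y by (auto simp: root_vectors_def)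
        then have "(shift z0 ^^ (k + n)) x = 0" using x by (simp add: funpow_add)
        then have "x \<in> root_vectors W z0" using x unfolding root_vectors_def by blast
        then show ?thesis using n x by simp
      qed
      then show ?thesis using l2_circle.subspace_0[OF subspace_root_vectors[OF I_sub]] by blast
    qed
    have dim_self: "l2_circle.dim (root_vectors I z0) = 0"
      using self dim_zero by simp
    have "(\<Sum>z\<in>insert z0 Z. l2_circle.dim (root_vectors W z))
        = l2_circle.dim (root_vectors W z0) + (\<Sum>z\<in>Z - {z0}. l2_circle.dim (root_vectors W z))"
      using Z(1) by (simp add: sum.insert_remove)
    also have "(\<Sum>z\<in>Z - {z0}. l2_circle.dim (root_vectors W z)) = (\<Sum>z\<in>Z - {z0}. l2_circle.dim (root_vectors I z))"
      by (intro sum.cong) (auto simp: other)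
    also have "\<dots> = (\<Sum>z\<in>Z. l2_circle.dim (root_vectors I z))"
      using Z(1) dim_self by (cases "z0 \<in> Z") (auto simp: sum.remove)
    finally show ?thesis
      using Z dims other by (intro exI[of _ "insert z0 Z"]) auto
  qed
qed

end

section \<open>Splitting off the low modes\<close>

lemma l2_norm_triangle_sum:
  assumes "finite I" "\<And>i. i \<in> I \<Longrightarrow> l2_seq (f i)"
  shows "l2_seq (\<lambda>k. \<Sum>i\<in>I. f i k)" "l2_norm (\<lambda>k. \<Sum>i\<in>I. f i k) \<le> (\<Sum>i\<in>I. l2_norm (f i))"
proof -
  have "l2_seq (\<lambda>k. \<Sum>i\<in>I. f i k) \<and> l2_norm (\<lambda>k. \<Sum>i\<in>I. f i k) \<le> (\<Sum>i\<in>I. l2_norm (f i))"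
    using assms
  proof (induction I rule: finite_induct)
    case (insert x F)
    then show ?case using l2_add[of "f x" "\<lambda>k. \<Sum>i\<in>F. f i k"] by fastforce
  qed auto
  then show "l2_seq (\<lambda>k. \<Sum>i\<in>I. f i k)" "l2_norm (\<lambda>k. \<Sum>i\<in>I. f i k) \<le> (\<Sum>i\<in>I. l2_norm (f i))"
    by auto
qed

definition low_modes :: "int \<Rightarrow> nat \<Rightarrow> int set" where
  "low_modes s M = {j. \<bar>2 * j + s\<bar> \<le> int M}"

text \<open>The modes sit at \<open>(pi * m)\<^sup>2\<close>. On the scale of \<open>m\<close> the
  line is halfway between \<open>M\<close> and \<open>M + 1\<close>, whence the distance 1 / 2 in
  \<open>gap_l2\<close>.\<close>

definition cut_line :: "nat \<Rightarrow> real" where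
  "cut_line M = (pi * (real M + 1 / 2))\<^sup>2"

lemma finite_low_modes: "finite (low_modes s M)"
  by (rule finite_subset[of _ "{- (int M + \<bar>s\<bar>)..int M + \<bar>s\<bar>}"]) (auto simp: low_modes_def)

lemma card_low_modes:
  assumes "s \<in> {0, 1}"
  shows "card (low_modes s M) \<le> 2 * M + 1"
proof -
  have "card (low_modes s M) = card ((\<lambda>j. 2 * j + s) ` low_modes s M)"
    by (intro card_image[symmetric]) (auto simp: inj_on_def)
  also have "\<dots> \<le> card {- int M..int M}"
    by (intro card_mono) (auto simp: low_modes_def)
  finally show ?thesis by simp
qed

text \<open>This is also the number of list positions from \<open>lambda_0\<close> up to the plus
  eigenvalue with index \<open>M\<close>, so the counts will match the numbering.\<close>

lemma card_low_modes_sum: "card (low_modes 0 M) + card (low_modes 1 M) = 2 * M + 1"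
proof -
  have "card (low_modes s M) = card ((\<lambda>j. 2 * j + s) ` low_modes s M)" for s
    by (intro card_image[symmetric]) (auto simp: inj_on_def)
  moreover have "card ((\<lambda>j. 2 * j + 0) ` low_modes 0 M) + card ((\<lambda>j. 2 * j + 1) ` low_modes 1 M)
      = card ((\<lambda>j. 2 * j + 0) ` low_modes 0 M \<union> (\<lambda>j. 2 * j + 1) ` low_modes 1 M)"
    by (rule card_Un_disjoint[symmetric]) (auto simp: finite_low_modes, presburger)
  moreover have "(\<lambda>j. 2 * j + 0) ` low_modes 0 M \<union> (\<lambda>j. 2 * j + 1) ` low_modes 1 M = {- int M..int M}"
  proof -
    have "m \<in> (\<lambda>j. 2 * j + 0) ` low_modes 0 M \<union> (\<lambda>j. 2 * j + 1) ` low_modes 1 M" if "m \<in> {- int M..int M}" for m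
    proof (cases "even m")
      case True
      then obtain j where "m = 2 * j" by blast
      then show ?thesis using that by (auto simp: low_modes_def)
    next
      case False
      then obtain j where "m = 2 * j + 1" by (metis oddE)
      then show ?thesis using that by (auto simp: low_modes_def intro!: image_eqI[of _ _ j])
    qed
    then have "{- int M..int M} \<subseteq> (\<lambda>j. 2 * j + 0) ` low_modes 0 M \<union> (\<lambda>j. 2 * j + 1) ` low_modes 1 M"
      by blast
    moreover have "(\<lambda>j. 2 * j + 0) ` low_modes 0 M \<union> (\<lambda>j. 2 * j + 1) ` low_modes 1 M \<subseteq> {- int M..int M}"
      by (auto simp: low_modes_def)
    ultimately show ?thesis by blast
  qed
  ultimately show ?thesis by simp
qed

text \<open>9 is a lower bound for \<open>pi\<^sup>2\<close>. Since the spectrum is quadratic, a gap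
  in frequency becomes one that is larger by the factor \<open>N\<close>; this produces the powers
  of \<open>1 / M\<close>.\<close>

lemma square_gap:
  fixes x y :: real
  assumes "0 \<le> y" "y \<le> x" "0 \<le> N" "N \<le> x"
  shows "9 * N * (x - y) \<le> pi\<^sup>2 * (x\<^sup>2 - y\<^sup>2)"
proof -
  have "3\<^sup>2 \<le> pi\<^sup>2" using pi_gt3 by (intro power_mono) auto
  then have pi9: "9 \<le> pi\<^sup>2" by simp
  have "N * (x - y) \<le> (x + y) * (x - y)"
    using assms by (intro mult_right_mono) auto
  then have "9 * (N * (x - y)) \<le> pi\<^sup>2 * ((x + y) * (x - y))"
    using pi9 assms by (intro mult_mono) auto
  then show ?thesis by (simp add: power2_eq_square algebra_simps)
qed

lemma lap_eq: "lap s j = pi\<^sup>2 * \<bar>real_of_int (2 * j + s)\<bar>\<^sup>2"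
  by (simp add: lap_def power_mult_distrib)

text \<open>The cube is what the Riccati contraction asks for:
  \<open>gap_const * r * A\<^sup>2\<close> has to be small against \<open>M\<close>, with
  \<open>r \<le> A = 2 * r + 1\<close>. The square of \<open>gap_const\<close> comes from
  \<open>no_graph_eigenvector\<close>, where two gap estimates are composed.\<close>

locale mode_splitting =
  fixes a :: "int \<Rightarrow> complex" and s :: int and M :: nat
  assumes a_l2: "l2_seq a" and s01: "s \<in> {0, 1}"
    and M_large: "16 * gap_const\<^sup>2 * (2 * l2_norm a + 1) ^ 3 \<le> real M"
begin

abbreviation "P \<equiv> low_modes s M"
abbreviation "d \<equiv> lap s"
abbreviation "r \<equiv> l2_norm a"
definition A :: real where "A = 2 * r + 1"
abbreviation "\<Gamma> \<equiv> gap_const"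

lemma finP: "finite P" by (rule finite_low_modes)

lemma A_ge_1: "1 \<le> A" and r_less_A: "r + 1 \<le> A" and r_le_A: "r \<le> A" by (simp_all add: A_def)

lemma M_large1: "16 * \<Gamma>\<^sup>2 * A\<^sup>2 \<le> real M" "16 * \<Gamma> * A ^ 3 \<le> real M" "16 * \<Gamma> * A\<^sup>2 \<le> real M"  "16 * \<Gamma> * A \<le> real M" "16 \<le> real M"
proof -
  have g: "1 \<le> \<Gamma>" by (rule gap_const_ge_1)
  have "\<Gamma> \<le> \<Gamma>\<^sup>2" using g by (simp add: power2_eq_square)
  have A23: "A\<^sup>2 \<le> A ^ 3" "A \<le> A\<^sup>2" using A_ge_1 by (auto intro: power_increasing self_le_power)
  have M: "16 * \<Gamma>\<^sup>2 * A ^ 3 \<le> real M" using M_large by (simp add: A_def)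
  have "16 * \<Gamma>\<^sup>2 * A\<^sup>2 \<le> 16 * \<Gamma>\<^sup>2 * A ^ 3" using A23(1) by (intro mult_left_mono) auto
  then show 1: "16 * \<Gamma>\<^sup>2 * A\<^sup>2 \<le> real M" using M by linarith
  have "16 * \<Gamma> * A ^ 3 \<le> 16 * \<Gamma>\<^sup>2 * A ^ 3" using \<open>\<Gamma> \<le> \<Gamma>\<^sup>2\<close> A_ge_1 by (intro mult_right_mono) auto
  then show 2: "16 * \<Gamma> * A ^ 3 \<le> real M" using M by linarith
  show 3: "16 * \<Gamma> * A\<^sup>2 \<le> real M"
    using \<open>\<Gamma> \<le> \<Gamma>\<^sup>2\<close> 1 mult_right_mono[of "16 * \<Gamma>" "16 * \<Gamma>\<^sup>2" "A\<^sup>2"] by simp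
  show 4: "16 * \<Gamma> * A \<le> real M"
    using A23(2) 3 g mult_left_mono[of A "A\<^sup>2" "16 * \<Gamma>"] by linarith
  show "16 \<le> real M"
    using 4 g A_ge_1 mult_mono[of 1 \<Gamma> 1 A] by linarith
qed

lemma gap_high_low:
  assumes "l \<notin> P" "k \<in> P"
  shows "9 * real M * (\<bar>real_of_int (2 * l + s)\<bar> - \<bar>real_of_int (2 * k + s)\<bar>) \<le> d l - d k"
    and "1 \<le> \<bar>real_of_int (2 * l + s)\<bar> - \<bar>real_of_int (2 * k + s)\<bar>"
    and "9 * real M \<le> d l - d k" and "0 < d l - d k"
proof -
  have k: "\<bar>2 * k + s\<bar> \<le> int M" and l: "int M + 1 \<le> \<bar>2 * l + s\<bar>"
    using assms by (auto simp: low_modes_def)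
  have k': "\<bar>real_of_int (2 * k + s)\<bar> \<le> real M"
    using iffD2[OF of_int_le_iff[where 'a = real] k] by simp
  have l': "real M + 1 \<le> \<bar>real_of_int (2 * l + s)\<bar>"
    using iffD2[OF of_int_le_iff[where 'a = real] l] by simp
  show 1: "9 * real M * (\<bar>real_of_int (2 * l + s)\<bar> - \<bar>real_of_int (2 * k + s)\<bar>) \<le> d l - d k"
    using square_gap[of "\<bar>real_of_int (2 * k + s)\<bar>" "\<bar>real_of_int (2 * l + s)\<bar>" "real M"] k' l'
    unfolding lap_eq by (simp only: right_diff_distrib)
  show 2: "1 \<le> \<bar>real_of_int (2 * l + s)\<bar> - \<bar>real_of_int (2 * k + s)\<bar>"
    using k' l' by linarith
  show 3: "9 * real M \<le> d l - d k"
    using 1 2 mult_left_mono[OF 2, of "9 * real M"] by linarith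
  show "0 < d l - d k" using 3 M_large1(5) by linarith
qed

text \<open>Entries of the Riccati solution are stored after multiplication with the spectral gap \<open>d l - d k\<close>,
  which makes the Riccati map a contraction in the sup norm.\<close>

definition entry :: "(int \<times> int \<Rightarrow> complex) \<Rightarrow> int \<Rightarrow> int \<Rightarrow> complex" where
  "entry Y k l = (if l \<notin> P \<and> k \<in> P then Y (l, k) / of_real (d l - d k) else 0)"

text \<open>In blocks of low and high modes, the graph of a map \<open>X\<close> from low to high is
  invariant exactly if the commutator of the diagonal with \<open>X\<close> equals minus the sum of
  the high-low block of \<open>a\<close> and \<open>a X\<close>, less \<open>X a\<close> and
  \<open>X a X\<close>. The entries of this commutator, \<open>(d l - d k) * X k l\<close>, are the
  unknowns \<open>Y\<close>.\<close>

definition ricc :: "(int \<times> int \<Rightarrow> complex) \<Rightarrow> int \<times> int \<Rightarrow> complex" where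
  "ricc Y = (\<lambda>(l, k). if l \<notin> P \<and> k \<in> P then
     - (a (l - k) + conv a (entry Y k) l
        - (\<Sum>k'\<in>P. entry Y k' l * a (k' - k)) - (\<Sum>k'\<in>P. entry Y k' l * conv a (entry Y k) k'))
     else 0)"

lemma ricc_in: "l \<notin> P \<Longrightarrow> k \<in> P \<Longrightarrow> ricc Y (l, k) = - (a (l - k) + conv a (entry Y k) l
        - (\<Sum>k'\<in>P. entry Y k' l * a (k' - k)) - (\<Sum>k'\<in>P. entry Y k' l * conv a (entry Y k) k'))"
  by (simp add: ricc_def)

lemma ricc_out: "\<not> (l \<notin> P \<and> k \<in> P) \<Longrightarrow> ricc Y (l, k) = 0"
  by (auto simp: ricc_def)

lemma norm_entry_le:
  assumes "cmod (Y (l, k)) \<le> C" "l \<notin> P" "k \<in> P"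
  shows "cmod (entry Y k l) \<le> C / (d l - d k)"
  using assms gap_high_low(4)[OF assms(2,3)] by (simp add: entry_def norm_divide divide_right_mono del: of_real_diff)

lemma entry_diff: "entry Y k l - entry Z k l = entry (\<lambda>p. Y p - Z p) k l"
  by (simp add: entry_def diff_divide_distrib)

lemma entry_column:
  assumes Y: "\<And>p. cmod (Y p) \<le> C"
  shows "l2_seq (entry Y k)" "l2_norm (entry Y k) \<le> C * \<Gamma> / real M"
proof -
  have C: "0 \<le> C" using Y[of "(0, 0)"] norm_ge_zero order_trans by blast
  have M: "0 < real M" using M_large1(5) by linarith
  have "1 / 2 \<le> \<bar>\<bar>real_of_int (2 * l + s)\<bar> - \<bar>real_of_int (2 * k + s)\<bar>\<bar>
      \<and> norm (entry Y k l) * \<bar>\<bar>real_of_int (2 * l + s)\<bar> - \<bar>real_of_int (2 * k + s)\<bar>\<bar> \<le> C / real M"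
    if "entry Y k l \<noteq> 0" for l
  proof -
    have lk: "l \<notin> P" "k \<in> P" using that by (auto simp: entry_def split: if_splits)
    define \<Delta> where "\<Delta> = \<bar>real_of_int (2 * l + s)\<bar> - \<bar>real_of_int (2 * k + s)\<bar>"
    have \<Delta>: "1 \<le> \<Delta>" "9 * real M * \<Delta> \<le> d l - d k" using gap_high_low[OF lk] by (auto simp: \<Delta>_def)
    have "norm (entry Y k l) * \<Delta> \<le> C / (d l - d k) * \<Delta>"
      using norm_entry_le[of Y l k C] Y lk \<Delta> by (intro mult_right_mono) auto
    also have "\<dots> \<le> C / (9 * real M * \<Delta>) * \<Delta>"
      using C \<Delta> M gap_high_low(4)[OF lk] by (intro mult_right_mono divide_left_mono) auto
    also have "\<dots> \<le> C / real M" using \<Delta> C M by (simp add: field_simps)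
    finally show ?thesis using \<Delta>(1) unfolding \<Delta>_def by linarith
  qed
  then show "l2_seq (entry Y k)" "l2_norm (entry Y k) \<le> C * \<Gamma> / real M"
    using gap_l2[of "C / real M" "entry Y k" s "\<bar>real_of_int (2 * k + s)\<bar>"] C by auto
qed

lemma entry_row:
  assumes Y: "\<And>p. cmod (Y p) \<le> C"
  shows "l2_seq (\<lambda>k. entry Y k l)" "l2_norm (\<lambda>k. entry Y k l) \<le> C * \<Gamma> / real M"
proof -
  have C: "0 \<le> C" using Y[of "(0, 0)"] norm_ge_zero order_trans by blast
  have M: "0 < real M" using M_large1(5) by linarith
  have "1 / 2 \<le> \<bar>\<bar>real_of_int (2 * k + s)\<bar> - \<bar>real_of_int (2 * l + s)\<bar>\<bar>
      \<and> norm (entry Y k l) * \<bar>\<bar>real_of_int (2 * k + s)\<bar> - \<bar>real_of_int (2 * l + s)\<bar>\<bar> \<le> C / real M"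
    if "entry Y k l \<noteq> 0" for k
  proof -
    have lk: "l \<notin> P" "k \<in> P" using that by (auto simp: entry_def split: if_splits)
    define \<Delta> where "\<Delta> = \<bar>real_of_int (2 * l + s)\<bar> - \<bar>real_of_int (2 * k + s)\<bar>"
    have \<Delta>: "1 \<le> \<Delta>" "9 * real M * \<Delta> \<le> d l - d k" using gap_high_low[OF lk] by (auto simp: \<Delta>_def)
    have "norm (entry Y k l) * \<Delta> \<le> C / (d l - d k) * \<Delta>"
      using norm_entry_le[of Y l k C] Y lk \<Delta> by (intro mult_right_mono) auto
    also have "\<dots> \<le> C / (9 * real M * \<Delta>) * \<Delta>"
      using C \<Delta> M gap_high_low(4)[OF lk] by (intro mult_right_mono divide_left_mono) auto
    also have "\<dots> \<le> C / real M" using \<Delta> C M by (simp add: field_simps)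
    finally have "norm (entry Y k l) * \<Delta> \<le> C / real M" .
    moreover have "\<bar>\<bar>real_of_int (2 * k + s)\<bar> - \<bar>real_of_int (2 * l + s)\<bar>\<bar> = \<Delta>"
      using \<Delta>(1) unfolding \<Delta>_def by linarith
    ultimately show ?thesis using \<Delta>(1) by simp
  qed
  then show "l2_seq (\<lambda>k. entry Y k l)" "l2_norm (\<lambda>k. entry Y k l) \<le> C * \<Gamma> / real M"
    using gap_l2[of "C / real M" "\<lambda>k. entry Y k l" s "\<bar>real_of_int (2 * l + s)\<bar>"] C by auto
qed

text \<open>There are at most \<open>2 * M + 1\<close> entries of size \<open>C / (9 * M)\<close>.
  The sum of a row is thus only bounded, not small; in the quadratic term of \<open>ricc\<close> the
  smallness comes from the factor \<open>conv\<close>.\<close>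

lemma entry_row_sum:
  assumes Y: "\<And>p. cmod (Y p) \<le> C"
  shows "(\<Sum>k\<in>P. cmod (entry Y k l)) \<le> C"
proof -
  have C: "0 \<le> C" using Y[of "(0, 0)"] norm_ge_zero order_trans by blast
  have M: "16 \<le> real M" by (rule M_large1)
  have "cmod (entry Y k l) \<le> C / (9 * real M)" if "k \<in> P" for k
  proof (cases "l \<in> P")
    case True
    then show ?thesis using C by (simp add: entry_def)
  next
    case False
    have "cmod (entry Y k l) \<le> C / (d l - d k)" using norm_entry_le[of Y l k C] Y False that by auto
    also have "\<dots> \<le> C / (9 * real M)"
      using C M gap_high_low[OF False that] by (intro divide_left_mono) auto
    finally show ?thesis .
  qed
  then have "(\<Sum>k\<in>P. cmod (entry Y k l)) \<le> real (card P) * (C / (9 * real M))"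
    by (rule sum_bounded_above)
  also have "\<dots> \<le> (2 * real M + 1) * (C / (9 * real M))"
    using card_low_modes[OF s01, of M] C by (intro mult_right_mono) auto
  also have "\<dots> = C * ((2 * real M + 1) / (9 * real M))" by simp
  also have "\<dots> \<le> C * 1" using C M by (intro mult_left_mono) auto
  finally show ?thesis by simp
qed

lemma sum_entry_shift_le:
  assumes Y: "\<And>p. cmod (Y p) \<le> C"
  shows "cmod (\<Sum>k'\<in>P. entry Y k' l * a (k' - k)) \<le> C * \<Gamma> / real M * r"
proof -
  have "(\<Sum>k'\<in>P. entry Y k' l * a (k' - k)) = (\<Sum>\<^sub>\<infinity>k'. entry Y k' l * a (k' - k))"
    unfolding infsum_finite[OF finP, symmetric]
    by (rule infsum_cong_neutral) (auto simp: entry_def)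
  also have "cmod \<dots> \<le> l2_norm (\<lambda>k'. entry Y k' l) * l2_norm (\<lambda>k'. a (k' - k))"
    using entry_row(1)[where Y = Y, OF Y] a_l2 l2_reindex[OF bij_int_shift[of k], of a] by (intro l2_product) auto
  also have "\<dots> \<le> C * \<Gamma> / real M * r"
    unfolding l2_reindex(2)[OF bij_int_shift[of k], of a]
    by (rule mult_right_mono[OF entry_row(2)[where Y = Y and l = l, OF Y]]) simp
  finally show ?thesis .
qed

lemma conv_entry_le:
  assumes Y: "\<And>p. cmod (Y p) \<le> C"
  shows "cmod (conv a (entry Y k) l) \<le> r * (C * \<Gamma> / real M)"
  using norm_conv_le[OF a_l2 entry_column(1)[where Y = Y, OF Y], of k l]
    mult_left_mono[OF entry_column(2)[where Y = Y and k = k, OF Y] l2_norm_nonneg[of a]]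
  by (rule order_trans)

lemma sum_entry_conv_le:
  assumes Y: "\<And>p. cmod (Y p) \<le> C" and Z: "\<And>p. cmod (Z p) \<le> D"
  shows "cmod (\<Sum>k'\<in>P. entry Y k' l * conv a (entry Z k) k') \<le> C * (r * (D * \<Gamma> / real M))"
proof -
  have D: "0 \<le> D" using Z[of "(0, 0)"] norm_ge_zero order_trans by blast
  have b: "cmod (conv a (entry Z k) k') \<le> r * (D * \<Gamma> / real M)" for k'
    by (rule conv_entry_le[where Y = Z, OF Z])
  have "cmod (\<Sum>k'\<in>P. entry Y k' l * conv a (entry Z k) k') \<le> (\<Sum>k'\<in>P. cmod (entry Y k' l) * (r * (D * \<Gamma> / real M)))"
    by (intro sum_norm_le) (auto simp only: norm_mult intro!: mult_left_mono b norm_ge_zero)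
  also have "\<dots> \<le> C * (r * (D * \<Gamma> / real M))"
    unfolding sum_distrib_right[symmetric] using gap_const_ge_1 D
    by (intro mult_right_mono entry_row_sum Y) auto
  finally show ?thesis .
qed

text \<open>With \<open>\<epsilon> = \<Gamma> * r / M\<close> the two linear terms are at most
  \<open>\<epsilon> * A\<close> and the quadratic one at most \<open>\<epsilon> * A\<^sup>2\<close>,
  in total less than 1, so \<open>r + 1 \<le> A\<close> makes the ball of radius \<open>A\<close>
  invariant. Differences of the quadratic term are split in two, and the Lipschitz constant is
  \<open>2 * \<epsilon> + 2 * (\<epsilon> * A)\<close>.\<close>

lemma riccati_solution:
  obtains Y where "\<And>p. cmod (Y p) \<le> A" "\<And>p. ricc Y p = Y p"
proof (rule sup_norm_fixpoint[of A ricc])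
  have M: "16 \<le> real M" by (rule M_large1)
  have g: "1 \<le> \<Gamma>" by (rule gap_const_ge_1)
  define \<epsilon> where "\<epsilon> = \<Gamma> * r / real M"
  have \<epsilon>0: "0 \<le> \<epsilon>" using g by (simp add: \<epsilon>_def)
  have \<epsilon>1: "16 * (\<epsilon> * A\<^sup>2) \<le> 1"
  proof -
    have "16 * (\<Gamma> * r * A\<^sup>2) \<le> 16 * (\<Gamma> * A * A\<^sup>2)" using g r_le_A by (intro mult_left_mono mult_right_mono) auto
    also have "\<dots> \<le> real M" using M_large1(2) by (simp add: power3_eq_cube power2_eq_square mult_ac)
    finally show ?thesis using M by (simp add: \<epsilon>_def field_simps)
  qed
  have A2: "A \<le> A\<^sup>2" using A_ge_1 by (auto intro: self_le_power)
  have \<epsilon>A: "16 * (\<epsilon> * A) \<le> 1" "16 * \<epsilon> \<le> 1"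
    using \<epsilon>1 mult_left_mono[OF A2 \<epsilon>0] mult_left_mono[OF A_ge_1 \<epsilon>0] by auto
  show "0 \<le> A" using A_ge_1 by simp
  fix Y Z :: "int \<times> int \<Rightarrow> complex" and e :: real and p :: "int \<times> int"
  {
    assume Y: "\<And>p. cmod (Y p) \<le> A"
    obtain l k where p: "p = (l, k)" by fastforce
    show "cmod (ricc Y p) \<le> A"
    proof (cases "l \<notin> P \<and> k \<in> P")
      case True
      have 1: "cmod (a (l - k)) \<le> r" by (rule norm_le_l2_norm[OF a_l2])
      have 2: "cmod (conv a (entry Y k) l) \<le> \<epsilon> * A"
        using conv_entry_le[where Y = Y and k = k and l = l, OF Y]
        by (simp add: \<epsilon>_def mult_ac)
      have 3: "cmod (\<Sum>k'\<in>P. entry Y k' l * a (k' - k)) \<le> \<epsilon> * A"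
        using sum_entry_shift_le[where Y = Y, OF Y, of l k] by (simp add: \<epsilon>_def mult_ac)
      have 4: "cmod (\<Sum>k'\<in>P. entry Y k' l * conv a (entry Y k) k') \<le> \<epsilon> * A\<^sup>2"
        using sum_entry_conv_le[where Y = Y and Z = Y, OF Y Y, of l k] by (simp add: \<epsilon>_def power2_eq_square mult_ac)
      have "cmod (ricc Y p) = cmod (a (l - k) + conv a (entry Y k) l
        - (\<Sum>k'\<in>P. entry Y k' l * a (k' - k)) - (\<Sum>k'\<in>P. entry Y k' l * conv a (entry Y k) k'))"
        unfolding p using True by (subst ricc_in) (auto simp only: norm_minus_cancel)
      also have "\<dots> \<le> r + \<epsilon> * A + \<epsilon> * A + \<epsilon> * A\<^sup>2"
        by (intro order_trans[OF norm_triangle_ineq4] order_trans[OF norm_triangle_ineq] add_mono 1 2 3 4)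
      also have "\<dots> \<le> r + 1" using \<epsilon>1 \<epsilon>A by linarith
      finally show ?thesis using r_less_A by simp
    next
      case False
      then show ?thesis using A_ge_1 by (simp add: p ricc_out)
    qed
  }
  {
    assume Y: "\<And>p. cmod (Y p) \<le> A" and Z: "\<And>p. cmod (Z p) \<le> A" and YZ: "\<And>p. cmod (Y p - Z p) \<le> e"
    have e: "0 \<le> e" using YZ[of "(0, 0)"] norm_ge_zero order_trans by blast
    obtain l k where p: "p = (l, k)" by fastforce
    show "cmod (ricc Y p - ricc Z p) \<le> e / 2"
    proof (cases "l \<notin> P \<and> k \<in> P")
      case True
      define D where "D = (\<lambda>p. Y p - Z p)"
      have D: "cmod (D p) \<le> e" for p using YZ by (simp add: D_def)
      have ent: "entry Y k l = entry Z k l + entry D k l" for k l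
        using entry_diff[of Y k l Z] unfolding D_def by (metis diff_add_cancel add.commute)
      have conv: "conv a (entry Y k) j = conv a (entry Z k) j + conv a (entry D k) j" for k j
      proof -
        have "entry Y k = (\<lambda>l. entry Z k l + entry D k l)" by (rule ext) (rule ent)
        then show ?thesis
          by (simp only: conv_add[OF a_l2 entry_column(1)[where Y = Z, OF Z] entry_column(1)[where Y = D, OF D]])
      qed
      have 2: "cmod (conv a (entry D k) l) \<le> \<epsilon> * e"
        using conv_entry_le[where Y = D and k = k and l = l, OF D]
        by (simp add: \<epsilon>_def mult_ac)
      have 3: "cmod (\<Sum>k'\<in>P. entry D k' l * a (k' - k)) \<le> \<epsilon> * e"
        using sum_entry_shift_le[where Y = D, OF D, of l k] by (simp add: \<epsilon>_def mult_ac)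
      have 4: "cmod (\<Sum>k'\<in>P. entry D k' l * conv a (entry Y k) k') \<le> \<epsilon> * A * e"
        using sum_entry_conv_le[where Y = D and Z = Y, OF D Y, of l k] by (simp add: \<epsilon>_def mult_ac)
      have 5: "cmod (\<Sum>k'\<in>P. entry Z k' l * conv a (entry D k) k') \<le> \<epsilon> * A * e"
        using sum_entry_conv_le[where Y = Z and Z = D, OF Z D, of l k] by (simp add: \<epsilon>_def mult_ac)
      have s1: "(\<Sum>k'\<in>P. entry Y k' l * a (k' - k)) = (\<Sum>k'\<in>P. entry Z k' l * a (k' - k)) + (\<Sum>k'\<in>P. entry D k' l * a (k' - k))"
        by (simp add: ent distrib_right sum.distrib)
      have s2: "(\<Sum>k'\<in>P. entry Y k' l * conv a (entry Y k) k') = (\<Sum>k'\<in>P. entry Z k' l * conv a (entry Z k) k')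
         + (\<Sum>k'\<in>P. entry Z k' l * conv a (entry D k) k') + (\<Sum>k'\<in>P. entry D k' l * conv a (entry Y k) k')"
        unfolding sum.distrib[symmetric] by (intro sum.cong refl) (simp add: ent[of _ l] conv algebra_simps)
      have "ricc Y p - ricc Z p = - (conv a (entry D k) l - (\<Sum>k'\<in>P. entry D k' l * a (k' - k))
          - (\<Sum>k'\<in>P. entry Z k' l * conv a (entry D k) k') - (\<Sum>k'\<in>P. entry D k' l * conv a (entry Y k) k'))"
        using True s1 s2 conv[of k l] unfolding p by (simp add: ricc_in algebra_simps)
      then have "cmod (ricc Y p - ricc Z p) = cmod (conv a (entry D k) l - (\<Sum>k'\<in>P. entry D k' l * a (k' - k))
          - (\<Sum>k'\<in>P. entry Z k' l * conv a (entry D k) k') - (\<Sum>k'\<in>P. entry D k' l * conv a (entry Y k) k'))"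
        by (simp only: norm_minus_cancel)
      also have "\<dots> \<le> \<epsilon> * e + \<epsilon> * e + \<epsilon> * A * e + \<epsilon> * A * e"
        by (intro order_trans[OF norm_triangle_ineq4] add_mono 2 3 4 5)
      also have "\<dots> = (2 * \<epsilon> + 2 * (\<epsilon> * A)) * e" by (simp add: algebra_simps)
      also have "\<dots> \<le> (1 / 2) * e" using \<epsilon>A by (intro mult_right_mono e) linarith
      finally show ?thesis by simp
    next
      case False
      then show ?thesis using e by (simp add: p ricc_out)
    qed
  }
qed (rule that)

end

section \<open>The invariant graph over the low modes\<close>

context mode_splitting
begin

definition Y_sol :: "int \<times> int \<Rightarrow> complex" where
  "Y_sol = (SOME Y. (\<forall>p. cmod (Y p) \<le> A) \<and> (\<forall>p. ricc Y p = Y p))"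

lemma Y_sol: "cmod (Y_sol p) \<le> A" "ricc Y_sol p = Y_sol p"
proof -
  have "\<exists>Y. (\<forall>p. cmod (Y p) \<le> A) \<and> (\<forall>p. ricc Y p = Y p)"
    using riccati_solution by metis
  then have "(\<forall>p. cmod (Y_sol p) \<le> A) \<and> (\<forall>p. ricc Y_sol p = Y_sol p)"
    unfolding Y_sol_def by (rule someI_ex)
  then show "cmod (Y_sol p) \<le> A" "ricc Y_sol p = Y_sol p" by blast+
qed

definition X :: "int \<Rightarrow> int \<Rightarrow> complex" where "X = entry Y_sol"

lemma X_zero: "l \<in> P \<or> k \<notin> P \<Longrightarrow> X k l = 0"
  by (auto simp: X_def entry_def)

lemma X_column: "l2_seq (X k)" "l2_norm (X k) \<le> A * \<Gamma> / real M"
  unfolding X_def by (rule entry_column[where Y = Y_sol, OF Y_sol(1)])+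

lemma X_row_sum: "(\<Sum>k\<in>P. cmod (X k l)) \<le> A"
  unfolding X_def by (rule entry_row_sum[where Y = Y_sol, OF Y_sol(1)])

text \<open>The gap \<open>d l - d k\<close> is at least the square of the distance from the mode to
  \<open>M\<close>. This quadratic growth gives absolutely summable columns, to which
  \<open>l2_synth\<close> can be applied.\<close>

lemma X_summable: "(\<lambda>l. cmod (X k l)) summable_on UNIV"
proof (rule gap_l1[of A "X k" s "real M"])
  show "0 \<le> A" using A_ge_1 by simp
  fix l assume "X k l \<noteq> 0"
  then have lk: "l \<notin> P" "k \<in> P" using X_zero by blast+
  define x where "x = \<bar>real_of_int (2 * l + s)\<bar>"
  define y where "y = \<bar>real_of_int (2 * k + s)\<bar>"
  have k: "\<bar>2 * k + s\<bar> \<le> int M" and l: "int M + 1 \<le> \<bar>2 * l + s\<bar>"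
    using lk by (auto simp: low_modes_def)
  have y: "0 \<le> y" "y \<le> real M" and x: "real M + 1 \<le> x"
    using iffD2[OF of_int_le_iff[where 'a = real] k] iffD2[OF of_int_le_iff[where 'a = real] l]
    by (auto simp: x_def y_def)
  show "1 / 2 \<le> \<bar>\<bar>real_of_int (2 * l + s)\<bar> - real M\<bar>" using x unfolding x_def by linarith
  have gap: "(x - real M)\<^sup>2 \<le> d l - d k"
  proof -
    have "3\<^sup>2 \<le> pi\<^sup>2" using pi_gt3 by (intro power_mono) auto
    then have pi1: "1 \<le> pi\<^sup>2" by simp
    have "(x - real M) * (x - real M) \<le> (x - y) * (x + y)"
      using x y by (intro mult_mono) auto
    then have "(x - real M)\<^sup>2 \<le> 1 * (x\<^sup>2 - y\<^sup>2)" by (simp add: power2_eq_square algebra_simps)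
    also have "\<dots> \<le> pi\<^sup>2 * (x\<^sup>2 - y\<^sup>2)"
      using pi1 x y by (intro mult_right_mono) (auto intro: power_mono)
    finally show ?thesis by (simp only: lap_eq x_def y_def right_diff_distrib)
  qed
  have "norm (X k l) * (x - real M)\<^sup>2 \<le> A / (d l - d k) * (d l - d k)"
    using norm_entry_le[of Y_sol l k A] Y_sol(1) lk gap A_ge_1 gap_high_low(4)[OF lk]
    unfolding X_def by (intro mult_mono) auto
  also have "\<dots> = A" using gap_high_low(4)[OF lk] by simp
  finally show "norm (X k l) * (\<bar>real_of_int (2 * l + s)\<bar> - real M)\<^sup>2 \<le> A" by (simp add: x_def)
qed

definition F :: "int \<Rightarrow> int \<Rightarrow> complex" where
  "F k j = (if j = k then 1 else 0) + X k j"

lemma F_summable: "(\<lambda>j. cmod (F k j)) summable_on UNIV"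
proof -
  have "(\<lambda>j. cmod (if j = k then 1 else 0)) summable_on UNIV"
    by (rule finite_nonzero_values_imp_summable_on) (auto intro: finite_subset[of _ "{k}"])
  then have "(\<lambda>j. cmod (if j = k then 1 else 0) + cmod (X k j)) summable_on UNIV"
    by (intro summable_on_add X_summable)
  then show ?thesis
    by (rule summable_on_comparison_test) (auto simp only: F_def intro: norm_triangle_ineq norm_ge_zero)
qed

lemma F_l2: "l2_seq (F k)"
  by (rule l2_seq_of_abs_summable[OF F_summable])

lemma conv_F: "conv a (F k) j = a (j - k) + conv a (X k) j"
  unfolding F_def[abs_def]
  using conv_add[OF a_l2 l2_single[of k 1] X_column(1)[of k], of j] by (simp add: conv_single)

lemma F_invariant:
  assumes "l \<notin> P" "k \<in> P"
  shows "of_real (d l) * X k l + conv a (F k) l = of_real (d k) * X k l + (\<Sum>k'\<in>P. X k' l * conv a (F k) k')"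
proof -
  have "(of_real (d l) - of_real (d k)) * X k l = Y_sol (l, k)"
    using assms gap_high_low(4)[OF assms] by (simp add: X_def entry_def)
  also have "\<dots> = ricc Y_sol (l, k)" by (simp add: Y_sol)
  also have "\<dots> = - (conv a (F k) l - (\<Sum>k'\<in>P. X k' l * conv a (F k) k'))"
    using assms by (simp add: ricc_in conv_F X_def[symmetric] distrib_left sum.distrib)
  finally show ?thesis by (simp add: algebra_simps)
qed

text \<open>The point of the graph of \<open>X\<close> above the low vector
  \<open>x\<close>.\<close>

definition graph_vec :: "(int \<Rightarrow> complex) \<Rightarrow> int \<Rightarrow> complex" where
  "graph_vec x j = (\<Sum>k\<in>P. x k * F k j)"

lemma graph_vec_low:
  assumes "j \<in> P"
  shows "graph_vec x j = x j"
proof -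
  have "graph_vec x j = (\<Sum>k\<in>P. if k = j then x k else 0)"
    unfolding graph_vec_def using assms by (intro sum.cong) (auto simp: F_def X_zero)
  then show ?thesis using finP assms by simp
qed

lemma graph_vec_high:
  assumes "l \<notin> P"
  shows "graph_vec x l = (\<Sum>k\<in>P. x k * X k l)"
proof -
  have "F k l = X k l" if "k \<in> P" for k using assms that by (auto simp: F_def)
  then show ?thesis by (simp add: graph_vec_def)
qed

lemma graph_vec_cong: "(\<And>k. k \<in> P \<Longrightarrow> x k = y k) \<Longrightarrow> graph_vec x j = graph_vec y j"
  by (simp add: graph_vec_def)

lemma graph_vec_summable: "(\<lambda>j. cmod (graph_vec x j)) summable_on UNIV"
  unfolding graph_vec_def by (rule l2_synth_sum(1)[OF finP F_summable])

lemma graph_vec_l2: "l2_seq (graph_vec x)"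
  by (rule l2_seq_of_abs_summable[OF graph_vec_summable])

lemma conv_graph_vec: "conv a (graph_vec x) j = (\<Sum>k\<in>P. x k * conv a (F k) j)"
  unfolding graph_vec_def[abs_def]
  using conv_sum(1)[OF a_l2 l2_cmult(1)[OF F_l2] finP, of x "\<lambda>k. k"] by (simp add: conv_cmult)

lemma graph_vec_invariant:
  "of_real (d j) * graph_vec x j + conv a (graph_vec x) j
    = graph_vec (\<lambda>k. of_real (d k) * x k + conv a (graph_vec x) k) j"
proof (cases "j \<in> P")
  case True
  then show ?thesis by (simp add: graph_vec_low)
next
  case False
  have "of_real (d j) * graph_vec x j + conv a (graph_vec x) j
      = (\<Sum>k\<in>P. x k * (of_real (d j) * X k j + conv a (F k) j))"
    by (simp add: graph_vec_high[OF False] conv_graph_vec sum_distrib_left sum.distrib algebra_simps)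
  also have "\<dots> = (\<Sum>k\<in>P. x k * (of_real (d k) * X k j + (\<Sum>k'\<in>P. X k' j * conv a (F k) k')))"
    by (intro sum.cong refl) (simp add: F_invariant[OF False])
  also have "\<dots> = (\<Sum>k\<in>P. of_real (d k) * x k * X k j) + (\<Sum>k\<in>P. \<Sum>k'\<in>P. x k * conv a (F k) k' * X k' j)"
    by (simp add: sum.distrib sum_distrib_left algebra_simps)
  also have "(\<Sum>k\<in>P. \<Sum>k'\<in>P. x k * conv a (F k) k' * X k' j) = (\<Sum>k'\<in>P. conv a (graph_vec x) k' * X k' j)"
    by (subst sum.swap) (simp add: conv_graph_vec sum_distrib_right)
  finally show ?thesis
    by (simp add: graph_vec_high[OF False] distrib_right sum.distrib)
qed

text \<open>The equation makes \<open>g\<close> an eigenvector of the operator induced on the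
  quotient by the graph, represented by its high modes. The diagonal of the quotient starts beyond
  the cut line; for \<open>z\<close> on the other side the gap bounds \<open>g\<close> by a small
  multiple of its own norm.\<close>

lemma high_part_zero:
  assumes g: "l2_seq g" and low: "\<And>j. j \<in> P \<Longrightarrow> g j = 0" and z: "Re z \<le> cut_line M"
    and eq: "\<And>l. l \<notin> P \<Longrightarrow> (of_real (d l) - z) * g l + conv a g l = (\<Sum>k\<in>P. conv a g k * X k l)"
  shows "g j = 0"
proof -
  define S where "S = l2_norm g"
  define C where "C = r * S * (1 + A)"
  have C0: "0 \<le> C" using A_ge_1 by (simp add: C_def S_def)
  have M: "16 \<le> real M" by (rule M_large1)
  have conv_le: "cmod (conv a g k) \<le> r * S" for k
    using norm_conv_le[OF a_l2 g] by (simp add: S_def)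
  have "1 / 2 \<le> \<bar>\<bar>real_of_int (2 * l + s)\<bar> - (real M + 1 / 2)\<bar>
      \<and> norm (g l) * \<bar>\<bar>real_of_int (2 * l + s)\<bar> - (real M + 1 / 2)\<bar> \<le> C / (9 * real M)" if "g l \<noteq> 0" for l
  proof -
    have l: "l \<notin> P" using that low by blast
    define x where "x = \<bar>real_of_int (2 * l + s)\<bar>"
    have "int M + 1 \<le> \<bar>2 * l + s\<bar>" using l by (auto simp: low_modes_def)
    from iffD2[OF of_int_le_iff[where 'a = real] this] have x: "real M + 1 \<le> x" by (simp add: x_def)
    have "9 * real M * (x - (real M + 1 / 2)) \<le> pi\<^sup>2 * (x\<^sup>2 - (real M + 1 / 2)\<^sup>2)"
      by (rule square_gap) (use x in auto)
    also have "\<dots> \<le> Re (of_real (d l) - z)"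
      using z by (simp only: lap_eq cut_line_def x_def power_mult_distrib right_diff_distrib) simp
    also have "\<dots> \<le> cmod (of_real (d l) - z)" by (rule complex_Re_le_cmod)
    finally have gap: "9 * real M * (x - (real M + 1 / 2)) \<le> cmod (of_real (d l) - z)" .
    have "cmod (of_real (d l) - z) * cmod (g l) = cmod ((\<Sum>k\<in>P. conv a g k * X k l) - conv a g l)"
      unfolding eq[OF l, symmetric] by (simp add: norm_mult)
    also have "\<dots> \<le> (\<Sum>k\<in>P. r * S * cmod (X k l)) + r * S"
      using conv_le by (intro order_trans[OF norm_triangle_ineq4] add_mono sum_norm_le)
        (auto simp: norm_mult intro!: mult_right_mono)
    also have "\<dots> \<le> r * S * A + r * S"
      using X_row_sum[of l] by (simp add: sum_distrib_left[symmetric] mult_left_mono S_def)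
    also have "\<dots> = C" by (simp add: C_def algebra_simps)
    finally have "9 * real M * (x - (real M + 1 / 2)) * cmod (g l) \<le> C"
      using gap mult_right_mono[OF gap norm_ge_zero[of "g l"]] by linarith
    then have "norm (g l) * (x - (real M + 1 / 2)) \<le> C / (9 * real M)"
      using M by (simp add: field_simps)
    then show ?thesis using x unfolding x_def by linarith
  qed
  then have "l2_norm g \<le> C / (9 * real M) * \<Gamma>"
    using gap_l2(2)[of "C / (9 * real M)" g s "real M + 1 / 2"] C0 by auto
  then have "9 * real M * S \<le> C * \<Gamma>" using M by (simp add: S_def field_simps)
  also have "C * \<Gamma> = (\<Gamma> * (r * (1 + A))) * S" by (simp add: C_def mult_ac)
  also have "\<dots> \<le> (\<Gamma> * (A * (2 * A))) * S"
    using gap_const_ge_1 r_le_A A_ge_1 by (intro mult_right_mono mult_left_mono mult_mono) (auto simp: S_def)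
  also have "\<dots> \<le> real M * S"
  proof (rule mult_right_mono)
    show "\<Gamma> * (A * (2 * A)) \<le> real M"
      using M_large1(3) mult_nonneg_nonneg[of \<Gamma> "A\<^sup>2"] gap_const_ge_1 by (simp add: power2_eq_square mult_ac)
  qed (simp add: S_def)
  finally have "real M * S \<le> 0" by (simp add: mult.commute)
  then have "S \<le> 0" using M by (simp add: mult_le_0_iff)
  then show ?thesis using l2_norm_eq_0D[OF g] by (simp add: S_def)
qed

text \<open>The counterpart of \<open>high_part_zero\<close> for \<open>z\<close> on the right: the
  separation of \<open>z\<close> from the low diagonal bounds the low part \<open>p\<close> by a
  small multiple of the norm of the whole vector, and the graph property bounds the whole by
  \<open>4 * (A * \<Gamma>)\<close> times \<open>p\<close>.\<close>

lemma no_graph_eigenvector: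
  assumes z: "cut_line M \<le> Re z" and eig: "\<And>j. of_real (d j) * graph_vec x j + conv a (graph_vec x) j = z * graph_vec x j"
  shows "graph_vec x j = 0"
proof -
  define v where "v = graph_vec x"
  define p where "p k = (if k \<in> P then x k else 0)" for k
  have M: "16 \<le> real M" by (rule M_large1)
  have v_l2: "l2_seq v" unfolding v_def by (rule graph_vec_l2)
  have v_split: "v = (\<lambda>j. p j + (\<Sum>k\<in>P. x k * X k j))"
  proof
    fix j
    show "v j = p j + (\<Sum>k\<in>P. x k * X k j)"
      by (cases "j \<in> P") (simp_all add: v_def p_def graph_vec_low graph_vec_high X_zero)
  qed
  define C where "C = r * l2_norm v"
  have "1 / 2 \<le> \<bar>\<bar>real_of_int (2 * k + s)\<bar> - (real M + 1 / 2)\<bar>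
      \<and> norm (p k) * \<bar>\<bar>real_of_int (2 * k + s)\<bar> - (real M + 1 / 2)\<bar> \<le> C / (9 * real M)" if "p k \<noteq> 0" for k
  proof -
    have k: "k \<in> P" using that by (auto simp: p_def split: if_splits)
    define y where "y = \<bar>real_of_int (2 * k + s)\<bar>"
    have "\<bar>2 * k + s\<bar> \<le> int M" using k by (auto simp: low_modes_def)
    from iffD2[OF of_int_le_iff[where 'a = real] this] have y: "0 \<le> y" "y \<le> real M" by (auto simp: y_def)
    have "9 * real M * ((real M + 1 / 2) - y) \<le> 9 * (real M + 1 / 2) * ((real M + 1 / 2) - y)"
      using y by (intro mult_right_mono) auto
    also have "\<dots> \<le> pi\<^sup>2 * ((real M + 1 / 2)\<^sup>2 - y\<^sup>2)"
      by (rule square_gap) (use y in auto)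
    also have "\<dots> \<le> Re (z - of_real (d k))"
      using z by (simp only: lap_eq cut_line_def y_def power_mult_distrib right_diff_distrib) simp
    also have "\<dots> \<le> cmod (z - of_real (d k))" by (rule complex_Re_le_cmod)
    finally have gap: "9 * real M * ((real M + 1 / 2) - y) \<le> cmod (z - of_real (d k))" .
    have "(z - of_real (d k)) * p k = conv a v k"
      using eig[of k] k by (simp add: v_def p_def graph_vec_low algebra_simps)
    then have "cmod (z - of_real (d k)) * cmod (p k) \<le> C"
      using norm_conv_le[OF a_l2 v_l2, of k] by (metis C_def norm_mult)
    then have "9 * real M * ((real M + 1 / 2) - y) * cmod (p k) \<le> C"
      using mult_right_mono[OF gap norm_ge_zero[of "p k"]] by linarith
    then have "norm (p k) * ((real M + 1 / 2) - y) \<le> C / (9 * real M)"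
      using M by (simp add: field_simps)
    moreover have "\<bar>y - (real M + 1 / 2)\<bar> = (real M + 1 / 2) - y" using y by simp
    ultimately show ?thesis using y unfolding y_def[symmetric] by simp
  qed
  then have p: "l2_seq p" "l2_norm p \<le> C / (9 * real M) * \<Gamma>"
    using gap_l2[of "C / (9 * real M)" p s "real M + 1 / 2"] by (auto simp: C_def)
  have "l2_norm (\<lambda>j. \<Sum>k\<in>P. x k * X k j) \<le> (\<Sum>k\<in>P. l2_norm (\<lambda>j. x k * X k j))"
    by (intro l2_norm_triangle_sum finP l2_cmult X_column)
  also have "\<dots> \<le> (\<Sum>k\<in>P. l2_norm p * (A * \<Gamma> / real M))"
  proof (rule sum_mono)
    fix k assume k: "k \<in> P"
    have "l2_norm (\<lambda>j. x k * X k j) \<le> cmod (x k) * l2_norm (X k)"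
      by (rule l2_cmult(2)[OF X_column(1)])
    also have "\<dots> \<le> l2_norm p * (A * \<Gamma> / real M)"
      using norm_le_l2_norm[OF p(1), of k] k X_column(2) by (intro mult_mono) (auto simp: p_def)
    finally show "l2_norm (\<lambda>j. x k * X k j) \<le> l2_norm p * (A * \<Gamma> / real M)" .
  qed
  also have "\<dots> = real (card P) * (l2_norm p * (A * \<Gamma> / real M))" by simp
  also have "\<dots> \<le> (3 * real M) * (l2_norm p * (A * \<Gamma> / real M))"
    using card_low_modes[OF s01, of M] M A_ge_1 gap_const_ge_1 by (intro mult_right_mono) auto
  also have "\<dots> = 3 * (A * \<Gamma>) * l2_norm p" using M by simp
  finally have "l2_norm (\<lambda>j. \<Sum>k\<in>P. x k * X k j) \<le> 3 * (A * \<Gamma>) * l2_norm p" .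
  moreover have "l2_norm v \<le> l2_norm p + l2_norm (\<lambda>j. \<Sum>k\<in>P. x k * X k j)"
    unfolding v_split by (intro l2_add p l2_norm_triangle_sum(1) finP l2_cmult X_column)
  ultimately have "l2_norm v \<le> (1 + 3 * (A * \<Gamma>)) * l2_norm p" by (simp add: algebra_simps)
  also have "\<dots> \<le> (4 * (A * \<Gamma>)) * (C / (9 * real M) * \<Gamma>)"
    using p(2) A_ge_1 gap_const_ge_1 mult_mono[of 1 A 1 \<Gamma>]
    by (intro mult_mono) (auto simp: mult.commute)
  also have "\<dots> = 4 * (A * \<Gamma>\<^sup>2 * r) / (9 * real M) * l2_norm v"
    by (simp add: C_def power2_eq_square)
  also have "\<dots> \<le> 1 / 2 * l2_norm v"
  proof (rule mult_right_mono)
    have "A * \<Gamma>\<^sup>2 * r \<le> A * \<Gamma>\<^sup>2 * A"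
      using r_le_A A_ge_1 by (intro mult_left_mono) auto
    also have "\<dots> = \<Gamma>\<^sup>2 * A\<^sup>2" by (simp add: power2_eq_square)
    finally have "4 * (A * \<Gamma>\<^sup>2 * r) \<le> 1 / 2 * (9 * real M)"
      using M_large1(1) M by linarith
    then show "4 * (A * \<Gamma>\<^sup>2 * r) / (9 * real M) \<le> 1 / 2"
      using M by (subst pos_divide_le_eq) auto
  qed simp
  finally have "l2_norm v \<le> 0" using l2_norm_nonneg[of v] by linarith
  then show ?thesis using l2_norm_eq_0D[OF v_l2] by (simp add: v_def)
qed

end

section \<open>Root spaces of Hill's operator left of a cut line\<close>

lemma fourier_coeff_l2: "l2_seq (fourier_coeff q)" "l2_norm (fourier_coeff q) \<le> norm q"
  using bessel[of 0 q] by (simp_all add: fourier_coeff_eq[abs_def])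

lemma zero_in_root_space: "0 \<in> root_space \<sigma> q z"
  unfolding root_space_def by (rule CollectI, rule exI[of _ 0]) simp

locale hill_splitting = mode_splitting "fourier_coeff q" s M for q :: l2_circle and s M
begin

abbreviation "\<sigma> \<equiv> trig s 1"

abbreviation hat :: "l2_circle \<Rightarrow> int \<Rightarrow> complex" where
  "hat y \<equiv> \<lambda>j. l2_coeff (2 * j + s) y"

definition b :: "int \<Rightarrow> l2_circle" where "b k = l2_synth s (F k)"

definition W :: "l2_circle set" where "W = l2_circle.span (b ` P)"

lemma hat_b: "hat (b k) = F k"
  by (auto simp: b_def l2_coeff_synth[OF F_summable])

lemma synth_graph_vec: "l2_synth s (graph_vec x) = (\<Sum>k\<in>P. scaleC (x k) (b k))"
  unfolding graph_vec_def[abs_def] b_def by (rule l2_synth_sum(2)[OF finP F_summable])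

lemma hat_synth_graph_vec: "hat (l2_synth s (graph_vec x)) = graph_vec x"
  by (auto simp: l2_coeff_synth[OF graph_vec_summable])

lemma inj_b: "inj_on b P"
proof (rule inj_onI)
  fix k k' assume k: "k \<in> P" "k' \<in> P" "b k = b k'"
  then have "F k k = F k' k" using hat_b by metis
  then show "k = k'" using k by (simp add: F_def X_zero split: if_splits)
qed

lemma independent_b: "l2_circle.independent (b ` P)"
proof -
  have "u v = 0" if u: "(\<Sum>v\<in>b ` P. scaleC (u v) v) = 0" and v: "v \<in> b ` P" for u v
  proof -
    obtain k where k: "k \<in> P" "v = b k" using v by blast
    have "l2_synth s (graph_vec (\<lambda>k. u (b k))) = 0"
      using u by (simp add: synth_graph_vec sum.reindex[OF inj_b])
    then have "graph_vec (\<lambda>k. u (b k)) k = 0"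
      using hat_synth_graph_vec[of "\<lambda>k. u (b k)"] by (metis l2_coeff_0)
    then show ?thesis using k by (simp add: graph_vec_low)
  qed
  then show ?thesis
    using l2_circle.dependent_finite[of "b ` P"] finP by auto
qed

text \<open>Membership expressed by coefficients. The first conjunct records that \<open>y\<close>
  is determined by them, which Bessel's inequality does not give.\<close>

lemma W_iff: "y \<in> W \<longleftrightarrow> y = l2_synth s (hat y) \<and> hat y = graph_vec (hat y)"
proof
  assume "y \<in> W"
  then obtain u where u: "y = (\<Sum>v\<in>b ` P. scaleC (u v) v)"
    using l2_circle.span_finite[of "b ` P"] finP unfolding W_def by auto
  have y: "y = l2_synth s (graph_vec (\<lambda>k. u (b k)))"
    using u by (simp add: synth_graph_vec sum.reindex[OF inj_b])
  have haty: "hat y = graph_vec (\<lambda>k. u (b k))"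
    unfolding y by (rule hat_synth_graph_vec)
  moreover have "graph_vec (\<lambda>k. u (b k)) = graph_vec (graph_vec (\<lambda>k. u (b k)))"
    by (rule ext, rule graph_vec_cong) (simp add: graph_vec_low)
  ultimately show "y = l2_synth s (hat y) \<and> hat y = graph_vec (hat y)"
    using y by metis
next
  assume *: "y = l2_synth s (hat y) \<and> hat y = graph_vec (hat y)"
  then have "y = (\<Sum>k\<in>P. scaleC (hat y k) (b k))" using synth_graph_vec[of "hat y"] by metis
  also have "\<dots> \<in> W"
    unfolding W_def by (intro l2_circle.span_sum l2_circle.span_scale l2_circle.span_base) auto
  finally show "y \<in> W" .
qed

lemma W_eqI: "y \<in> W \<Longrightarrow> y' \<in> W \<Longrightarrow> hat y = hat y' \<Longrightarrow> y = y'"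
  using W_iff by metis

lemma subspace_W: "l2_circle.subspace W"
  by (simp add: W_def)

lemma dim_W: "l2_circle.dim W = card P"
  using l2_circle.dim_span_eq_card_independent[OF independent_b] card_image[OF inj_b] by (simp add: W_def)

lemma W_finite_span: "finite (b ` P)" "W \<subseteq> l2_circle.span (b ` P)"
  using finP by (auto simp: W_def)

lemma hat_l2: "l2_seq (hat y)" by (rule bessel(1))

text \<open>Hill's operator is a relation, whereas \<open>l2_operator\<close> asks for a total
  linear map. \<open>T\<close> is prescribed on the basis \<open>b\<close> and extended linearly; on
  \<open>W\<close> it has the coefficients of Hill's operator.\<close>

lemma operator_on_W:
  obtains T where "Vector_Spaces.linear scaleC scaleC T"
    and "\<And>y. y \<in> W \<Longrightarrow> T y \<in> W"
    and "\<And>y j. y \<in> W \<Longrightarrow> hat (T y) j = of_real (d j) * hat y j + conv (fourier_coeff q) (hat y) j"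
proof -
  interpret vp: vector_space_pair scaleC scaleC ..
  define image where "image k = l2_synth s (graph_vec (\<lambda>j. of_real (d j) * F k j + conv (fourier_coeff q) (F k) j))" for k
  obtain T where lin: "Vector_Spaces.linear scaleC scaleC T"
    and T: "\<And>v. v \<in> b ` P \<Longrightarrow> T v = image (the_inv_into P b v)"
    using vp.linear_independent_extend[OF independent_b, of "\<lambda>v. image (the_inv_into P b v)"] by blast
  interpret T: Vector_Spaces.linear scaleC scaleC T by (rule lin)
  have Tb: "T (b k) = image k" if "k \<in> P" for k
    using T[of "b k"] that by (simp add: the_inv_into_f_f[OF inj_b])
  have W: "image k \<in> W" for k
    unfolding image_def synth_graph_vec W_def
    by (intro l2_circle.span_sum l2_circle.span_scale l2_circle.span_base) auto
  have F_graph: "F k = graph_vec (F k)" if "k \<in> P" for k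
    using W_iff[of "b k"] that l2_circle.span_base[of "b k" "b ` P"] by (simp add: hat_b W_def)
  have hat_image: "hat (image k) j = of_real (d j) * F k j + conv (fourier_coeff q) (F k) j" if "k \<in> P" for k j
    using graph_vec_invariant[of j "F k"]
    by (simp only: image_def l2_coeff_synth[OF graph_vec_summable] F_graph[OF that, symmetric])
  have expand: "y = (\<Sum>k\<in>P. scaleC (hat y k) (b k))" if "y \<in> W" for y
    using W_iff[of y] that synth_graph_vec[of "hat y"] by metis
  have Ty: "T y = (\<Sum>k\<in>P. scaleC (hat y k) (image k))" if "y \<in> W" for y
  proof -
    have "T y = T (\<Sum>k\<in>P. scaleC (hat y k) (b k))" using expand[OF that] by simp
    also have "\<dots> = (\<Sum>k\<in>P. scaleC (hat y k) (image k))"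
      by (simp add: T.sum T.scale Tb cong: sum.cong)
    finally show ?thesis .
  qed
  show thesis
  proof (rule that[OF lin])
    fix y assume y: "y \<in> W"
    show "T y \<in> W"
      unfolding Ty[OF y] by (intro l2_circle.subspace_sum subspace_W l2_circle.subspace_scale W)
    fix j
    have haty: "hat y = graph_vec (hat y)" using W_iff y by blast
    have "hat (T y) j = (\<Sum>k\<in>P. hat y k * (of_real (d j) * F k j + conv (fourier_coeff q) (F k) j))"
      unfolding Ty[OF y] by (simp add: l2_coeff_sum l2_coeff_scale hat_image)
    also have "\<dots> = of_real (d j) * graph_vec (hat y) j + conv (fourier_coeff q) (graph_vec (hat y)) j"
      by (simp add: conv_graph_vec graph_vec_def sum_distrib_left sum.distrib algebra_simps)
    finally show "hat (T y) j = of_real (d j) * hat y j + conv (fourier_coeff q) (hat y) j"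
      using haty by simp
  qed
qed

lemma root_spaces_left:
  obtains Z where "finite Z" "\<And>z. z \<in> Z \<Longrightarrow> Re z < cut_line M"
    "\<And>z. Re z \<le> cut_line M \<Longrightarrow> z \<notin> Z \<Longrightarrow> root_space \<sigma> q z = {0}"
    "(\<Sum>z\<in>Z. l2_circle.dim (root_space \<sigma> q z)) = card P"
    "\<And>z. Re z \<le> cut_line M \<Longrightarrow> root_space \<sigma> q z \<subseteq> l2_circle.span (b ` P)"
    "\<And>z. z \<in> Z \<Longrightarrow> root_space \<sigma> q z \<noteq> {0}"
proof -
  obtain T where lin: "Vector_Spaces.linear scaleC scaleC T"
    and TW: "\<And>y. y \<in> W \<Longrightarrow> T y \<in> W"
    and hatT: "\<And>y j. y \<in> W \<Longrightarrow> hat (T y) j = of_real (d j) * hat y j + conv (fourier_coeff q) (hat y) j"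
    using operator_on_W by blast
  interpret T: l2_operator T by (rule l2_operator.intro[OF lin])
  have T_hill: "(y, T y) \<in> hill_operator \<sigma> q" if y: "y \<in> W" for y
  proof -
    have g: "y = l2_synth s (hat y)" "hat y = graph_vec (hat y)" using W_iff y by blast+
    have "(\<lambda>j. cmod (hat y j)) summable_on UNIV"
      using graph_vec_summable[of "hat y"] g(2) by simp
    from hill_operator_synth[OF s01 this, of "T y" q] show ?thesis
      using hatT[OF y] g(1) by simp
  qed
  \<comment> \<open>Induction along the chain: if the image \<open>y1\<close> of \<open>y\<close>
    under the shifted operator lies in \<open>W\<close>, then the deviation \<open>g\<close> of
    \<open>hat y\<close> from the graph satisfies the equation of \<open>high_part_zero\<close>, so
    \<open>y\<close> lies in \<open>W\<close> as well.\<close>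
  have into: "y \<in> W \<and> (T.shift z ^^ k) y = 0" if "(y, 0) \<in> hill_shifted \<sigma> q z ^^ k" "Re z \<le> cut_line M" for y z k
    using that
  proof (induction k arbitrary: y)
    case 0
    then show ?case by (simp add: l2_circle.subspace_0[OF subspace_W])
  next
    case (Suc k)
    obtain y1 where y1: "(y, y1) \<in> hill_shifted \<sigma> q z" "(y1, 0) \<in> hill_shifted \<sigma> q z ^^ k"
      using Suc.prems(1) by (rule relpow_Suc_E2)
    then have IH: "y1 \<in> W" "(T.shift z ^^ k) y1 = 0" using Suc.IH Suc.prems(2) by auto
    obtain f where f: "(y, f) \<in> hill_operator \<sigma> q" "y1 = f - scaleC z y"
      using y1(1) by (auto simp: hill_shifted_def)
    have hat_f: "hat f j = of_real (d j) * hat y j + conv (fourier_coeff q) (hat y) j" for j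
      by (rule hill_operator_coeff(3)[OF f(1)])
    have hat_y1: "hat y1 j = (of_real (d j) - z) * hat y j + conv (fourier_coeff q) (hat y) j" for j
      by (simp only: f(2) l2_coeff_diff l2_coeff_scale hat_f left_diff_distrib) simp
    define h where "h = graph_vec (hat y)"
    define g where "g j = hat y j - h j" for j
    have h_l2: "l2_seq h" unfolding h_def by (rule graph_vec_l2)
    have g_l2: "l2_seq g" unfolding g_def by (intro l2_diff hat_l2 h_l2)
    have conv_g: "conv (fourier_coeff q) g j = conv (fourier_coeff q) (hat y) j - conv (fourier_coeff q) h j" for j
      unfolding g_def by (rule conv_diff[OF a_l2 hat_l2 h_l2])
    have g0: "g j = 0" for j
    proof (rule high_part_zero[OF g_l2])
      show "Re z \<le> cut_line M" by fact
      show "g k = 0" if "k \<in> P" for k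
        using that by (simp add: g_def h_def graph_vec_low)
      fix l assume l: "l \<notin> P"
      have "(of_real (d l) - z) * g l + conv (fourier_coeff q) g l
          = hat y1 l - (of_real (d l) * h l + conv (fourier_coeff q) h l) + z * h l"
        by (simp only: hat_y1 conv_g g_def left_diff_distrib right_diff_distrib) simp
      also have "\<dots> = graph_vec (hat y1) l
          - graph_vec (\<lambda>k. of_real (d k) * hat y k + conv (fourier_coeff q) h k) l + z * graph_vec (hat y) l"
        using graph_vec_invariant[of l "hat y"] W_iff[of y1] IH(1) by (simp add: h_def)
      also have "\<dots> = (\<Sum>k\<in>P. (hat y1 k - (of_real (d k) * hat y k + conv (fourier_coeff q) h k) + z * hat y k) * X k l)"
        by (simp add: graph_vec_high[OF l] sum_distrib_left sum.distrib sum_subtractf algebra_simps)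
      also have "\<dots> = (\<Sum>k\<in>P. conv (fourier_coeff q) g k * X k l)"
        by (intro sum.cong refl) (simp only: hat_y1 conv_g left_diff_distrib, simp add: left_diff_distrib)
      finally show "(of_real (d l) - z) * g l + conv (fourier_coeff q) g l = (\<Sum>k\<in>P. conv (fourier_coeff q) g k * X k l)" .
    qed
    have "hat y = graph_vec (hat y)"
    proof
      fix j
      show "hat y j = graph_vec (hat y) j" using g0[of j] by (simp only: g_def h_def right_minus_eq)
    qed
    moreover have "y = l2_synth s (hat y)" by (rule hill_operator_coeff(4)[OF f(1)])
    ultimately have yW: "y \<in> W" using W_iff by blast
    have "f \<in> W"
      using l2_circle.subspace_add[OF subspace_W IH(1) l2_circle.subspace_scale[OF subspace_W yW, of z]] f(2) by simp
    then have "f = T y"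
      by (rule W_eqI[OF _ TW[OF yW]]) (simp add: hat_f hatT[OF yW] fun_eq_iff)
    then have "T.shift z y = y1" by (simp add: T.shift_def f(2))
    then have "(T.shift z ^^ Suc k) y = 0" using IH(2) by (simp add: funpow_swap1)
    then show ?case using yW by simp
  qed
  have out: "(y, 0) \<in> hill_shifted \<sigma> q z ^^ k" if "y \<in> W" "(T.shift z ^^ k) y = 0" for y z k
    using that
  proof (induction k arbitrary: y)
    case 0
    then show ?case by simp
  next
    case (Suc k)
    have "(y, T.shift z y) \<in> hill_shifted \<sigma> q z"
      using T_hill[OF Suc.prems(1)] by (auto simp: hill_shifted_def T.shift_def)
    moreover have "T.shift z y \<in> W"
      using T.shift_in_subspace[OF subspace_W TW Suc.prems(1), where k = 1 and z = z] by simp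
    moreover have "(T.shift z ^^ k) (T.shift z y) = 0"
      using Suc.prems(2) by (simp add: funpow_swap1)
    ultimately show ?case using Suc.IH by (intro relpow_Suc_I2)
  qed
  have root: "root_space \<sigma> q z = T.root_vectors W z" if "Re z \<le> cut_line M" for z
    using into[OF _ that] out unfolding root_space_def T.root_vectors_def by blast
  obtain Z where Z: "finite Z" "\<And>z. z \<notin> Z \<Longrightarrow> T.root_vectors W z = {0}"
    "(\<Sum>z\<in>Z. l2_circle.dim (T.root_vectors W z)) = l2_circle.dim W"
    using T.root_space_decomposition[OF subspace_W TW W_finite_span] by blast
  \<comment> \<open>\<open>T\<close> has no eigenvalue on \<open>W\<close> on or beyond the line, so
    the full dimension \<open>card P\<close> is accounted for on the left.\<close>
  have right: "T.root_vectors W z = {0}" if z: "cut_line M \<le> Re z" for z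
  proof -
    have "y = 0" if "y \<in> W" "(T.shift z ^^ k) y = 0" for y k
      using that
    proof (induction k arbitrary: y)
      case (Suc k)
      have "(T.shift z ^^ k) (T.shift z y) = 0"
        using Suc.prems(2) by (simp add: funpow_swap1)
      then have "T.shift z y = 0"
        using Suc.IH T.shift_in_subspace[OF subspace_W TW Suc.prems(1), where k = 1 and z = z] by simp
      then have "T y = scaleC z y" by (simp add: T.shift_def)
      then have "of_real (d j) * hat y j + conv (fourier_coeff q) (hat y) j = z * hat y j" for j
        using hatT[OF Suc.prems(1), of j] by (simp add: l2_coeff_scale)
      moreover have g: "hat y = graph_vec (hat y)" "y = l2_synth s (hat y)" using W_iff Suc.prems(1) by blast+
      ultimately have "graph_vec (hat y) j = 0" for j
        using no_graph_eigenvector[OF z, of "hat y" j] by metis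
      then have "hat y = (\<lambda>_. 0)" using g(1) by metis
      then show ?case using g(2) by simp
    qed simp
    then show ?thesis
      using l2_circle.subspace_0[OF T.subspace_root_vectors[OF subspace_W]] by (auto simp: T.root_vectors_def)
  qed
  define Z' where "Z' = {z \<in> Z. Re z < cut_line M \<and> T.root_vectors W z \<noteq> {0}}"
  have "(\<Sum>z\<in>Z'. l2_circle.dim (T.root_vectors W z)) = (\<Sum>z\<in>Z. l2_circle.dim (T.root_vectors W z))"
  proof (rule sum.mono_neutral_left[OF Z(1)])
    show "\<forall>z\<in>Z - Z'. l2_circle.dim (T.root_vectors W z) = 0"
    proof
      fix z assume "z \<in> Z - Z'"
      then have "T.root_vectors W z = {0}" using right[of z] by (auto simp: Z'_def not_less)
      then show "l2_circle.dim (T.root_vectors W z) = 0" by (simp add: dim_zero)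
    qed
  qed (auto simp: Z'_def)
  then have sum: "(\<Sum>z\<in>Z'. l2_circle.dim (root_space \<sigma> q z)) = card P"
    using Z(3) dim_W root by (simp add: Z'_def)
  show thesis
  proof (rule that[of Z'])
    show "finite Z'" using Z(1) by (simp add: Z'_def)
    show "Re z < cut_line M" if "z \<in> Z'" for z using that by (simp add: Z'_def)
    show "root_space \<sigma> q z = {0}" if "Re z \<le> cut_line M" "z \<notin> Z'" for z
      using that Z(2)[of z] right[of z] root[of z] by (auto simp: Z'_def)
    show "(\<Sum>z\<in>Z'. l2_circle.dim (root_space \<sigma> q z)) = card P" by (rule sum)
    show "root_space \<sigma> q z \<subseteq> l2_circle.span (b ` P)" if "Re z \<le> cut_line M" for z
      using root[OF that] by (auto simp: T.root_vectors_def W_def)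
    show "root_space \<sigma> q z \<noteq> {0}" if "z \<in> Z'" for z
      using that root[of z] by (auto simp: Z'_def)
  qed
qed

end

section \<open>Listing the eigenvalues\<close>

abbreviation lex_less :: "complex \<Rightarrow> complex \<Rightarrow> bool" where
  "lex_less z w \<equiv> lex_le z w \<and> z \<noteq> w"

lemma lex_le_refl [simp]: "lex_le z z"
  by (simp add: lex_le_def)

lemma lex_le_trans: "lex_le x y \<Longrightarrow> lex_le y z \<Longrightarrow> lex_le x z"
  by (auto simp: lex_le_def)

lemma lex_le_antisym: "lex_le x y \<Longrightarrow> lex_le y x \<Longrightarrow> x = y"
  by (auto simp: lex_le_def complex_eq_iff)

lemma lex_le_total: "lex_le x y \<or> lex_le y x"
  by (auto simp: lex_le_def)

lemma lex_less_trans: "lex_less x y \<Longrightarrow> lex_less y z \<Longrightarrow> lex_less x z"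
  using lex_le_trans lex_le_antisym by metis

lemma lex_min_max_exist:
  assumes "finite S" "S \<noteq> {}"
  shows "\<exists>z\<in>S. \<forall>w\<in>S. lex_le z w" "\<exists>z\<in>S. \<forall>w\<in>S. lex_le w z"
proof -
  show "\<exists>z\<in>S. \<forall>w\<in>S. lex_le z w"
    using assms
  proof (induction S rule: finite_ne_induct)
    case (insert x S)
    then obtain z where z: "z \<in> S" "\<forall>w\<in>S. lex_le z w" by blast
    show ?case
    proof (cases "lex_le x z")
      case True
      then show ?thesis using z lex_le_trans by (intro bexI[of _ x]) auto
    next
      case False
      then show ?thesis using z lex_le_total[of x z] by (intro bexI[of _ z]) auto
    qed
  qed simp
  show "\<exists>z\<in>S. \<forall>w\<in>S. lex_le w z"
    using assms
  proof (induction S rule: finite_ne_induct)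
    case (insert x S)
    then obtain z where z: "z \<in> S" "\<forall>w\<in>S. lex_le w z" by blast
    show ?case
    proof (cases "lex_le z x")
      case True
      then show ?thesis using z lex_le_trans by (intro bexI[of _ x]) auto
    next
      case False
      then show ?thesis using z lex_le_total[of x z] by (intro bexI[of _ z]) auto
    qed
  qed simp
qed

text \<open>Finitely many points left of each vertical line make the set of lexicographic
  predecessors finite; the unbounded count keeps the listing from ending.\<close>

locale lex_multiplicity =
  fixes m :: "complex \<Rightarrow> nat"
  assumes fin: "finite {z. 0 < m z \<and> Re z \<le> c}"
    and unbounded: "\<exists>c. K \<le> (\<Sum>z\<in>{z. 0 < m z \<and> Re z \<le> c}. m z)"
begin

definition below :: "complex \<Rightarrow> complex set" where
  "below z = {w. 0 < m w \<and> lex_less w z}"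

text \<open>The number of list positions before \<open>z\<close>: the copies of \<open>z\<close>
  occupy the positions from \<open>rank z\<close> to \<open>rank z + m z - 1\<close>.\<close>

definition rank :: "complex \<Rightarrow> nat" where
  "rank z = (\<Sum>w\<in>below z. m w)"

lemma finite_below: "finite (below z)"
  by (rule finite_subset[OF _ fin[of "Re z"]]) (auto simp: below_def lex_le_def)

lemma below_mono:
  assumes "lex_less z w"
  shows "below z \<subseteq> below w"
proof
  fix v assume "v \<in> below z"
  then show "v \<in> below w" using lex_less_trans[of v z w] assms by (auto simp: below_def)
qed

lemma rank_step:
  assumes zw: "lex_less z w"
  shows "rank z + m z \<le> rank w"
proof (cases "m z = 0")
  case True
  then show ?thesis
    using finite_below below_mono[OF zw] by (auto simp: rank_def intro: sum_mono2)
next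
  case False
  then have "insert z (below z) \<subseteq> below w"
    using below_mono[OF zw] zw by (auto simp: below_def)
  then have "(\<Sum>v\<in>insert z (below z). m v) \<le> rank w"
    unfolding rank_def by (intro sum_mono2 finite_below) auto
  moreover have "z \<notin> below z" by (simp add: below_def)
  ultimately show ?thesis using finite_below by (simp add: rank_def)
qed

lemma slot_unique:
  assumes "rank z \<le> k" "k < rank z + m z" "rank w \<le> k" "k < rank w + m w"
  shows "z = w"
  using rank_step[of z w] rank_step[of w z] lex_le_total[of z w] assms by fastforce

text \<open>Among the points whose slot reaches beyond \<open>k\<close> take the least. If its slot
  started after \<open>k\<close>, that of its immediate predecessor would already reach beyond
  \<open>k\<close>.\<close>

lemma slot_exists: "\<exists>z. rank z \<le> k \<and> k < rank z + m z"
proof -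
  obtain c where c: "Suc k \<le> (\<Sum>z\<in>{z. 0 < m z \<and> Re z \<le> c}. m z)" using unbounded by blast
  define S where "S = {z. 0 < m z \<and> Re z \<le> c}"
  have finS: "finite S" unfolding S_def by (rule fin)
  have "S \<noteq> {}" using c unfolding S_def[symmetric] by auto
  then obtain z1 where z1: "z1 \<in> S" "\<forall>w\<in>S. lex_le w z1" using lex_min_max_exist(2)[OF finS] by blast
  have "S \<subseteq> insert z1 (below z1)" using z1 by (auto simp: below_def S_def)
  then have "(\<Sum>z\<in>S. m z) \<le> (\<Sum>z\<in>insert z1 (below z1). m z)"
    using finite_below by (intro sum_mono2) auto
  also have "\<dots> = rank z1 + m z1" using finite_below by (simp add: rank_def below_def)
  finally have "k < rank z1 + m z1" using c by (simp add: S_def)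
  then have "{z \<in> S. k < rank z + m z} \<noteq> {}" using z1 by auto
  then obtain z where z: "z \<in> S" "k < rank z + m z" and min: "\<And>w. w \<in> S \<Longrightarrow> k < rank w + m w \<Longrightarrow> lex_le z w"
    using lex_min_max_exist(1)[of "{z \<in> S. k < rank z + m z}"] finS by auto
  have "rank z \<le> k"
  proof (rule ccontr)
    assume "\<not> rank z \<le> k"
    then have "below z \<noteq> {}" by (auto simp: rank_def)
    then obtain w where w: "w \<in> below z" "\<forall>v\<in>below z. lex_le v w"
      using lex_min_max_exist(2)[OF finite_below] by blast
    have "below z \<subseteq> insert w (below w)" using w by (auto simp: below_def)
    then have "rank z \<le> (\<Sum>v\<in>insert w (below w). m v)"
      unfolding rank_def using finite_below by (intro sum_mono2) auto
    also have "\<dots> = rank w + m w" using finite_below by (simp add: rank_def below_def)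
    finally have "k < rank w + m w" using \<open>\<not> rank z \<le> k\<close> by simp
    moreover have "w \<in> S" using w(1) z(1) by (auto simp: below_def S_def lex_le_def)
    ultimately have "lex_le z w" using min by blast
    then show False using w(1) lex_le_antisym by (auto simp: below_def)
  qed
  then show ?thesis using z by blast
qed

lemma listing_exists:
  "\<exists>\<mu>. (\<forall>k. lex_le (\<mu> k) (\<mu> (Suc k))) \<and> (\<forall>z. finite {k. \<mu> k = z} \<and> card {k. \<mu> k = z} = m z)"
proof -
  obtain \<mu> where \<mu>: "\<And>k. rank (\<mu> k) \<le> k \<and> k < rank (\<mu> k) + m (\<mu> k)"
    using slot_exists by metis
  have "lex_le (\<mu> k) (\<mu> (Suc k))" for k
    using rank_step[of "\<mu> (Suc k)" "\<mu> k"] lex_le_total[of "\<mu> k" "\<mu> (Suc k)"] \<mu>[of k] \<mu>[of "Suc k"] by force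
  moreover have "{k. \<mu> k = z} = {rank z..<rank z + m z}" for z
  proof (intro set_eqI iffI)
    fix k assume "k \<in> {k. \<mu> k = z}"
    then show "k \<in> {rank z..<rank z + m z}" using \<mu>[of k] by auto
  next
    fix k assume "k \<in> {rank z..<rank z + m z}"
    then show "k \<in> {k. \<mu> k = z}" using slot_unique[of "\<mu> k" k z] \<mu>[of k] by auto
  qed
  ultimately show ?thesis by (intro exI[of _ \<mu>]) auto
qed

text \<open>Counting the positions with values below \<open>\<mu> k\<close>, and those with values
  up to it, forces every listing into the slots given by \<open>rank\<close>. Hence the
  \<open>THE\<close> in \<open>periodic_eigenvalue\<close> is well defined.\<close>

lemma listing_rank:
  assumes sorted: "\<And>k. lex_le (\<mu> k) (\<mu> (Suc k))"
    and mult: "\<And>z. finite {k. \<mu> k = z} \<and> card {k. \<mu> k = z} = m z"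
  shows "rank (\<mu> k) \<le> k" "k < rank (\<mu> k) + m (\<mu> k)"
proof -
  have mono: "lex_le (\<mu> i) (\<mu> j)" if "i \<le> j" for i j
    using that by (induction j rule: dec_induct) (auto intro: lex_le_trans sorted)
  have pos: "0 < m (\<mu> i)" for i
    using mult[of "\<mu> i"] card_gt_0_iff[of "{k. \<mu> k = \<mu> i}"] by auto
  have un: "{i. \<mu> i \<in> B} = (\<Union>w\<in>B. {i. \<mu> i = w})" for B by auto
  have card: "card {i. \<mu> i \<in> B} = (\<Sum>w\<in>B. m w)" "finite {i. \<mu> i \<in> B}" if "finite B" for B
  proof -
    show "card {i. \<mu> i \<in> B} = (\<Sum>w\<in>B. m w)"
      unfolding un using that mult by (subst card_UN_disjoint) auto
    show "finite {i. \<mu> i \<in> B}" unfolding un using that mult by auto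
  qed
  have "{i. \<mu> i \<in> below (\<mu> k)} \<subseteq> {..<k}"
  proof
    fix i assume "i \<in> {i. \<mu> i \<in> below (\<mu> k)}"
    then have "lex_less (\<mu> i) (\<mu> k)" by (simp add: below_def)
    then have "\<not> k \<le> i" using mono[of k i] lex_le_antisym[of "\<mu> i" "\<mu> k"] by blast
    then show "i \<in> {..<k}" by simp
  qed
  then have "card {i. \<mu> i \<in> below (\<mu> k)} \<le> card {..<k}" by (intro card_mono) auto
  then show "rank (\<mu> k) \<le> k" using card(1)[OF finite_below] by (simp add: rank_def)
  have "{..k} \<subseteq> {i. \<mu> i \<in> insert (\<mu> k) (below (\<mu> k))}"
    using mono pos by (auto simp: below_def)
  then have "card {..k} \<le> card {i. \<mu> i \<in> insert (\<mu> k) (below (\<mu> k))}"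
    using card(2)[of "insert (\<mu> k) (below (\<mu> k))"] finite_below by (intro card_mono) auto
  also have "\<dots> = (\<Sum>w\<in>insert (\<mu> k) (below (\<mu> k)). m w)"
    using finite_below by (intro card) auto
  also have "\<dots> = rank (\<mu> k) + m (\<mu> k)" using finite_below by (simp add: rank_def below_def)
  finally show "k < rank (\<mu> k) + m (\<mu> k)" by simp
qed

lemma listing_unique:
  "\<exists>!\<mu>. (\<forall>k. lex_le (\<mu> k) (\<mu> (Suc k))) \<and> (\<forall>z. finite {k. \<mu> k = z} \<and> card {k. \<mu> k = z} = m z)"
proof (rule ex_ex1I[OF listing_exists])
  fix \<mu> \<nu>
  assume 1: "(\<forall>k. lex_le (\<mu> k) (\<mu> (Suc k))) \<and> (\<forall>z. finite {k. \<mu> k = z} \<and> card {k. \<mu> k = z} = m z)"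
    and 2: "(\<forall>k. lex_le (\<nu> k) (\<nu> (Suc k))) \<and> (\<forall>z. finite {k. \<nu> k = z} \<and> card {k. \<nu> k = z} = m z)"
  show "\<mu> = \<nu>"
  proof
    fix k
    show "\<mu> k = \<nu> k"
      using listing_rank[of \<mu> k] listing_rank[of \<nu> k] 1 2 by (intro slot_unique) auto
  qed
qed

end

section \<open>Counting eigenvalues between consecutive cut lines\<close>

definition split_threshold :: "real \<Rightarrow> real" where
  "split_threshold R = 16 * gap_const\<^sup>2 * (2 * R + 1) ^ 3"

text \<open>One threshold serves all potentials of a ball. This matters when the potential is
  changed in \<open>collapsed_neighbour\<close>.\<close>

lemma hill_splitting_intro:
  assumes "norm q \<le> R" "split_threshold R \<le> real M" "s \<in> {0, 1}"
  shows "hill_splitting q s M"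
proof -
  have "l2_norm (fourier_coeff q) \<le> R" using fourier_coeff_l2(2)[of q] assms(1) by simp
  then have "16 * gap_const\<^sup>2 * (2 * l2_norm (fourier_coeff q) + 1) ^ 3 \<le> split_threshold R"
    unfolding split_threshold_def by (intro mult_left_mono power_mono) auto
  then show ?thesis
    using assms fourier_coeff_l2(1) by (unfold_locales) auto
qed

lemma trig_parity: "trig 0 1 = 1" "trig 1 1 = -1"
  by (simp_all add: trig_at_1)

lemma algebraic_multiplicity_eq:
  "algebraic_multiplicity q z = l2_circle.dim (root_space (trig 0 1) q z) + l2_circle.dim (root_space (trig 1 1) q z)"
  by (simp add: algebraic_multiplicity_def trig_parity)

text \<open>An infinite dimension is 0 for \<open>dim\<close>; the common finite spanning set in the
  last conclusion makes dimensions comparable later.\<close>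

lemma eigenvalues_left:
  assumes q: "norm q \<le> R" "split_threshold R \<le> real M"
  defines "S \<equiv> {z. 0 < algebraic_multiplicity q z \<and> Re z \<le> cut_line M}"
  shows "finite S" "(\<Sum>z\<in>S. algebraic_multiplicity q z) = 2 * M + 1" "\<And>z. z \<in> S \<Longrightarrow> Re z < cut_line M"
    and "\<exists>B. finite B \<and> (\<forall>z s. s \<in> {0, 1} \<longrightarrow> Re z \<le> cut_line M \<longrightarrow> root_space (trig s 1) q z \<subseteq> l2_circle.span B)"
proof -
  interpret h0: hill_splitting q 0 M by (rule hill_splitting_intro[OF q]) simp
  interpret h1: hill_splitting q 1 M by (rule hill_splitting_intro[OF q]) simp
  obtain Z0 where Z0: "finite Z0" "\<And>z. z \<in> Z0 \<Longrightarrow> Re z < cut_line M"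
    "\<And>z. Re z \<le> cut_line M \<Longrightarrow> z \<notin> Z0 \<Longrightarrow> root_space (trig 0 1) q z = {0}"
    "(\<Sum>z\<in>Z0. l2_circle.dim (root_space (trig 0 1) q z)) = card (low_modes 0 M)"
    "\<And>z. Re z \<le> cut_line M \<Longrightarrow> root_space (trig 0 1) q z \<subseteq> l2_circle.span (h0.b ` low_modes 0 M)"
    by (rule h0.root_spaces_left) blast
  obtain Z1 where Z1: "finite Z1" "\<And>z. z \<in> Z1 \<Longrightarrow> Re z < cut_line M"
    "\<And>z. Re z \<le> cut_line M \<Longrightarrow> z \<notin> Z1 \<Longrightarrow> root_space (trig 1 1) q z = {0}"
    "(\<Sum>z\<in>Z1. l2_circle.dim (root_space (trig 1 1) q z)) = card (low_modes 1 M)"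
    "\<And>z. Re z \<le> cut_line M \<Longrightarrow> root_space (trig 1 1) q z \<subseteq> l2_circle.span (h1.b ` low_modes 1 M)"
    by (rule h1.root_spaces_left) blast
  have S_sub: "S \<subseteq> Z0 \<union> Z1"
  proof
    fix z assume z: "z \<in> S"
    show "z \<in> Z0 \<union> Z1"
    proof (rule ccontr)
      assume "z \<notin> Z0 \<union> Z1"
      then have "root_space (trig 0 1) q z = {0}" "root_space (trig 1 1) q z = {0}"
        using Z0(3) Z1(3) z unfolding S_def by blast+
      then have "algebraic_multiplicity q z = 0"
        by (simp only: algebraic_multiplicity_eq dim_zero)
      then show False using z by (simp add: S_def)
    qed
  qed
  show "finite S" by (rule finite_subset[OF S_sub]) (use Z0(1) Z1(1) in auto)
  show "\<And>z. z \<in> S \<Longrightarrow> Re z < cut_line M" using S_sub Z0(2) Z1(2) by blast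
  have "(\<Sum>z\<in>S. algebraic_multiplicity q z) = (\<Sum>z\<in>Z0 \<union> Z1. algebraic_multiplicity q z)"
    using S_sub Z0 Z1 by (intro sum.mono_neutral_left) (auto simp: S_def intro: less_imp_le)
  also have "\<dots> = (\<Sum>z\<in>Z0 \<union> Z1. l2_circle.dim (root_space (trig 0 1) q z))
      + (\<Sum>z\<in>Z0 \<union> Z1. l2_circle.dim (root_space (trig 1 1) q z))"
    by (simp add: algebraic_multiplicity_eq sum.distrib)
  also have "(\<Sum>z\<in>Z0 \<union> Z1. l2_circle.dim (root_space (trig 0 1) q z)) = (\<Sum>z\<in>Z0. l2_circle.dim (root_space (trig 0 1) q z))"
    using Z0(1,3) Z1(1,2) dim_zero by (intro sum.mono_neutral_right) (auto simp: less_imp_le)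
  also have "(\<Sum>z\<in>Z0 \<union> Z1. l2_circle.dim (root_space (trig 1 1) q z)) = (\<Sum>z\<in>Z1. l2_circle.dim (root_space (trig 1 1) q z))"
    using Z1(1,3) Z0(1,2) dim_zero by (intro sum.mono_neutral_right) (auto simp: less_imp_le)
  finally show "(\<Sum>z\<in>S. algebraic_multiplicity q z) = 2 * M + 1"
    using Z0(4) Z1(4) card_low_modes_sum[of M] by simp
  show "\<exists>B. finite B \<and> (\<forall>z s. s \<in> {0, 1} \<longrightarrow> Re z \<le> cut_line M \<longrightarrow> root_space (trig s 1) q z \<subseteq> l2_circle.span B)"
  proof (intro exI[of _ "h0.b ` low_modes 0 M \<union> h1.b ` low_modes 1 M"] conjI allI impI)
    show "finite (h0.b ` low_modes 0 M \<union> h1.b ` low_modes 1 M)" by (simp add: finite_low_modes)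
    fix z s assume "s \<in> {0, 1::int}" "Re z \<le> cut_line M"
    then show "root_space (trig s 1) q z \<subseteq> l2_circle.span (h0.b ` low_modes 0 M \<union> h1.b ` low_modes 1 M)"
      using Z0(5)[of z] Z1(5)[of z]
        l2_circle.span_mono[of "h0.b ` low_modes 0 M" "h0.b ` low_modes 0 M \<union> h1.b ` low_modes 1 M"]
        l2_circle.span_mono[of "h1.b ` low_modes 1 M" "h0.b ` low_modes 0 M \<union> h1.b ` low_modes 1 M"] by fastforce
  qed
qed

lemma cut_line_unbounded: "\<exists>M::nat. M0 \<le> M \<and> c \<le> cut_line M"
proof -
  obtain M :: nat where M: "max (real M0) (max c 1) \<le> real M" using real_arch_simple by blast
  have "real M * 1 \<le> real M * real M" using M by (intro mult_left_mono) auto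
  also have "\<dots> \<le> (real M + 1 / 2) * (real M + 1 / 2)" by (intro mult_mono) auto
  also have "\<dots> \<le> (pi * (real M + 1 / 2)) * (pi * (real M + 1 / 2))"
    using pi_gt3 by (intro mult_mono) auto
  finally have "real M \<le> cut_line M" by (simp add: cut_line_def power2_eq_square)
  then show ?thesis using M by (intro exI[of _ M]) auto
qed

lemma lex_multiplicity_hill: "lex_multiplicity (algebraic_multiplicity q)"
proof
  obtain M0 :: nat where M0: "split_threshold (norm q) \<le> real M0" using real_arch_simple by blast
  have thr: "split_threshold (norm q) \<le> real M" if "M0 \<le> M" for M using M0 that by linarith
  show "finite {z. 0 < algebraic_multiplicity q z \<and> Re z \<le> c}" for c
  proof -
    obtain M where "M0 \<le> M" "c \<le> cut_line M" using cut_line_unbounded by blast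
    then show ?thesis
      by (intro finite_subset[OF _ eigenvalues_left(1)[OF order_refl thr]]) auto
  qed
  show "\<exists>c. K \<le> (\<Sum>z\<in>{z. 0 < algebraic_multiplicity q z \<and> Re z \<le> c}. algebraic_multiplicity q z)" for K
    using eigenvalues_left(2)[OF order_refl thr, of "max M0 K"]
    by (intro exI[of _ "cut_line (max M0 K)"]) auto
qed

lemma eigenvalue_listing_periodic: "eigenvalue_listing q (periodic_eigenvalue q)"
proof -
  interpret lex_multiplicity "algebraic_multiplicity q" by (rule lex_multiplicity_hill)
  have "\<exists>!\<mu>. eigenvalue_listing q \<mu>"
    unfolding eigenvalue_listing_def by (rule listing_unique)
  then show ?thesis unfolding periodic_eigenvalue_def by (rule theI')
qed

text \<open>Real parts do not decrease along the listing, so the indices left of the line form an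
  initial segment, whose length is the count.\<close>

lemma eigenvalues_left_indices:
  assumes q: "norm q \<le> R" "split_threshold R \<le> real M"
  shows "Re (periodic_eigenvalue q k) \<le> cut_line M \<longleftrightarrow> k < 2 * M + 1"
    and "Re (periodic_eigenvalue q k) \<noteq> cut_line M"
proof -
  define \<mu> where "\<mu> = periodic_eigenvalue q"
  define S where "S = {z. 0 < algebraic_multiplicity q z \<and> Re z \<le> cut_line M}"
  note S = eigenvalues_left[OF q, folded S_def]
  have sorted: "\<And>k. lex_le (\<mu> k) (\<mu> (Suc k))"
    and mult: "\<And>z. finite {k. \<mu> k = z} \<and> card {k. \<mu> k = z} = algebraic_multiplicity q z"
    using eigenvalue_listing_periodic[of q] by (auto simp: eigenvalue_listing_def \<mu>_def)
  have mono: "Re (\<mu> i) \<le> Re (\<mu> j)" if "i \<le> j" for i j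
    using that
  proof (induction j rule: dec_induct)
    case (step n)
    then show ?case using sorted[of n] by (auto simp: lex_le_def)
  qed simp
  have pos: "0 < algebraic_multiplicity q (\<mu> i)" for i
    using mult[of "\<mu> i"] card_gt_0_iff[of "{k. \<mu> k = \<mu> i}"] by auto
  define I where "I = {k. Re (\<mu> k) \<le> cut_line M}"
  have I_eq: "I = (\<Union>z\<in>S. {k. \<mu> k = z})" using pos by (auto simp: I_def S_def)
  have finI: "finite I" unfolding I_eq using S(1) mult by auto
  have cardI: "card I = 2 * M + 1"
    unfolding I_eq using S(1,2) mult by (subst card_UN_disjoint) auto
  have init: "i \<in> I" if "j \<in> I" "i \<le> j" for i j using that mono[of i j] by (auto simp: I_def)
  have "k < 2 * M + 1" if "k \<in> I"
  proof -
    have "{..k} \<subseteq> I" using init that by auto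
    then show ?thesis using card_mono[OF finI, of "{..k}"] cardI by simp
  qed
  moreover have "k \<in> I" if "k < 2 * M + 1"
  proof (rule ccontr)
    assume "k \<notin> I"
    then have "I \<subseteq> {..<k}" using init by (meson lessThan_iff not_less subsetI)
    then show False using card_mono[of "{..<k}" I] cardI that by simp
  qed
  ultimately show "Re (periodic_eigenvalue q k) \<le> cut_line M \<longleftrightarrow> k < 2 * M + 1"
    by (auto simp: I_def \<mu>_def)
  show "Re (periodic_eigenvalue q k) \<noteq> cut_line M"
    using S(3)[of "\<mu> k"] pos[of k] by (auto simp: S_def \<mu>_def)
qed

text \<open>Stated for \<open>Suc n\<close>, because the lines \<open>n\<close> and
  \<open>Suc n\<close> enclose exactly the indices \<open>2 * n + 1\<close> and
  \<open>2 * n + 2\<close>.\<close>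

lemma lambda_in_strip:
  assumes q: "norm q \<le> R" "split_threshold R \<le> real n"
  shows "cut_line n < Re (lambda_minus (Suc n) q)" "Re (lambda_minus (Suc n) q) < cut_line (Suc n)"
    "cut_line n < Re (lambda_plus (Suc n) q)" "Re (lambda_plus (Suc n) q) < cut_line (Suc n)"
proof -
  have q': "split_threshold R \<le> real (Suc n)" using q(2) by simp
  show "cut_line n < Re (lambda_minus (Suc n) q)" "Re (lambda_minus (Suc n) q) < cut_line (Suc n)"
    "cut_line n < Re (lambda_plus (Suc n) q)" "Re (lambda_plus (Suc n) q) < cut_line (Suc n)"
    using eigenvalues_left_indices[OF q, of "2 * Suc n - 1"] eigenvalues_left_indices[OF q(1) q', of "2 * Suc n - 1"]
      eigenvalues_left_indices[OF q, of "2 * Suc n"] eigenvalues_left_indices[OF q(1) q', of "2 * Suc n"]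
    by (auto simp: lambda_minus_def lambda_plus_def)
qed

lemma multiplicity_in_strip:
  assumes q: "norm q \<le> R" "split_threshold R \<le> real n"
    and z: "cut_line n < Re z" "Re z \<le> cut_line (Suc n)"
  shows "algebraic_multiplicity q z = card {k \<in> {2 * Suc n - 1, 2 * Suc n}. periodic_eigenvalue q k = z}"
proof -
  have q': "split_threshold R \<le> real (Suc n)" using q(2) by simp
  have "{k. periodic_eigenvalue q k = z} = {k \<in> {2 * Suc n - 1, 2 * Suc n}. periodic_eigenvalue q k = z}"
  proof -
    have "k \<in> {2 * Suc n - 1, 2 * Suc n}" if k: "periodic_eigenvalue q k = z" for k
    proof -
      have "\<not> k < 2 * n + 1" "k < 2 * Suc n + 1"
        using eigenvalues_left_indices(1)[OF q, of k] eigenvalues_left_indices(1)[OF q(1) q', of k] z k by auto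
      then show ?thesis by auto
    qed
    then show ?thesis by blast
  qed
  moreover have "card {k. periodic_eigenvalue q k = z} = algebraic_multiplicity q z"
    using eigenvalue_listing_periodic[of q] by (simp add: eigenvalue_listing_def)
  ultimately show ?thesis by metis
qed

lemma lambda_multiplicity:
  assumes q: "norm q \<le> R" "split_threshold R \<le> real n"
  shows "0 < algebraic_multiplicity q (lambda_minus (Suc n) q)" "0 < algebraic_multiplicity q (lambda_plus (Suc n) q)"
    and "lambda_minus (Suc n) q = lambda_plus (Suc n) q \<Longrightarrow> algebraic_multiplicity q (lambda_plus (Suc n) q) = 2"
    and "\<lbrakk>cut_line n < Re z; Re z \<le> cut_line (Suc n); 2 \<le> algebraic_multiplicity q z\<rbrakk>
      \<Longrightarrow> lambda_minus (Suc n) q = z \<and> lambda_plus (Suc n) q = z \<and> algebraic_multiplicity q z = 2"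
proof -
  show "0 < algebraic_multiplicity q (lambda_minus (Suc n) q)" "0 < algebraic_multiplicity q (lambda_plus (Suc n) q)"
    using lambda_in_strip[OF q] multiplicity_in_strip[OF q]
    by (auto simp: card_gt_0_iff lambda_minus_def lambda_plus_def less_imp_le)
  show "algebraic_multiplicity q (lambda_plus (Suc n) q) = 2" if "lambda_minus (Suc n) q = lambda_plus (Suc n) q"
  proof -
    have "{k \<in> {2 * Suc n - 1, 2 * Suc n}. periodic_eigenvalue q k = lambda_plus (Suc n) q} = {2 * Suc n - 1, 2 * Suc n}"
      using that by (auto simp: lambda_minus_def lambda_plus_def)
    then show ?thesis
      using lambda_in_strip[OF q] multiplicity_in_strip[OF q, of "lambda_plus (Suc n) q"] by simp
  qed
  show "lambda_minus (Suc n) q = z \<and> lambda_plus (Suc n) q = z \<and> algebraic_multiplicity q z = 2"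
    if z: "cut_line n < Re z" "Re z \<le> cut_line (Suc n)" "2 \<le> algebraic_multiplicity q z"
  proof -
    define K where "K = {k \<in> {2 * Suc n - 1, 2 * Suc n}. periodic_eigenvalue q k = z}"
    have K: "2 \<le> card K" "card K = algebraic_multiplicity q z"
      using z multiplicity_in_strip[OF q z(1,2)] by (auto simp: K_def)
    have sub: "K \<subseteq> {2 * Suc n - 1, 2 * Suc n}" by (auto simp: K_def)
    have c2: "card {2 * Suc n - 1, 2 * Suc n} = 2" by simp
    have "K = {2 * Suc n - 1, 2 * Suc n}"
      using card_seteq[OF _ sub] K(1) c2 by simp
    then show ?thesis using K c2 unfolding K_def lambda_minus_def lambda_plus_def by auto
  qed
qed

section \<open>Reduction to two modes\<close>

definition strip :: "nat \<Rightarrow> complex set" where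
  "strip n = {z. (pi * (real n - 1 / 2))\<^sup>2 \<le> Re z \<and> Re z \<le> (pi * (real n + 1 / 2))\<^sup>2}"

text \<open>The resolvent of the diagonal with the two resonant modes \<open>n\<close> and
  \<open>- n\<close> removed. The sign is chosen so that the remaining rows of the eigenvalue
  equation read \<open>f = res * conv a f\<close>.\<close>

definition res :: "int \<Rightarrow> nat \<Rightarrow> complex \<Rightarrow> int \<Rightarrow> complex" where
  "res s n \<mu> j = (if \<bar>2 * j + s\<bar> = int n then 0 else 1 / (\<mu> - of_real (lap s j)))"

text \<open>In the strip the real part of \<open>\<mu>\<close> is within
  \<open>pi\<^sup>2 * (n + 1 / 4)\<close> of the resonant value, while the other modes are at
  distance \<open>pi\<^sup>2 * g\<close> from it, with \<open>g \<ge> 2 * n - 1\<close>. For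
  \<open>n \<ge> 2\<close> a quarter of \<open>g\<close> survives the subtraction, and
  \<open>9 / 4 \<ge> 2\<close> gives the constant 2.\<close>

lemma res_gap:
  assumes n: "2 \<le> n" and \<mu>: "\<mu> \<in> strip n" and j: "\<bar>2 * j + s\<bar> \<noteq> int n"
  defines "x \<equiv> \<bar>real_of_int (2 * j + s)\<bar>"
  shows "2 * real n * \<bar>x - real n\<bar> \<le> cmod (\<mu> - of_real (lap s j))" and "1 \<le> \<bar>x - real n\<bar>"
    and "(x - real n)\<^sup>2 \<le> cmod (\<mu> - of_real (lap s j))"
proof -
  have x0: "0 \<le> x" by (simp add: x_def)
  have "1 \<le> \<bar>\<bar>2 * j + s\<bar> - int n\<bar>" using j by linarith
  from iffD2[OF of_int_le_iff[where 'a = real] this] show gap1: "1 \<le> \<bar>x - real n\<bar>"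
    by (simp add: x_def)
  define g where "g = \<bar>x\<^sup>2 - (real n)\<^sup>2\<bar>"
  have g_eq: "g = \<bar>x - real n\<bar> * (x + real n)"
  proof -
    have "x\<^sup>2 - (real n)\<^sup>2 = (x - real n) * (x + real n)" by (simp add: power2_eq_square algebra_simps)
    then show ?thesis using x0 by (simp add: g_def abs_mult)
  qed
  have "1 * (x + real n) \<le> g" unfolding g_eq using gap1 x0 by (intro mult_right_mono) auto
  have g_ge: "2 * real n - 1 \<le> g"
  proof (cases "real n \<le> x")
    case True
    then show ?thesis using \<open>1 * (x + real n) \<le> g\<close> by simp
  next
    case False
    then have x1: "x \<le> real n - 1" using gap1 by auto
    have "(real n - x) * (x + real n) = (real n)\<^sup>2 - x\<^sup>2" by (simp add: power2_eq_square algebra_simps)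
    moreover have "x\<^sup>2 \<le> (real n - 1)\<^sup>2" using x1 x0 by (intro power_mono)
    moreover have "(real n - 1)\<^sup>2 = (real n)\<^sup>2 - 2 * real n + 1" by (simp add: power2_eq_square algebra_simps)
    ultimately show ?thesis using False by (simp add: g_eq)
  qed
  have pi9: "9 \<le> pi\<^sup>2" using power_mono[of 3 pi 2] pi_gt3 by simp
  have "\<bar>Re \<mu> - pi\<^sup>2 * (real n)\<^sup>2\<bar> \<le> pi\<^sup>2 * (real n + 1 / 4)"
  proof -
    have "(pi * (real n - 1 / 2))\<^sup>2 = pi\<^sup>2 * (real n)\<^sup>2 - pi\<^sup>2 * real n + pi\<^sup>2 / 4"
      "(pi * (real n + 1 / 2))\<^sup>2 = pi\<^sup>2 * (real n)\<^sup>2 + pi\<^sup>2 * real n + pi\<^sup>2 / 4"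
      "pi\<^sup>2 * (real n + 1 / 4) = pi\<^sup>2 * real n + pi\<^sup>2 / 4"
      by (simp_all add: power2_eq_square algebra_simps)
    then show ?thesis using \<mu> pi9 by (auto simp: strip_def abs_le_iff)
  qed
  moreover have "pi\<^sup>2 * g = \<bar>pi\<^sup>2 * x\<^sup>2 - pi\<^sup>2 * (real n)\<^sup>2\<bar>"
    unfolding g_def by (simp add: abs_mult right_diff_distrib[symmetric])
  ultimately have "pi\<^sup>2 * g - pi\<^sup>2 * (real n + 1 / 4) \<le> \<bar>Re \<mu> - pi\<^sup>2 * x\<^sup>2\<bar>"
    by linarith
  also have "\<dots> = \<bar>Re (\<mu> - of_real (lap s j))\<bar>" by (simp add: lap_eq x_def)
  also have "\<dots> \<le> cmod (\<mu> - of_real (lap s j))" by (rule abs_Re_le_cmod)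
  finally have 1: "pi\<^sup>2 * (g - (real n + 1 / 4)) \<le> cmod (\<mu> - of_real (lap s j))"
    by (simp add: right_diff_distrib)
  have "9 * (g / 4) \<le> pi\<^sup>2 * (g - (real n + 1 / 4))"
  proof (rule mult_mono[OF pi9])
    have "2 \<le> real n" using n by simp
    then show "g / 4 \<le> g - (real n + 1 / 4)" using g_ge by (simp add: field_simps)
    show "0 \<le> g / 4" by (simp add: g_def)
  qed simp
  then have 2: "2 * g \<le> cmod (\<mu> - of_real (lap s j))" using 1 g_ge n by linarith
  have "\<bar>x - real n\<bar> * real n \<le> g"
    unfolding g_eq using x0 by (intro mult_left_mono) auto
  then show "2 * real n * \<bar>x - real n\<bar> \<le> cmod (\<mu> - of_real (lap s j))"
    using 2 by (simp add: mult_ac)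
  have "\<bar>x - real n\<bar> * \<bar>x - real n\<bar> \<le> g"
    unfolding g_eq using x0 by (intro mult_left_mono) auto
  then show "(x - real n)\<^sup>2 \<le> cmod (\<mu> - of_real (lap s j))"
    using 2 g_ge n by (simp add: power2_eq_square)
qed

text \<open>Multiplication by \<open>res\<close> takes bounded to square summable sequences with a
  factor \<open>1 / n\<close>, and \<open>conv\<close> takes them back to bounded ones: the loop in
  which the reduced equation is solved.\<close>

lemma res_mult_l2:
  assumes n: "2 \<le> n" and \<mu>: "\<mu> \<in> strip n" and y: "\<And>j. cmod (y j) \<le> C"
  shows "l2_seq (\<lambda>j. res s n \<mu> j * y j)" "l2_norm (\<lambda>j. res s n \<mu> j * y j) \<le> C * (gap_const / real n)"
    and "(\<lambda>j. cmod (res s n \<mu> j * y j)) summable_on UNIV"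
proof -
  have C: "0 \<le> C" using y[of 0] norm_ge_zero order_trans by blast
  have *: "1 / 2 \<le> \<bar>\<bar>real_of_int (2 * j + s)\<bar> - real n\<bar>
    \<and> norm (res s n \<mu> j * y j) * \<bar>\<bar>real_of_int (2 * j + s)\<bar> - real n\<bar> \<le> C / real n
    \<and> norm (res s n \<mu> j * y j) * (\<bar>real_of_int (2 * j + s)\<bar> - real n)\<^sup>2 \<le> C"
    if "res s n \<mu> j * y j \<noteq> 0" for j
  proof -
    have j: "\<bar>2 * j + s\<bar> \<noteq> int n" using that by (auto simp: res_def)
    define g where "g = \<bar>\<bar>real_of_int (2 * j + s)\<bar> - real n\<bar>"
    define D where "D = cmod (\<mu> - of_real (lap s j))"
    have g: "2 * real n * g \<le> D" "1 \<le> g" "g\<^sup>2 \<le> D"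
      using res_gap[OF n \<mu> j] by (auto simp: g_def D_def)
    have D: "0 < D" using g by (meson less_le_trans one_le_power zero_less_one order_trans)
    have nr: "norm (res s n \<mu> j * y j) \<le> C / D"
      using j y[of j] D by (simp add: res_def norm_mult norm_divide D_def[symmetric] divide_right_mono)
    have "norm (res s n \<mu> j * y j) * g \<le> C / D * g"
      using nr g by (intro mult_right_mono) auto
    also have "\<dots> = C * (g / D)" by simp
    also have "\<dots> \<le> C * (1 / real n)"
    proof (rule mult_left_mono[OF _ C])
      have "0 \<le> real n * g" using g(2) by simp
      then have "g * real n \<le> 1 * D" using g(1) by (simp only: mult.commute[of g] mult_1 mult.assoc)
      then show "g / D \<le> 1 / real n" using D n by (simp add: field_simps)
    qed
    finally have 1: "norm (res s n \<mu> j * y j) * g \<le> C / real n" by simp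
    have "norm (res s n \<mu> j * y j) * g\<^sup>2 \<le> C / D * D"
      using nr g C D by (intro mult_mono) auto
    then have "norm (res s n \<mu> j * y j) * g\<^sup>2 \<le> C" using D by simp
    then show ?thesis using 1 g(2) by (simp add: g_def)
  qed
  show "l2_seq (\<lambda>j. res s n \<mu> j * y j)" "l2_norm (\<lambda>j. res s n \<mu> j * y j) \<le> C * (gap_const / real n)"
    using gap_l2[of "C / real n" "\<lambda>j. res s n \<mu> j * y j" s "real n"] * C by auto
  show "(\<lambda>j. cmod (res s n \<mu> j * y j)) summable_on UNIV"
    using * C by (intro gap_l1[of C "\<lambda>j. res s n \<mu> j * y j" s "real n"]) auto
qed

lemma norm_res_le_1:
  assumes "2 \<le> n" "\<mu> \<in> strip n"
  shows "cmod (res s n \<mu> j) \<le> 1"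
proof (cases "\<bar>2 * j + s\<bar> = int n")
  case False
  have "1\<^sup>2 \<le> (\<bar>real_of_int (2 * j + s)\<bar> - real n)\<^sup>2"
    using res_gap(2)[OF assms False] by (metis abs_le_square_iff abs_one)
  then have "1 \<le> cmod (\<mu> - of_real (lap s j))" using res_gap(3)[OF assms False] by simp
  then show ?thesis using False by (simp add: res_def norm_divide divide_le_eq)
qed (simp add: res_def)

lemma res_diff:
  assumes "2 \<le> n" "\<mu> \<in> strip n" "\<mu>' \<in> strip n"
  shows "res s n \<mu> j - res s n \<mu>' j = (\<mu>' - \<mu>) * (res s n \<mu> j * res s n \<mu>' j)"
proof (cases "\<bar>2 * j + s\<bar> = int n")
  case False
  have "0 < (\<bar>real_of_int (2 * j + s)\<bar> - real n)\<^sup>2"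
    using res_gap(2)[OF assms(1,2) False] by (auto simp: power2_eq_square zero_less_mult_iff)
  then have "\<mu> - of_real (lap s j) \<noteq> 0" "\<mu>' - of_real (lap s j) \<noteq> 0"
    using res_gap(3)[OF assms(1,2) False] res_gap(3)[OF assms(1,3) False] by auto
  then show ?thesis using False by (simp add: res_def field_simps)
qed (simp add: res_def)

text \<open>Each pass through the equation halves the bound for \<open>w\<close>.\<close>

lemma res_homogeneous_zero:
  assumes n: "2 \<le> n" and \<mu>: "\<mu> \<in> strip n" and a: "l2_seq a" "l2_norm a * (gap_const / real n) \<le> 1 / 2"
    and w: "\<And>j. cmod (w j) \<le> C" and eq: "\<And>j. w j = conv a (\<lambda>k. res s n \<mu> k * w k) j"
  shows "w j = 0"
proof -
  have C: "0 \<le> C" using w[of 0] norm_ge_zero order_trans by blast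
  have le: "cmod (w j) \<le> C / 2 ^ i" for i j
  proof (induction i arbitrary: j)
    case (Suc i)
    have "cmod (w j) \<le> l2_norm a * l2_norm (\<lambda>k. res s n \<mu> k * w k)"
      by (subst eq) (rule norm_conv_le[OF a(1) res_mult_l2(1)[where y = w, OF n \<mu> Suc]])
    also have "\<dots> \<le> l2_norm a * (C / 2 ^ i * (gap_const / real n))"
      by (intro mult_left_mono res_mult_l2(2)[where y = w, OF n \<mu> Suc]) simp
    also have "\<dots> = C / 2 ^ i * (l2_norm a * (gap_const / real n))" by simp
    also have "\<dots> \<le> C / 2 ^ i * (1 / 2)" using a(2) C by (intro mult_left_mono) auto
    finally show ?case by simp
  qed (use w in simp)
  have "cmod (w j) \<le> 0"
  proof (rule LIMSEQ_le_const)
    show "(\<lambda>i. C / 2 ^ i) \<longlonglongrightarrow> 0" by (intro LIMSEQ_divide_realpow_zero) auto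
  qed (use le in auto)
  then show ?thesis by simp
qed

lemma res_solution_exists:
  assumes n: "2 \<le> n" and \<mu>: "\<mu> \<in> strip n" and a: "l2_seq a" "l2_norm a * (gap_const / real n) \<le> 1 / 2"
  obtains y where "\<And>j. cmod (y j) \<le> 2 * l2_norm a" "\<And>j. y j = a (j - i) + conv a (\<lambda>k. res s n \<mu> k * y k) j"
proof -
  define r where "r = l2_norm a"
  define \<Phi> where "\<Phi> y j = a (j - i) + conv a (\<lambda>k. res s n \<mu> k * y k) j" for y j
  have conv_le: "cmod (conv a (\<lambda>k. res s n \<mu> k * y k) j) \<le> e / 2" if "\<And>j. cmod (y j) \<le> e" for y e j
  proof -
    have e: "0 \<le> e" using that[of 0] norm_ge_zero order_trans by blast
    have "cmod (conv a (\<lambda>k. res s n \<mu> k * y k) j) \<le> r * (e * (gap_const / real n))"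
      using norm_conv_le[OF a(1) res_mult_l2(1)[where y = y, OF n \<mu> that]]
        mult_left_mono[OF res_mult_l2(2)[where y = y, OF n \<mu> that], of r] unfolding r_def by (meson l2_norm_nonneg order_trans)
    also have "\<dots> = e * (r * (gap_const / real n))" by simp
    also have "\<dots> \<le> e * (1 / 2)" using a(2) e by (intro mult_left_mono) (auto simp: r_def)
    finally show ?thesis by simp
  qed
  show thesis
  proof (rule sup_norm_fixpoint[of "2 * r" \<Phi>])
    show "0 \<le> 2 * r" by (simp add: r_def)
  next
    fix f :: "int \<Rightarrow> complex" and j assume f: "\<And>i. cmod (f i) \<le> 2 * r"
    have "cmod (\<Phi> f j) \<le> cmod (a (j - i)) + cmod (conv a (\<lambda>k. res s n \<mu> k * f k) j)"
      unfolding \<Phi>_def by (rule norm_triangle_ineq)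
    also have "\<dots> \<le> r + (2 * r) / 2"
      unfolding r_def by (intro add_mono norm_le_l2_norm a(1) conv_le) (use f in \<open>simp add: r_def\<close>)
    finally show "cmod (\<Phi> f j) \<le> 2 * r" by simp
  next
    fix f g :: "int \<Rightarrow> complex" and e j
    assume f: "\<And>i. cmod (f i) \<le> 2 * r" and g: "\<And>i. cmod (g i) \<le> 2 * r" and fg: "\<And>i. cmod (f i - g i) \<le> e"
    have "conv a (\<lambda>k. res s n \<mu> k * (f k - g k)) j
        = conv a (\<lambda>k. res s n \<mu> k * f k) j - conv a (\<lambda>k. res s n \<mu> k * g k) j"
      unfolding right_diff_distrib by (intro conv_diff a(1) res_mult_l2(1)[where y = f, OF n \<mu> f] res_mult_l2(1)[where y = g, OF n \<mu> g])
    then have "\<Phi> f j - \<Phi> g j = conv a (\<lambda>k. res s n \<mu> k * (f k - g k)) j"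
      by (simp add: \<Phi>_def)
    then show "cmod (\<Phi> f j - \<Phi> g j) \<le> e / 2"
      using conv_le[of "\<lambda>k. f k - g k" e] fg by simp
  next
    fix f assume f: "\<And>i. cmod (f i) \<le> 2 * r" "\<And>i. \<Phi> f i = f i"
    show thesis
    proof (rule that)
      show "cmod (f j) \<le> 2 * l2_norm a" for j using f(1) by (simp add: r_def)
      show "f j = a (j - i) + conv a (\<lambda>k. res s n \<mu> k * f k) j" for j
        by (rule f(2)[unfolded \<Phi>_def, symmetric])
    qed
  qed
qed

text \<open>The value of \<open>conv a\<close> on the vector with entry 1 at \<open>i\<close> and
  the entries \<open>res * y\<close> added (see \<open>conv_mode\<close>). At resonant
  \<open>i\<close> and \<open>j\<close> these are the entries of the Schur complement left by
  eliminating all other modes.\<close>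

definition ysol :: "int \<Rightarrow> nat \<Rightarrow> (int \<Rightarrow> complex) \<Rightarrow> complex \<Rightarrow> int \<Rightarrow> int \<Rightarrow> complex" where
  "ysol s n a \<mu> i = (SOME y. (\<forall>j. cmod (y j) \<le> 2 * l2_norm a)
     \<and> (\<forall>j. y j = a (j - i) + conv a (\<lambda>k. res s n \<mu> k * y k) j))"

lemma ysol:
  assumes "2 \<le> n" "\<mu> \<in> strip n" "l2_seq a" "l2_norm a * (gap_const / real n) \<le> 1 / 2"
  shows "cmod (ysol s n a \<mu> i j) \<le> 2 * l2_norm a"
    and "ysol s n a \<mu> i j = a (j - i) + conv a (\<lambda>k. res s n \<mu> k * ysol s n a \<mu> i k) j"
proof -
  have "\<exists>y. (\<forall>j. cmod (y j) \<le> 2 * l2_norm a) \<and> (\<forall>j. y j = a (j - i) + conv a (\<lambda>k. res s n \<mu> k * y k) j)"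
    using res_solution_exists[OF assms, of i s] by metis
  then have *: "(\<forall>j. cmod (ysol s n a \<mu> i j) \<le> 2 * l2_norm a)
     \<and> (\<forall>j. ysol s n a \<mu> i j = a (j - i) + conv a (\<lambda>k. res s n \<mu> k * ysol s n a \<mu> i k) j)"
    unfolding ysol_def by (rule someI_ex)
  then show "cmod (ysol s n a \<mu> i j) \<le> 2 * l2_norm a" by blast
  show "ysol s n a \<mu> i j = a (j - i) + conv a (\<lambda>k. res s n \<mu> k * ysol s n a \<mu> i k) j"
    using * by blast
qed

text \<open>To leading order \<open>ysol\<close> depends on \<open>a\<close> through the single
  coefficient \<open>a (j - i)\<close> and not on \<open>\<mu>\<close>. The remainder splits into
  the effects of changing \<open>a\<close>, \<open>\<mu>\<close> and \<open>y\<close>, each with a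
  factor \<open>1 / n\<close>; the last is absorbed by means of the supremum \<open>E\<close>. The
  assumption \<open>small\<close> bounds both \<open>R * \<kappa>\<close> and
  \<open>R\<^sup>2 * \<kappa>\<close> by \<open>e / 8\<close>.\<close>

lemma ysol_lipschitz:
  assumes n: "2 \<le> n" and \<mu>: "\<mu> \<in> strip n" "\<mu>' \<in> strip n"
    and a: "l2_seq a" "l2_norm a \<le> R" and b: "l2_seq b" "l2_norm b \<le> R"
    and small: "8 * (R + 1)\<^sup>2 * (gap_const / real n) \<le> e" "e \<le> 1"
  shows "cmod (ysol s n a \<mu> i j - ysol s n b \<mu>' i j - (a (j - i) - b (j - i)))
    \<le> e * (l2_norm (\<lambda>k. a k - b k) + cmod (\<mu> - \<mu>'))"
proof -
  define \<kappa> where "\<kappa> = gap_const / real n"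
  define \<Delta> where "\<Delta> = l2_norm (\<lambda>k. a k - b k) + cmod (\<mu> - \<mu>')"
  have R0: "0 \<le> R" using a(2) l2_norm_nonneg order_trans by blast
  have \<kappa>0: "0 \<le> \<kappa>" using gap_const_ge_1 by (simp add: \<kappa>_def)
  have "R \<le> (R + 1)\<^sup>2" "R\<^sup>2 \<le> (R + 1)\<^sup>2" "2 * R \<le> (R + 1)\<^sup>2"
    using R0 by (auto simp: power2_eq_square algebra_simps)
  then have R\<kappa>: "8 * (R * \<kappa>) \<le> e" "8 * (R\<^sup>2 * \<kappa>) \<le> e" and R\<kappa>3: "8 * ((R + 1)\<^sup>2 * \<kappa>) \<le> e"
    using small(1) mult_right_mono[OF _ \<kappa>0, of R "(R + 1)\<^sup>2"] mult_right_mono[OF _ \<kappa>0, of "R\<^sup>2" "(R + 1)\<^sup>2"]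
    by (simp_all add: \<kappa>_def[symmetric] mult.assoc)
  have half: "l2_norm c * (gap_const / real n) \<le> 1 / 2" if "l2_norm c \<le> R" for c :: "int \<Rightarrow> complex"
    using mult_right_mono[OF that \<kappa>0] R\<kappa> small(2) by (simp add: \<kappa>_def[symmetric])
  define y where "y = ysol s n a \<mu> i"
  define y' where "y' = ysol s n b \<mu>' i"
  note Y = ysol[OF n \<mu>(1) a(1) half[OF a(2)], of s i, folded y_def]
  note Y' = ysol[OF n \<mu>(2) b(1) half[OF b(2)], of s i, folded y'_def]
  have y_bd: "cmod (y j) \<le> 2 * R" for j using Y(1)[of j] a(2) by linarith
  have y'_bd: "cmod (y' j) \<le> 2 * R" for j using Y'(1)[of j] b(2) by linarith
  have ab_l2: "l2_seq (\<lambda>k. a k - b k)" by (intro l2_diff a b)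
  define rem where "rem j = y j - y' j - (a (j - i) - b (j - i))" for j
  have rem_eq: "rem j = conv (\<lambda>k. a k - b k) (\<lambda>k. res s n \<mu> k * y k) j
      + (\<mu>' - \<mu>) * conv b (\<lambda>k. res s n \<mu>' k * (res s n \<mu> k * y k)) j
      + conv b (\<lambda>k. res s n \<mu>' k * (y k - y' k)) j" for j
  proof -
    note l1 = res_mult_l2(1)[where y = y and s = s, OF n \<mu>(1) y_bd] and l2 = res_mult_l2(1)[where y = y and s = s, OF n \<mu>(2) y_bd]
      and l3 = res_mult_l2(1)[where y = y' and s = s, OF n \<mu>(2) y'_bd]
    have "conv b (\<lambda>k. (\<mu>' - \<mu>) * (res s n \<mu>' k * (res s n \<mu> k * y k))) j
        = conv b (\<lambda>k. res s n \<mu> k * y k - res s n \<mu>' k * y k) j"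
    proof -
      have "(\<mu>' - \<mu>) * (res s n \<mu>' k * (res s n \<mu> k * y k)) = res s n \<mu> k * y k - res s n \<mu>' k * y k" for k
        unfolding left_diff_distrib[symmetric] res_diff[OF n \<mu>] by (simp add: mult_ac)
      then show ?thesis by simp
    qed
    also have "\<dots> = conv b (\<lambda>k. res s n \<mu> k * y k) j - conv b (\<lambda>k. res s n \<mu>' k * y k) j"
      by (rule conv_diff[OF b(1) l1 l2])
    finally have "(\<mu>' - \<mu>) * conv b (\<lambda>k. res s n \<mu>' k * (res s n \<mu> k * y k)) j
        = conv b (\<lambda>k. res s n \<mu> k * y k) j - conv b (\<lambda>k. res s n \<mu>' k * y k) j"
      by (simp add: conv_cmult)
    moreover have "conv b (\<lambda>k. res s n \<mu>' k * (y k - y' k)) j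
        = conv b (\<lambda>k. res s n \<mu>' k * y k) j - conv b (\<lambda>k. res s n \<mu>' k * y' k) j"
      unfolding right_diff_distrib by (rule conv_diff[OF b(1) l2 l3])
    moreover have "conv (\<lambda>k. a k - b k) (\<lambda>k. res s n \<mu> k * y k) j
        = conv a (\<lambda>k. res s n \<mu> k * y k) j - conv b (\<lambda>k. res s n \<mu> k * y k) j"
      by (rule conv_diff_left[OF a(1) b(1) l1])
    ultimately show ?thesis using Y(2)[of j] Y'(2)[of j] by (simp add: rem_def)
  qed
  have T1: "cmod (conv (\<lambda>k. a k - b k) (\<lambda>k. res s n \<mu> k * y k) j) \<le> l2_norm (\<lambda>k. a k - b k) * (2 * R * \<kappa>)" for j
    using norm_conv_le[OF ab_l2 res_mult_l2(1)[where y = y and s = s, OF n \<mu>(1) y_bd], of j]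
      mult_left_mono[OF res_mult_l2(2)[where y = y and s = s, OF n \<mu>(1) y_bd], of "l2_norm (\<lambda>k. a k - b k)"]
    by (simp add: \<kappa>_def)
  have conv_b: "cmod (conv b (\<lambda>k. res s n \<mu>' k * v k) j) \<le> R * (E * \<kappa>)" if v: "\<And>k. cmod (v k) \<le> E" for v E j
  proof -
    have "0 \<le> E" using v[of 0] norm_ge_zero order_trans by blast
    have "cmod (conv b (\<lambda>k. res s n \<mu>' k * v k) j) \<le> l2_norm b * l2_norm (\<lambda>k. res s n \<mu>' k * v k)"
      by (rule norm_conv_le[OF b(1) res_mult_l2(1)[where y = v and s = s, OF n \<mu>(2) v]])
    also have "\<dots> \<le> R * (E * \<kappa>)"
      using res_mult_l2(2)[where y = v and s = s, OF n \<mu>(2) v] b(2) R0 unfolding \<kappa>_def by (intro mult_mono) auto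
    finally show ?thesis .
  qed
  have T2: "cmod ((\<mu>' - \<mu>) * conv b (\<lambda>k. res s n \<mu>' k * (res s n \<mu> k * y k)) j) \<le> cmod (\<mu> - \<mu>') * (R * (2 * R * \<kappa>))" for j
  proof -
    have ry: "cmod (res s n \<mu> k * y k) \<le> 2 * R" for k
      using mult_mono[OF norm_res_le_1[OF n \<mu>(1), of s k] y_bd[of k]] by (simp add: norm_mult)
    then show ?thesis
      unfolding norm_mult norm_minus_commute[of \<mu>' \<mu>] by (intro mult_left_mono conv_b ry) simp
  qed
  define E where "E = (SUP k. cmod (y k - y' k))"
  have bdd: "bdd_above (range (\<lambda>k. cmod (y k - y' k)))"
    by (rule bdd_aboveI[of _ "2 * R + 2 * R"])
      (use y_bd y'_bd norm_triangle_ineq4 in \<open>fastforce intro: order_trans[OF norm_triangle_ineq4] add_mono\<close>)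
  have E: "cmod (y k - y' k) \<le> E" for k unfolding E_def by (rule cSUP_upper[OF _ bdd]) simp
  have E0: "0 \<le> E" using E[of 0] norm_ge_zero order_trans by blast
  have rem_le: "cmod (rem j) \<le> 2 * (R * \<kappa>) * \<Delta> + 2 * (R\<^sup>2 * \<kappa>) * \<Delta> + R * \<kappa> * E" for j
  proof -
    have "cmod (rem j) \<le> l2_norm (\<lambda>k. a k - b k) * (2 * R * \<kappa>) + cmod (\<mu> - \<mu>') * (R * (2 * R * \<kappa>)) + R * (E * \<kappa>)"
      unfolding rem_eq by (intro order_trans[OF norm_triangle_ineq] add_mono T1 T2 conv_b E)
    also have "\<dots> \<le> \<Delta> * (2 * R * \<kappa>) + \<Delta> * (R * (2 * R * \<kappa>)) + R * (E * \<kappa>)"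
      using R0 \<kappa>0 by (intro add_mono mult_right_mono order_refl) (auto simp: \<Delta>_def)
    finally show ?thesis by (simp add: power2_eq_square mult_ac)
  qed
  have \<Delta>0: "0 \<le> \<Delta>" by (simp add: \<Delta>_def)
  have coef: "2 * (R * \<kappa>) * \<Delta> + 2 * (R\<^sup>2 * \<kappa>) * \<Delta> \<le> (e / 2) * \<Delta>"
    using mult_right_mono[OF R\<kappa>(1) \<Delta>0] mult_right_mono[OF R\<kappa>(2) \<Delta>0] by (simp add: algebra_simps)
  have E_le: "E \<le> \<Delta> + (e / 2) * \<Delta> + R * \<kappa> * E"
    unfolding E_def[of]
  proof (rule cSUP_least)
    fix k
    have "y k - y' k = (a (k - i) - b (k - i)) + rem k" by (simp add: rem_def)
    then have "cmod (y k - y' k) \<le> cmod (a (k - i) - b (k - i)) + cmod (rem k)"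
      by (metis norm_triangle_ineq)
    also have "cmod (a (k - i) - b (k - i)) \<le> \<Delta>"
      using norm_le_l2_norm[OF ab_l2, of "k - i"] by (simp add: \<Delta>_def add_increasing2)
    finally show "cmod (y k - y' k) \<le> \<Delta> + (e / 2) * \<Delta> + R * \<kappa> * (SUP k. cmod (y k - y' k))"
      using rem_le[of k] coef unfolding E_def by linarith
  qed simp
  have "R * \<kappa> * E \<le> (1 / 8) * E" using R\<kappa>(1) small(2) by (intro mult_right_mono E0) linarith
  moreover have "(e / 2) * \<Delta> \<le> (1 / 2) * \<Delta>" using small(2) by (intro mult_right_mono \<Delta>0) linarith
  ultimately have "E \<le> 2 * \<Delta>" using E_le \<Delta>0 by linarith
  moreover have e0: "0 \<le> e" using R\<kappa>(1) mult_nonneg_nonneg[OF R0 \<kappa>0] by linarith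
  ultimately have "R * \<kappa> * E \<le> (e / 8) * (2 * \<Delta>)"
    using R\<kappa>(1) R0 \<kappa>0 E0 by (intro mult_mono) auto
  moreover have "(e / 8) * (2 * \<Delta>) = (e / 4) * \<Delta>" by simp
  ultimately have "cmod (rem j) \<le> (e / 2) * \<Delta> + (e / 4) * \<Delta>" using rem_le[of j] coef by linarith
  also have "\<dots> \<le> e * \<Delta>"
    using mult_nonneg_nonneg[OF e0 \<Delta>0] by linarith
  finally show ?thesis by (simp add: rem_def y_def y'_def \<Delta>_def)
qed

section \<open>The two resonant indices and weighted estimates for the reduced equation\<close>

definition par :: "nat \<Rightarrow> int" where "par n = int n mod 2"
definition jp :: "nat \<Rightarrow> int" where "jp n = int n div 2"
definition jm :: "nat \<Rightarrow> int" where "jm n = - (int n div 2) - int n mod 2"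

lemma par01: "par n \<in> {0, 1}"
  by (auto simp: par_def)

text \<open>The frequency \<open>n\<close> belongs to one boundary condition, that of parity
  \<open>par n\<close>, where it occurs at \<open>jp n\<close> and \<open>jm n\<close>. The
  reflection in the second line exchanges these indices, and their difference \<open>n\<close> makes
  \<open>a n\<close> and \<open>a (- n)\<close> the leading terms of their coupling.\<close>

lemma pair_indices: "2 * jp n + par n = int n" "2 * jm n + par n = - int n" "jp n - jm n = int n"
  "- par n - jp n = jm n" "- par n - jm n = jp n"
  by (simp_all add: jp_def jm_def par_def, presburger+)

lemma low_index_iff: "\<bar>2 * j + par n\<bar> = int n \<longleftrightarrow> j = jp n \<or> j = jm n"
  using pair_indices(1,2)[of n] by auto

lemma jp_neq_jm: "2 \<le> n \<Longrightarrow> jp n \<noteq> jm n"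
  using pair_indices(3)[of n] by auto

lemma lap_pair: "lap (par n) (jp n) = (pi * real n)\<^sup>2" "lap (par n) (jm n) = (pi * real n)\<^sup>2"
  unfolding lap_def pair_indices by simp_all

lemma lap_reflect: "lap s (- s - j) = lap s j"
proof -
  have "2 * (- s - j) + s = - (2 * j + s)" by simp
  then show ?thesis unfolding lap_def by (simp only: of_int_minus mult_minus_right power2_minus)
qed

lemma res_reflect: "res s n \<mu> (- s - j) = res s n \<mu> j"
proof -
  have "2 * (- s - j) + s = - (2 * j + s)" by simp
  then show ?thesis unfolding res_def lap_reflect by (simp only: abs_minus_cancel)
qed

text \<open>Submultiplicativity splits \<open>v (j - i)\<close> into
  \<open>v (j - k) * v (k - i)\<close>; the weight is centred at the source \<open>i\<close> of the
  solution.\<close>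

lemma conv_weighted_le:
  fixes v :: "int \<Rightarrow> real"
  assumes v: "\<And>k. 0 \<le> v k" "\<And>k l. v (k + l) \<le> v k * v l"
    and a: "l2_seq (\<lambda>k. of_real (v k) * a k)" and f: "l2_seq (\<lambda>k. of_real (v (k - i)) * f k)"
    and sm: "l2_seq a" "l2_seq f"
  shows "v (j - i) * cmod (conv a f j) \<le> l2_norm (\<lambda>k. of_real (v k) * a k) * l2_norm (\<lambda>k. of_real (v (k - i)) * f k)"
proof -
  define A where "A k = of_real (v (j - k)) * a (j - k)" for k
  define F where "F k = of_real (v (k - i)) * f k" for k
  have A: "l2_seq A" "l2_norm A = l2_norm (\<lambda>k. of_real (v k) * a k)"
    using l2_reindex[OF bij_int_minus[of j], of "\<lambda>k. of_real (v k) * a k"] a by (simp_all add: A_def[abs_def])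
  have F: "l2_seq F" using f by (simp add: F_def[abs_def])
  have s1: "(\<lambda>k. cmod (a (j - k) * f k)) summable_on UNIV"
    using l2_product(1)[of "\<lambda>k. a (j - k)" f] sm l2_reindex[OF bij_int_minus[of j], of a] by auto
  have "v (j - i) * cmod (conv a f j) \<le> v (j - i) * (\<Sum>\<^sub>\<infinity>k. cmod (a (j - k) * f k))"
    unfolding conv_def by (intro mult_left_mono norm_infsum_bound s1 v)
  also have "\<dots> = (\<Sum>\<^sub>\<infinity>k. v (j - i) * cmod (a (j - k) * f k))"
    by (simp add: infsum_cmult_right')
  also have "\<dots> \<le> (\<Sum>\<^sub>\<infinity>k. norm (A k) * norm (F k))"
  proof (rule infsum_mono)
    show "(\<lambda>k. v (j - i) * cmod (a (j - k) * f k)) summable_on UNIV"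
      using s1 by (rule summable_on_cmult_right)
    show "(\<lambda>k. norm (A k) * norm (F k)) summable_on UNIV" by (rule l2_cauchy_schwarz(1)[OF A(1) F])
    fix k
    have "v (j - i) \<le> v (j - k) * v (k - i)" using v(2)[of "j - k" "k - i"] by simp
    then have "v (j - i) * cmod (a (j - k) * f k) \<le> v (j - k) * v (k - i) * cmod (a (j - k) * f k)"
      by (intro mult_right_mono) auto
    also have "\<dots> = norm (A k) * norm (F k)"
      using v(1) by (simp add: A_def F_def norm_mult mult_ac)
    finally show "v (j - i) * cmod (a (j - k) * f k) \<le> norm (A k) * norm (F k)" .
  qed
  also have "\<dots> \<le> l2_norm A * l2_norm F" by (rule l2_cauchy_schwarz(2)[OF A(1) F])
  finally show ?thesis by (simp add: A(2) F_def[abs_def])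
qed

text \<open>The bound \<open>B\<close> makes the weighted supremum \<open>S\<close> finite, so that
  half of it can be absorbed. The estimate itself does not contain \<open>B\<close>, which later
  allows the cap of the weights to tend to infinity.\<close>

lemma ysol_weighted:
  fixes v :: "int \<Rightarrow> real"
  assumes n: "2 \<le> n" and \<mu>: "\<mu> \<in> strip n" and a: "l2_seq a" "l2_norm a * (gap_const / real n) \<le> 1 / 2"
    and v: "\<And>k. 1 \<le> v k" "\<And>k l. v (k + l) \<le> v k * v l" "\<And>k. v k \<le> B"
    and small: "l2_norm (\<lambda>k. of_real (v k) * a k) * (gap_const / real n) \<le> 1 / 2"
  shows "v (j - i) * cmod (ysol s n a \<mu> i j - a (j - i))
    \<le> 2 * (l2_norm (\<lambda>k. of_real (v k) * a k))\<^sup>2 * (gap_const / real n)"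
proof -
  define \<rho> where "\<rho> = l2_norm (\<lambda>k. of_real (v k) * a k)"
  define \<kappa> where "\<kappa> = gap_const / real n"
  define y where "y = ysol s n a \<mu> i"
  note Y = ysol[OF n \<mu> a, of s i, folded y_def]
  have B1: "1 \<le> B" using v(1,3)[of 0] by linarith
  have v0: "0 \<le> v k" for k using v(1)[of k] by linarith
  have va: "l2_seq (\<lambda>k. of_real (v k) * a k)"
    by (rule l2_comparison(1)[OF a(1), of _ B]) (use v v0 B1 in \<open>auto simp: norm_mult intro!: mult_right_mono\<close>)
  define S where "S = (SUP k. v (k - i) * cmod (y k))"
  have bdd: "bdd_above (range (\<lambda>k. v (k - i) * cmod (y k)))"
  proof (rule bdd_aboveI)
    fix x assume "x \<in> range (\<lambda>k. v (k - i) * cmod (y k))"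
    then obtain k where "x = v (k - i) * cmod (y k)" by blast
    then show "x \<le> B * (2 * l2_norm a)" using Y(1)[of k] v(3) v0 B1 by (auto intro!: mult_mono)
  qed
  have S: "v (k - i) * cmod (y k) \<le> S" for k unfolding S_def by (rule cSUP_upper[OF _ bdd]) simp
  define F where "F k = res s n \<mu> k * (of_real (v (k - i)) * y k)" for k
  have vy: "cmod (of_real (v (k - i)) * y k) \<le> S" for k using S[of k] v0 by (simp add: norm_mult)
  have F: "l2_seq F" "l2_norm F \<le> S * \<kappa>"
    using res_mult_l2(1,2)[where y = "\<lambda>k. of_real (v (k - i)) * y k" and s = s, OF n \<mu> vy]
    by (simp_all add: F_def[abs_def] \<kappa>_def)
  have F': "(\<lambda>k. of_real (v (k - i)) * (res s n \<mu> k * y k)) = F" by (auto simp: F_def mult_ac)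
  have c: "v (k - i) * cmod (conv a (\<lambda>k. res s n \<mu> k * y k) k) \<le> \<rho> * (S * \<kappa>)" for k
  proof -
    have "v (k - i) * cmod (conv a (\<lambda>k. res s n \<mu> k * y k) k) \<le> \<rho> * l2_norm F"
      using conv_weighted_le[of v a i "\<lambda>k. res s n \<mu> k * y k" k] v0 v(2) va F(1) a(1)
        res_mult_l2(1)[where y = y and s = s, OF n \<mu> Y(1)] unfolding F' \<rho>_def by blast
    also have "\<dots> \<le> \<rho> * (S * \<kappa>)" using F(2) by (intro mult_left_mono) (auto simp: \<rho>_def)
    finally show ?thesis .
  qed
  have S0: "0 \<le> S" using S[of 0] v0[of "0 - i"] by (meson mult_nonneg_nonneg norm_ge_zero order_trans)
  have half: "\<rho> * (S * \<kappa>) \<le> S / 2"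
    using mult_right_mono[OF small S0] by (simp add: \<rho>_def \<kappa>_def mult_ac)
  have "S \<le> \<rho> + S / 2"
    unfolding S_def
  proof (rule cSUP_least)
    fix k
    have "v (k - i) * cmod (a (k - i)) \<le> \<rho>"
      using norm_le_l2_norm[OF va, of "k - i"] v0 by (simp add: \<rho>_def norm_mult)
    moreover have "v (k - i) * cmod (y k) \<le> v (k - i) * (cmod (a (k - i)) + cmod (conv a (\<lambda>k. res s n \<mu> k * y k) k))"
      by (subst Y(2)) (intro mult_left_mono norm_triangle_ineq v0)
    ultimately show "v (k - i) * cmod (y k) \<le> \<rho> + (SUP k. v (k - i) * cmod (y k)) / 2"
      using c[of k] half unfolding S_def[symmetric] distrib_left by linarith
  qed simp
  then have "S \<le> 2 * \<rho>" by simp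
  have \<kappa>0: "0 \<le> \<kappa>" using gap_const_ge_1 by (simp add: \<kappa>_def)
  have "y j - a (j - i) = conv a (\<lambda>k. res s n \<mu> k * y k) j" using Y(2)[of j] by simp
  then have "v (j - i) * cmod (y j - a (j - i)) \<le> \<rho> * (S * \<kappa>)" using c[of j] by simp
  also have "\<dots> \<le> \<rho> * (2 * \<rho> * \<kappa>)"
    using \<open>S \<le> 2 * \<rho>\<close> \<kappa>0 by (intro mult_left_mono mult_right_mono) (auto simp: \<rho>_def)
  also have "\<dots> = 2 * \<rho>\<^sup>2 * \<kappa>" by (simp add: power2_eq_square)
  finally show ?thesis by (simp add: y_def \<rho>_def \<kappa>_def)
qed

text \<open>Convolution with \<open>a\<close> is symmetric for the bilinear form pairing the index \<open>j\<close> with its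
  reflection \<open>- s - j\<close>.\<close>

lemma conv_reflect_symmetric:
  assumes a: "l2_seq a" and f: "(\<lambda>k. cmod (f k)) summable_on UNIV" and g: "(\<lambda>k. cmod (g k)) summable_on UNIV"
  shows "(\<Sum>\<^sub>\<infinity>j. g (- s - j) * conv a f j) = (\<Sum>\<^sub>\<infinity>j. f (- s - j) * conv a g j)"
proof -
  define h where "h j k = g (- s - j) * (a (j - k) * f k)" for j k
  have bij: "bij_betw (\<lambda>j. - s - j) UNIV UNIV" using bij_int_minus[of "- s"] by (simp add: bij_def bij_betw_def)
  have g': "(\<lambda>j. cmod (g (- s - j))) summable_on UNIV"
    using summable_on_reindex_bij_betw[OF bij, of "\<lambda>k. cmod (g k)"] g by simp
  have "(\<lambda>(j, k). l2_norm a * cmod (g (- s - j)) * cmod (f k)) summable_on (SIGMA j:UNIV. UNIV)"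
  proof (rule summable_on_SigmaI[where g = "\<lambda>j. l2_norm a * cmod (g (- s - j)) * (\<Sum>\<^sub>\<infinity>k. cmod (f k))"])
    show "((\<lambda>k. case (j, k) of (j, k) \<Rightarrow> l2_norm a * cmod (g (- s - j)) * cmod (f k)) has_sum
        l2_norm a * cmod (g (- s - j)) * (\<Sum>\<^sub>\<infinity>k. cmod (f k))) UNIV" for j
      using has_sum_cmult_right[OF has_sum_infsum[OF f], of "l2_norm a * cmod (g (- s - j))"] by simp
    show "(\<lambda>j. l2_norm a * cmod (g (- s - j)) * (\<Sum>\<^sub>\<infinity>k. cmod (f k))) summable_on UNIV"
      using g' by (intro summable_on_cmult_left summable_on_cmult_right)
  qed auto
  then have "(\<lambda>p. cmod (case p of (j, k) \<Rightarrow> h j k)) summable_on UNIV \<times> UNIV"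
  proof (rule summable_on_comparison_test)
    fix p :: "int \<times> int"
    obtain j k where p: "p = (j, k)" by fastforce
    have "cmod (g (- s - j)) * (cmod (a (j - k)) * cmod (f k)) \<le> cmod (g (- s - j)) * (l2_norm a * cmod (f k))"
      by (intro mult_left_mono mult_right_mono norm_le_l2_norm a) auto
    then show "cmod (case p of (j, k) \<Rightarrow> h j k) \<le> (case p of (j, k) \<Rightarrow> l2_norm a * cmod (g (- s - j)) * cmod (f k))"
      by (simp add: p h_def norm_mult mult_ac)
  qed auto
  then have "(\<lambda>(j, k). h j k) summable_on UNIV \<times> UNIV"
    by (rule abs_summable_summable)
  then have swap: "(\<Sum>\<^sub>\<infinity>j. \<Sum>\<^sub>\<infinity>k. h j k) = (\<Sum>\<^sub>\<infinity>k. \<Sum>\<^sub>\<infinity>j. h j k)"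
    by (rule infsum_swap_banach)
  have "(\<Sum>\<^sub>\<infinity>j. g (- s - j) * conv a f j) = (\<Sum>\<^sub>\<infinity>j. \<Sum>\<^sub>\<infinity>k. h j k)"
    by (simp add: h_def conv_def infsum_cmult_right')
  also have "\<dots> = (\<Sum>\<^sub>\<infinity>k. f k * conv a g (- s - k))"
  proof (subst swap, rule infsum_cong)
    fix k
    have "(\<Sum>\<^sub>\<infinity>j. h j k) = (\<Sum>\<^sub>\<infinity>j. f k * (a (- s - k - (- s - j)) * g (- s - j)))"
      by (rule infsum_cong) (simp add: h_def)
    also have "\<dots> = (\<Sum>\<^sub>\<infinity>j. f k * (a (- s - k - j) * g j))"
      using infsum_reindex_bij_betw[OF bij, of "\<lambda>j. f k * (a (- s - k - j) * g j)"] by simp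
    also have "\<dots> = f k * conv a g (- s - k)"
      by (simp add: conv_def infsum_cmult_right')
    finally show "(\<Sum>\<^sub>\<infinity>j. h j k) = f k * conv a g (- s - k)" .
  qed
  also have "\<dots> = (\<Sum>\<^sub>\<infinity>k. f (- s - k) * conv a g k)"
    using infsum_reindex_bij_betw[OF bij, of "\<lambda>k. f (- s - k) * conv a g k"] by simp
  finally show ?thesis .
qed

lemma summable_norm_add:
  fixes f g :: "int \<Rightarrow> complex"
  assumes "(\<lambda>k. cmod (f k)) summable_on UNIV" "(\<lambda>k. cmod (g k)) summable_on UNIV"
  shows "(\<lambda>k. cmod (f k + g k)) summable_on UNIV"
  by (rule summable_on_comparison_test[OF summable_on_add[OF assms]]) (auto intro: norm_triangle_ineq)

lemma summable_norm_single: "(\<lambda>k. cmod (if k = i then c else 0)) summable_on UNIV"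
  by (rule finite_nonzero_values_imp_summable_on) (auto intro: finite_subset[of _ "{i}"])

lemma infsum_single_mult: "(\<Sum>\<^sub>\<infinity>k. (if k = i then c else 0) * (g k :: complex)) = c * g i"
proof -
  have "(\<Sum>\<^sub>\<infinity>k. (if k = i then c else 0) * g k) = (\<Sum>\<^sub>\<infinity>k\<in>{i}. (if k = i then c else 0) * g k)"
    by (rule infsum_cong_neutral) auto
  then show ?thesis by simp
qed

lemma infsum_add_single:
  fixes f g :: "int \<Rightarrow> complex"
  assumes "(\<lambda>k. f k * g k) summable_on UNIV"
  shows "(\<Sum>\<^sub>\<infinity>k. ((if k = i then c else 0) + f k) * g k) = c * g i + (\<Sum>\<^sub>\<infinity>k. f k * g k)"
proof -
  have "(\<lambda>k. (if k = i then c else 0) * g k) summable_on UNIV"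
    by (rule finite_nonzero_values_imp_summable_on) (auto intro: finite_subset[of _ "{i}"])
  from infsum_add[OF this assms] show ?thesis
    by (simp add: distrib_right infsum_single_mult)
qed

definition c_plus :: "nat \<Rightarrow> (int \<Rightarrow> complex) \<Rightarrow> complex \<Rightarrow> complex" where
  "c_plus n a \<mu> = ysol (par n) n a \<mu> (jm n) (jp n)"

definition c_minus :: "nat \<Rightarrow> (int \<Rightarrow> complex) \<Rightarrow> complex \<Rightarrow> complex" where
  "c_minus n a \<mu> = ysol (par n) n a \<mu> (jp n) (jm n)"

text \<open>By \<open>y_symmetric\<close> the diagonal entry at \<open>jm n\<close> is the same as
  at \<open>jp n\<close>, so one \<open>\<zeta>\<close> serves both rows and the determinant is
  \<open>\<zeta>\<^sup>2 - cp * cm\<close>.\<close>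

definition pair_zeta :: "nat \<Rightarrow> (int \<Rightarrow> complex) \<Rightarrow> complex \<Rightarrow> complex" where
  "pair_zeta n a \<mu> = \<mu> - of_real ((pi * real n)\<^sup>2) - ysol (par n) n a \<mu> (jp n) (jp n)"

text \<open>After elimination of all modes except \<open>jp n\<close> and \<open>jm n\<close>, the equation for an eigenvector with
  eigenvalue \<open>\<mu>\<close> becomes \<open>\<zeta> x = cp y\<close>, \<open>\<zeta> y = cm x\<close> for the two remaining entries.\<close>

locale pair_modes =
  fixes n :: nat and a :: "int \<Rightarrow> complex" and \<mu> :: complex
  assumes n2: "2 \<le> n" and \<mu>_strip: "\<mu> \<in> strip n" and a_l2: "l2_seq a"
    and half: "l2_norm a * (gap_const / real n) \<le> 1 / 2"
begin

abbreviation "s \<equiv> par n"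
abbreviation "rs \<equiv> res s n \<mu>"
abbreviation "y \<equiv> ysol s n a \<mu>"
abbreviation "\<kappa> \<equiv> gap_const / real n"

lemmas y_le = ysol(1)[OF n2 \<mu>_strip a_l2 half]
lemmas y_eq = ysol(2)[OF n2 \<mu>_strip a_l2 half]

definition mode :: "int \<Rightarrow> int \<Rightarrow> complex" where
  "mode i j = (if j = i then 1 else 0) + rs j * y i j"

lemma res_y_summable: "(\<lambda>j. cmod (rs j * y i j)) summable_on UNIV"
  by (rule res_mult_l2(3)[where y = "y i", OF n2 \<mu>_strip y_le])

lemma mode_summable: "(\<lambda>j. cmod (mode i j)) summable_on UNIV"
  unfolding mode_def by (intro summable_norm_add summable_norm_single res_y_summable)

lemma conv_mode: "conv a (mode i) j = y i j"
proof -
  have "conv a (mode i) j = conv a (\<lambda>j. if j = i then 1 else 0) j + conv a (\<lambda>j. rs j * y i j) j"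
    unfolding mode_def[abs_def]
    by (rule conv_add[OF a_l2 l2_single res_mult_l2(1)[where y = "y i", OF n2 \<mu>_strip y_le]])
  then show ?thesis using y_eq[of s i j] by (simp add: conv_single)
qed

text \<open>The reflection form is evaluated on the two modes. Each side is a diagonal entry plus a
  sum weighted by \<open>res\<close>; as \<open>res\<close> is invariant under the reflection, the
  two sums agree.\<close>

lemma y_symmetric: "y (jp n) (jp n) = y (jm n) (jm n)"
proof -
  have sm: "(\<lambda>j. rs j * y i (- s - j) * y i' j) summable_on UNIV" for i i'
  proof (rule abs_summable_summable)
    have "(\<lambda>j. 2 * l2_norm a * cmod (rs j * y i' j)) summable_on UNIV"
      by (intro summable_on_cmult_right res_y_summable)
    then show "(\<lambda>j. cmod (rs j * y i (- s - j) * y i' j)) summable_on UNIV"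
    proof (rule summable_on_comparison_test)
      fix j
      have "cmod (y i (- s - j)) * cmod (rs j * y i' j) \<le> 2 * l2_norm a * cmod (rs j * y i' j)"
        by (intro mult_right_mono y_le) auto
      then show "cmod (rs j * y i (- s - j) * y i' j) \<le> 2 * l2_norm a * cmod (rs j * y i' j)"
        by (simp add: norm_mult mult_ac)
    qed auto
  qed
  have form: "(\<Sum>\<^sub>\<infinity>j. mode i (- s - j) * y i' j) = y i' (- s - i) + (\<Sum>\<^sub>\<infinity>j. rs j * y i (- s - j) * y i' j)" for i i'
  proof -
    have "mode i (- s - j) = (if j = - s - i then 1 else 0) + rs j * y i (- s - j)" for j
      by (auto simp: mode_def res_reflect)
    then show ?thesis using infsum_add_single[OF sm[of i i'], of "- s - i" 1] by simp
  qed
  have bij: "bij_betw (\<lambda>j. - s - j) UNIV UNIV" using bij_int_minus[of "- s"] by (simp add: bij_def bij_betw_def)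
  have "(\<Sum>\<^sub>\<infinity>j. mode (jm n) (- s - j) * conv a (mode (jp n)) j) = (\<Sum>\<^sub>\<infinity>j. mode (jp n) (- s - j) * conv a (mode (jm n)) j)"
    by (rule conv_reflect_symmetric[OF a_l2 mode_summable mode_summable])
  then have "y (jp n) (jp n) + (\<Sum>\<^sub>\<infinity>j. rs j * y (jm n) (- s - j) * y (jp n) j)
      = y (jm n) (jm n) + (\<Sum>\<^sub>\<infinity>j. rs j * y (jp n) (- s - j) * y (jm n) j)"
    unfolding conv_mode form pair_indices .
  moreover have "(\<Sum>\<^sub>\<infinity>j. rs j * y (jm n) (- s - j) * y (jp n) j) = (\<Sum>\<^sub>\<infinity>j. rs j * y (jp n) (- s - j) * y (jm n) j)"
    using infsum_reindex_bij_betw[OF bij, of "\<lambda>j. rs j * y (jp n) (- s - j) * y (jm n) j"]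
    by (simp add: res_reflect mult_ac)
  ultimately show ?thesis by simp
qed

abbreviation "cp \<equiv> c_plus n a \<mu>"
abbreviation "cm \<equiv> c_minus n a \<mu>"
abbreviation "\<zeta> \<equiv> pair_zeta n a \<mu>"

lemma res_nonzero:
  assumes "\<bar>2 * j + s'\<bar> \<noteq> int n"
  shows "\<mu> - of_real (lap s' j) \<noteq> 0"
proof -
  have "0 < (\<bar>real_of_int (2 * j + s')\<bar> - real n)\<^sup>2"
    using res_gap(2)[OF n2 \<mu>_strip assms] by (auto simp: power2_eq_square zero_less_mult_iff)
  then show ?thesis using res_gap(3)[OF n2 \<mu>_strip assms] by auto
qed

lemma eigenvector_high:
  assumes "(of_real (lap s' j) - \<mu>) * f j + conv a f j = 0" "\<bar>2 * j + s'\<bar> \<noteq> int n"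
  shows "f j = res s' n \<mu> j * conv a f j"
proof -
  have "(\<mu> - of_real (lap s' j)) * f j = conv a f j" using assms(1) by (simp add: algebra_simps)
  then show ?thesis using res_nonzero[OF assms(2)] assms(2) by (simp add: res_def field_simps)
qed

text \<open>The parity \<open>s'\<close> is free. For \<open>par n\<close> this says that an
  eigenvector has a resonant entry; for the other parity, where \<open>low\<close> is vacuous, it
  excludes eigenvectors altogether.\<close>

lemma eigenvector_no_low_part:
  assumes f: "l2_seq f" and eig: "\<And>j. (of_real (lap s' j) - \<mu>) * f j + conv a f j = 0"
    and low: "\<And>j. \<bar>2 * j + s'\<bar> = int n \<Longrightarrow> f j = 0"
  shows "f j = 0"
proof -
  have f_eq: "f j = res s' n \<mu> j * conv a f j" for j
    using eigenvector_high[OF eig] low by (cases "\<bar>2 * j + s'\<bar> = int n") (auto simp: res_def)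
  have "conv a f j = 0" for j
  proof (rule res_homogeneous_zero[OF n2 \<mu>_strip a_l2 half, of "conv a f"])
    show "cmod (conv a f j) \<le> l2_norm a * l2_norm f" for j by (rule norm_conv_le[OF a_l2 f])
    have "f = (\<lambda>k. res s' n \<mu> k * conv a f k)" using f_eq by blast
    then show "conv a f j = conv a (\<lambda>k. res s' n \<mu> k * conv a f k) j" for j by simp
  qed
  then show ?thesis using f_eq[of j] by simp
qed

text \<open>The difference \<open>u\<close> of \<open>conv a f\<close> and the combination of the
  two solutions \<open>y\<close> satisfies the homogeneous equation and vanishes. The resonant rows
  then form the 2 x 2 system.\<close>

lemma eigenvector_pair:
  assumes f: "l2_seq f" and eig: "\<And>j. (of_real (lap s j) - \<mu>) * f j + conv a f j = 0"
  shows "conv a f j = f (jp n) * y (jp n) j + f (jm n) * y (jm n) j"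
    and "\<zeta> * f (jp n) = cp * f (jm n)" "\<zeta> * f (jm n) = cm * f (jp n)"
proof -
  define x1 where "x1 = f (jp n)"
  define x2 where "x2 = f (jm n)"
  define w where "w = conv a f"
  define u where "u j = w j - (x1 * y (jp n) j + x2 * y (jm n) j)" for j
  note ne = jp_neq_jm[OF n2]
  have f_eq: "f = (\<lambda>j. (if j = jp n then x1 else 0) + ((if j = jm n then x2 else 0) + rs j * w j))"
  proof
    fix j
    show "f j = (if j = jp n then x1 else 0) + ((if j = jm n then x2 else 0) + rs j * w j)"
    proof (cases "\<bar>2 * j + s\<bar> = int n")
      case True
      then show ?thesis using ne by (auto simp: low_index_iff res_def x1_def x2_def)
    next
      case False
      then show ?thesis using eigenvector_high[OF eig False] by (auto simp: low_index_iff w_def)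
    qed
  qed
  have w_bd: "cmod (w j) \<le> l2_norm a * l2_norm f" for j
    unfolding w_def by (rule norm_conv_le[OF a_l2 f])
  have ly: "l2_seq (\<lambda>k. rs k * y i k)" for i
    by (rule res_mult_l2(1)[where y = "y i", OF n2 \<mu>_strip y_le])
  have lw: "l2_seq (\<lambda>k. rs k * w k)" by (rule res_mult_l2(1)[where y = w, OF n2 \<mu>_strip w_bd])
  have w_eq: "w j = a (j - jp n) * x1 + a (j - jm n) * x2 + conv a (\<lambda>k. rs k * w k) j" for j
  proof -
    have "w j = conv a (\<lambda>j. (if j = jp n then x1 else 0) + ((if j = jm n then x2 else 0) + rs j * w j)) j"
      using f_eq by (simp add: w_def)
    also have "\<dots> = conv a (\<lambda>j. if j = jp n then x1 else 0) j + (conv a (\<lambda>j. if j = jm n then x2 else 0) j + conv a (\<lambda>k. rs k * w k) j)"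
      by (simp only: conv_add[OF a_l2 l2_single l2_add(1)[OF l2_single lw]] conv_add[OF a_l2 l2_single lw])
    finally show ?thesis by (simp add: conv_single)
  qed
  have u_eq: "u j = conv a (\<lambda>k. rs k * u k) j" for j
  proof -
    have "(\<lambda>k. rs k * u k) = (\<lambda>k. rs k * w k - (x1 * (rs k * y (jp n) k) + x2 * (rs k * y (jm n) k)))"
      by (auto simp: u_def algebra_simps)
    then have "conv a (\<lambda>k. rs k * u k) j = conv a (\<lambda>k. rs k * w k) j
        - (x1 * conv a (\<lambda>k. rs k * y (jp n) k) j + x2 * conv a (\<lambda>k. rs k * y (jm n) k) j)"
      by (simp only: conv_diff[OF a_l2 lw l2_add(1)[OF l2_cmult(1)[OF ly] l2_cmult(1)[OF ly]]]
          conv_add[OF a_l2 l2_cmult(1)[OF ly] l2_cmult(1)[OF ly]] conv_cmult)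
    also have "conv a (\<lambda>k. rs k * w k) j = w j - (a (j - jp n) * x1 + a (j - jm n) * x2)"
      using w_eq[of j] by simp
    also have "conv a (\<lambda>k. rs k * y (jp n) k) j = y (jp n) j - a (j - jp n)"
      using y_eq[of s "jp n" j] by simp
    also have "conv a (\<lambda>k. rs k * y (jm n) k) j = y (jm n) j - a (j - jm n)"
      using y_eq[of s "jm n" j] by simp
    finally show ?thesis by (simp add: u_def algebra_simps)
  qed
  have "u j = 0" for j
  proof (rule res_homogeneous_zero[OF n2 \<mu>_strip a_l2 half _ u_eq])
    show "cmod (u j) \<le> l2_norm a * l2_norm f + (cmod x1 * (2 * l2_norm a) + cmod x2 * (2 * l2_norm a))" for j
      unfolding u_def
      by (intro order_trans[OF norm_triangle_ineq4] add_mono w_bd order_trans[OF norm_triangle_ineq])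
        (auto simp: norm_mult intro!: mult_left_mono y_le)
  qed
  then show w: "conv a f j = f (jp n) * y (jp n) j + f (jm n) * y (jm n) j" for j
    by (simp add: u_def w_def x1_def x2_def)
  have "(\<mu> - of_real ((pi * real n)\<^sup>2)) * f (jp n) = conv a f (jp n)"
    using eig[of "jp n"] by (simp add: lap_pair algebra_simps)
  then show "\<zeta> * f (jp n) = cp * f (jm n)"
    unfolding w by (simp add: pair_zeta_def c_plus_def algebra_simps)
  have "(\<mu> - of_real ((pi * real n)\<^sup>2)) * f (jm n) = conv a f (jm n)"
    using eig[of "jm n"] by (simp add: lap_pair algebra_simps)
  then show "\<zeta> * f (jm n) = cm * f (jp n)"
    unfolding w by (simp add: pair_zeta_def c_minus_def y_symmetric algebra_simps)
qed

lemma eigenvector_determinant: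
  assumes f: "l2_seq f" and eig: "\<And>j. (of_real (lap s j) - \<mu>) * f j + conv a f j = 0" and ne: "f j \<noteq> 0"
  shows "\<zeta>\<^sup>2 = cp * cm"
proof -
  note p = eigenvector_pair(2,3)[OF f eig]
  have "f (jp n) \<noteq> 0 \<or> f (jm n) \<noteq> 0"
    using eigenvector_no_low_part[OF f eig, of j] ne by (auto simp: low_index_iff)
  moreover have "\<zeta>\<^sup>2 * f (jp n) = cp * cm * f (jp n)"
  proof -
    have "\<zeta>\<^sup>2 * f (jp n) = \<zeta> * (\<zeta> * f (jp n))" by (simp add: power2_eq_square)
    also have "\<dots> = cp * (\<zeta> * f (jm n))" unfolding p(1) by (rule mult.left_commute)
    finally show ?thesis unfolding p(2) by (simp only: mult.assoc)
  qed
  moreover have "\<zeta>\<^sup>2 * f (jm n) = cp * cm * f (jm n)"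
  proof -
    have "\<zeta>\<^sup>2 * f (jm n) = \<zeta> * (\<zeta> * f (jm n))" by (simp add: power2_eq_square)
    also have "\<dots> = cm * (\<zeta> * f (jp n))" unfolding p(2) by (rule mult.left_commute)
    finally show ?thesis unfolding p(1) by (simp only: mult.assoc mult.left_commute)
  qed
  ultimately show ?thesis by auto
qed

lemma mode_eigenvector:
  assumes "cp = 0" "cm = 0" "\<zeta> = 0" and i: "i = jp n \<or> i = jm n"
  shows "(of_real (lap s j) - \<mu>) * mode i j + conv a (mode i) j = 0"
proof (cases "\<bar>2 * j + s\<bar> = int n")
  case True
  then have "j = jp n \<or> j = jm n" by (simp add: low_index_iff)
  moreover have "y i i = \<mu> - of_real ((pi * real n)\<^sup>2)"
    using assms y_symmetric by (auto simp: pair_zeta_def)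
  ultimately show ?thesis
    using assms True unfolding conv_mode
    by (auto simp: mode_def res_def c_plus_def c_minus_def lap_pair algebra_simps)
next
  case False
  then have "j \<noteq> i" using i by (auto simp: low_index_iff)
  then show ?thesis
    using False res_nonzero[OF False] unfolding conv_mode by (simp add: mode_def res_def field_simps)
qed

text \<open>The eigenvector \<open>f1\<close> is the image of \<open>f2\<close> under an operator
  that is symmetric for the reflection form and annihilates \<open>f1\<close>, so \<open>f1\<close>
  is isotropic (the fact \<open>zero\<close>). The form pairs the two resonant entries with each
  other, and twice their product must be cancelled by the nonresonant part, which is small.\<close>

lemma jordan_chain_estimate:
  assumes f1: "(\<lambda>j. cmod (f1 j)) summable_on UNIV" and f2: "(\<lambda>j. cmod (f2 j)) summable_on UNIV"
    and lap_f2: "l2_seq (\<lambda>j. of_real (lap s j) * f2 j)"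
    and eig: "\<And>j. (of_real (lap s j) - \<mu>) * f1 j + conv a f1 j = 0"
    and chain: "\<And>j. (of_real (lap s j) - \<mu>) * f2 j + conv a f2 j = f1 j"
  shows "2 * (cmod (f1 (jp n)) * cmod (f1 (jm n)))
    \<le> (2 * l2_norm a * (cmod (f1 (jp n)) + cmod (f1 (jm n))) * \<kappa>)\<^sup>2"
proof -
  have bij: "bij_betw (\<lambda>j. - s - j) UNIV UNIV" using bij_int_minus[of "- s"] by (simp add: bij_def bij_betw_def)
  note f1_l2 = l2_seq_of_abs_summable[OF f1] and f2_l2 = l2_seq_of_abs_summable[OF f2]
  define f1r where "f1r j = f1 (- s - j)" for j
  have f1r_l2: "l2_seq f1r" unfolding f1r_def[abs_def] using l2_reindex[OF bij_int_minus[of "- s"], of f1] f1_l2 by simp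
  have Df2: "l2_seq (\<lambda>j. (of_real (lap s j) - \<mu>) * f2 j)"
    using l2_diff(1)[OF lap_f2 l2_cmult(1)[OF f2_l2, of \<mu>]] by (simp add: left_diff_distrib)
  have conv_f2: "conv a f2 = (\<lambda>j. f1 j - (of_real (lap s j) - \<mu>) * f2 j)"
    using chain by (auto simp: algebra_simps)
  have conv_f1: "conv a f1 j = - ((of_real (lap s j) - \<mu>) * f1 j)" for j
    using eig[of j] by (simp add: eq_neg_iff_add_eq_0 add.commute)
  have conv_f2_l2: "l2_seq (conv a f2)" unfolding conv_f2 by (intro l2_diff f1_l2 Df2)
  have "(\<Sum>\<^sub>\<infinity>j. f1r j * conv a f2 j) = (\<Sum>\<^sub>\<infinity>j. f2 (- s - j) * conv a f1 j)"
    unfolding f1r_def by (rule conv_reflect_symmetric[OF a_l2 f2 f1])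
  also have "\<dots> = (\<Sum>\<^sub>\<infinity>j. f2 j * conv a f1 (- s - j))"
    using infsum_reindex_bij_betw[OF bij, of "\<lambda>j. f2 j * conv a f1 (- s - j)"] by simp
  also have "\<dots> = (\<Sum>\<^sub>\<infinity>j. - (f1r j * ((of_real (lap s j) - \<mu>) * f2 j)))"
    by (rule infsum_cong) (simp add: conv_f1 lap_reflect f1r_def mult_ac)
  finally have eq1: "(\<Sum>\<^sub>\<infinity>j. f1r j * conv a f2 j) = (\<Sum>\<^sub>\<infinity>j. - (f1r j * ((of_real (lap s j) - \<mu>) * f2 j)))" .
  have "(\<Sum>\<^sub>\<infinity>j. f1r j * f1 j) = (\<Sum>\<^sub>\<infinity>j. f1r j * ((of_real (lap s j) - \<mu>) * f2 j) + f1r j * conv a f2 j)"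
    by (rule infsum_cong) (simp add: chain[symmetric] distrib_left)
  also have "\<dots> = (\<Sum>\<^sub>\<infinity>j. f1r j * ((of_real (lap s j) - \<mu>) * f2 j)) + (\<Sum>\<^sub>\<infinity>j. f1r j * conv a f2 j)"
    by (rule infsum_add[OF l2_product(2)[OF f1r_l2 Df2] l2_product(2)[OF f1r_l2 conv_f2_l2]])
  also have "\<dots> = 0" unfolding eq1 by (simp add: infsum_uminus)
  finally have zero: "(\<Sum>\<^sub>\<infinity>j. f1r j * f1 j) = 0" .
  define x1 where "x1 = f1 (jp n)"
  define x2 where "x2 = f1 (jm n)"
  define w where "w = conv a f1"
  define g where "g j = rs j * w j" for j
  define gr where "gr j = g (- s - j)" for j
  have w_bd: "cmod (w j) \<le> 2 * l2_norm a * (cmod x1 + cmod x2)" for j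
  proof -
    have "cmod (w j) \<le> cmod (x1 * y (jp n) j) + cmod (x2 * y (jm n) j)"
      unfolding w_def eigenvector_pair(1)[OF f1_l2 eig] x1_def x2_def by (rule norm_triangle_ineq)
    also have "\<dots> \<le> cmod x1 * (2 * l2_norm a) + cmod x2 * (2 * l2_norm a)"
      unfolding norm_mult by (intro add_mono mult_left_mono y_le) auto
    finally show ?thesis by (simp add: algebra_simps)
  qed
  have g_l2: "l2_seq g" "l2_norm g \<le> 2 * l2_norm a * (cmod x1 + cmod x2) * \<kappa>"
    using res_mult_l2(1,2)[where y = w and s = s, OF n2 \<mu>_strip w_bd] by (simp_all add: g_def[abs_def])
  have gr_l2: "l2_seq gr" "l2_norm gr = l2_norm g"
    unfolding gr_def[abs_def] using l2_reindex[OF bij_int_minus[of "- s"], of g] g_l2 by auto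
  note ne = jp_neq_jm[OF n2]
  have f1_eq: "f1 j = (if j = jp n then x1 else 0) + ((if j = jm n then x2 else 0) + g j)" for j
  proof (cases "\<bar>2 * j + s\<bar> = int n")
    case True
    then show ?thesis using ne by (auto simp: low_index_iff res_def x1_def x2_def g_def)
  next
    case False
    then show ?thesis using eigenvector_high[OF eig False] by (auto simp: low_index_iff w_def g_def)
  qed
  have f1r_eq: "f1r j * f1 j = (if j = jp n then x2 * x1 else 0) + ((if j = jm n then x1 * x2 else 0) + gr j * g j)" for j
  proof -
    have r1: "- s - j = jp n \<longleftrightarrow> j = jm n" "- s - j = jm n \<longleftrightarrow> j = jp n"
      using pair_indices(4,5)[of n] by auto
    have g0: "g (jp n) = 0" "g (jm n) = 0"
      using low_index_iff[of "jp n" n] low_index_iff[of "jm n" n] by (auto simp: g_def res_def)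
    consider "j = jp n" | "j = jm n" | "j \<noteq> jp n" "j \<noteq> jm n" by blast
    then show ?thesis
    proof cases
      case 1
      then show ?thesis using ne by (simp add: f1r_def gr_def g0 pair_indices x1_def x2_def)
    next
      case 2
      then show ?thesis using ne by (simp add: f1r_def gr_def g0 pair_indices x1_def x2_def)
    next
      case 3
      then have "f1 j = g j" "f1 (- s - j) = g (- s - j)"
        using f1_eq[of j] f1_eq[of "- s - j"] r1 by simp_all
      then show ?thesis using 3 by (simp add: f1r_def gr_def)
    qed
  qed
  have sm1: "(\<lambda>j. (if j = i then c else 0)) summable_on UNIV" for i and c :: complex
    by (rule finite_nonzero_values_imp_summable_on) (auto intro: finite_subset[of _ "{i}"])
  have isum: "(\<Sum>\<^sub>\<infinity>j. if j = i then c else 0) = c" for i :: int and c :: complex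
    using infsum_single_mult[of i c "\<lambda>_. 1"] by simp
  note smg = l2_product(2)[OF gr_l2(1) g_l2(1)]
  have "0 = x2 * x1 + (x1 * x2 + (\<Sum>\<^sub>\<infinity>j. gr j * g j))"
    using zero unfolding f1r_eq
    by (simp add: infsum_add[OF sm1 summable_on_add[OF sm1 smg]] infsum_add[OF sm1 smg] isum)
  then have "2 * (x1 * x2) = - (\<Sum>\<^sub>\<infinity>j. gr j * g j)" by (simp add: eq_neg_iff_add_eq_0 algebra_simps)
  then have "cmod (2 * (x1 * x2)) = cmod (\<Sum>\<^sub>\<infinity>j. gr j * g j)" by (simp only: norm_minus_cancel)
  also have "\<dots> \<le> l2_norm gr * l2_norm g" by (rule l2_product(3)[OF gr_l2(1) g_l2(1)])
  also have "\<dots> \<le> (2 * l2_norm a * (cmod x1 + cmod x2) * \<kappa>)\<^sup>2"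
    unfolding gr_l2(2) power2_eq_square using g_l2(2) order_trans[OF l2_norm_nonneg g_l2(2)] by (intro mult_mono) auto
  finally show ?thesis by (simp add: norm_mult x1_def x2_def)
qed

end

section \<open>Gap lengths\<close>

lemma strip_Suc: "strip (Suc n) = {z. cut_line n \<le> Re z \<and> Re z \<le> cut_line (Suc n)}"
  by (simp add: strip_def cut_line_def add.commute)

text \<open>On its left side the strip extends by \<open>pi\<^sup>2 * (n - 1 / 4)\<close> from the
  centre, and by more on the right.\<close>

lemma strip_near_center:
  assumes "2 \<le> n" "cmod (z - of_real ((pi * real n)\<^sup>2)) \<le> real n"
  shows "z \<in> strip n" "(pi * (real n - 1 / 2))\<^sup>2 < Re z"
proof -
  have n: "2 \<le> real n" using assms(1) by simp
  have "\<bar>Re (z - of_real ((pi * real n)\<^sup>2))\<bar> \<le> real n"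
    using abs_Re_le_cmod assms(2) order_trans by blast
  then have 1: "\<bar>Re z - pi\<^sup>2 * (real n)\<^sup>2\<bar> \<le> real n" by (simp add: power_mult_distrib)
  have pi9: "9 \<le> pi\<^sup>2" using power_mono[of 3 pi 2] pi_gt3 by simp
  have 2: "9 * (real n - 1 / 4) \<le> pi\<^sup>2 * (real n - 1 / 4)" using pi9 n by (intro mult_right_mono) auto
  have "(pi * (real n - 1 / 2))\<^sup>2 = pi\<^sup>2 * (real n)\<^sup>2 - pi\<^sup>2 * (real n - 1 / 4)"
    "(pi * (real n + 1 / 2))\<^sup>2 = pi\<^sup>2 * (real n)\<^sup>2 + pi\<^sup>2 * (real n - 1 / 4) + pi\<^sup>2 / 2"
    by (simp_all add: power2_eq_square algebra_simps)
  then show "z \<in> strip n" "(pi * (real n - 1 / 2))\<^sup>2 < Re z"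
    using 1 2 n pi9 by (auto simp: strip_def abs_le_iff)
qed

lemma small_imp_half:
  assumes "l2_norm a \<le> R" "8 * (R + 1)\<^sup>2 * (gap_const / real n) \<le> e" "e \<le> 1"
  shows "l2_norm a * (gap_const / real n) \<le> e / 8" "l2_norm a * (gap_const / real n) \<le> 1 / 2"
proof -
  have R: "0 \<le> R" using assms(1) l2_norm_nonneg order_trans by blast
  have "l2_norm a \<le> (R + 1)\<^sup>2"
  proof -
    have "0 \<le> R * R" "(R + 1)\<^sup>2 = R * R + 2 * R + 1" by (simp_all add: power2_eq_square algebra_simps)
    then show ?thesis using assms(1) R by linarith
  qed
  then have "l2_norm a * (gap_const / real n) \<le> (R + 1)\<^sup>2 * (gap_const / real n)"
    using gap_const_ge_1 by (intro mult_right_mono) auto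
  then show "l2_norm a * (gap_const / real n) \<le> e / 8" using assms(2) by linarith
  then show "l2_norm a * (gap_const / real n) \<le> 1 / 2" using assms(3) by linarith
qed

text \<open>As functions of \<open>a n\<close>, \<open>a (- n)\<close> and \<open>\<mu>\<close> the
  three quantities change like these variables, up to the factor \<open>e\<close>. Both the gap
  estimates and the contraction in \<open>collapsed_neighbour\<close> rest on this.\<close>

lemma pair_lipschitz:
  assumes n: "2 \<le> n" and \<mu>: "\<mu> \<in> strip n" "\<mu>' \<in> strip n"
    and a: "l2_seq a" "l2_norm a \<le> R" and b: "l2_seq b" "l2_norm b \<le> R"
    and small: "8 * (R + 1)\<^sup>2 * (gap_const / real n) \<le> e" "e \<le> 1"
  defines "\<Delta> \<equiv> l2_norm (\<lambda>k. a k - b k) + cmod (\<mu> - \<mu>')"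
  shows "cmod (c_plus n a \<mu> - c_plus n b \<mu>' - (a (int n) - b (int n))) \<le> e * \<Delta>"
    and "cmod (c_minus n a \<mu> - c_minus n b \<mu>' - (a (- int n) - b (- int n))) \<le> e * \<Delta>"
    and "cmod ((pair_zeta n a \<mu> - pair_zeta n b \<mu>') - ((\<mu> - \<mu>') - (a 0 - b 0))) \<le> e * \<Delta>"
proof -
  note L = ysol_lipschitz[OF n \<mu> a b small, of "par n", folded \<Delta>_def]
  have i: "jm n - jp n = - int n" using pair_indices(3)[of n] by simp
  show "cmod (c_plus n a \<mu> - c_plus n b \<mu>' - (a (int n) - b (int n))) \<le> e * \<Delta>"
    using L[of "jm n" "jp n"] by (simp add: c_plus_def pair_indices)
  show "cmod (c_minus n a \<mu> - c_minus n b \<mu>' - (a (- int n) - b (- int n))) \<le> e * \<Delta>"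
    using L[of "jp n" "jm n"] by (simp add: c_minus_def i)
  have "cmod (- (ysol (par n) n a \<mu> (jp n) (jp n) - ysol (par n) n b \<mu>' (jp n) (jp n) - (a 0 - b 0))) \<le> e * \<Delta>"
    using L[of "jp n" "jp n"] by (simp only: norm_minus_cancel) simp
  then show "cmod ((pair_zeta n a \<mu> - pair_zeta n b \<mu>') - ((\<mu> - \<mu>') - (a 0 - b 0))) \<le> e * \<Delta>"
    by (simp add: pair_zeta_def algebra_simps)
qed

lemma hill_shifted_iff: "(y, f) \<in> hill_shifted \<sigma> q z \<longleftrightarrow> (y, f + scaleC z y) \<in> hill_operator \<sigma> q"
  unfolding hill_shifted_def by force

lemma hill_shifted_coeff:
  fixes s q z y f
  assumes "(y, f) \<in> hill_shifted (trig s 1) q z"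
  defines "c \<equiv> \<lambda>j. l2_coeff (2 * j + s) y"
  shows "(\<lambda>j. cmod (c j)) summable_on UNIV" "l2_seq (\<lambda>j. of_real (lap s j) * c j)" "y = l2_synth s c"
    and "(of_real (lap s j) - z) * c j + conv (fourier_coeff q) c j = l2_coeff (2 * j + s) f"
proof -
  have h: "(y, f + scaleC z y) \<in> hill_operator (trig s 1) q" using assms(1) by (simp add: hill_shifted_iff)
  note H = hill_operator_coeff[OF h]
  show "(\<lambda>j. cmod (c j)) summable_on UNIV" unfolding c_def by (rule H(1))
  show "l2_seq (\<lambda>j. of_real (lap s j) * c j)" unfolding c_def by (rule H(2))
  show "y = l2_synth s c" unfolding c_def by (rule H(4))
  show "(of_real (lap s j) - z) * c j + conv (fourier_coeff q) c j = l2_coeff (2 * j + s) f"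
    using H(3)[of j] by (simp only: l2_coeff_add l2_coeff_scale c_def left_diff_distrib) (simp add: algebra_simps)
qed

lemma eigenvector_of_root_vector:
  assumes "y \<in> root_space \<sigma> q z" "y \<noteq> 0"
  obtains v where "(v, 0) \<in> hill_shifted \<sigma> q z" "v \<noteq> 0"
proof -
  obtain k where "(y, 0) \<in> hill_shifted \<sigma> q z ^^ k" using assms(1) by (auto simp: root_space_def)
  then have "\<exists>v. (v, 0) \<in> hill_shifted \<sigma> q z \<and> v \<noteq> 0"
    using assms(2)
  proof (induction k arbitrary: y)
    case (Suc k)
    obtain y1 where "(y, y1) \<in> hill_shifted \<sigma> q z" "(y1, 0) \<in> hill_shifted \<sigma> q z ^^ k"
      using Suc.prems(1) by (rule relpow_Suc_E2)
    then show ?case using Suc by (cases "y1 = 0") auto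
  qed auto
  then show thesis using that by blast
qed

text \<open>In the absence of chains, algebraic multiplicity 2 provides two independent
  eigenvectors.\<close>

lemma root_space_eigen_or_chain:
  assumes "\<not> (\<exists>y2 y1. (y2, y1) \<in> hill_shifted \<sigma> q z \<and> (y1, 0) \<in> hill_shifted \<sigma> q z \<and> y1 \<noteq> 0)"
    and "y \<in> root_space \<sigma> q z"
  shows "y = 0 \<or> (y, 0) \<in> hill_shifted \<sigma> q z"
proof -
  obtain k where "(y, 0) \<in> hill_shifted \<sigma> q z ^^ k" using assms(2) by (auto simp: root_space_def)
  then show ?thesis
  proof (induction k arbitrary: y)
    case (Suc k)
    obtain y1 where y1: "(y, y1) \<in> hill_shifted \<sigma> q z" "(y1, 0) \<in> hill_shifted \<sigma> q z ^^ k"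
      using Suc.prems(1) by (rule relpow_Suc_E2)
    then show ?case using Suc.IH[OF y1(2)] assms(1) by blast
  qed auto
qed

lemma eigenspace_subset_root_space: "eigenspace \<sigma> q z \<subseteq> root_space \<sigma> q z"
proof
  fix y assume "y \<in> eigenspace \<sigma> q z"
  then have "(y, 0) \<in> hill_shifted \<sigma> q z ^^ 1" by (simp add: eigenspace_def)
  then show "y \<in> root_space \<sigma> q z" unfolding root_space_def by blast
qed

text \<open>Monotonicity would fail without the finite span, since an infinite dimension counts as
  0.\<close>

lemma dim_mono_finite_span:
  assumes "S \<subseteq> T" "T \<subseteq> l2_circle.span B" "finite B"
  shows "l2_circle.dim S \<le> l2_circle.dim T"
proof -
  obtain C where C: "C \<subseteq> S" "l2_circle.independent C" "card C = l2_circle.dim S"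
    by (rule l2_circle.basis_exists)
  obtain D where D: "D \<subseteq> T" "l2_circle.independent D" "T \<subseteq> l2_circle.span D" "card D = l2_circle.dim T"
    by (rule l2_circle.basis_exists)
  have "finite D" using l2_circle.independent_span_bound[OF assms(3) D(2)] D(1) assms(2) by auto
  then show ?thesis
    using l2_circle.independent_span_bound[OF _ C(2), of D] C D assms(1) by auto
qed

lemma card_independent_le_dim:
  assumes "C \<subseteq> S" "l2_circle.independent C" "S \<subseteq> l2_circle.span B" "finite B"
  shows "card C \<le> l2_circle.dim S"
  using dim_mono_finite_span[OF assms(1,3,4)] l2_circle.dim_eq_card_independent[OF assms(2)] by simp

text \<open>The threshold is required at \<open>n - 1\<close> because the strip lies between the cut
  lines \<open>n - 1\<close> and \<open>n\<close>. \<open>R\<close> may exceed the norm of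
  \<open>q\<close>, which leaves room for perturbed potentials with the same parameters.\<close>

locale hill_pair =
  fixes q :: l2_circle and n :: nat and R e :: real
  assumes n2: "2 \<le> n" and qR: "norm q \<le> R"
    and thr: "split_threshold R \<le> real n - 1"
    and small: "8 * (R + 1)\<^sup>2 * (gap_const / real n) \<le> e" and e_small: "e \<le> 1 / 256"
begin

abbreviation "a \<equiv> fourier_coeff q"

lemma coeff_l2: "l2_seq a" "l2_norm a \<le> R"
  using fourier_coeff_l2[of q] qR by auto

lemma e0: "0 \<le> e"
proof -
  have "0 \<le> 8 * (R + 1)\<^sup>2 * (gap_const / real n)" using gap_const_ge_1 by auto
  then show ?thesis using small by linarith
qed

lemma pair: "z \<in> strip n \<Longrightarrow> pair_modes n a z"
  using small_imp_half(2)[OF coeff_l2(2) small] e_small n2 coeff_l2 by unfold_locales auto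

lemma n_pred: "n = Suc (n - 1)" "split_threshold R \<le> real (n - 1)" "strip n = {z. cut_line (n - 1) \<le> Re z \<and> Re z \<le> cut_line n}"
proof -
  show 1: "n = Suc (n - 1)" using n2 by simp
  show "split_threshold R \<le> real (n - 1)" using thr n2 by (simp add: of_nat_diff)
  show "strip n = {z. cut_line (n - 1) \<le> Re z \<and> Re z \<le> cut_line n}"
    using strip_Suc[of "n - 1"] 1 by simp
qed

lemma lambda_strip: "lambda_plus n q \<in> strip n" "lambda_minus n q \<in> strip n"
  "cut_line (n - 1) < Re (lambda_plus n q)"
  using lambda_in_strip[OF qR n_pred(2)] unfolding n_pred(1)[symmetric] by (simp_all add: n_pred(3))

lemma other_parity_root_space:
  assumes z: "z \<in> strip n" and s': "s' \<in> {0, 1}" "s' \<noteq> par n"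
  shows "root_space (trig s' 1) q z = {0}"
proof -
  interpret pair_modes n a z by (rule pair[OF z])
  have "y = 0" if y: "y \<in> root_space (trig s' 1) q z" for y
  proof (rule ccontr)
    assume "y \<noteq> 0"
    from y this obtain v where v: "(v, 0) \<in> hill_shifted (trig s' 1) q z" "v \<noteq> 0"
      by (rule eigenvector_of_root_vector)
    note H = hill_shifted_coeff[OF v(1)]
    have odd: "\<bar>2 * j + s'\<bar> \<noteq> int n" for j
      using s' unfolding par_def by (auto; presburger)
    have "l2_coeff (2 * j + s') v = 0" for j
      by (rule eigenvector_no_low_part[where f = "\<lambda>j. l2_coeff (2 * j + s') v" and s' = s', OF l2_seq_of_abs_summable[OF H(1)]])
        (use H(4) odd in auto)
    then have "v = 0" using H(3) by simp
    then show False using v(2) by simp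
  qed
  then show ?thesis using zero_in_root_space by blast
qed

lemma algebraic_multiplicity_pair:
  assumes z: "z \<in> strip n"
  shows "algebraic_multiplicity q z = l2_circle.dim (root_space (trig (par n) 1) q z)"
    and "geometric_multiplicity q z = l2_circle.dim (eigenspace (trig (par n) 1) q z)"
proof -
  have p: "par n = 0 \<or> par n = 1" using par01[of n] by auto
  have r: "root_space (trig (1 - par n) 1) q z = {0}"
    by (rule other_parity_root_space[OF z]) (use p in auto)
  have "l2_circle.dim (eigenspace (trig (1 - par n) 1) q z) \<le> l2_circle.dim {0}"
    by (rule dim_mono_finite_span[of _ _ "{}"]) (use eigenspace_subset_root_space[of "trig (1 - par n) 1" q z] r in auto)
  then have eg: "l2_circle.dim (eigenspace (trig (1 - par n) 1) q z) = 0" by (simp add: dim_zero)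
  show "algebraic_multiplicity q z = l2_circle.dim (root_space (trig (par n) 1) q z)"
    using p
  proof
    assume "par n = 0" then show ?thesis using r by (simp add: algebraic_multiplicity_eq dim_zero)
  next
    assume "par n = 1" then show ?thesis using r by (simp add: algebraic_multiplicity_eq dim_zero)
  qed
  have *: "geometric_multiplicity q z = l2_circle.dim (eigenspace (trig 0 1) q z) + l2_circle.dim (eigenspace (trig 1 1) q z)"
    by (simp add: geometric_multiplicity_def trig_parity)
  show "geometric_multiplicity q z = l2_circle.dim (eigenspace (trig (par n) 1) q z)"
    using p
  proof
    assume "par n = 0" then show ?thesis using eg * by simp
  next
    assume "par n = 1" then show ?thesis using eg * by simp
  qed
qed

lemma eigenvalue_determinant:
  assumes z: "z \<in> strip n" and alg: "0 < algebraic_multiplicity q z"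
  shows "(pair_zeta n a z)\<^sup>2 = c_plus n a z * c_minus n a z"
proof -
  interpret pair_modes n a z by (rule pair[OF z])
  have "root_space (trig (par n) 1) q z \<noteq> {0}"
  proof
    assume "root_space (trig (par n) 1) q z = {0}"
    then have "algebraic_multiplicity q z = 0" using algebraic_multiplicity_pair(1)[OF z] dim_zero by metis
    then show False using alg by simp
  qed
  then obtain y where "y \<in> root_space (trig (par n) 1) q z" "y \<noteq> 0"
    using zero_in_root_space by blast
  then obtain v where v: "(v, 0) \<in> hill_shifted (trig (par n) 1) q z" "v \<noteq> 0"
    by (rule eigenvector_of_root_vector)
  note H = hill_shifted_coeff[OF v(1)]
  have "\<exists>j. l2_coeff (2 * j + par n) v \<noteq> 0"
  proof (rule ccontr)
    assume "\<nexists>j. l2_coeff (2 * j + par n) v \<noteq> 0"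
    then have "v = 0" using H(3) by simp
    then show False using v(2) by simp
  qed
  then obtain j where "l2_coeff (2 * j + par n) v \<noteq> 0" ..
  then show ?thesis
    using eigenvector_determinant[OF l2_seq_of_abs_summable[OF H(1)], of j] H(4) by simp
qed

text \<open>If \<open>z\<close> is a double eigenvalue, then either a Jordan chain gives an eigenvector that is isotropic for
  the reflection form, which forces one of its two low entries to dominate, or the eigenspace is
  two-dimensional and contains an eigenvector with only one low entry.\<close>

lemma double_eigenvalue_zeta:
  assumes z: "z \<in> strip n" and alg: "algebraic_multiplicity q z = 2"
  shows "cmod (pair_zeta n a z) \<le> e * (cmod (c_plus n a z) + cmod (c_minus n a z))"
proof -
  interpret pair_modes n a z by (rule pair[OF z])
  define \<sigma> where "\<sigma> = trig (par n) 1"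
  have zeta0: ?thesis if "\<zeta> = 0" using that e0 by simp
  \<comment> \<open>Without an entry at \<open>jp n\<close> there must be one at
    \<open>jm n\<close>, and \<open>\<zeta> * f (jm n) = cm * f (jp n)\<close> forces
    \<open>\<zeta> = 0\<close>.\<close>
  have single: "\<zeta> = 0" if "l2_seq f" "\<And>j. (of_real (lap s j) - z) * f j + conv a f j = 0" "f (jp n) = 0" "f i \<noteq> 0" for f i
  proof -
    have "f (jm n) \<noteq> 0"
      using eigenvector_no_low_part[OF that(1,2), of i] that(3,4) by (auto simp: low_index_iff)
    then show ?thesis using eigenvector_pair(3)[OF that(1,2)] that(3) by simp
  qed
  show ?thesis
  proof (cases "\<exists>y2 y1. (y2, y1) \<in> hill_shifted \<sigma> q z \<and> (y1, 0) \<in> hill_shifted \<sigma> q z \<and> y1 \<noteq> 0")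
    case True
    then obtain y2 y1 where y: "(y2, y1) \<in> hill_shifted \<sigma> q z" "(y1, 0) \<in> hill_shifted \<sigma> q z" "y1 \<noteq> 0" by blast
    define f1 where "f1 j = l2_coeff (2 * j + s) y1" for j
    define f2 where "f2 j = l2_coeff (2 * j + s) y2" for j
    note H1 = hill_shifted_coeff[OF y(2)[unfolded \<sigma>_def], folded f1_def]
    note H2 = hill_shifted_coeff[OF y(1)[unfolded \<sigma>_def], folded f1_def f2_def]
    have eig1: "(of_real (lap s j) - z) * f1 j + conv a f1 j = 0" for j using H1(4)[of j] by simp
    define X where "X = cmod (f1 (jp n))"
    define Y where "Y = cmod (f1 (jm n))"
    have J: "2 * (X * Y) \<le> (2 * l2_norm a * (X + Y) * \<kappa>)\<^sup>2"
      unfolding X_def Y_def by (rule jordan_chain_estimate[OF H1(1) H2(1,2) eig1 H2(4)])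
    have X0: "0 \<le> X" and Y0: "0 \<le> Y" by (auto simp: X_def Y_def)
    have \<kappa>a: "l2_norm a * \<kappa> \<le> e / 8" using small_imp_half(1)[OF coeff_l2(2) small] e_small by simp
    have "2 * l2_norm a * (X + Y) * \<kappa> = 2 * (X + Y) * (l2_norm a * \<kappa>)" by (simp only: mult_ac)
    also have "\<dots> \<le> 2 * (X + Y) * (e / 8)" using \<kappa>a X0 Y0 by (intro mult_left_mono) auto
    also have "\<dots> = (X + Y) * (e / 4)" by simp
    finally have "2 * l2_norm a * (X + Y) * \<kappa> \<le> (X + Y) * (e / 4)" .
    then have "2 * (X * Y) \<le> ((X + Y) * (e / 4))\<^sup>2"
      using J X0 Y0 gap_const_ge_1 by (intro order_trans[OF J] power_mono) auto
    also have "\<dots> \<le> (X + Y)\<^sup>2 * (e / 4)"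
    proof -
      have "e * e \<le> e * 4" using e0 e_small by (intro mult_left_mono) auto
      then have "(e / 4)\<^sup>2 \<le> e / 4" by (simp add: power2_eq_square)
      then show ?thesis unfolding power_mult_distrib by (intro mult_left_mono) auto
    qed
    finally have XY: "2 * (X * Y) \<le> (X + Y)\<^sup>2 * (e / 4)" .
    have "\<not> (X = 0 \<and> Y = 0)"
    proof
      assume "X = 0 \<and> Y = 0"
      then have "f1 j = 0" for j
        using eigenvector_no_low_part[OF l2_seq_of_abs_summable[OF H1(1)] eig1, of j] by (auto simp: low_index_iff X_def Y_def)
      then have "f1 = (\<lambda>_. 0)" by blast
      then show False using H1(3) y(3) by simp
    qed
    then have pos: "0 < X \<or> 0 < Y" using X0 Y0 by auto
    note Z = eigenvector_pair(2,3)[OF l2_seq_of_abs_summable[OF H1(1)] eig1]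
    have Zx: "cmod \<zeta> * X = cmod cp * Y" and Zy: "cmod \<zeta> * Y = cmod cm * X"
      using arg_cong[OF Z(1), of cmod] arg_cong[OF Z(2), of cmod] by (simp_all add: norm_mult X_def Y_def)
    \<comment> \<open>\<open>XY\<close> makes the smaller of the two entries at most
      \<open>e\<close> times the larger; the equation in which \<open>\<zeta>\<close> multiplies the
      larger one gives the estimate.\<close>
    show ?thesis
    proof (cases "Y \<le> X")
      case True
      then have X: "0 < X" using pos by auto
      have "2 * (X * Y) \<le> (2 * X)\<^sup>2 * (e / 4)"
        using XY True X0 Y0 e0 by (intro order_trans[OF XY] mult_right_mono power_mono) auto
      then have "X * (2 * Y) \<le> X * (X * e)" by (simp add: power2_eq_square mult_ac)
      then have "Y \<le> e * X" using X Y0 by (simp add: mult.commute)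
      then have "cmod \<zeta> * X \<le> (e * cmod cp) * X"
        unfolding Zx using mult_left_mono[of Y "e * X" "cmod cp"] by (simp add: mult_ac)
      then have "cmod \<zeta> \<le> e * cmod cp" using X by simp
      then show ?thesis using mult_nonneg_nonneg[OF e0 norm_ge_zero[of cm]] by (simp add: distrib_left)
    next
      case False
      then have Y: "0 < Y" using pos X0 by auto
      have "2 * (X * Y) \<le> (2 * Y)\<^sup>2 * (e / 4)"
        using XY False X0 Y0 e0 by (intro order_trans[OF XY] mult_right_mono power_mono) auto
      then have "Y * (2 * X) \<le> Y * (Y * e)" by (simp add: power2_eq_square mult_ac)
      then have "X \<le> e * Y" using Y X0 by (simp add: mult.commute)
      then have "cmod \<zeta> * Y \<le> (e * cmod cm) * Y"
        unfolding Zy using mult_left_mono[of X "e * Y" "cmod cm"] by (simp add: mult_ac)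
      then have "cmod \<zeta> \<le> e * cmod cm" using Y by simp
      then show ?thesis using mult_nonneg_nonneg[OF e0 norm_ge_zero[of cp]] by (simp add: distrib_left)
    qed
  next
    case False
    obtain C where C: "C \<subseteq> root_space \<sigma> q z" "l2_circle.independent C" "card C = l2_circle.dim (root_space \<sigma> q z)"
      by (rule l2_circle.basis_exists)
    have "card C = 2" using C(3) alg algebraic_multiplicity_pair(1)[OF z] by (simp add: \<sigma>_def)
    then obtain y1 y2 where y: "C = {y1, y2}" "y1 \<noteq> y2" by (auto simp: card_2_iff)
    have ne: "y1 \<noteq> 0" "y2 \<noteq> 0" using l2_circle.dependent_zero[of C] C(2) y by auto
    have e1: "(y1, 0) \<in> hill_shifted \<sigma> q z" and e2: "(y2, 0) \<in> hill_shifted \<sigma> q z"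
      using root_space_eigen_or_chain[OF False] C(1) y ne by blast+
    define f1 where "f1 j = l2_coeff (2 * j + s) y1" for j
    define f2 where "f2 j = l2_coeff (2 * j + s) y2" for j
    note H1 = hill_shifted_coeff[OF e1[unfolded \<sigma>_def], folded f1_def]
    note H2 = hill_shifted_coeff[OF e2[unfolded \<sigma>_def], folded f2_def]
    have l2: "l2_seq f1" "l2_seq f2" using H1(1) H2(1) l2_seq_of_abs_summable by auto
    have eig1: "(of_real (lap s j) - z) * f1 j + conv a f1 j = 0" for j using H1(4)[of j] by simp
    have eig2: "(of_real (lap s j) - z) * f2 j + conv a f2 j = 0" for j using H2(4)[of j] by simp
    \<comment> \<open>The coefficients of a combination that vanishes at
      \<open>jp n\<close>.\<close>
    define c1 where "c1 = f2 (jp n)"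
    define c2 where "c2 = - f1 (jp n)"
    define t where "t j = c1 * f1 j + c2 * f2 j" for j
    have t_l2: "l2_seq t" unfolding t_def by (intro l2_add(1) l2_cmult l2)
    have t_eig: "(of_real (lap s j) - z) * t j + conv a t j = 0" for j
    proof -
      have "conv a t j = c1 * conv a f1 j + c2 * conv a f2 j"
        unfolding t_def[abs_def] by (simp only: conv_add[OF coeff_l2(1) l2_cmult(1)[OF l2(1)] l2_cmult(1)[OF l2(2)]] conv_cmult)
      moreover have "(of_real (lap s j) - z) * t j = c1 * ((of_real (lap s j) - z) * f1 j) + c2 * ((of_real (lap s j) - z) * f2 j)"
        by (simp add: t_def algebra_simps)
      ultimately have "(of_real (lap s j) - z) * t j + conv a t j
          = c1 * ((of_real (lap s j) - z) * f1 j + conv a f1 j) + c2 * ((of_real (lap s j) - z) * f2 j + conv a f2 j)"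
        by (simp add: algebra_simps)
      then show ?thesis by (simp add: eig1 eig2)
    qed
    show ?thesis
    proof (cases "\<exists>i. t i \<noteq> 0")
      case True
      then obtain i where "t i \<noteq> 0" ..
      moreover have "t (jp n) = 0" by (simp add: t_def c1_def c2_def)
      ultimately show ?thesis using zeta0 single[OF t_l2 t_eig] by blast
    next
      case nt: False
      have sm: "(\<lambda>j. cmod (c * f j)) summable_on UNIV" if "(\<lambda>j. cmod (f j)) summable_on UNIV" for c :: complex and f :: "int \<Rightarrow> complex"
        using that by (simp add: norm_mult summable_on_cmult_right)
      have "l2_synth s t = scaleC c1 y1 + scaleC c2 y2"
        unfolding t_def[abs_def] using l2_synth_add[OF sm[OF H1(1)] sm[OF H2(1)], of s c1 c2]
        by (simp add: l2_synth_scale[OF H1(1)] l2_synth_scale[OF H2(1)] H1(3)[symmetric] H2(3)[symmetric])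
      moreover have "t = (\<lambda>_. 0)" using nt by auto
      ultimately have sum0: "scaleC c1 y1 + scaleC c2 y2 = 0" by simp
      have "(\<Sum>v\<in>C. scaleC ((if v = y1 then c1 else c2)) v) = 0"
        using sum0 y by simp
      then have "c1 = 0 \<and> c2 = 0"
        using l2_circle.independentD[OF C(2) _ order_refl, of "\<lambda>v. if v = y1 then c1 else c2"] y by (metis finite.emptyI finite_insert insertI1 insertI2)
      then have "f1 (jp n) = 0" by (simp add: c2_def)
      moreover have "\<exists>i. f1 i \<noteq> 0"
      proof (rule ccontr)
        assume "\<nexists>i. f1 i \<noteq> 0"
        then have "f1 = (\<lambda>_. 0)" by auto
        then show False using H1(3) ne by simp
      qed
      ultimately show ?thesis using zeta0 single[OF l2(1) eig1] by blast
    qed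
  qed
qed

text \<open>In this degenerate case both modes are eigenvectors, and the count in the strip leaves
  no further eigenvalue. It is the situation in which an alternate gap length is known to
  vanish.\<close>

lemma double_point:
  assumes z: "z \<in> strip n" "cut_line (n - 1) < Re z"
    and zero: "c_plus n a z = 0" "c_minus n a z = 0" "pair_zeta n a z = 0"
  shows "lambda_plus n q = z" "lambda_minus n q = z" "geometric_multiplicity q z = 2"
proof -
  interpret pair_modes n a z by (rule pair[OF z(1)])
  define \<sigma> where "\<sigma> = trig s 1"
  define b where "b i = l2_synth s (mode i)" for i
  have coeff_b: "l2_coeff (2 * j + s) (b i) = mode i j" for i j
    unfolding b_def by (rule l2_coeff_synth[OF mode_summable])
  have eig: "b i \<in> eigenspace \<sigma> q z" if "i = jp n \<or> i = jm n" for i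
  proof -
    have "(b i, scaleC z (b i)) \<in> hill_operator \<sigma> q"
      unfolding b_def \<sigma>_def
    proof (rule hill_operator_synth[OF par01 mode_summable])
      fix j
      show "l2_coeff (2 * j + s) (scaleC z (l2_synth s (mode i))) = of_real (lap s j) * mode i j + conv a (mode i) j"
        using mode_eigenvector[OF zero that, of j]
        unfolding l2_coeff_scale l2_coeff_synth[OF mode_summable] left_diff_distrib
        by (simp only: diff_add_eq right_minus_eq)
    qed
    then show ?thesis by (simp add: eigenspace_def hill_shifted_iff)
  qed
  have low: "mode i (jp n) = (if i = jp n then 1 else 0)" "mode i (jm n) = (if i = jm n then 1 else 0)" for i
    using low_index_iff[of "jp n" n] low_index_iff[of "jm n" n] by (auto simp: mode_def res_def)
  note ne = jp_neq_jm[OF n2]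
  have neb: "b (jp n) \<noteq> b (jm n)" using coeff_b[of "jp n"] low ne by (metis zero_neq_one)
  have ind: "l2_circle.independent {b (jp n), b (jm n)}"
  proof -
    have "u v = 0" if u: "(\<Sum>v\<in>{b (jp n), b (jm n)}. scaleC (u v) v) = 0" and v: "v \<in> {b (jp n), b (jm n)}" for u v
    proof -
      have 0: "scaleC (u (b (jp n))) (b (jp n)) + scaleC (u (b (jm n))) (b (jm n)) = 0" using u neb by simp
      have "u (b (jp n)) * mode (jp n) j + u (b (jm n)) * mode (jm n) j = 0" for j
        using arg_cong[OF 0, of "l2_coeff (2 * j + s)"] by (simp only: l2_coeff_add l2_coeff_scale coeff_b l2_coeff_0)
      from this[of "jp n"] this[of "jm n"] show ?thesis using v low ne by auto
    qed
    then show ?thesis using l2_circle.dependent_finite[of "{b (jp n), b (jm n)}"] by auto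
  qed
  have thr': "split_threshold R \<le> real n" using thr by simp
  obtain B where B: "finite B" "\<And>z s. s \<in> {0, 1} \<Longrightarrow> Re z \<le> cut_line n \<Longrightarrow> root_space (trig s 1) q z \<subseteq> l2_circle.span B"
    using eigenvalues_left(4)[OF qR thr'] by blast
  have rs: "root_space \<sigma> q z \<subseteq> l2_circle.span B"
    unfolding \<sigma>_def by (rule B(2)[OF par01]) (use z n_pred(3) in auto)
  have card2: "card {b (jp n), b (jm n)} = 2" using neb by simp
  have geo: "2 \<le> l2_circle.dim (eigenspace \<sigma> q z)"
    using card_independent_le_dim[OF _ ind _ B(1), of "eigenspace \<sigma> q z"] eig rs eigenspace_subset_root_space[of \<sigma> q z] card2
    by auto
  have le: "l2_circle.dim (eigenspace \<sigma> q z) \<le> l2_circle.dim (root_space \<sigma> q z)"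
    by (rule dim_mono_finite_span[OF eigenspace_subset_root_space rs B(1)])
  then have "2 \<le> algebraic_multiplicity q z"
    using geo algebraic_multiplicity_pair(1)[OF z(1)] by (simp add: \<sigma>_def)
  moreover have "Re z \<le> cut_line (Suc (n - 1))" unfolding n_pred(1)[symmetric] using z(1) n_pred(3) by auto
  ultimately have *: "lambda_minus n q = z \<and> lambda_plus n q = z \<and> algebraic_multiplicity q z = 2"
    using lambda_multiplicity(4)[OF qR n_pred(2) z(2)] unfolding n_pred(1)[symmetric] by simp
  then show "lambda_plus n q = z" "lambda_minus n q = z" by auto
  show "geometric_multiplicity q z = 2"
    using geo le * algebraic_multiplicity_pair[OF z(1)] by (simp add: \<sigma>_def)
qed

definition "\<rho> = cmod (c_plus n a (lambda_plus n q)) + cmod (c_minus n a (lambda_plus n q))"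

text \<open>Subtract the determinant equations at the two eigenvalues. Between them
  \<open>\<zeta>\<close> changes by about the gap \<open>g\<close>, and the product of the couplings
  by at most \<open>g * (e * (2 * \<rho> + g))\<close>. Division by the difference of the two values
  of \<open>\<zeta>\<close> shows that their sum is small, so each is about half of \<open>g\<close>
  in modulus. For \<open>g = 0\<close> the bound comes from
  \<open>double_eigenvalue_zeta\<close>.\<close>

lemma gap_estimates:
  shows "cmod (pair_zeta n a (lambda_plus n q)) \<le> \<rho>"
    and "(cmod (pair_zeta n a (lambda_plus n q)))\<^sup>2 = cmod (c_plus n a (lambda_plus n q)) * cmod (c_minus n a (lambda_plus n q))"
    and "cmod (gap_length n q) \<le> 3 * \<rho>"
    and "cmod (pair_zeta n a (lambda_plus n q)) \<le> 2 * e * \<rho> + 2 * cmod (gap_length n q)"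
proof -
  define p where "p = lambda_plus n q"
  define m where "m = lambda_minus n q"
  define g where "g = cmod (gap_length n q)"
  have g: "g = cmod (p - m)" by (simp add: g_def gap_length_def p_def m_def)
  have alg: "0 < algebraic_multiplicity q p" "0 < algebraic_multiplicity q m"
    using lambda_multiplicity(1,2)[OF qR n_pred(2)] unfolding n_pred(1)[symmetric] by (auto simp: p_def m_def)
  have ps: "p \<in> strip n" "m \<in> strip n" using lambda_strip by (auto simp: p_def m_def)
  define zp where "zp = pair_zeta n a p"
  define zm where "zm = pair_zeta n a m"
  define x where "x = c_plus n a p"
  define y where "y = c_minus n a p"
  define x' where "x' = c_plus n a m"
  define y' where "y' = c_minus n a m"
  have zp: "zp\<^sup>2 = x * y" and zm: "zm\<^sup>2 = x' * y'"
    using eigenvalue_determinant[OF ps(1) alg(1)] eigenvalue_determinant[OF ps(2) alg(2)]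
    by (auto simp: zp_def zm_def x_def y_def x'_def y'_def)
  have \<rho>: "\<rho> = cmod x + cmod y" by (simp add: \<rho>_def x_def y_def p_def)
  have \<rho>0: "0 \<le> \<rho>" by (simp add: \<rho>)
  have e1: "e \<le> 1" using e_small by simp
  note L = pair_lipschitz[OF n2 ps coeff_l2 coeff_l2 small e1, simplified, folded g]
  have Lx: "cmod (x - x') \<le> e * g" and Ly: "cmod (y - y') \<le> e * g" and Lz: "cmod ((zp - zm) - (p - m)) \<le> e * g"
    using L by (simp_all add: x_def x'_def y_def y'_def zp_def zm_def g)
  have sq_le: "cmod w \<le> cmod u + cmod v" if "w\<^sup>2 = u * v" for u v w :: complex
  proof (rule power2_le_imp_le)
    have "(cmod w)\<^sup>2 = cmod u * cmod v" using that by (metis norm_mult norm_power)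
    also have "\<dots> \<le> (cmod u + cmod v)\<^sup>2" by (simp add: power2_eq_square algebra_simps add_increasing)
    finally show "(cmod w)\<^sup>2 \<le> (cmod u + cmod v)\<^sup>2" .
  qed simp
  have zp_le: "cmod zp \<le> \<rho>" using sq_le[OF zp] by (simp add: \<rho>)
  then show "cmod (pair_zeta n a (lambda_plus n q)) \<le> \<rho>" by (simp add: zp_def p_def)
  have "(cmod zp)\<^sup>2 = cmod x * cmod y" using zp by (metis norm_mult norm_power)
  then show "(cmod (pair_zeta n a (lambda_plus n q)))\<^sup>2 = cmod (c_plus n a (lambda_plus n q)) * cmod (c_minus n a (lambda_plus n q))"
    by (simp add: zp_def p_def x_def y_def)
  have x': "cmod x' \<le> cmod x + e * g" using Lx norm_triangle_sub[of x' x] by (simp add: norm_minus_commute)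
  have y': "cmod y' \<le> cmod y + e * g" using Ly norm_triangle_sub[of y' y] by (simp add: norm_minus_commute)
  have zm_le: "cmod zm \<le> \<rho> + 2 * (e * g)" using sq_le[OF zm] x' y' by (simp add: \<rho>)
  have g0: "0 \<le> g" by (simp add: g_def)
  have eg: "e * g \<le> (1 / 256) * g" by (rule mult_right_mono[OF e_small g0])
  have g_le: "g \<le> cmod (zp - zm) + e * g"
    using Lz norm_triangle_sub[of "p - m" "zp - zm"] by (simp add: g norm_minus_commute)
  have "cmod (zp - zm) \<le> cmod zp + cmod zm" by (rule norm_triangle_ineq4)
  then have "g \<le> 3 * \<rho>" using g_le zp_le zm_le eg \<rho>0 by linarith
  then show "cmod (gap_length n q) \<le> 3 * \<rho>" by (simp add: g_def)
  have "cmod zp \<le> 2 * e * \<rho> + 2 * g"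
  proof (cases "g = 0")
    case True
    then have "m = p" using g by simp
    then have "algebraic_multiplicity q p = 2"
      using lambda_multiplicity(3)[OF qR n_pred(2)] unfolding n_pred(1)[symmetric] by (simp add: p_def m_def)
    then have "cmod zp \<le> e * \<rho>" using double_eigenvalue_zeta[OF ps(1)] by (simp add: zp_def \<rho> x_def y_def)
    then show ?thesis using True mult_nonneg_nonneg[OF e0 \<rho>0] by simp
  next
    case False
    then have gp: "0 < g" using g0 by simp
    have "(zp - zm) * (zp + zm) = (x - x') * y + x' * (y - y')"
      using zp zm by (simp add: power2_eq_square algebra_simps)
    then have "cmod (zp - zm) * cmod (zp + zm) \<le> cmod (x - x') * cmod y + cmod x' * cmod (y - y')"
      by (metis norm_mult norm_triangle_ineq)
    also have "\<dots> \<le> (e * g) * \<rho> + (\<rho> + g) * (e * g)"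
    proof (intro add_mono mult_mono Lx Ly)
      show "cmod y \<le> \<rho>" by (simp add: \<rho>)
      have "cmod x \<le> \<rho>" by (simp add: \<rho>)
      then show "cmod x' \<le> \<rho> + g" using x' eg gp by linarith
    qed (use e0 g0 \<rho>0 in auto)
    also have "\<dots> = g * (e * (2 * \<rho> + g))" by (simp add: algebra_simps)
    finally have 1: "cmod (zp - zm) * cmod (zp + zm) \<le> g * (e * (2 * \<rho> + g))" .
    have "g / 2 \<le> cmod (zp - zm)" using g_le eg gp by linarith
    then have "g / 2 * cmod (zp + zm) \<le> g * (e * (2 * \<rho> + g))"
      using 1 mult_right_mono[of "g / 2" "cmod (zp - zm)" "cmod (zp + zm)"] by simp
    then have "g * cmod (zp + zm) \<le> g * (2 * (e * (2 * \<rho> + g)))" by simp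
    then have sum: "cmod (zp + zm) \<le> 2 * (e * (2 * \<rho> + g))" using gp by simp
    have dif: "cmod (zp - zm) \<le> g + e * g"
      using Lz norm_triangle_sub[of "zp - zm" "p - m"] by (simp add: g)
    have "2 * zp = (zp + zm) + (zp - zm)" by simp
    then have "2 * cmod zp \<le> cmod (zp + zm) + cmod (zp - zm)"
      by (metis norm_mult norm_numeral norm_triangle_ineq)
    also have "\<dots> \<le> 2 * (e * (2 * \<rho> + g)) + (g + e * g)" using sum dif by simp
    also have "\<dots> = 4 * (e * \<rho>) + 3 * (e * g) + g" by (simp add: algebra_simps)
    finally show ?thesis using eg gp by linarith
  qed
  then show "cmod (pair_zeta n a (lambda_plus n q)) \<le> 2 * e * \<rho> + 2 * cmod (gap_length n q)"
    by (simp add: zp_def p_def g_def)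
qed

end

section \<open>Alternate gap lengths\<close>

lemma l2_exp_eq: "l2_exp m = l2_class (trig (2 * m))"
  unfolding l2_exp_def by (rule arg_cong[of _ _ l2_class]) (auto simp: trig_def cis_conv_exp algebra_simps)

lemma pairing_exp: "pairing (l2_exp i) (l2_exp j) = (if i + j = 0 then 1 else 0)"
proof -
  have "pairing (l2_exp i) (l2_exp j) = (\<integral>x. trig (2 * i) x * trig (2 * j) x \<partial>circle_measure)"
    unfolding l2_exp_eq by (intro pairing.abs_eq l2_rel_refl square_integrable_trig)
  also have "\<dots> = (\<integral>x. trig (2 * (i + j)) x \<partial>circle_measure)" by (simp add: trig_mult)
  finally show ?thesis by (simp only: trig_integral)
qed

lemma norm_l2_exp: "norm (l2_exp i) = 1"
  by (simp add: l2_exp_eq norm_l2_class[OF square_integrable_trig] measure_restrict_space)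

lemma scaleC_class:
  assumes "square_integrable f"
  shows "scaleC c (l2_class f) = l2_class (\<lambda>x. c * f x)"
  by (rule scaleC.abs_eq[OF l2_rel_refl[OF assms]])

lemma norm_scaleC: "norm (scaleC c y) = cmod c * norm y"
proof -
  note f = square_integrable_rep[of y]
  have "norm (scaleC c (l2_class (l2_rep y))) = cmod c * norm (l2_class (l2_rep y))"
    unfolding scaleC_class[OF f] norm_l2_class[OF f] norm_l2_class[OF square_integrable_cmult[OF f]]
    by (simp add: norm_mult power_mult_distrib real_sqrt_mult)
  then show ?thesis by (simp add: l2_class_rep)
qed

lemma l2_cos_eq:
  "l2_cos n \<xi> = scaleC (trig (2 * int n) \<xi> / 2) (l2_exp (int n)) + scaleC (trig (- 2 * int n) \<xi> / 2) (l2_exp (- int n))"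
proof -
  have *: "of_real (cos (2 * real n * pi * (x + \<xi>))) =
      trig (2 * int n) \<xi> / 2 * trig (2 * int n) x + trig (- 2 * int n) \<xi> / 2 * trig (2 * (- int n)) x" for x
  proof -
    have t: "2 * real n * pi * (x + \<xi>) = pi * of_int (2 * int n) * (\<xi> + x)" by (simp add: algebra_simps)
    have "trig (2 * int n) \<xi> * trig (2 * int n) x + trig (- (2 * int n)) \<xi> * trig (- (2 * int n)) x
        = trig (2 * int n) (\<xi> + x) + trig (- (2 * int n)) (\<xi> + x)"
      by (simp only: trig_add)
    also have "\<dots> = 2 * of_real (cos (2 * real n * pi * (x + \<xi>)))"
      unfolding t by (simp add: trig_def complex_eq_iff)
    finally show ?thesis by (simp add: add_divide_distrib[symmetric])
  qed
  note sq = square_integrable_cmult[OF square_integrable_trig]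
  have r: "l2_rel (\<lambda>x. c * trig m x) (\<lambda>x. c * trig m x)" for c m by (rule l2_rel_refl[OF sq])
  show ?thesis
    unfolding l2_cos_def l2_exp_eq * scaleC_class[OF square_integrable_trig] plus_l2_circle.abs_eq[OF r r] by (rule refl)
qed

lemma pairing_cos:
  assumes "1 \<le> n"
  shows "pairing (l2_cos n \<xi>) (scaleC \<alpha> (l2_exp (int n)) + scaleC \<beta> (l2_exp (- int n)))
    = (trig (- 2 * int n) \<xi> * \<alpha> + trig (2 * int n) \<xi> * \<beta>) / 2"
proof -
  have r: "pairing x (u + v) = pairing x u + pairing x v" "pairing x (scaleC c u) = c * pairing x u" for x u v c
    by (simp_all add: pairing_commute[of x] pairing_add_left pairing_scale_left)
  show ?thesis
    unfolding l2_cos_eq using assms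
    by (simp add: pairing_add_left pairing_scale_left r pairing_exp add_divide_distrib mult.commute)
qed

text \<open>Cauchy-Schwarz for the real inner product, after a rotation by a unimodular
  \<open>u\<close> that makes the integral real and nonnegative.\<close>

lemma pairing_le: "cmod (pairing g h) \<le> norm g * norm h"
proof -
  define f k where "f = l2_rep g" and "k = l2_rep h"
  have f: "square_integrable f" and k: "square_integrable k" by (simp_all add: f_def k_def square_integrable_rep)
  have gf: "g = l2_class f" and hk: "h = l2_class k" by (simp_all add: f_def k_def l2_class_rep)
  define p where "p = (\<integral>x. f x * k x \<partial>circle_measure)"
  have p: "pairing g h = p" unfolding gf hk p_def by (rule pairing.abs_eq[OF l2_rel_refl[OF f] l2_rel_refl[OF k]])
  define u where "u = (if p = 0 then 1 else cnj (sgn p))"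
  have u: "cmod u = 1" "u * p = of_real (cmod p)"
  proof -
    have "cnj (sgn p) * p = of_real (cmod p)" if "p \<noteq> 0"
    proof -
      have "cnj p * p = of_real (cmod p) * of_real (cmod p)"
        using complex_norm_square[of p] by (simp add: power2_eq_square mult.commute)
      then show ?thesis using that by (simp add: sgn_div_norm scaleR_conv_of_real divide_inverse mult.assoc)
    qed
    then show "cmod u = 1" "u * p = of_real (cmod p)" by (auto simp: u_def norm_sgn)
  qed
  define k' where "k' x = cnj u * cnj (k x)" for x
  have k': "square_integrable k'" unfolding k'_def by (intro square_integrable_cmult square_integrable_cnj k)
  have "inner g (l2_class k') = (\<integral>x. Re (f x * cnj (k' x)) \<partial>circle_measure)"
    unfolding gf by (rule inner_l2_circle.abs_eq[OF l2_rel_refl[OF f] l2_rel_refl[OF k']])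
  also have "\<dots> = (\<integral>x. Re (u * (f x * k x)) \<partial>circle_measure)"
    by (simp only: k'_def complex_cnj_mult complex_cnj_cnj mult.left_commute)
  also have "\<dots> = Re (\<integral>x. u * (f x * k x) \<partial>circle_measure)"
    by (rule integral_Re) (intro integrable_mult_right integrable_mult_square_integrable f k)
  also have "\<dots> = cmod p" by (simp add: p_def[symmetric] u(2))
  finally have "cmod p \<le> norm g * norm (l2_class k')" using norm_cauchy_schwarz[of g "l2_class k'"] by simp
  also have "norm (l2_class k') = norm h"
    unfolding hk norm_l2_class[OF k] norm_l2_class[OF k'] by (simp add: k'_def norm_mult u(1))
  finally show ?thesis by (simp add: p)
qed

lemma scaleR_scaleC: "r *\<^sub>R y = scaleC (of_real r) y"
  by transfer (simp add: l2_rel_def square_integrable_cmult)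

lemma bounded_linear_pairing: "bounded_linear (pairing g)"
proof (rule bounded_linear_intro[where K = "norm g"])
  show "pairing g (x + y) = pairing g x + pairing g y" for x y
    by (simp add: pairing_commute[of g] pairing_add_left)
  show "pairing g (r *\<^sub>R x) = r *\<^sub>R pairing g x" for r x
    by (simp add: pairing_commute[of g] scaleR_scaleC pairing_scale_left scaleR_conv_of_real)
  show "norm (pairing g x) \<le> norm x * norm g" for x
    using pairing_le[of g x] by (simp add: mult.commute)
qed

text \<open>The mean value inequality applied to \<open>f\<close> minus the linear functional
  \<open>pairing t\<close>.\<close>

lemma gradient_mean_value:
  assumes der: "\<And>p. (f has_derivative pairing (d p)) (at p)"
    and near: "\<And>p. norm p \<le> R \<Longrightarrow> norm (d p - t) \<le> B"
    and "norm p \<le> R" "norm q \<le> R"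
  shows "cmod (f p - f q - pairing t (p - q)) \<le> B * norm (p - q)"
proof -
  have bl: "bounded_linear (pairing t)" by (rule bounded_linear_pairing)
  have "norm ((f p - pairing t p) - (f q - pairing t q)) \<le> B * norm (p - q)"
  proof (rule differentiable_bound[where S = "cball 0 R" and f' = "\<lambda>p. pairing (d p - t)"])
    fix x :: l2_circle assume x: "x \<in> cball 0 R"
    have "((\<lambda>p. f p - pairing t p) has_derivative (\<lambda>h. pairing (d x) h - pairing t h)) (at x)"
      by (intro has_derivative_diff der bounded_linear_imp_has_derivative bl)
    moreover have "pairing (d x) h - pairing t h = pairing (d x - t) h" for h
      using pairing_add_left[of "d x - t" t h] by simp
    ultimately show "((\<lambda>p. f p - pairing t p) has_derivative pairing (d x - t)) (at x within cball 0 R)"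
      by (simp add: has_derivative_at_withinI)
    have "onorm (pairing (d x - t)) \<le> norm (d x - t)"
      by (rule onorm_bound) (simp_all add: pairing_le)
    then show "onorm (pairing (d x - t)) \<le> B" using near[of x] x by simp
  qed (use assms in auto)
  then show ?thesis
    unfolding linear_diff[OF bounded_linear.linear[OF bl], of p q] by (simp add: algebra_simps)
qed

definition two_mode_shift :: "nat \<Rightarrow> complex \<Rightarrow> complex \<Rightarrow> l2_circle" where
  "two_mode_shift n \<alpha> \<beta> = scaleC \<alpha> (l2_exp (int n)) + scaleC \<beta> (l2_exp (- int n))"

lemma norm_two_mode_shift: "norm (two_mode_shift n \<alpha> \<beta>) \<le> cmod \<alpha> + cmod \<beta>"
  unfolding two_mode_shift_def by (rule order_trans[OF norm_triangle_ineq]) (simp add: norm_scaleC norm_l2_exp)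

lemma fourier_coeff_add: "fourier_coeff (p + q) k = fourier_coeff p k + fourier_coeff q k"
  by (simp add: fourier_coeff_def pairing_add_left)

lemma fourier_coeff_diff: "fourier_coeff (p - q) k = fourier_coeff p k - fourier_coeff q k"
  using fourier_coeff_add[of "p - q" q k] by simp

lemma fourier_coeff_two_mode_shift:
  "fourier_coeff (two_mode_shift n \<alpha> \<beta>) k = (if k = int n then \<alpha> else 0) + (if k = - int n then \<beta> else 0)"
  by (simp add: two_mode_shift_def fourier_coeff_def pairing_add_left pairing_scale_left pairing_exp)

lemma two_mode_shift_diff: "two_mode_shift n \<alpha> \<beta> - two_mode_shift n \<alpha>' \<beta>' = two_mode_shift n (\<alpha> - \<alpha>') (\<beta> - \<beta>')"
  by (simp add: two_mode_shift_def l2_circle.scale_left_diff_distrib algebra_simps)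

lemma two_mode_shift_0: "two_mode_shift n 0 0 = 0"
  by (simp add: two_mode_shift_def)

text \<open>The three conditions \<open>c_plus = c_minus = pair_zeta = 0\<close> are solved by contraction for the two corrections
  of the potential and the spectral parameter.\<close>

lemma (in hill_pair) collapsed_neighbour:
  assumes R1: "norm q \<le> R1" "33 * R1 \<le> R"
  obtains \<alpha> \<beta> where "cmod \<alpha> \<le> 4 * \<rho>" "cmod \<beta> \<le> 4 * \<rho>"
    "cmod (\<alpha> + c_plus n a (lambda_plus n q)) \<le> 12 * e * \<rho>" "cmod (\<beta> + c_minus n a (lambda_plus n q)) \<le> 12 * e * \<rho>"
    "norm (q + two_mode_shift n \<alpha> \<beta>) \<le> R"
    "lambda_plus n (q + two_mode_shift n \<alpha> \<beta>) = lambda_minus n (q + two_mode_shift n \<alpha> \<beta>)"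
    "geometric_multiplicity (q + two_mode_shift n \<alpha> \<beta>) (lambda_plus n (q + two_mode_shift n \<alpha> \<beta>)) = 2"
proof -
  define z where "z = lambda_plus n q"
  have zs: "z \<in> strip n" using lambda_strip by (simp add: z_def)
  interpret pair_modes n a z by (rule pair[OF zs])
  have R10: "0 \<le> R1" using R1(1) norm_ge_zero order_trans by blast
  have na: "l2_norm a \<le> R1" using fourier_coeff_l2(2)[of q] R1(1) by simp
  have e1: "e \<le> 1" using e_small by simp
  have \<rho>: "\<rho> = cmod cp + cmod cm" by (simp add: \<rho>_def z_def)
  have \<rho>0: "0 \<le> \<rho>" by (simp add: \<rho>)
  have cz: "cmod \<zeta> \<le> \<rho>" using gap_estimates(1) by (simp add: z_def)
  have c: "cmod cp \<le> 2 * R1" "cmod cm \<le> 2 * R1" "cmod (y (jp n) (jp n)) \<le> 2 * R1"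
    using y_le[of "par n" "jm n" "jp n"] y_le[of "par n" "jp n" "jm n"] y_le[of "par n" "jp n" "jp n"] na
    by (auto simp: c_plus_def c_minus_def)
  have \<rho>R: "\<rho> \<le> 4 * R1" using c by (simp add: \<rho>)
  have zD: "cmod (z - of_real ((pi * real n)\<^sup>2)) \<le> 6 * R1"
  proof -
    have "z - of_real ((pi * real n)\<^sup>2) = \<zeta> + y (jp n) (jp n)" by (simp add: pair_zeta_def)
    then show ?thesis using norm_triangle_ineq[of \<zeta> "y (jp n) (jp n)"] cz \<rho>R c(3) by simp
  qed
  \<comment> \<open>22 = 6 + 16: the parameter starts within \<open>6 * R1\<close> of the centre of
    the strip and moves by at most \<open>4 * \<rho> \<le> 16 * R1\<close>;
    \<open>strip_near_center\<close> allows a total of \<open>n\<close>.\<close>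
  have nR: "22 * R1 \<le> real n"
  proof -
    have R0': "0 \<le> R" using R10 R1(2) by simp
    have "1 * 1 \<le> (2 * R + 1) * (2 * R + 1)" using R0' by (intro mult_mono) auto
    then have "(2 * R + 1) * 1 \<le> (2 * R + 1) * ((2 * R + 1) * (2 * R + 1))" using R0' by (intro mult_left_mono) auto
    then have 1: "2 * R + 1 \<le> (2 * R + 1) ^ 3" by (simp add: power3_eq_cube mult_ac)
    have "1 \<le> gap_const\<^sup>2" using gap_const_ge_1 by simp
    then have "1 * (2 * R + 1) ^ 3 \<le> (16 * gap_const\<^sup>2) * (2 * R + 1) ^ 3" using R0' by (intro mult_right_mono) auto
    then have "2 * R + 1 \<le> split_threshold R" using 1 by (simp add: split_threshold_def)
    then show ?thesis using thr R1(2) R10 by linarith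
  qed
  define b where "b f = fourier_coeff (q + two_mode_shift n (f 0) (f 1))" for f :: "nat \<Rightarrow> complex"
  define m where "m f = z + f 2" for f :: "nat \<Rightarrow> complex"
  \<comment> \<open>Newton's map with the identity as approximate derivative. The unknowns are the
    changes \<open>f 0\<close>, \<open>f 1\<close> of the two coefficients and \<open>f 2\<close> of
    the parameter; the other components of the image are 0, so \<open>nat\<close> can serve as index
    type.\<close>
  define \<Phi> where "\<Phi> f i = (if i = 0 then f 0 - c_plus n (b f) (m f) else if i = 1 then f 1 - c_minus n (b f) (m f)
      else if i = 2 then f 2 - pair_zeta n (b f) (m f) else 0)" for f :: "nat \<Rightarrow> complex" and i :: nat
  have b_l2: "l2_seq (b f)" for f by (simp add: b_def fourier_coeff_l2)
  \<comment> \<open>33 = 1 + 16 + 16, since both shifts are at most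
    \<open>4 * \<rho> \<le> 16 * R1\<close>.\<close>
  have qf: "norm (q + two_mode_shift n (f 0) (f 1)) \<le> R" if "\<And>i. cmod (f i) \<le> 4 * \<rho>" for f :: "nat \<Rightarrow> complex"
    using norm_triangle_ineq[of q "two_mode_shift n (f 0) (f 1)"] norm_two_mode_shift[of n "f 0" "f 1"] that[of 0] that[of 1]
      R1 \<rho>R by linarith
  have b_R: "l2_norm (b f) \<le> R" if "\<And>i. cmod (f i) \<le> 4 * \<rho>" for f
    using fourier_coeff_l2(2)[of "q + two_mode_shift n (f 0) (f 1)"] qf[where f = f, OF that] by (simp add: b_def)
  have m_near: "m f \<in> strip n" "cut_line (n - 1) < Re (m f)" if f: "\<And>i. cmod (f i) \<le> 4 * \<rho>" for f
  proof -
    have "cmod (m f - of_real ((pi * real n)\<^sup>2)) \<le> cmod (z - of_real ((pi * real n)\<^sup>2)) + cmod (f 2)"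
      using norm_triangle_ineq[of "z - of_real ((pi * real n)\<^sup>2)" "f 2"] by (simp add: m_def algebra_simps)
    also have "\<dots> \<le> real n" using zD f[of 2] \<rho>R nR by linarith
    finally have "cmod (m f - of_real ((pi * real n)\<^sup>2)) \<le> real n" .
    from strip_near_center[OF n2 this] show "m f \<in> strip n" "cut_line (n - 1) < Re (m f)"
      using n2 by (simp_all add: cut_line_def of_nat_diff)
  qed
  have diff: "cmod (\<Phi> f i - \<Phi> g i) \<le> e * (3 * d)"
    if f: "\<And>i. cmod (f i) \<le> 4 * \<rho>" and g: "\<And>i. cmod (g i) \<le> 4 * \<rho>" and d: "\<And>i. cmod (f i - g i) \<le> d" for f g d i
  proof -
    have d0: "0 \<le> d" using d[of 0] norm_ge_zero order_trans by blast
    have bd: "b f k - b g k = fourier_coeff (two_mode_shift n (f 0 - g 0) (f 1 - g 1)) k" for k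
      by (simp add: b_def two_mode_shift_diff[symmetric] fourier_coeff_add fourier_coeff_diff)
    have "l2_norm (\<lambda>k. b f k - b g k) \<le> norm (two_mode_shift n (f 0 - g 0) (f 1 - g 1))"
      unfolding bd by (rule fourier_coeff_l2(2))
    \<comment> \<open>Two coefficients and the parameter change by at most \<open>d\<close> each,
      hence the 3 in \<open>diff\<close>.\<close>
    also have "\<dots> \<le> 2 * d" using norm_two_mode_shift[of n "f 0 - g 0" "f 1 - g 1"] d[of 0] d[of 1] by linarith
    finally have "l2_norm (\<lambda>k. b f k - b g k) + cmod (m f - m g) \<le> 3 * d" using d[of 2] by (simp add: m_def)
    then have D: "e * (l2_norm (\<lambda>k. b f k - b g k) + cmod (m f - m g)) \<le> e * (3 * d)" by (rule mult_left_mono[OF _ e0])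
    note L = order_trans[OF pair_lipschitz(1)[OF n2 m_near(1)[where f = f, OF f] m_near(1)[where f = g, OF g] b_l2 b_R[where f = f, OF f] b_l2 b_R[where f = g, OF g] small e1] D]
      order_trans[OF pair_lipschitz(2)[OF n2 m_near(1)[where f = f, OF f] m_near(1)[where f = g, OF g] b_l2 b_R[where f = f, OF f] b_l2 b_R[where f = g, OF g] small e1] D]
      order_trans[OF pair_lipschitz(3)[OF n2 m_near(1)[where f = f, OF f] m_near(1)[where f = g, OF g] b_l2 b_R[where f = f, OF f] b_l2 b_R[where f = g, OF g] small e1] D]
    have k: "b f (int n) - b g (int n) = f 0 - g 0" "b f (- int n) - b g (- int n) = f 1 - g 1" "b f 0 - b g 0 = 0"
      unfolding bd using n2 by (auto simp: fourier_coeff_two_mode_shift)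
    have mm: "m f - m g = f 2 - g 2" by (simp add: m_def)
    have swap: "cmod (x - u - (x' - u')) \<le> c" if "cmod (u - u' - (x - x')) \<le> c" for x u x' u' :: complex and c
      using that norm_minus_cancel[of "u - u' - (x - x')"] by (simp add: algebra_simps)
    show ?thesis
      using L[unfolded k mm diff_0_right, THEN swap] e0 d0 unfolding \<Phi>_def by auto
  qed
  have base: "cmod (\<Phi> (\<lambda>_. 0) i) \<le> \<rho>" for i
    using cz \<rho>0 by (auto simp: \<Phi>_def b_def m_def two_mode_shift_0 \<rho>)
  have A0: "0 \<le> 4 * \<rho>" using \<rho>0 by simp
  have zero: "cmod ((\<lambda>_. 0) i) \<le> 4 * \<rho>" for i :: nat using A0 by simp
  have "\<exists>f. (\<forall>i. cmod (f i) \<le> 4 * \<rho>) \<and> (\<forall>i. \<Phi> f i = f i)"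
  proof (rule sup_norm_fixpoint[of "4 * \<rho>" \<Phi>])
    fix f :: "nat \<Rightarrow> complex" and i assume f: "\<And>i. cmod (f i) \<le> 4 * \<rho>"
    have "cmod (\<Phi> f i - \<Phi> (\<lambda>_. 0) i) \<le> e * (3 * (4 * \<rho>))"
      by (rule diff[OF f zero]) (use f in simp_all)
    also have "\<dots> \<le> (1 / 256) * (3 * (4 * \<rho>))" by (rule mult_right_mono[OF e_small]) (use A0 in simp)
    finally show "cmod (\<Phi> f i) \<le> 4 * \<rho>"
      using base[of i] \<rho>0 norm_triangle_sub[of "\<Phi> f i" "\<Phi> (\<lambda>_. 0) i"] by linarith
  next
    fix f g :: "nat \<Rightarrow> complex" and d i
    assume fg: "\<And>i. cmod (f i) \<le> 4 * \<rho>" "\<And>i. cmod (g i) \<le> 4 * \<rho>" "\<And>i. cmod (f i - g i) \<le> d"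
    have d0: "0 \<le> d" using fg(3)[of 0] norm_ge_zero order_trans by blast
    have "cmod (\<Phi> f i - \<Phi> g i) \<le> e * (3 * d)" by (rule diff[OF fg])
    also have "\<dots> \<le> (1 / 256) * (3 * d)" by (rule mult_right_mono[OF e_small]) (use d0 in simp)
    finally show "cmod (\<Phi> f i - \<Phi> g i) \<le> d / 2" using d0 by linarith
  qed (use A0 in blast)+
  then obtain f where f: "\<And>i. cmod (f i) \<le> 4 * \<rho>" and fix_f: "\<And>i. \<Phi> f i = f i" by blast
  have vanish: "c_plus n (b f) (m f) = 0" "c_minus n (b f) (m f) = 0" "pair_zeta n (b f) (m f) = 0"
    using fix_f[of 0] fix_f[of 1] fix_f[of 2] by (simp_all add: \<Phi>_def)
  \<comment> \<open>The image of 0 consists of minus the couplings and minus \<open>\<zeta>\<close>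
    at \<open>q\<close> itself, so this measures the distance of the solution from the linear
    guess.\<close>
  have close: "cmod (f i - \<Phi> (\<lambda>_. 0) i) \<le> e * (3 * (4 * \<rho>))" for i
    unfolding fix_f[of i, symmetric] by (rule diff[OF f zero]) (use f in simp_all)
  interpret q0: hill_pair "q + two_mode_shift n (f 0) (f 1)" n R e
    by unfold_locales (use n2 qf[where f = f, OF f] thr small e_small in auto)
  note P = q0.double_point[OF m_near[where f = f, OF f], folded b_def, OF vanish]
  show thesis
  proof
    show "cmod (f 0) \<le> 4 * \<rho>" "cmod (f 1) \<le> 4 * \<rho>" by (rule f)+
    show "cmod (f 0 + c_plus n a (lambda_plus n q)) \<le> 12 * e * \<rho>" "cmod (f 1 + c_minus n a (lambda_plus n q)) \<le> 12 * e * \<rho>"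
      using close[of 0] close[of 1] by (simp_all add: \<Phi>_def b_def m_def two_mode_shift_0 z_def mult_ac)
    show "norm (q + two_mode_shift n (f 0) (f 1)) \<le> R" by (rule qf[where f = f, OF f])
    show "lambda_plus n (q + two_mode_shift n (f 0) (f 1)) = lambda_minus n (q + two_mode_shift n (f 0) (f 1))"
      using P by simp
    show "geometric_multiplicity (q + two_mode_shift n (f 0) (f 1)) (lambda_plus n (q + two_mode_shift n (f 0) (f 1))) = 2"
      using P by simp
  qed
qed

text \<open>From \<open>q\<close> to the collapsed potential the mean value inequality gives
  \<open>\<delta> n q = - P\<close> up to \<open>\<rho> / 16\<close>, where \<open>P\<close> pairs
  the cosine with the shift. The phase \<open>\<xi>\<close> is arbitrary, so \<open>P\<close> may
  vanish if \<open>\<alpha>\<close> and \<open>\<beta>\<close> have equal modulus, and only half the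
  difference of the moduli is a lower bound. If the gap is small, this difference is large, because
  \<open>(x - y)\<^sup>2 = (x + y)\<^sup>2 - 4 * x * y\<close> for the moduli of the couplings,
  whose product is the squared modulus of \<open>\<zeta>\<close>.\<close>

lemma (in hill_pair) triangle_size_estimates:
  assumes R1: "norm q \<le> R1" "33 * R1 \<le> R"
    and der: "\<And>p. (\<delta> n has_derivative pairing (d p)) (at p)"
    and zero: "\<And>p. lambda_plus n p = lambda_minus n p \<Longrightarrow> geometric_multiplicity p (lambda_plus n p) = 2 \<Longrightarrow> \<delta> n p = 0"
    and near: "\<And>p. norm p \<le> R \<Longrightarrow> norm (d p - l2_cos n \<xi>) \<le> 1 / 32"
  shows "\<rho> \<le> 16 * triangle_size \<delta> n q" "triangle_size \<delta> n q \<le> 6 * \<rho>"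
proof -
  obtain \<alpha> \<beta> where ab: "cmod \<alpha> \<le> 4 * \<rho>" "cmod \<beta> \<le> 4 * \<rho>"
    "cmod (\<alpha> + c_plus n a (lambda_plus n q)) \<le> 12 * e * \<rho>" "cmod (\<beta> + c_minus n a (lambda_plus n q)) \<le> 12 * e * \<rho>"
    and q0: "norm (q + two_mode_shift n \<alpha> \<beta>) \<le> R"
    "lambda_plus n (q + two_mode_shift n \<alpha> \<beta>) = lambda_minus n (q + two_mode_shift n \<alpha> \<beta>)"
    "geometric_multiplicity (q + two_mode_shift n \<alpha> \<beta>) (lambda_plus n (q + two_mode_shift n \<alpha> \<beta>)) = 2"
    by (rule collapsed_neighbour[OF R1])
  define x where "x = c_plus n a (lambda_plus n q)"
  define y where "y = c_minus n a (lambda_plus n q)"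
  define \<zeta> where "\<zeta> = pair_zeta n a (lambda_plus n q)"
  define g where "g = cmod (gap_length n q)"
  define D where "D = cmod (\<delta> n q)"
  have \<rho>: "\<rho> = cmod x + cmod y" by (simp add: \<rho>_def x_def y_def)
  have \<rho>0: "0 \<le> \<rho>" by (simp add: \<rho>)
  have e\<rho>: "12 * e * \<rho> \<le> 12 / 256 * \<rho>" using mult_right_mono[OF e_small \<rho>0] by simp
  have A: "cmod \<alpha> \<le> cmod x + 12 * e * \<rho>" "cmod x \<le> cmod \<alpha> + 12 * e * \<rho>"
    using ab(3) norm_triangle_ineq2[of \<alpha> "- x"] norm_triangle_ineq2[of "- x" \<alpha>]
    by (simp_all add: x_def[symmetric] norm_minus_commute[of "- x"])
  have B: "cmod \<beta> \<le> cmod y + 12 * e * \<rho>" "cmod y \<le> cmod \<beta> + 12 * e * \<rho>"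
    using ab(4) norm_triangle_ineq2[of \<beta> "- y"] norm_triangle_ineq2[of "- y" \<beta>]
    by (simp_all add: y_def[symmetric] norm_minus_commute[of "- y"])
  define P where "P = (trig (- 2 * int n) \<xi> * \<alpha> + trig (2 * int n) \<xi> * \<beta>) / 2"
  have "cmod (\<delta> n (q + two_mode_shift n \<alpha> \<beta>) - \<delta> n q - pairing (l2_cos n \<xi>) (q + two_mode_shift n \<alpha> \<beta> - q))
      \<le> 1 / 32 * norm (q + two_mode_shift n \<alpha> \<beta> - q)"
    by (rule gradient_mean_value[OF der near q0(1) qR])
  moreover have "\<delta> n (q + two_mode_shift n \<alpha> \<beta>) = 0" by (rule zero[OF q0(2,3)])
  moreover have "pairing (l2_cos n \<xi>) (q + two_mode_shift n \<alpha> \<beta> - q) = P"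
    unfolding P_def using n2 pairing_cos[of n \<xi> \<alpha> \<beta>] by (simp add: two_mode_shift_def)
  ultimately have "cmod (\<delta> n q + P) \<le> 1 / 32 * (cmod \<alpha> + cmod \<beta>)"
    using norm_two_mode_shift[of n \<alpha> \<beta>] norm_minus_cancel[of "\<delta> n q + P"] by simp
  moreover have "cmod \<alpha> + cmod \<beta> \<le> 2 * \<rho>" using A(1) B(1) e\<rho> \<rho>0 \<rho> by linarith
  ultimately have DP: "cmod (\<delta> n q + P) \<le> 1 / 16 * \<rho>" by simp
  have P: "2 * cmod P \<le> cmod \<alpha> + cmod \<beta>" "\<bar>cmod \<alpha> - cmod \<beta>\<bar> \<le> 2 * cmod P"
    using norm_triangle_ineq[of "trig (- 2 * int n) \<xi> * \<alpha>" "trig (2 * int n) \<xi> * \<beta>"]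
      norm_triangle_ineq2[of "trig (- 2 * int n) \<xi> * \<alpha>" "- (trig (2 * int n) \<xi> * \<beta>)"]
      norm_triangle_ineq2[of "- (trig (2 * int n) \<xi> * \<beta>)" "trig (- 2 * int n) \<xi> * \<alpha>"]
    by (auto simp: P_def norm_mult norm_divide norm_minus_commute[of "- (trig (2 * int n) \<xi> * \<beta>)"] abs_le_iff)
  have D_le: "D \<le> cmod P + 1 / 16 * \<rho>" "cmod P \<le> D + 1 / 16 * \<rho>"
    using DP norm_triangle_ineq2[of "\<delta> n q" "- P"] norm_triangle_ineq2[of "- P" "\<delta> n q"]
    by (simp_all add: D_def norm_minus_commute[of "- P"])
  note G = gap_estimates[folded \<zeta>_def x_def y_def g_def]
  have size: "triangle_size \<delta> n q = g + D" by (simp add: triangle_size_def g_def D_def)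
  have "D \<le> 3 * \<rho>" using D_le(1) P(1) A(1) B(1) e\<rho> \<rho>0 \<rho> by linarith
  then show "triangle_size \<delta> n q \<le> 6 * \<rho>" using G(3) by (simp add: size)
  have D0: "0 \<le> D" and g0: "0 \<le> g" by (simp_all add: D_def g_def)
  show "\<rho> \<le> 16 * triangle_size \<delta> n q"
  proof (cases "g \<le> \<rho> / 16")
    case True
    have "cmod \<zeta> \<le> \<rho> / 4" using G(4) e\<rho> True \<rho>0 by linarith
    then have "(cmod \<zeta>)\<^sup>2 \<le> (\<rho> / 4)\<^sup>2" by (rule power_mono) simp
    then have xy: "cmod x * cmod y \<le> \<rho>\<^sup>2 / 16" using G(2) by (simp add: power_divide)
    have "(\<rho> / 2)\<^sup>2 = \<rho>\<^sup>2 / 4" by (simp add: power_divide)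
    then have "(\<rho> / 2)\<^sup>2 \<le> \<rho>\<^sup>2 - 4 * (cmod x * cmod y)"
      using xy zero_le_power2[of \<rho>] by linarith
    also have "\<dots> = \<bar>cmod x - cmod y\<bar>\<^sup>2" by (simp add: \<rho> power2_eq_square algebra_simps)
    finally have "\<rho> / 2 \<le> \<bar>cmod x - cmod y\<bar>" by (rule power2_le_imp_le) simp
    moreover have "\<bar>cmod x - cmod y\<bar> \<le> \<bar>cmod \<alpha> - cmod \<beta>\<bar> + 2 * (12 * e * \<rho>)" using A B by linarith
    ultimately have "\<rho> / 2 \<le> 2 * cmod P + 2 * (12 * e * \<rho>)" using P(2) by (meson add_right_mono order_trans)
    then have "\<rho> / 2 \<le> 2 * cmod P + 2 * (12 / 256 * \<rho>)" using e\<rho> by linarith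
    then show ?thesis using D_le(2) \<rho>0 g0 unfolding size by argo
  qed (use D0 in \<open>simp add: size\<close>)
qed


text \<open>\<open>33 * norm q\<close> is the radius that \<open>collapsed_neighbour\<close> asks
  for. On this ball the gradient error is at most \<open>B / n\<close>, so it and the other
  conditions are satisfied for large \<open>n\<close>.\<close>

lemma triangle_size_comparable:
  assumes "alternate_gap_lengths \<delta>"
  shows "\<forall>\<^sub>F n in sequentially. lambda_plus n q \<in> strip n \<and>
    cmod (c_plus n (fourier_coeff q) (lambda_plus n q)) + cmod (c_minus n (fourier_coeff q) (lambda_plus n q)) \<le> 16 * triangle_size \<delta> n q \<and>
    triangle_size \<delta> n q \<le> 6 * (cmod (c_plus n (fourier_coeff q) (lambda_plus n q)) + cmod (c_minus n (fourier_coeff q) (lambda_plus n q)))"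
proof -
  obtain d \<xi> C where der: "\<And>n p. 1 \<le> n \<Longrightarrow> (\<delta> n has_derivative pairing (d n p)) (at p)"
    and zero: "\<And>n p. 1 \<le> n \<Longrightarrow> lambda_plus n p = lambda_minus n p \<Longrightarrow> geometric_multiplicity p (lambda_plus n p) = 2 \<Longrightarrow> \<delta> n p = 0"
    and bdd: "\<And>R. bounded (C ` {0..R})" and near: "\<And>n p. 1 \<le> n \<Longrightarrow> norm (d n p - l2_cos n (\<xi> n)) \<le> C (norm p) / real n"
    using assms unfolding alternate_gap_lengths_def by metis
  define R where "R = 33 * norm q"
  obtain B where B: "\<And>r. r \<in> {0..R} \<Longrightarrow> \<bar>C r\<bar> \<le> B"
    using bdd[of R] unfolding bounded_iff by (metis image_eqI real_norm_def)
  have "\<forall>\<^sub>F n in sequentially. max (split_threshold R + 3) (max (256 * (8 * (R + 1)\<^sup>2 * gap_const)) (32 * B)) \<le> real n"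
    using filterlim_real_sequentially unfolding filterlim_at_top by blast
  then show ?thesis
  proof eventually_elim
    case (elim n)
    have thr0: "0 \<le> split_threshold R" using gap_const_ge_1 by (simp add: split_threshold_def R_def)
    then have n: "3 \<le> real n" using elim by simp
    interpret hill_pair q n R "1 / 256"
    proof
      show "2 \<le> n" "norm q \<le> R" using n by (simp_all add: R_def)
      show "split_threshold R \<le> real n - 1" using elim by simp
      show "8 * (R + 1)\<^sup>2 * (gap_const / real n) \<le> 1 / 256" using elim n by (simp add: field_simps)
    qed simp
    have "norm (d n p - l2_cos n (\<xi> n)) \<le> 1 / 32" if "norm p \<le> R" for p
    proof -
      have "C (norm p) \<le> B" using B[of "norm p"] that by auto
      then have "C (norm p) \<le> real n / 32" using elim by simp
      then have "C (norm p) / real n \<le> 1 / 32" using n by (simp add: field_simps)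
      moreover have "norm (d n p - l2_cos n (\<xi> n)) \<le> C (norm p) / real n" using near[of n p] n by simp
      ultimately show ?thesis by linarith
    qed
    note E = triangle_size_estimates[of "norm q" \<delta> "d n" "\<xi> n", OF order_refl _ der zero this]
    show ?case
      using E(1,2) n lambda_strip(1) unfolding \<rho>_def by (simp add: R_def)
  qed
qed

section \<open>Weights\<close>

text \<open>The last clause says, without division, that \<open>h k / k\<close> does not increase.
  It implies subadditivity and, unlike subadditivity, is inherited by the minimum with a linear
  function.\<close>

definition sublinear_growth :: "(nat \<Rightarrow> real) \<Rightarrow> bool" where
  "sublinear_growth h \<longleftrightarrow> mono h \<and> h 0 = 0 \<and> (\<forall>k l. k \<le> l \<longrightarrow> real k * h l \<le> real l * h k)"

lemma sublinear_growth_nonneg: "sublinear_growth h \<Longrightarrow> 0 \<le> h k"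
  unfolding sublinear_growth_def by (metis monoD le0)

lemma sublinear_growth_subadditive:
  assumes h: "sublinear_growth h"
  shows "h (k + l) \<le> h k + h l"
proof (cases "k + l = 0")
  case False
  have le: "real i * h j \<le> real j * h i" if "i \<le> j" for i j using h that unfolding sublinear_growth_def by blast
  have "real k * h (k + l) \<le> real (k + l) * h k" "real l * h (k + l) \<le> real (k + l) * h l"
    by (rule le; simp)+
  then have "real (k + l) * h (k + l) \<le> real (k + l) * (h k + h l)" by (simp add: algebra_simps)
  then show ?thesis using False by simp
qed (use h in \<open>simp add: sublinear_growth_def\<close>)

lemma sublinear_growth_min:
  assumes h: "sublinear_growth h" and "0 \<le> \<epsilon>"
  shows "sublinear_growth (\<lambda>k. min (\<epsilon> * real k) (h k))"
  unfolding sublinear_growth_def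
proof (intro conjI allI impI monoI)
  fix k l :: nat assume kl: "k \<le> l"
  have "h k \<le> h l" "real k * h l \<le> real l * h k" using h kl by (auto simp: sublinear_growth_def monoD)
  moreover have "\<epsilon> * real k \<le> \<epsilon> * real l" using assms(2) kl by (simp add: mult_left_mono)
  ultimately show "min (\<epsilon> * real k) (h k) \<le> min (\<epsilon> * real l) (h l)" by linarith
  have "real k * min (\<epsilon> * real l) (h l) \<le> real k * (\<epsilon> * real l)" "real k * min (\<epsilon> * real l) (h l) \<le> real k * h l"
    by (intro mult_left_mono; simp)+
  then show "real k * min (\<epsilon> * real l) (h l) \<le> real l * min (\<epsilon> * real k) (h k)"
    using \<open>real k * h l \<le> real l * h k\<close> by (auto simp: min_def mult_ac)
qed (use h in \<open>simp add: sublinear_growth_def\<close>)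

text \<open>The cap \<open>M\<close> makes the weight bounded and keeps it submultiplicative; the
  estimates will be uniform in \<open>M\<close>.\<close>

definition radial_weight :: "(nat \<Rightarrow> real) \<Rightarrow> nat \<Rightarrow> int \<Rightarrow> real" where
  "radial_weight h M n = exp (h (min (nat \<bar>n\<bar>) M))"

lemma radial_weight:
  assumes h: "sublinear_growth h"
  shows "1 \<le> radial_weight h M k" "radial_weight h M (k + l) \<le> radial_weight h M k * radial_weight h M l"
    "radial_weight h M k \<le> exp (h M)" "radial_weight h M k \<le> exp (h (nat \<bar>k\<bar>))"
proof -
  have mono: "h i \<le> h j" if "i \<le> j" for i j using h that by (auto simp: sublinear_growth_def monoD)
  show "1 \<le> radial_weight h M k" using sublinear_growth_nonneg[OF h] by (simp add: radial_weight_def)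
  show "radial_weight h M k \<le> exp (h M)" "radial_weight h M k \<le> exp (h (nat \<bar>k\<bar>))"
    by (simp_all add: radial_weight_def mono)
  have 1: "h (min (nat \<bar>k + l\<bar>) M) \<le> h (min (nat \<bar>k\<bar>) M + min (nat \<bar>l\<bar>) M)"
  proof (rule mono)
    have "min u M \<le> min i M + min j M" if "u \<le> i + j" for u i j :: nat using that by linarith
    moreover have "nat \<bar>k + l\<bar> \<le> nat \<bar>k\<bar> + nat \<bar>l\<bar>" by linarith
    ultimately show "min (nat \<bar>k + l\<bar>) M \<le> min (nat \<bar>k\<bar>) M + min (nat \<bar>l\<bar>) M" by blast
  qed
  show "radial_weight h M (k + l) \<le> radial_weight h M k * radial_weight h M l"
    unfolding radial_weight_def mult_exp_exp exp_le_cancel_iff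
    by (rule order_trans[OF 1 sublinear_growth_subadditive[OF h]])
qed

text \<open>Below the index from which the monotonicity holds the logarithm of the weight is replaced by a linear function.\<close>

lemma subexponential_growth:
  assumes w: "normalized_weight w" "strictly_subexponential w"
  obtains h C where "sublinear_growth h" "(\<lambda>k. h k / real k) \<longlonglongrightarrow> 0" "0 \<le> C"
    "\<And>n. w n \<le> C * exp (h (nat \<bar>n\<bar>))" "\<And>n. exp (h (nat \<bar>n\<bar>)) \<le> C * w n"
proof -
  define \<phi> where "\<phi> k = ln (w (int k)) / real k" for k
  have w1: "1 \<le> w k" for k using w(1) by (simp add: normalized_weight_def)
  have w_abs: "w (int (nat \<bar>n\<bar>)) = w n" for n using w(1) by (auto simp: normalized_weight_def abs_if)
  have w_mono: "w (int k) \<le> w (int l)" if "k \<le> l" for k l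
    using w(2) that by (auto simp: strictly_subexponential_def mono_on_def)
  have \<phi>0: "0 \<le> \<phi> k" for k using w1 by (simp add: \<phi>_def)
  have lim: "\<phi> \<longlonglongrightarrow> 0" using w(2) by (simp add: strictly_subexponential_def \<phi>_def[abs_def])
  obtain N where N: "monoseq (\<lambda>k. \<phi> (k + N))" using w(2) by (auto simp: strictly_subexponential_def \<phi>_def)
  \<comment> \<open>Eventual monotonicity could also mean increasing; but a nonnegative increasing
    sequence with limit 0 vanishes, so \<open>\<phi>\<close> is nonincreasing from \<open>N\<close>
    on in both cases.\<close>
  have dec: "\<phi> l \<le> \<phi> k" if "N \<le> k" "k \<le> l" for k l
  proof -
    have kl: "k - N + N = k" "l - N + N = l" "k - N \<le> l - N" using that by auto
    from N consider "incseq (\<lambda>k. \<phi> (k + N))" | "decseq (\<lambda>k. \<phi> (k + N))" by (auto simp: monoseq_iff)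
    then show ?thesis
    proof cases
      case 1
      have "\<phi> (l - N + N) \<le> 0" by (rule incseq_le[OF 1]) (rule LIMSEQ_ignore_initial_segment[OF lim])
      then show ?thesis using \<phi>0[of k] kl by simp
    next
      case 2
      then show ?thesis using decseqD[OF 2 kl(3)] kl by simp
    qed
  qed
  \<comment> \<open>The successor excludes the index 0, where the quotient \<open>\<phi>\<close> is
    0 by convention and does not determine the logarithm.\<close>
  define N0 where "N0 = Suc N"
  define h where "h k = real k * \<phi> (max k N0)" for k
  have h_ln: "h k = ln (w (int k))" if "N0 \<le> k" for k
    using that by (simp add: h_def \<phi>_def N0_def max_def)
  have h_le: "h k \<le> ln (w (int (max k N0)))" for k
  proof -
    have "h k \<le> h (max k N0)" unfolding h_def using \<phi>0 by (simp add: mult_right_mono)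
    then show ?thesis by (simp add: h_ln)
  qed
  have h_mono: "h k \<le> h l" if "k \<le> l" for k l
  proof (cases "N0 \<le> l")
    case True
    have "w (int (max k N0)) \<le> w (int l)" by (rule w_mono) (use True that in auto)
    then have "ln (w (int (max k N0))) \<le> ln (w (int l))" using w1[of "int (max k N0)"] by (intro ln_mono) linarith+
    then show ?thesis using h_le[of k] h_ln[OF True] by linarith
  next
    case False
    then show ?thesis using that \<phi>0 by (simp add: h_def max_def mult_right_mono)
  qed
  show thesis
  proof
    show "sublinear_growth h" unfolding sublinear_growth_def
    proof (intro conjI allI impI monoI h_mono)
      fix k l :: nat assume kl: "k \<le> l"
      have "\<phi> (max l N0) \<le> \<phi> (max k N0)" by (rule dec) (use kl in \<open>auto simp: N0_def\<close>)
      then have "real k * real l * \<phi> (max l N0) \<le> real k * real l * \<phi> (max k N0)" by (rule mult_left_mono) simp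
      then show "real k * h l \<le> real l * h k" by (simp add: h_def mult_ac)
    qed (simp_all add: h_def)
    show "(\<lambda>k. h k / real k) \<longlonglongrightarrow> 0"
    proof (rule Lim_transform_eventually[OF lim])
      show "\<forall>\<^sub>F k in sequentially. \<phi> k = h k / real k"
        using eventually_ge_at_top[of N0] by eventually_elim (simp add: h_ln \<phi>_def)
    qed
    show "0 \<le> w (int N0)" using w1[of "int N0"] by simp
    have C: "1 * x \<le> w (int N0) * x" if "1 \<le> x" for x :: real by (rule mult_right_mono) (use w1 that in auto)
    have C': "w (int N0) * 1 \<le> w (int N0) * x" if "1 \<le> x" for x :: real
      by (rule mult_left_mono) (use w1[of "int N0"] that in auto)
    fix n
    define k where "k = nat \<bar>n\<bar>"
    have "0 \<le> h k" using \<phi>0 by (simp add: h_def)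
    then have e1: "1 \<le> exp (h k)" by simp
    have e_ln: "exp (ln (w j)) = w j" for j using w1[of j] by (intro exp_ln) linarith
    have "w (int k) \<le> w (int N0) * exp (h k) \<and> exp (h k) \<le> w (int N0) * w (int k)"
    proof (cases "N0 \<le> k")
      case True
      then have "exp (h k) = w (int k)" by (simp add: h_ln e_ln)
      then show ?thesis using C[OF w1[of "int k"]] by simp
    next
      case False
      have "w (int k) \<le> w (int N0)" using w_mono[of k N0] False by simp
      moreover have "exp (h k) \<le> w (int N0)" using h_le[of k] False e_ln[of "int N0"] by (metis exp_le_cancel_iff max.absorb2 nat_le_linear)
      ultimately show ?thesis using C'[OF e1] C'[OF w1[of "int k"]] by simp
    qed
    then show "w n \<le> w (int N0) * exp (h (nat \<bar>n\<bar>))" "exp (h (nat \<bar>n\<bar>)) \<le> w (int N0) * w n"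
      unfolding k_def w_abs by auto
  qed
qed

lemma summable_tail_small:
  fixes f :: "int \<Rightarrow> real"
  assumes "f summable_on UNIV" "\<And>k. 0 \<le> f k"
  obtains N where "\<And>F. finite F \<Longrightarrow> (\<And>k. k \<in> F \<Longrightarrow> int N \<le> \<bar>k\<bar>) \<Longrightarrow> sum f F \<le> 1"
proof -
  have "\<exists>F0. finite F0 \<and> infsum f UNIV - 1 < sum f F0"
  proof (rule ccontr)
    assume *: "\<nexists>F0. finite F0 \<and> infsum f UNIV - 1 < sum f F0"
    have "infsum f UNIV \<le> infsum f UNIV - 1"
      by (rule infsum_le_finite_sums[OF assms(1)]) (use * in \<open>auto simp: not_less\<close>)
    then show False by simp
  qed
  then obtain F0 where F0: "finite F0" "infsum f UNIV - 1 < sum f F0" by blast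
  obtain m where m: "\<And>k. k \<in> F0 \<Longrightarrow> \<bar>k\<bar> \<le> m" using F0(1) bdd_above_finite[of "abs ` F0"] by (auto simp: bdd_above_def)
  show thesis
  proof (rule that[of "nat (m + 1)"])
    fix F :: "int set" assume F: "finite F" "\<And>k. k \<in> F \<Longrightarrow> int (nat (m + 1)) \<le> \<bar>k\<bar>"
    have "F \<inter> F0 = {}" using m F(2) by force
    then have "sum f F + sum f F0 = sum f (F \<union> F0)" by (rule sum.union_disjoint[OF F(1) F0(1), symmetric])
    also have "\<dots> \<le> infsum f UNIV" using F(1) F0(1) assms by (intro finite_sum_le_infsum) auto
    finally show "sum f F \<le> 1" using F0(2) by linarith
  qed
qed

lemma l2_seq_eventually_le:
  fixes f g :: "int \<Rightarrow> complex"
  assumes g: "l2_seq g" and le: "\<And>k. int N \<le> \<bar>k\<bar> \<Longrightarrow> cmod (f k) \<le> C * cmod (g k)" and C: "0 \<le> C"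
  shows "l2_seq f"
proof -
  have "l2_seq (\<lambda>k. if int N \<le> \<bar>k\<bar> then f k else 0)"
    by (rule l2_comparison(1)[OF g _ C]) (use le C in auto)
  moreover have "l2_seq (\<lambda>k. if int N \<le> \<bar>k\<bar> then 0 else f k)"
    unfolding l2_seq_def
    by (rule finite_nonzero_values_imp_summable_on, rule finite_subset[of _ "{- int N..int N}"]) auto
  ultimately have "l2_seq (\<lambda>k. (if int N \<le> \<bar>k\<bar> then f k else 0) + (if int N \<le> \<bar>k\<bar> then 0 else f k))"
    by (rule l2_add(1))
  moreover have "(\<lambda>k. (if int N \<le> \<bar>k\<bar> then f k else 0) + (if int N \<le> \<bar>k\<bar> then 0 else f k)) = f" by auto
  ultimately show ?thesis by simp
qed

lemma l2_seq_inverse_int: "l2_seq (\<lambda>k::int. 1 / of_int k :: complex)"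
proof (rule gap_l2(1)[where C = 2 and s = 0 and t = 0])
  fix j :: int assume "(1 / of_int j :: complex) \<noteq> 0"
  then have j: "j \<noteq> 0" by auto
  then show "1 / 2 \<le> \<bar>\<bar>real_of_int (2 * j + 0)\<bar> - 0\<bar>" by auto
  show "norm (1 / of_int j :: complex) * \<bar>\<bar>real_of_int (2 * j + 0)\<bar> - 0\<bar> \<le> 2"
    using j by (simp add: norm_divide abs_mult)
qed simp

text \<open>The sequence \<open>b\<close> is a perturbation of \<open>a\<close> whose error, measured in any bounded submultiplicative weight, is
  quadratic in the weighted norm of \<open>a\<close> and gains one power of the index.\<close>

locale weighted_perturbation =
  fixes a b :: "int \<Rightarrow> complex" and K :: real and N :: nat
  assumes a_l2: "l2_seq a" and K0: "0 \<le> K" and N1: "1 \<le> N"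
    and close: "\<And>v B n. \<lbrakk>\<And>k. 1 \<le> v k; \<And>k l. v (k + l) \<le> v k * v l; \<And>k. v k \<le> B; int N \<le> \<bar>n\<bar>;
        l2_norm (\<lambda>k. of_real (v k) * a k) * (K / \<bar>of_int n\<bar>) \<le> 1 / 2\<rbrakk>
      \<Longrightarrow> v n * cmod (b n - a n) \<le> 2 * (l2_norm (\<lambda>k. of_real (v k) * a k))\<^sup>2 * (K / \<bar>of_int n\<bar>)"
begin

lemma radial_l2:
  assumes "sublinear_growth h"
  shows "l2_seq (\<lambda>k. of_real (radial_weight h M k) * a k)"
  by (rule l2_comparison(1)[OF a_l2, of _ "exp (h M)"])
    (use radial_weight[OF assms, of M] in \<open>auto simp: norm_mult radial_weight_def intro!: mult_right_mono\<close>)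

lemma radial_close:
  assumes h: "sublinear_growth h" and n: "int N \<le> \<bar>n\<bar>" and S: "l2_norm (\<lambda>k. of_real (radial_weight h M k) * a k) \<le> S"
    and small: "2 * S * K \<le> \<bar>of_int n\<bar>"
  shows "radial_weight h M n * cmod (b n - a n) \<le> 2 * S\<^sup>2 * K * cmod (1 / of_int n)"
proof -
  define s where "s = l2_norm (\<lambda>k. of_real (radial_weight h M k) * a k)"
  have n0: "0 < \<bar>real_of_int n\<bar>" using n N1 by auto
  have c: "cmod (1 / of_int n) = 1 / \<bar>of_int n\<bar>" by (simp add: norm_divide)
  have s0: "0 \<le> s" by (simp add: s_def)
  have "s * K \<le> S * K" using S K0 unfolding s_def by (rule mult_right_mono)
  then have "s * (K / \<bar>of_int n\<bar>) \<le> 1 / 2" using small n0 by (simp add: field_simps)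
  then have "radial_weight h M n * cmod (b n - a n) \<le> 2 * s\<^sup>2 * (K / \<bar>of_int n\<bar>)"
    unfolding s_def by (intro close[where B = "exp (h M)"] radial_weight[OF h] n)
  also have "\<dots> \<le> 2 * S\<^sup>2 * (K / \<bar>of_int n\<bar>)"
    using S s0 K0 by (intro mult_right_mono mult_left_mono power_mono) (auto simp: s_def)
  finally show ?thesis by (simp add: c)
qed

text \<open>\<open>S\<close> does not depend on the cap, so \<open>radial_close\<close> can be used
  at each \<open>k\<close> with the cap equal to the absolute value of \<open>k\<close>, where the
  capped weight has its full value. The error is dominated by \<open>1 / k\<close>.\<close>

lemma transfer_weight:
  assumes h: "sublinear_growth h" and W: "l2_seq (\<lambda>k. of_real (exp (h (nat \<bar>k\<bar>))) * a k)"
  shows "l2_seq (\<lambda>k. of_real (exp (h (nat \<bar>k\<bar>))) * b k)"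
proof -
  define S where "S = l2_norm (\<lambda>k. of_real (exp (h (nat \<bar>k\<bar>))) * a k)"
  have S: "l2_norm (\<lambda>k. of_real (radial_weight h M k) * a k) \<le> S" for M
    using l2_comparison(2)[OF W, of "\<lambda>k. of_real (radial_weight h M k) * a k" 1] radial_weight[OF h, of M]
    by (simp add: S_def norm_mult mult_right_mono radial_weight_def)
  obtain N' :: nat where N': "2 * S * K \<le> real N'" using real_arch_simple by blast
  have d: "l2_seq (\<lambda>k. of_real (exp (h (nat \<bar>k\<bar>))) * (b k - a k))"
  proof (rule l2_seq_eventually_le[OF l2_seq_inverse_int, of "max N N'"])
    fix k assume k: "int (max N N') \<le> \<bar>k\<bar>"
    then have "real N' \<le> real_of_int \<bar>k\<bar>" by linarith
    then have "2 * S * K \<le> \<bar>of_int k\<bar>" using N' by simp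
    from radial_close[OF h _ S this, of "nat \<bar>k\<bar>"] k
    show "cmod (of_real (exp (h (nat \<bar>k\<bar>))) * (b k - a k)) \<le> 2 * S\<^sup>2 * K * cmod (1 / of_int k)"
      by (simp add: norm_mult radial_weight_def)
  qed (use K0 in simp)
  show ?thesis using l2_add(1)[OF W d] by (simp add: algebra_simps)
qed

text \<open>The weights \<open>exp (min (\<epsilon> k) (h k))\<close> deform the trivial weight into one that is eventually equal to \<open>exp (h k)\<close>.
  Along the deformation the weighted norm of \<open>a\<close> cannot cross the gap between \<open>B\<close> and \<open>2 B\<close>.\<close>

lemma transfer_weight_back:
  assumes h: "sublinear_growth h" and lim: "(\<lambda>k. h k / real k) \<longlonglongrightarrow> 0"
    and W: "l2_seq (\<lambda>k. of_real (exp (h (nat \<bar>k\<bar>))) * b k)"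
  shows "l2_seq (\<lambda>k. of_real (exp (h (nat \<bar>k\<bar>))) * a k)"
proof -
  \<comment> \<open>The factor 2 pays for the squared weight on indices below \<open>N'\<close>,
    which is at most 2 by the choice of \<open>\<epsilon>0\<close>; the 1 pays for the tail of
    \<open>f\<close>.\<close>
  define B where "B = 2 * (l2_norm a)\<^sup>2 + 1"
  have B1: "1 \<le> B" by (simp add: B_def)
  \<comment> \<open>A majorant for the weighted \<open>a\<close> on the tail, independent of
    \<open>\<epsilon>\<close> and \<open>M\<close>: the given \<open>b\<close> and the error in
    \<open>radial_close\<close> for \<open>S\<^sup>2 = 2 * B\<close>.\<close>
  define f where "f k = 2 * (cmod (of_real (exp (h (nat \<bar>k\<bar>))) * b k))\<^sup>2 + 2 * (4 * B * K * cmod (1 / of_int k))\<^sup>2" for k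
  have "f summable_on UNIV" unfolding f_def power_mult_distrib
    using W l2_seq_inverse_int
    by (intro summable_on_add summable_on_cmult_right) (simp_all add: l2_seq_def norm_mult power_mult_distrib)
  moreover have "0 \<le> f k" for k by (simp add: f_def)
  ultimately obtain N2 where tail: "\<And>F. finite F \<Longrightarrow> (\<And>k. k \<in> F \<Longrightarrow> int N2 \<le> \<bar>k\<bar>) \<Longrightarrow> sum f F \<le> 1"
    using summable_tail_small by metis
  obtain N3 :: nat where N3: "2 * sqrt (2 * B) * K \<le> real N3" using real_arch_simple by blast
  define N' where "N' = max N (max N2 N3)"
  define \<epsilon>0 where "\<epsilon>0 = ln 2 / (2 * (real N' + 1))"
  have \<epsilon>0: "0 < \<epsilon>0" by (simp add: \<epsilon>0_def)
  have \<epsilon>0_N: "exp (\<epsilon>0 * real N') ^ 2 \<le> 2"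
  proof -
    have "2 * (\<epsilon>0 * real N') \<le> ln 2" by (simp add: \<epsilon>0_def field_simps)
    then have "exp (2 * (\<epsilon>0 * real N')) \<le> exp (ln 2)" by (simp only: exp_le_cancel_iff)
    then show ?thesis by (simp add: exp_double)
  qed
  define H where "H \<epsilon> k = min (\<epsilon> * real k) (h k)" for \<epsilon> k
  have H: "sublinear_growth (H \<epsilon>)" if "0 \<le> \<epsilon>" for \<epsilon>
    unfolding H_def[abs_def] by (rule sublinear_growth_min[OF h that])
  define v where "v \<epsilon> M = radial_weight (H \<epsilon>) M" for \<epsilon> M
  define G where "G \<epsilon> M = l2_norm (\<lambda>k. of_real (v \<epsilon> M k) * a k)" for \<epsilon> M
  have G0: "0 \<le> G \<epsilon> M" for \<epsilon> M by (simp add: G_def)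
  have v0: "0 \<le> v \<epsilon> M k" for \<epsilon> M k by (simp add: v_def radial_weight_def)
  have gap: "(G \<epsilon> M)\<^sup>2 \<le> B" if \<epsilon>: "0 \<le> \<epsilon>" "\<epsilon> \<le> \<epsilon>0" and G2: "(G \<epsilon> M)\<^sup>2 \<le> 2 * B" for \<epsilon> M
  proof -
    have GS: "G \<epsilon> M \<le> sqrt (2 * B)" using G2 by (rule real_le_rsqrt)
    have point: "(cmod (of_real (v \<epsilon> M k) * a k))\<^sup>2 \<le> 2 * (cmod (a k))\<^sup>2 + (if int N' \<le> \<bar>k\<bar> then f k else 0)" for k
    proof (cases "int N' \<le> \<bar>k\<bar>")
      case True
      then have k: "int N \<le> \<bar>k\<bar>" "real N3 \<le> \<bar>real_of_int k\<bar>" by (auto simp: N'_def)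
      have "2 * sqrt (2 * B) * K \<le> \<bar>of_int k\<bar>" using N3 k(2) by linarith
      from radial_close[OF H[OF \<epsilon>(1)] k(1) GS[unfolded G_def v_def] this]
      have 1: "v \<epsilon> M k * cmod (b k - a k) \<le> 4 * B * K * cmod (1 / of_int k)"
        using B1 by (simp add: v_def)
      have "H \<epsilon> (min (nat \<bar>k\<bar>) M) \<le> h (nat \<bar>k\<bar>)"
        using h unfolding H_def sublinear_growth_def by (meson min.cobounded1 min.coboundedI2 monoD)
      then have "v \<epsilon> M k \<le> exp (h (nat \<bar>k\<bar>))" by (simp add: v_def radial_weight_def)
      then have 2: "v \<epsilon> M k * cmod (b k) \<le> cmod (of_real (exp (h (nat \<bar>k\<bar>))) * b k)"
        by (simp add: norm_mult mult_right_mono)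
      have "cmod (a k) \<le> cmod (b k) + cmod (b k - a k)"
        using norm_triangle_ineq4[of "b k" "b k - a k"] by simp
      then have "v \<epsilon> M k * cmod (a k) \<le> v \<epsilon> M k * cmod (b k) + v \<epsilon> M k * cmod (b k - a k)"
        using mult_left_mono[OF _ v0] by (fastforce simp: distrib_left)
      then have "cmod (of_real (v \<epsilon> M k) * a k) \<le> cmod (of_real (exp (h (nat \<bar>k\<bar>))) * b k) + 4 * B * K * cmod (1 / of_int k)"
        using 1 2 v0[of \<epsilon> M k] by (simp add: norm_mult)
      then have "(cmod (of_real (v \<epsilon> M k) * a k))\<^sup>2 \<le> (cmod (of_real (exp (h (nat \<bar>k\<bar>))) * b k) + 4 * B * K * cmod (1 / of_int k))\<^sup>2"
        by (rule power_mono) simp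
      also have "\<dots> \<le> f k"
        unfolding f_def using zero_le_power2[of "cmod (of_real (exp (h (nat \<bar>k\<bar>))) * b k) - 4 * B * K * cmod (1 / of_int k)"]
        unfolding power2_sum power2_diff by linarith
      finally show ?thesis using True by (simp add: add_increasing)
    next
      case False
      have "H \<epsilon> (min (nat \<bar>k\<bar>) M) \<le> \<epsilon> * real (min (nat \<bar>k\<bar>) M)" by (simp add: H_def)
      also have "\<dots> \<le> \<epsilon>0 * real N'" using \<epsilon> False by (intro mult_mono) auto
      finally have "v \<epsilon> M k \<le> exp (\<epsilon>0 * real N')" by (simp add: v_def radial_weight_def)
      then have "(v \<epsilon> M k)\<^sup>2 \<le> 2" using \<epsilon>0_N power_mono[OF _ v0, of \<epsilon> M k "exp (\<epsilon>0 * real N')" 2] by linarith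
      then have "(v \<epsilon> M k)\<^sup>2 * (cmod (a k))\<^sup>2 \<le> 2 * (cmod (a k))\<^sup>2" by (rule mult_right_mono) simp
      then show ?thesis using False by (simp add: norm_mult power_mult_distrib)
    qed
    have "(\<Sum>k\<in>F. (cmod (of_real (v \<epsilon> M k) * a k))\<^sup>2) \<le> (sqrt B)\<^sup>2" if F: "finite F" for F
    proof -
      have "(\<Sum>k\<in>F. (cmod (of_real (v \<epsilon> M k) * a k))\<^sup>2) \<le> (\<Sum>k\<in>F. 2 * (cmod (a k))\<^sup>2 + (if int N' \<le> \<bar>k\<bar> then f k else 0))"
        by (rule sum_mono) (rule point)
      also have "\<dots> = 2 * (\<Sum>k\<in>F. (cmod (a k))\<^sup>2) + sum f {k \<in> F. int N' \<le> \<bar>k\<bar>}"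
        using F by (simp add: sum.distrib sum_distrib_left sum.inter_filter)
      also have "\<dots> \<le> 2 * (l2_norm a)\<^sup>2 + 1"
        using l2_seq_sum_le[OF a_l2 F] tail[of "{k \<in> F. int N' \<le> \<bar>k\<bar>}"] F by (fastforce simp: N'_def)
      finally show ?thesis using B1 by (simp add: B_def)
    qed
    from l2_seqI_sum_le(2)[OF this] have "G \<epsilon> M \<le> sqrt B" using B1 by (simp add: G_def)
    then have "(G \<epsilon> M)\<^sup>2 \<le> (sqrt B)\<^sup>2" by (rule power_mono) (rule G0)
    then show ?thesis using B1 by simp
  qed
  have bound: "(G \<epsilon>0 M)\<^sup>2 \<le> B" for M
  proof -
    \<comment> \<open>A continuity argument in discrete form: the steps are so short that, with the
      cap \<open>M\<close>, the squared norm at most doubles, and \<open>gap\<close> brings it back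
      below \<open>B\<close>. The number of steps depends on \<open>M\<close>, the final bound does
      not.\<close>
    obtain J0 :: nat where J0: "2 * (real M * \<epsilon>0) / ln 2 \<le> real J0" using real_arch_simple by blast
    define J where "J = Suc J0"
    define \<eta> where "\<eta> = \<epsilon>0 / real J"
    have \<eta>: "0 < \<eta>" "real J * \<eta> = \<epsilon>0" using \<epsilon>0 by (simp_all add: \<eta>_def J_def)
    have "2 * (real M * \<epsilon>0) \<le> real J0 * ln 2" using J0 by (simp add: pos_divide_le_eq)
    also have "\<dots> \<le> real J * ln 2" by (simp add: J_def)
    finally have "2 * (real M * \<epsilon>0) \<le> real J * ln 2" .
    then have "2 * (real M * \<eta>) \<le> ln 2" by (simp add: \<eta>_def J_def field_simps)
    then have "exp (2 * (real M * \<eta>)) \<le> exp (ln 2)" by (simp only: exp_le_cancel_iff)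
    then have step2: "(exp (real M * \<eta>))\<^sup>2 \<le> 2" by (simp add: exp_double)
    have "(G (real j * \<eta>) M)\<^sup>2 \<le> B" if "j \<le> J" for j
      using that
    proof (induction j)
      case 0
      have "v 0 M k = 1" for k using sublinear_growth_nonneg[OF h] by (simp add: v_def radial_weight_def H_def)
      then show ?case by (simp add: G_def B_def)
    next
      case (Suc j)
      define \<epsilon> where "\<epsilon> = real j * \<eta>"
      have \<epsilon>: "0 \<le> \<epsilon>" using \<eta>(1) by (simp add: \<epsilon>_def)
      have S: "real (Suc j) * \<eta> = \<epsilon> + \<eta>" by (simp add: \<epsilon>_def algebra_simps)
      have "real (Suc j) * \<eta> \<le> real J * \<eta>" using Suc.prems \<eta>(1) by (intro mult_right_mono) auto
      then have le: "\<epsilon> + \<eta> \<le> \<epsilon>0" using \<eta>(2) S by simp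
      have step: "v (\<epsilon> + \<eta>) M k \<le> exp (real M * \<eta>) * v \<epsilon> M k" for k
      proof -
        define m where "m = min (nat \<bar>k\<bar>) M"
        have "real m * \<eta> \<le> real M * \<eta>" using \<eta>(1) by (intro mult_right_mono) (auto simp: m_def)
        moreover have "0 \<le> real m * \<eta>" using \<eta>(1) by simp
        moreover have "(\<epsilon> + \<eta>) * real m = \<epsilon> * real m + real m * \<eta>" by (simp add: algebra_simps)
        ultimately have "H (\<epsilon> + \<eta>) m \<le> real M * \<eta> + H \<epsilon> m" unfolding H_def by linarith
        then show ?thesis by (simp add: v_def radial_weight_def exp_add[symmetric] m_def)
      qed
      have "G (\<epsilon> + \<eta>) M \<le> exp (real M * \<eta>) * G \<epsilon> M"
        unfolding G_def
        by (rule l2_comparison(2)) (use step v0 radial_l2[OF H[OF \<epsilon>]] in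
          \<open>auto simp: norm_mult v_def mult.assoc[symmetric] intro!: mult_right_mono\<close>)
      then have "(G (\<epsilon> + \<eta>) M)\<^sup>2 \<le> (exp (real M * \<eta>) * G \<epsilon> M)\<^sup>2" by (rule power_mono) (rule G0)
      also have "\<dots> \<le> 2 * B"
        unfolding power_mult_distrib using step2 Suc.IH Suc.prems by (intro mult_mono) (auto simp: \<epsilon>_def)
      finally show ?case unfolding S using \<epsilon> \<eta>(1) le by (intro gap) auto
    qed
    from this[of J] show ?thesis using \<eta>(2) by simp
  qed
  \<comment> \<open>A finite set of indices does not see a cap beyond it, which removes
    \<open>M\<close>.\<close>
  have V: "l2_seq (\<lambda>k. of_real (exp (H \<epsilon>0 (nat \<bar>k\<bar>))) * a k)"
  proof (rule l2_seqI_sum_le(1)[where C = "sqrt B"])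
    fix F :: "int set" assume F: "finite F"
    obtain m where m: "\<And>k. k \<in> F \<Longrightarrow> \<bar>k\<bar> \<le> m" using F bdd_above_finite[of "abs ` F"] by (auto simp: bdd_above_def)
    define M where "M = nat m"
    have "(\<Sum>k\<in>F. (cmod (of_real (exp (H \<epsilon>0 (nat \<bar>k\<bar>))) * a k))\<^sup>2) = (\<Sum>k\<in>F. (cmod (of_real (v \<epsilon>0 M k) * a k))\<^sup>2)"
    proof (rule sum.cong[OF refl])
      fix k assume "k \<in> F"
      then have "min (nat \<bar>k\<bar>) M = nat \<bar>k\<bar>" using m[of k] by (simp add: M_def)
      then show "(cmod (of_real (exp (H \<epsilon>0 (nat \<bar>k\<bar>))) * a k))\<^sup>2 = (cmod (of_real (v \<epsilon>0 M k) * a k))\<^sup>2"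
        by (simp add: v_def radial_weight_def)
    qed
    also have "\<dots> \<le> (G \<epsilon>0 M)\<^sup>2"
      unfolding G_def v_def by (rule l2_seq_sum_le[OF radial_l2[OF H] F]) (use \<epsilon>0 in simp)
    also have "\<dots> \<le> B" by (rule bound)
    finally show "(\<Sum>k\<in>F. (cmod (of_real (exp (H \<epsilon>0 (nat \<bar>k\<bar>))) * a k))\<^sup>2) \<le> (sqrt B)\<^sup>2" using B1 by simp
  qed (use B1 in simp)
  \<comment> \<open>Subexponential growth enters at this point: far out the linear function exceeds
    \<open>h\<close>, and the minimum is \<open>h\<close>.\<close>
  have "\<forall>\<^sub>F k in sequentially. h k / real k < \<epsilon>0" by (rule order_tendstoD(2)[OF lim \<epsilon>0])
  then obtain N4 where N4: "\<And>k. N4 \<le> k \<Longrightarrow> h k / real k < \<epsilon>0" by (auto simp: eventually_sequentially)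
  show ?thesis
  proof (rule l2_seq_eventually_le[OF V, of "Suc N4" _ 1])
    fix k :: int assume k: "int (Suc N4) \<le> \<bar>k\<bar>"
    then have "N4 \<le> nat \<bar>k\<bar>" "0 < real (nat \<bar>k\<bar>)" by auto
    then have "h (nat \<bar>k\<bar>) \<le> \<epsilon>0 * real (nat \<bar>k\<bar>)" using N4[of "nat \<bar>k\<bar>"] by (simp only: pos_divide_less_eq less_imp_le)
    then have "H \<epsilon>0 (nat \<bar>k\<bar>) = h (nat \<bar>k\<bar>)" by (simp add: H_def)
    then show "cmod (of_real (exp (h (nat \<bar>k\<bar>))) * a k) \<le> 1 * cmod (of_real (exp (H \<epsilon>0 (nat \<bar>k\<bar>))) * a k)" by simp
  qed simp
qed

lemma weighted_l2_iff:
  assumes w: "normalized_weight w" "strictly_subexponential w"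
  shows "l2_seq (\<lambda>k. of_real (w k) * a k) \<longleftrightarrow> l2_seq (\<lambda>k. of_real (w k) * b k)"
proof -
  obtain h C where h: "sublinear_growth h" "(\<lambda>k. h k / real k) \<longlonglongrightarrow> 0" and C: "0 \<le> C"
    and wh: "\<And>n. w n \<le> C * exp (h (nat \<bar>n\<bar>))" "\<And>n. exp (h (nat \<bar>n\<bar>)) \<le> C * w n"
    by (rule subexponential_growth[OF w], rule that, assumption+)
  have w0: "0 \<le> w n" for n using w(1) order_trans[OF zero_le_one] by (auto simp: normalized_weight_def)
  have "l2_seq (\<lambda>k. of_real (w k) * c k) \<longleftrightarrow> l2_seq (\<lambda>k. of_real (exp (h (nat \<bar>k\<bar>))) * c k)" for c :: "int \<Rightarrow> complex"
  proof
    assume 1: "l2_seq (\<lambda>k. of_real (w k) * c k)"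
    show "l2_seq (\<lambda>k. of_real (exp (h (nat \<bar>k\<bar>))) * c k)"
      by (rule l2_comparison(1)[OF 1 _ C]) (use wh(2) w0 in \<open>simp add: norm_mult mult.assoc[symmetric] mult_right_mono\<close>)
  next
    assume 1: "l2_seq (\<lambda>k. of_real (exp (h (nat \<bar>k\<bar>))) * c k)"
    show "l2_seq (\<lambda>k. of_real (w k) * c k)"
      by (rule l2_comparison(1)[OF 1 _ C]) (use wh(1) w0 in \<open>simp add: norm_mult mult.assoc[symmetric] mult_right_mono\<close>)
  qed
  then show ?thesis using transfer_weight[OF h(1)] transfer_weight_back[OF h] by blast
qed

end

section \<open>From sums over the integers to sums over the gaps\<close>

lemma summable_on_int_iff:
  fixes f :: "int \<Rightarrow> real"
  assumes f0: "\<And>k. 0 \<le> f k"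
  shows "f summable_on UNIV \<longleftrightarrow> summable (\<lambda>n. f (int n) + f (- int n))"
proof -
  \<comment> \<open>\<open>Suc\<close> keeps 0 out of the second range, so the two ranges are
    disjoint; the series on the right counts \<open>f 0\<close> twice, which does not affect
    convergence.\<close>
  have U: "range int \<union> range (\<lambda>n. - int (Suc n)) = UNIV"
  proof -
    have "k \<in> range int \<union> range (\<lambda>n. - int (Suc n))" for k by (cases k rule: int_cases) auto
    then show ?thesis by blast
  qed
  have "range int \<inter> range (\<lambda>n. - int (Suc n)) = {}" by auto
  from summable_on_Un_disjoint[OF _ _ this, of f]
  have "f summable_on UNIV \<longleftrightarrow> f summable_on range int \<and> f summable_on range (\<lambda>n. - int (Suc n))"
    unfolding U using summable_on_subset_banach[OF _ subset_UNIV, of f] by blast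
  also have "f summable_on range int \<longleftrightarrow> summable (\<lambda>n. f (int n))"
    using summable_on_reindex[of int UNIV f] f0 by (simp add: inj_on_def summable_on_UNIV_nonneg_real_iff o_def)
  also have "f summable_on range (\<lambda>n. - int (Suc n)) \<longleftrightarrow> summable (\<lambda>n. f (- int (Suc n)))"
    using summable_on_reindex[of "\<lambda>n. - int (Suc n)" UNIV f] f0
    by (simp add: inj_on_def summable_on_UNIV_nonneg_real_iff o_def)
  also have "\<dots> \<longleftrightarrow> summable (\<lambda>n. f (- int n))" by (rule summable_Suc_iff[of "\<lambda>n. f (- int n)"])
  also have "summable (\<lambda>n. f (int n)) \<and> summable (\<lambda>n. f (- int n)) \<longleftrightarrow> summable (\<lambda>n. f (int n) + f (- int n))"
  proof
    assume *: "summable (\<lambda>n. f (int n) + f (- int n))"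
    show "summable (\<lambda>n. f (int n)) \<and> summable (\<lambda>n. f (- int n))"
      by (intro conjI summable_comparison_test'[OF *, of 0]) (simp_all add: f0)
  qed (auto intro: summable_add)
  finally show ?thesis .
qed

lemma summable_on_from_1_iff:
  fixes f :: "nat \<Rightarrow> real"
  assumes "\<And>n. 0 \<le> f n"
  shows "f summable_on {1..} \<longleftrightarrow> summable f"
proof -
  have "{1..} = range Suc" by (auto simp: image_iff Suc_le_eq gr0_conv_Suc)
  then have "f summable_on {1..} \<longleftrightarrow> summable (\<lambda>n. f (Suc n))"
    using summable_on_reindex[of Suc UNIV f] assms by (simp add: summable_on_UNIV_nonneg_real_iff o_def)
  then show ?thesis by (simp only: summable_Suc_iff)
qed

lemma summable_eventually_comparable:
  fixes f g :: "nat \<Rightarrow> real"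
  assumes "\<forall>\<^sub>F n in sequentially. \<bar>f n\<bar> \<le> C * g n \<and> \<bar>g n\<bar> \<le> D * f n"
  shows "summable f \<longleftrightarrow> summable g"
proof
  assume "summable f"
  then have "summable (\<lambda>n. D * f n)" by (rule summable_mult)
  moreover have "\<forall>\<^sub>F n in sequentially. norm (g n) \<le> D * f n" using assms by (rule eventually_mono) simp
  ultimately show "summable g" by (rule summable_comparison_test_ev[rotated])
next
  assume "summable g"
  then have "summable (\<lambda>n. C * g n)" by (rule summable_mult)
  moreover have "\<forall>\<^sub>F n in sequentially. norm (f n) \<le> C * g n" using assms by (rule eventually_mono) simp
  ultimately show "summable f" by (rule summable_comparison_test_ev[rotated])
qed

theorem theorem5:
  fixes w :: "int \<Rightarrow> real" and \<delta> :: "nat \<Rightarrow> l2_circle \<Rightarrow> complex" and q :: l2_circle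
  assumes "normalized_weight w"
    and "strictly_subexponential w"
    and "alternate_gap_lengths \<delta>"
  shows "q \<in> weighted_space w \<longleftrightarrow>
    (\<lambda>n::nat. (w (int n))\<^sup>2 * (triangle_size \<delta> n q)\<^sup>2) summable_on {1..}"
proof -
  define a where "a = fourier_coeff q"
  define z where "z n = lambda_plus n q" for n
  \<comment> \<open>The couplings at \<open>lambda_plus\<close>, arranged as one sequence over the
    integers so that \<open>weighted_perturbation\<close> can compare it with \<open>a\<close>. The
    value at 0 is immaterial, since indices are estimated from \<open>N \<ge> 1\<close> on
    only.\<close>
  define b where "b k = (if 0 < k then c_plus (nat k) a (z (nat k)) else c_minus (nat (- k)) a (z (nat (- k))))" for k
  define r where "r n = cmod (b (int n)) + cmod (b (- int n))" for n
  have a_l2: "l2_seq a" by (simp add: a_def fourier_coeff_l2)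
  have "\<forall>\<^sub>F n in sequentially. 2 * l2_norm a * gap_const \<le> real n"
    using filterlim_real_sequentially unfolding filterlim_at_top by blast
  then have "\<forall>\<^sub>F n in sequentially. 2 \<le> n \<and> z n \<in> strip n \<and> l2_norm a * (gap_const / real n) \<le> 1 / 2
      \<and> r n \<le> 16 * triangle_size \<delta> n q \<and> triangle_size \<delta> n q \<le> 6 * r n"
    using triangle_size_comparable[OF assms(3), of q] eventually_ge_at_top[of 2]
  proof eventually_elim
    case (elim n)
    then have "l2_norm a * (gap_const / real n) \<le> 1 / 2" by (simp add: field_simps)
    then show ?case using elim by (simp add: r_def b_def a_def z_def)
  qed
  then obtain N where N: "\<And>n. N \<le> n \<Longrightarrow> 2 \<le> n" "\<And>n. N \<le> n \<Longrightarrow> z n \<in> strip n"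
      "\<And>n. N \<le> n \<Longrightarrow> l2_norm a * (gap_const / real n) \<le> 1 / 2"
      "\<And>n. N \<le> n \<Longrightarrow> r n \<le> 16 * triangle_size \<delta> n q" "\<And>n. N \<le> n \<Longrightarrow> triangle_size \<delta> n q \<le> 6 * r n"
    unfolding eventually_sequentially by blast
  interpret weighted_perturbation a b gap_const N
  proof
    show "l2_seq a" by (rule a_l2)
    show "0 \<le> gap_const" using gap_const_ge_1 by simp
    show "1 \<le> N" using N(1)[of N] by simp
    fix v :: "int \<Rightarrow> real" and B n
    assume v: "\<And>k. 1 \<le> v k" "\<And>k l. v (k + l) \<le> v k * v l" "\<And>k. v k \<le> B" and n: "int N \<le> \<bar>n\<bar>"
      and small: "l2_norm (\<lambda>k. of_real (v k) * a k) * (gap_const / \<bar>of_int n\<bar>) \<le> 1 / 2"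
    define m where "m = nat \<bar>n\<bar>"
    have m: "N \<le> m" "real m = \<bar>of_int n\<bar>" using n by (auto simp: m_def)
    note Y = ysol_weighted[where s = "par m", OF N(1-2)[OF m(1)] a_l2 N(3)[OF m(1)] v small[folded m(2)]]
    have i: "jm m - jp m = - int m" using pair_indices(3)[of m] by simp
    show "v n * cmod (b n - a n) \<le> 2 * (l2_norm (\<lambda>k. of_real (v k) * a k))\<^sup>2 * (gap_const / \<bar>of_int n\<bar>)"
    proof (cases "0 < n")
      case True
      then have "n = int m" by (simp add: m_def)
      then show ?thesis using Y[of "jp m" "jm m"] True by (simp add: b_def c_plus_def pair_indices(3))
    next
      case False
      then have "n = - int m" by (simp add: m_def)
      then show ?thesis using Y[of "jm m" "jp m"] False by (simp add: b_def c_minus_def i)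
    qed
  qed
  have "q \<in> weighted_space w \<longleftrightarrow> l2_seq (\<lambda>k. of_real (w k) * a k)"
    by (simp add: weighted_space_def l2_seq_def a_def norm_mult power_mult_distrib)
  also have "\<dots> \<longleftrightarrow> l2_seq (\<lambda>k. of_real (w k) * b k)" by (rule weighted_l2_iff[OF assms(1,2)])
  also have "\<dots> \<longleftrightarrow> (\<lambda>k. (w k)\<^sup>2 * (cmod (b k))\<^sup>2) summable_on UNIV"
    by (simp add: l2_seq_def norm_mult power_mult_distrib)
  also have "\<dots> \<longleftrightarrow> summable (\<lambda>n. (w (int n))\<^sup>2 * (cmod (b (int n)))\<^sup>2 + (w (- int n))\<^sup>2 * (cmod (b (- int n)))\<^sup>2)"
    by (rule summable_on_int_iff) simp
  also have "\<dots> \<longleftrightarrow> summable (\<lambda>n. (w (int n))\<^sup>2 * (triangle_size \<delta> n q)\<^sup>2)"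
  proof (rule summable_eventually_comparable[where C = "16\<^sup>2" and D = "2 * 6\<^sup>2"])
    show "\<forall>\<^sub>F n in sequentially. \<bar>(w (int n))\<^sup>2 * (cmod (b (int n)))\<^sup>2 + (w (- int n))\<^sup>2 * (cmod (b (- int n)))\<^sup>2\<bar>
          \<le> 16\<^sup>2 * ((w (int n))\<^sup>2 * (triangle_size \<delta> n q)\<^sup>2) \<and>
        \<bar>(w (int n))\<^sup>2 * (triangle_size \<delta> n q)\<^sup>2\<bar>
          \<le> 2 * 6\<^sup>2 * ((w (int n))\<^sup>2 * (cmod (b (int n)))\<^sup>2 + (w (- int n))\<^sup>2 * (cmod (b (- int n)))\<^sup>2)"
      using eventually_ge_at_top[of N]
    proof eventually_elim
      case (elim n)
      define x y t where "x = cmod (b (int n))" and "y = cmod (b (- int n))" and "t = triangle_size \<delta> n q"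
      have xy: "0 \<le> x" "0 \<le> y" "0 \<le> t" by (simp_all add: x_def y_def t_def triangle_size_def)
      have R: "x + y \<le> 16 * t" "t \<le> 6 * (x + y)" using N(4,5)[OF elim] by (simp_all add: r_def x_def y_def t_def)
      have "x\<^sup>2 + y\<^sup>2 \<le> (x + y)\<^sup>2" using xy by (simp add: power2_sum)
      also have "\<dots> \<le> (16 * t)\<^sup>2" using R(1) xy by (intro power_mono) auto
      finally have 1: "x\<^sup>2 + y\<^sup>2 \<le> 16\<^sup>2 * t\<^sup>2" by (simp only: power_mult_distrib)
      have "t\<^sup>2 \<le> (6 * (x + y))\<^sup>2" using R(2) xy by (intro power_mono) auto
      also have "\<dots> = 6\<^sup>2 * (x + y)\<^sup>2" by (simp only: power_mult_distrib)
      also have "(x + y)\<^sup>2 \<le> 2 * (x\<^sup>2 + y\<^sup>2)"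
        using zero_le_power2[of "x - y"] by (simp add: power2_eq_square algebra_simps)
      finally have 2: "t\<^sup>2 \<le> 2 * 6\<^sup>2 * (x\<^sup>2 + y\<^sup>2)" by simp
      have w: "w (- int n) = w (int n)" using assms(1) by (simp add: normalized_weight_def)
      show ?case
        using mult_left_mono[OF 1, of "(w (int n))\<^sup>2"] mult_left_mono[OF 2, of "(w (int n))\<^sup>2"]
        unfolding w x_def[symmetric] y_def[symmetric] t_def[symmetric] by (simp add: algebra_simps)
    qed
  qed
  also have "\<dots> \<longleftrightarrow> (\<lambda>n::nat. (w (int n))\<^sup>2 * (triangle_size \<delta> n q)\<^sup>2) summable_on {1..}"
    by (rule summable_on_from_1_iff[symmetric]) simp
  finally show ?thesis .
qed

end
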